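(* Let $\Bbbk=\mathbb{Z}$ or a field, let $L$ be a finite $d$-dimensional simplicial complex, and let $A=\Bbbk[G_L^{\mathrm{ab}}]$, where $G_L=\pi_1(T_L)$. Then $L$ is a ($d$-dimensional) Cohen–Macaulay complex over $\Bbbk$ if and only if $H^p(T_L,A)=0$ for all $p\neq d+1$ and $H^{d+1}(T_L,A)$ is a free $\Bbbk$-module.
   Context: Let $\mathsf{V}$ be the vertex set of $L$. Let $S^1=e^0\cup e^1$ be the circle with its standard cell decomposition. The toric complex $T_L\subseteq(S^1)^{\mathsf{V}}$ is the subcomplex $T_L=\bigcup_{\tau\in L}\{x: x_i=e^0 \text{ for } i\notin\tau\}$. Its fundamental group $G_L$ is the right-angled Artin group with a generator for each $v\in\mathsf{V}$ and relations $vw=wv$ for each edge $\{v,w\}$ of $L$; its abelianization $G_L^{\mathrm{ab}}$ is free abelian on $\mathsf{V}$. $A$ is regarded as a local system on $T_L$ via $G_L\to G_L^{\mathrm{ab}}$. A $d$-dimensional complex $L$ is Cohen–Macaulay over $\Bbbk$ if for each simplex $\sigma\in L$ (including $\emptyset$), the reduced cohomology $\widetilde{H}^*(\operatorname{lk}(\sigma),\Bbbk)$ of the link is concentrated in degree $d-|\sigma|$ and is torsion-free. *)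

theory Defs
  imports "HOL-Analysis.Analysis" "HOL-Homology.Homology" "HOL-Algebra.Generated_Groups" "HOL-Algebra.Module" "HOL-Algebra.AbelCoset"
begin

section \<open>Modules and cohomology of cochain complexes\<close>

text \<open>
  Scalars are elements of a type \<open>'k\<close>; modules are \<open>module\<close> records. Only the fields
  \<open>carrier\<close>, \<open>zero\<close>, \<open>add\<close> and \<open>smult\<close> of a module matter; the ring fields \<open>mult\<close> and \<open>one\<close>
  are left \<open>undefined\<close>, except for group algebras.
\<close>

text \<open>The ring \<open>'k\<close> is a field or (by its unique ring homomorphism from \<open>int\<close>) the integers.\<close>

definition field_or_integers :: "'k::comm_ring_1 itself \<Rightarrow> bool" where
  "field_or_integers _ \<longleftrightarrow>
     (\<forall>x::'k. x \<noteq> 0 \<longrightarrow> (\<exists>y. x * y = 1)) \<or> bij (of_int :: int \<Rightarrow> 'k)"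

definition zero_module :: "('k, 'm) module \<Rightarrow> bool" where
  "zero_module M \<longleftrightarrow> carrier M = {\<zero>\<^bsub>M\<^esub>}"

definition torsion_free_module :: "('k::zero, 'm) module \<Rightarrow> bool" where
  "torsion_free_module M \<longleftrightarrow>
     (\<forall>r. \<forall>m \<in> carrier M. r \<noteq> 0 \<longrightarrow> r \<odot>\<^bsub>M\<^esub> m = \<zero>\<^bsub>M\<^esub> \<longrightarrow> m = \<zero>\<^bsub>M\<^esub>)"

definition free_module :: "('k::zero, 'm) module \<Rightarrow> bool" where
  "free_module M \<longleftrightarrow>
     (\<exists>S \<subseteq> carrier M. \<forall>m \<in> carrier M.
        \<exists>!c :: 'm \<Rightarrow> 'k. finite {s. c s \<noteq> 0} \<and> {s. c s \<noteq> 0} \<subseteq> S \<and>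
          m = (\<Oplus>\<^bsub>M\<^esub>s\<in>{s. c s \<noteq> 0}. c s \<odot>\<^bsub>M\<^esub> s))"

text \<open>The module \<open>Z / B\<close> of cosets, for submodules \<open>B \<subseteq> Z\<close> of \<open>M\<close>.\<close>

definition subquotient :: "('k, 'm) module \<Rightarrow> 'm set \<Rightarrow> 'm set \<Rightarrow> ('k, 'm set) module" where
  "subquotient M Z B =
     \<lparr>carrier = (\<lambda>z. B +>\<^bsub>M\<^esub> z) ` Z, mult = undefined, one = undefined,
      zero = B, add = set_add M,
      smult = (\<lambda>r U. \<Union>x\<in>U. B +>\<^bsub>M\<^esub> (r \<odot>\<^bsub>M\<^esub> x))\<rparr>"

definition cohomology ::
  "(int \<Rightarrow> ('k, 'm) module) \<Rightarrow> (int \<Rightarrow> 'm \<Rightarrow> 'm) \<Rightarrow> int \<Rightarrow> ('k, 'm set) module" where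
  "cohomology C \<delta> p =
     subquotient (C p) {c \<in> carrier (C p). \<delta> p c = \<zero>\<^bsub>C (p + 1)\<^esub>}
       (\<delta> (p - 1) ` carrier (C (p - 1)))"


section \<open>Simplicial complexes and the Cohen--Macaulay property\<close>

text \<open>
  A finite simplicial complex is a set of finite sets containing the empty simplex. Its vertex set
  is \<open>\<Union>L\<close>, which may be a proper subset of the finite type \<open>'v\<close>.
\<close>

definition simplicial_cx :: "'v::finite set set \<Rightarrow> bool" where
  "simplicial_cx L \<longleftrightarrow> {} \<in> L \<and> (\<forall>\<sigma>\<in>L. \<forall>\<tau>. \<tau> \<subseteq> \<sigma> \<longrightarrow> \<tau> \<in> L)"

definition cx_dim :: "'v::finite set set \<Rightarrow> int" where
  "cx_dim L = int (Max (card ` L)) - 1"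

definition link :: "'v set set \<Rightarrow> 'v set \<Rightarrow> 'v set set" where
  "link L \<sigma> = {\<tau>. \<tau> \<inter> \<sigma> = {} \<and> \<tau> \<union> \<sigma> \<in> L}"

text \<open>
  Augmented simplicial cochains: the empty simplex has dimension \<open>-1\<close>. Simplices are oriented by
  the vertex ordering that the injection \<open>to_nat\<close> induces on a finite type.
\<close>

definition simplicial_cochains ::
  "'k::comm_ring_1 itself \<Rightarrow> 'v::finite set set \<Rightarrow> int \<Rightarrow> ('k, 'v set \<Rightarrow> 'k) module" where
  "simplicial_cochains _ K p =
     \<lparr>carrier = {f. \<forall>\<sigma>. \<not> (\<sigma> \<in> K \<and> int (card \<sigma>) = p + 1) \<longrightarrow> f \<sigma> = 0},
      mult = undefined, one = undefined,
      zero = (\<lambda>\<sigma>. 0), add = (\<lambda>f g \<sigma>. f \<sigma> + g \<sigma>), smult = (\<lambda>r f \<sigma>. r * f \<sigma>)\<rparr>"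

definition simplicial_coboundary ::
  "'v::finite set set \<Rightarrow> int \<Rightarrow> ('v set \<Rightarrow> 'k::comm_ring_1) \<Rightarrow> 'v set \<Rightarrow> 'k" where
  "simplicial_coboundary K p f \<sigma> =
     (if \<sigma> \<in> K \<and> int (card \<sigma>) = p + 2
      then (\<Sum>v\<in>\<sigma>. (-1) ^ card {u \<in> \<sigma>. to_nat u < to_nat v} * f (\<sigma> - {v})) else 0)"

definition reduced_cohomology ::
  "'k::comm_ring_1 itself \<Rightarrow> 'v::finite set set \<Rightarrow> int \<Rightarrow> ('k, ('v set \<Rightarrow> 'k) set) module" where
  "reduced_cohomology k K = cohomology (simplicial_cochains k K) (simplicial_coboundary K)"

definition cohen_macaulay :: "'k::comm_ring_1 itself \<Rightarrow> 'v::finite set set \<Rightarrow> bool" where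
  "cohen_macaulay k L \<longleftrightarrow>
     (\<forall>\<sigma>\<in>L. (\<forall>p. p \<noteq> cx_dim L - int (card \<sigma>) \<longrightarrow>
                 zero_module (reduced_cohomology k (link L \<sigma>) p)) \<and>
            (\<forall>p. torsion_free_module (reduced_cohomology k (link L \<sigma>) p)))"


section \<open>The fundamental group and its group algebra\<close>

definition paths_from_to :: "'a::topological_space set \<Rightarrow> 'a \<Rightarrow> 'a \<Rightarrow> (real \<Rightarrow> 'a) set" where
  "paths_from_to X x y =
     {\<gamma>. path \<gamma> \<and> path_image \<gamma> \<subseteq> X \<and> pathstart \<gamma> = x \<and> pathfinish \<gamma> = y}"

definition path_class :: "'a::topological_space set \<Rightarrow> (real \<Rightarrow> 'a) \<Rightarrow> (real \<Rightarrow> 'a) set" where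
  "path_class X \<gamma> = {\<gamma>'. homotopic_paths X \<gamma> \<gamma>'}"

definition fundamental_group ::
  "'a::topological_space set \<Rightarrow> 'a \<Rightarrow> (real \<Rightarrow> 'a) set monoid" where
  "fundamental_group X x0 =
     \<lparr>carrier = path_class X ` paths_from_to X x0 x0,
      mult = (\<lambda>P Q. \<Union>\<gamma>\<in>P. \<Union>\<eta>\<in>Q. path_class X (\<gamma> +++ \<eta>)),
      one = path_class X (\<lambda>t. x0)\<rparr>"

definition commutator_subgroup :: "('g, 'b) monoid_scheme \<Rightarrow> 'g set" where
  "commutator_subgroup G = derived G (carrier G)"

definition abelianization :: "('g, 'b) monoid_scheme \<Rightarrow> 'g set monoid" where
  "abelianization G = G Mod commutator_subgroup G"

definition abelianization_map :: "('g, 'b) monoid_scheme \<Rightarrow> 'g \<Rightarrow> 'g set" where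
  "abelianization_map G g = commutator_subgroup G #>\<^bsub>G\<^esub> g"

text \<open>The group algebra: finitely supported functions, with convolution.\<close>

definition group_algebra ::
  "'k::comm_ring_1 itself \<Rightarrow> ('g, 'b) monoid_scheme \<Rightarrow> ('k, 'g \<Rightarrow> 'k) module" where
  "group_algebra _ G =
     \<lparr>carrier = {a. finite {g. a g \<noteq> 0} \<and> {g. a g \<noteq> 0} \<subseteq> carrier G},
      mult = (\<lambda>a b h. if h \<in> carrier G
                      then \<Sum>g\<in>{g. a g \<noteq> 0}. a g * b (m_inv G g \<otimes>\<^bsub>G\<^esub> h) else 0),
      one = (\<lambda>h. if h = \<one>\<^bsub>G\<^esub> then 1 else 0),
      zero = (\<lambda>h. 0), add = (\<lambda>a b h. a h + b h), smult = (\<lambda>r a h. r * a h)\<rparr>"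

definition group_element :: "'g \<Rightarrow> 'g \<Rightarrow> 'k::comm_ring_1" where
  "group_element g = (\<lambda>h. if h = g then 1 else 0)"


section \<open>Singular cohomology with local coefficients\<close>

text \<open>
  Let \<open>M\<close> be a module on which the fundamental group \<open>\<pi>\<close> of \<open>(X, x0)\<close> acts from the left through
  \<open>act\<close>. The cochains are the \<open>\<pi>\<close>-equivariant maps from the singular simplices of the universal
  cover of \<open>X\<close> to \<open>M\<close>. A point of the universal cover over \<open>x\<close> is a homotopy class of paths from
  \<open>x0\<close> to \<open>x\<close>, and a singular simplex of the cover is determined by its image \<open>\<sigma>\<close> in \<open>X\<close> and
  the lift of the initial vertex; it is thus given by a pair of a singular simplex \<open>\<sigma>\<close> of \<open>X\<close> and
  a homotopy class of paths \<open>\<gamma>\<close> from \<open>x0\<close> to the initial vertex of \<open>\<sigma>\<close>.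
  The initial vertex of the face opposite to it is the second vertex of \<open>\<sigma>\<close>, so there the path
  has to be prolonged along the first edge of \<open>\<sigma>\<close>.
\<close>

definition initial_vertex :: "((nat \<Rightarrow> real) \<Rightarrow> 'a) \<Rightarrow> 'a" where
  "initial_vertex \<sigma> = \<sigma> (\<lambda>i. if i = 0 then 1 else 0)"

definition first_edge :: "((nat \<Rightarrow> real) \<Rightarrow> 'a) \<Rightarrow> real \<Rightarrow> 'a" where
  "first_edge \<sigma> = (\<lambda>t. \<sigma> (\<lambda>i. if i = 0 then 1 - t else if i = 1 then t else 0))"

definition lifted_simplex ::
  "'a::topological_space set \<Rightarrow> 'a \<Rightarrow> int \<Rightarrow> ((nat \<Rightarrow> real) \<Rightarrow> 'a) \<Rightarrow> (real \<Rightarrow> 'a) \<Rightarrow> bool" where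
  "lifted_simplex X x0 p \<sigma> \<gamma> \<longleftrightarrow>
     0 \<le> p \<and> singular_simplex (nat p) (top_of_set X) \<sigma> \<and>
     \<gamma> \<in> paths_from_to X x0 (initial_vertex \<sigma>)"

definition local_cochains ::
  "'a::topological_space set \<Rightarrow> 'a \<Rightarrow> ('k, 'm) module \<Rightarrow> ((real \<Rightarrow> 'a) set \<Rightarrow> 'm \<Rightarrow> 'm) \<Rightarrow> int \<Rightarrow>
     ('k, ((nat \<Rightarrow> real) \<Rightarrow> 'a) \<Rightarrow> (real \<Rightarrow> 'a) \<Rightarrow> 'm) module" where
  "local_cochains X x0 M act p =
     \<lparr>carrier = {f.
        (\<forall>\<sigma> \<gamma>. lifted_simplex X x0 p \<sigma> \<gamma> \<longrightarrow> f \<sigma> \<gamma> \<in> carrier M) \<and>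
        (\<forall>\<sigma> \<gamma>. \<not> lifted_simplex X x0 p \<sigma> \<gamma> \<longrightarrow> f \<sigma> \<gamma> = \<zero>\<^bsub>M\<^esub>) \<and>
        (\<forall>\<sigma> \<gamma> \<gamma>'. lifted_simplex X x0 p \<sigma> \<gamma> \<longrightarrow> homotopic_paths X \<gamma> \<gamma>' \<longrightarrow> f \<sigma> \<gamma>' = f \<sigma> \<gamma>) \<and>
        (\<forall>\<sigma> \<gamma>. \<forall>\<omega> \<in> paths_from_to X x0 x0. lifted_simplex X x0 p \<sigma> \<gamma> \<longrightarrow>
           f \<sigma> (\<omega> +++ \<gamma>) = act (path_class X \<omega>) (f \<sigma> \<gamma>))},
      mult = undefined, one = undefined,
      zero = (\<lambda>\<sigma> \<gamma>. \<zero>\<^bsub>M\<^esub>),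
      add = (\<lambda>f g \<sigma> \<gamma>. f \<sigma> \<gamma> \<oplus>\<^bsub>M\<^esub> g \<sigma> \<gamma>),
      smult = (\<lambda>r f \<sigma> \<gamma>. r \<odot>\<^bsub>M\<^esub> f \<sigma> \<gamma>)\<rparr>"

definition local_coboundary ::
  "'a::topological_space set \<Rightarrow> 'a \<Rightarrow> ('k::comm_ring_1, 'm) module \<Rightarrow> int \<Rightarrow>
     (((nat \<Rightarrow> real) \<Rightarrow> 'a) \<Rightarrow> (real \<Rightarrow> 'a) \<Rightarrow> 'm) \<Rightarrow>
     ((nat \<Rightarrow> real) \<Rightarrow> 'a) \<Rightarrow> (real \<Rightarrow> 'a) \<Rightarrow> 'm" where
  "local_coboundary X x0 M p f \<sigma> \<gamma> =
     (let q = nat (p + 1) in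
      if lifted_simplex X x0 (p + 1) \<sigma> \<gamma>
      then f (singular_face q 0 \<sigma>) (\<gamma> +++ first_edge \<sigma>) \<oplus>\<^bsub>M\<^esub>
           (\<Oplus>\<^bsub>M\<^esub>i\<in>{1..q}. (-1) ^ i \<odot>\<^bsub>M\<^esub> f (singular_face q i \<sigma>) \<gamma>)
      else \<zero>\<^bsub>M\<^esub>)"

definition local_cohomology ::
  "'a::topological_space set \<Rightarrow> 'a \<Rightarrow> ('k::comm_ring_1, 'm) module \<Rightarrow>
     ((real \<Rightarrow> 'a) set \<Rightarrow> 'm \<Rightarrow> 'm) \<Rightarrow> int \<Rightarrow>
     ('k, (((nat \<Rightarrow> real) \<Rightarrow> 'a) \<Rightarrow> (real \<Rightarrow> 'a) \<Rightarrow> 'm) set) module" where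
  "local_cohomology X x0 M act =
     cohomology (local_cochains X x0 M act) (local_coboundary X x0 M)"


section \<open>The toric complex\<close>

text \<open>
  The circle is the unit circle in the complex plane, with \<open>e\<^sup>0 = 1\<close>. Coordinates outside the
  vertex set \<open>\<Union>L\<close> are constantly \<open>e\<^sup>0\<close>, so that this is a subspace of the torus on \<open>\<Union>L\<close>.
\<close>

definition toric_complex :: "'v::finite set set \<Rightarrow> (complex^'v) set" where
  "toric_complex L =
     (\<Union>\<tau>\<in>L. {x. (\<forall>i. x $ i \<in> sphere 0 1) \<and> (\<forall>i. i \<notin> \<tau> \<longrightarrow> x $ i = 1)})"

definition toric_base :: "complex^'v" where
  "toric_base = (\<chi> i. 1)"

definition toric_group :: "'v::finite set set \<Rightarrow> (real \<Rightarrow> complex^'v) set monoid" where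
  "toric_group L = fundamental_group (toric_complex L) toric_base"

definition toric_coeffs :: "'k::comm_ring_1 itself \<Rightarrow> 'v::finite set set \<Rightarrow>
    ('k, (real \<Rightarrow> complex^'v) set set \<Rightarrow> 'k) module" where
  "toric_coeffs k L = group_algebra k (abelianization (toric_group L))"

text \<open>A loop acts on the coefficients as multiplication by its class in the abelianization.\<close>

definition toric_action :: "'k::comm_ring_1 itself \<Rightarrow> 'v::finite set set \<Rightarrow>
    (real \<Rightarrow> complex^'v) set \<Rightarrow> ((real \<Rightarrow> complex^'v) set set \<Rightarrow> 'k) \<Rightarrow>
    ((real \<Rightarrow> complex^'v) set set \<Rightarrow> 'k)" where
  "toric_action k L g a =
     group_element (abelianization_map (toric_group L) g) \<otimes>\<^bsub>toric_coeffs k L\<^esub> a"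

definition toric_cohomology where
  "toric_cohomology (k :: 'k::comm_ring_1 itself) (L :: 'v::finite set set) =
     local_cohomology (toric_complex L) toric_base (toric_coeffs k L) (toric_action k L)"

end

theory Submission
 imports Defs
begin

text \<open>
The coefficients are made scalar by passing to the universal abelian cover of the toric complex.
This cover is the union of cubes \<open>abelian_cover\<close> in Euclidean space. It lies over the toric complex
by the coordinatewise exponential \<open>exp_cover\<close>, and the lattice acts on it by translations. An
angle function on each coordinate lifts paths and simplices to the cover. The endpoint of the lift
of a loop identifies the abelianization of the fundamental group with the lattice
(\<open>lattice_class_bij\<close>): a path between lattice points is homotopic to a composite of unit edges, so
the class of a loop depends only on the endpoint. Hence a cochain with values in the group algebra
is a scalar cochain of the cover that is nonzero on only finitely many translates of each simplex;
these are the orbit-finite cochains, and \<open>local_of\<close> is the correspondence.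

Cubes and unions of open stars of lattice points are acyclic carriers for maps between the small
singular simplices and the cells of the cover, and equivariant subdivision makes singular simplices
small. As all choices are equivariant, the resulting chain equivalence acts on orbit-finite
cochains, and these may be taken to be cellular (\<open>singular_cellular_iso\<close>).

An orbit-finite cellular cochain is a finitely supported function of a simplex \<open>\<tau>\<close> of \<open>L\<close> and a
lattice point \<open>n\<close>. The coboundary adds a vertex \<open>v\<close> to \<open>\<tau>\<close> and takes the difference in the
direction \<open>v\<close>. A finitely supported function on the integers is, in a unique way, the sum of a
function supported at 0 and of a difference. Applied in all directions of \<open>\<tau>\<close>, this writes the
values at \<open>\<tau>\<close> as the sum over \<open>S \<subseteq> \<tau>\<close> of the iterated differences in the directions
\<open>\<tau> - S\<close> of functions that live where the coordinates in \<open>S\<close> vanish. In these terms the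
coboundary only enlarges \<open>\<tau> - S\<close>. So the complex is the direct sum, over the simplices \<open>S\<close> and
the lattice points with vanishing coordinates in \<open>S\<close>, of the augmented cochain complexes of the
links of \<open>S\<close>, shifted by \<open>card S + 1\<close> (\<open>cellular_split_iso\<close>).

The cohomology in degree \<open>p\<close> is therefore a direct sum of copies of the reduced cohomology of the
links of \<open>S\<close> in degree \<open>p - 1 - card S\<close>, in which every link occurs. For \<open>p = d + 1\<close> this is
the degree \<open>d - card S\<close> of the Cohen--Macaulay property. It remains to compare freeness with
torsion-freeness: a free module is torsion-free, and over a field or the integers the torsion-free
cohomology of a finite complex has a basis (\<open>torsion_free_quotient_coordinates\<close>).
\<close>

section \<open>Quotients of modules\<close>

text \<open>The module laws for a scalar type in place of a ring record.\<close>

locale kmodule = abelian_group M for M :: "('k::comm_ring_1, 'm) module" (structure) +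
 assumes smult_closed [simp, intro]: "x \<in> carrier M ==> r \<odot> x \<in> carrier M"
  and smult_distrib: "x \<in> carrier M ==> y \<in> carrier M ==> r \<odot> (x \<oplus> y) = r \<odot> x \<oplus> r \<odot> y"
  and smult_add: "x \<in> carrier M ==> (r + s) \<odot> x = r \<odot> x \<oplus> s \<odot> x"
  and smult_assoc: "x \<in> carrier M ==> (r * s) \<odot> x = r \<odot> (s \<odot> x)"
  and smult_one [simp]: "x \<in> carrier M ==> 1 \<odot> x = x"
begin

lemma smult_zero_left [simp]: "x \<in> carrier M ==> 0 \<odot> x = \<zero>"
 by (metis add.l_cancel_one' add_0 smult_add smult_closed)

lemma smult_zero_right [simp]: "r \<odot> \<zero> = \<zero>"
 by (metis add.l_cancel_one' l_zero smult_closed smult_distrib zero_closed)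

lemma smult_minus_one: "x \<in> carrier M ==> (-1) \<odot> x = \<ominus> x"
 by (metis (no_types) add.inv_equality ab_left_minus smult_add smult_closed smult_one
   smult_zero_left a_inv_def)

lemma smult_finsum:
 "f \<in> A \<rightarrow> carrier M ==> r \<odot> (\<Oplus>a\<in>A. f a) = (\<Oplus>a\<in>A. r \<odot> f a)"
proof (induction A rule: infinite_finite_induct)
 case (insert a A)
 then have f: "f \<in> A \<rightarrow> carrier M" and fa: "f a \<in> carrier M" by auto
 have g: "(\<lambda>a. r \<odot> f a) \<in> A \<rightarrow> carrier M" using f by auto
 have "r \<odot> (\<Oplus>a\<in>insert a A. f a) = r \<odot> (f a \<oplus> (\<Oplus>a\<in>A. f a))"
  using insert f fa by simp
 also have "\<dots> = r \<odot> f a \<oplus> (\<Oplus>a\<in>A. r \<odot> f a)"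
  using insert f fa by (simp add: smult_distrib)
 also have "\<dots> = (\<Oplus>a\<in>insert a A. r \<odot> f a)"
  using insert f fa g by simp
 finally show ?case .
qed simp_all

text \<open>Multiplying a relation by a scalar keeps its support, as there are no zero divisors; so the
 uniqueness of the coefficients of \<open>0\<close> makes them vanish.\<close>

lemma free_imp_torsion_free:
 assumes dom: "!!a b::'k. a * b = 0 ==> a = 0 \<or> b = 0"
  and free: "free_module M"
 shows "torsion_free_module M"
 unfolding torsion_free_module_def
proof (intro allI ballI impI)
 fix r :: 'k and m assume m: "m \<in> carrier M" and r: "r ~= 0" and rm: "r \<odot> m = \<zero>"
 obtain S where S: "S \<subseteq> carrier M"
  and ex1': "\<forall>m \<in> carrier M. \<exists>!c :: 'm => 'k. finite {s. c s ~= 0} \<and> {s. c s ~= 0} \<subseteq> S \<and>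
     m = (\<Oplus>s\<in>{s. c s ~= 0}. c s \<odot> s)"
  using free unfolding free_module_def by (elim exE conjE) (rule that)
 note ex1 = bspec[OF ex1']
 obtain c where c: "finite {s. c s ~= 0}" "{s. c s ~= 0} \<subseteq> S" "m = (\<Oplus>s\<in>{s. c s ~= 0}. c s \<odot> s)"
  using ex1[OF m] by (elim ex1E conjE) (rule that)
 have supp: "{s. r * c s ~= 0} = {s. c s ~= 0}"
  using dom r by auto
 have cM: "(\<lambda>s. c s \<odot> s) \<in> {s. c s ~= 0} \<rightarrow> carrier M"
  using c(2) S by auto
 have "\<zero> = r \<odot> m" using rm by simp
 also have "\<dots> = (\<Oplus>s\<in>{s. c s ~= 0}. r \<odot> (c s \<odot> s))"
  unfolding c(3) by (rule smult_finsum[OF cM])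
 also have "\<dots> = (\<Oplus>s\<in>{s. c s ~= 0}. (r * c s) \<odot> s)"
  by (rule finsum_cong') (use c(2) S in \<open>auto simp: smult_assoc\<close>)
 finally have 1: "\<zero> = (\<Oplus>s\<in>{s. r * c s ~= 0}. (r * c s) \<odot> s)"
  using supp by simp
 have "(\<lambda>s. r * c s) = (\<lambda>s. 0)"
  by (rule trans[OF sym[OF the1_equality[OF ex1[OF zero_closed]]] the1_equality[OF ex1[OF zero_closed]]])
   (use 1 c supp in auto)
 then have "{s. c s ~= 0} = {}" using supp by (metis (mono_tags, lifting) Collect_empty_eq)
 then show "m = \<zero>" unfolding c(3) by simp
qed

end

locale ksub = kmodule M for M :: "('k::comm_ring_1, 'm) module" (structure) +
 fixes Z B :: "'m set"
 assumes Z_sub: "Z \<subseteq> carrier M" and B_sub: "B \<subseteq> carrier M"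
  and Z_zero: "\<zero> \<in> Z" and B_zero: "\<zero> \<in> B"
  and Z_add: "x \<in> Z ==> y \<in> Z ==> x \<oplus> y \<in> Z"
  and B_add: "x \<in> B ==> y \<in> B ==> x \<oplus> y \<in> B"
  and Z_smult: "x \<in> Z ==> r \<odot> x \<in> Z"
  and B_smult: "x \<in> B ==> r \<odot> x \<in> B"
begin

lemma Z_minus: "x \<in> Z ==> \<ominus> x \<in> Z"
 using Z_smult[of x "-1"] Z_sub smult_minus_one by auto

lemma B_minus: "x \<in> B ==> \<ominus> x \<in> B"
 using B_smult[of x "-1"] B_sub smult_minus_one by auto

lemma B_subgroup: "abelian_subgroup B M"
proof (rule abelian_subgroupI3)
 show "additive_subgroup B M"
  using B_sub B_zero B_add B_minus
  by (auto intro!: additive_subgroupI add.subgroupI simp: a_inv_def)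
qed unfold_locales

abbreviation Q where "Q \<equiv> subquotient M Z B"
abbreviation cls where "cls z \<equiv> B +> z"

lemma cls_eq_iff:
 assumes "x \<in> carrier M" "y \<in> carrier M"
 shows "cls x = cls y \<longleftrightarrow> x \<ominus> y \<in> B"
proof -
 interpret B: abelian_subgroup B M by (rule B_subgroup)
 have "cls x = cls y \<longleftrightarrow> x \<in> cls y"
  using assms B.a_repr_independence'[of x y] B.a_rcos_self[of x] by metis
 also have "\<dots> \<longleftrightarrow> (\<exists>b\<in>B. x = b \<oplus> y)"
  by (auto simp: a_r_coset_def')
 also have "\<dots> \<longleftrightarrow> x \<ominus> y \<in> B"
 proof
  assume "\<exists>b\<in>B. x = b \<oplus> y"
  then obtain b where "b \<in> B" "x = b \<oplus> y" by blast
  then show "x \<ominus> y \<in> B" using assms B_sub by (auto simp: minus_eq a_assoc r_neg)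
 next
  assume "x \<ominus> y \<in> B"
  moreover have "x = (x \<ominus> y) \<oplus> y" using assms by (simp add: minus_eq a_assoc l_neg)
  ultimately show "\<exists>b\<in>B. x = b \<oplus> y" by blast
 qed
 finally show ?thesis .
qed

lemma Q_carrier: "carrier Q = cls ` Z"
 and Q_zero: "\<zero>\<^bsub>Q\<^esub> = B"
 by (simp_all add: subquotient_def)

lemma cls_zero: "cls \<zero> = B"
 using a_coset_add_zero B_sub by auto

lemma Q_zero': "\<zero>\<^bsub>Q\<^esub> = cls \<zero>"
 by (simp add: cls_zero Q_zero)

lemma Q_add: "x \<in> carrier M ==> y \<in> carrier M ==> cls x \<oplus>\<^bsub>Q\<^esub> cls y = cls (x \<oplus> y)"
 using abelian_subgroup.a_rcos_sum[OF B_subgroup] by (simp add: subquotient_def)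

lemma Q_smult:
 assumes "x \<in> carrier M"
 shows "r \<odot>\<^bsub>Q\<^esub> cls x = cls (r \<odot> x)"
proof -
 have "cls (r \<odot> y) = cls (r \<odot> x)" if "y \<in> cls x" for y
 proof -
  have y: "y \<in> carrier M" and "cls y = cls x"
   using that assms abelian_subgroup.a_repr_independence'[OF B_subgroup that]
    a_r_coset_subset_G[OF B_sub assms] by auto
  then have "y \<ominus> x \<in> B" using cls_eq_iff assms by blast
  then have "r \<odot> (y \<ominus> x) \<in> B" by (rule B_smult)
  moreover have "r \<odot> (y \<ominus> x) = r \<odot> y \<ominus> r \<odot> x"
   using y assms
   by (simp add: minus_eq smult_distrib flip: smult_minus_one)
    (metis mult.commute smult_assoc)
  ultimately show ?thesis
   using cls_eq_iff[of "r \<odot> y" "r \<odot> x"] y assms by auto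
 qed
 moreover have "x \<in> cls x"
  using abelian_subgroup.a_rcos_self[OF B_subgroup assms] .
 moreover have "r \<odot>\<^bsub>Q\<^esub> cls x = (\<Union>y\<in>cls x. cls (r \<odot> y))"
  by (simp add: subquotient_def)
 ultimately show ?thesis
  by (metis (no_types, lifting) SUP_cong SUP_const empty_iff)
qed

lemma Q_kmodule: "kmodule Q"
proof -
 note sub = subsetD[OF Z_sub]
 have ab: "abelian_group Q"
 proof (rule abelian_groupI)
  fix u assume "u \<in> carrier Q"
  then obtain x where x: "x \<in> Z" "u = cls x" by (auto simp: Q_carrier)
  then show "\<zero>\<^bsub>Q\<^esub> \<oplus>\<^bsub>Q\<^esub> u = u"
   by (simp add: Q_zero' Q_add sub)
  have "cls (\<ominus> x) \<oplus>\<^bsub>Q\<^esub> u = \<zero>\<^bsub>Q\<^esub>"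
   using x by (simp add: Q_zero' Q_add sub l_neg)
  then show "\<exists>y\<in>carrier Q. y \<oplus>\<^bsub>Q\<^esub> u = \<zero>\<^bsub>Q\<^esub>"
   using Z_minus[OF x(1)] by (auto simp: Q_carrier)
 next
  show "\<zero>\<^bsub>Q\<^esub> \<in> carrier Q" using Z_zero by (simp add: Q_zero' Q_carrier)
 next
  fix u v assume "u \<in> carrier Q" "v \<in> carrier Q"
  then obtain x y where x: "x \<in> Z" "u = cls x" and y: "y \<in> Z" "v = cls y"
   by (auto simp: Q_carrier)
  show "u \<oplus>\<^bsub>Q\<^esub> v \<in> carrier Q" using x y Z_add by (simp add: Q_add sub Q_carrier)
  show "u \<oplus>\<^bsub>Q\<^esub> v = v \<oplus>\<^bsub>Q\<^esub> u" using x y by (simp add: Q_add sub a_comm)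
  fix w assume "w \<in> carrier Q"
  then obtain z where z: "z \<in> Z" "w = cls z" by (auto simp: Q_carrier)
  show "u \<oplus>\<^bsub>Q\<^esub> v \<oplus>\<^bsub>Q\<^esub> w = u \<oplus>\<^bsub>Q\<^esub> (v \<oplus>\<^bsub>Q\<^esub> w)"
   using x y z by (simp add: Q_add sub a_assoc)
 qed
 show ?thesis
 proof (intro kmodule.intro[OF ab] kmodule_axioms.intro)
  fix u r assume "u \<in> carrier Q"
  then obtain x where x: "x \<in> Z" "u = cls x" by (auto simp: Q_carrier)
  show "r \<odot>\<^bsub>Q\<^esub> u \<in> carrier Q" using x by (simp add: Q_carrier Q_smult sub Z_smult)
  show "1 \<odot>\<^bsub>Q\<^esub> u = u" using x by (simp add: Q_smult sub)
  show "(r * s) \<odot>\<^bsub>Q\<^esub> u = r \<odot>\<^bsub>Q\<^esub> (s \<odot>\<^bsub>Q\<^esub> u)" for s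
   using x by (simp add: Q_smult sub smult_assoc)
  show "(r + s) \<odot>\<^bsub>Q\<^esub> u = r \<odot>\<^bsub>Q\<^esub> u \<oplus>\<^bsub>Q\<^esub> s \<odot>\<^bsub>Q\<^esub> u" for s
   using x by (simp add: Q_smult Q_add sub smult_add)
  fix v assume "v \<in> carrier Q"
  then obtain y where y: "y \<in> Z" "v = cls y" by (auto simp: Q_carrier)
  show "r \<odot>\<^bsub>Q\<^esub> (u \<oplus>\<^bsub>Q\<^esub> v) = r \<odot>\<^bsub>Q\<^esub> u \<oplus>\<^bsub>Q\<^esub> r \<odot>\<^bsub>Q\<^esub> v"
   using x y by (simp add: Q_smult Q_add sub smult_distrib)
 qed
qed

lemma cls_eq_zero_iff: "x \<in> carrier M ==> cls x = B \<longleftrightarrow> x \<in> B"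
 using cls_eq_iff[of x \<zero>] smult_minus_one[of \<zero>]
 by (simp add: cls_zero minus_eq)

lemma zero_module_iff: "zero_module Q \<longleftrightarrow> Z \<subseteq> B"
proof -
 have "zero_module Q \<longleftrightarrow> (\<forall>z\<in>Z. cls z = B)"
  unfolding zero_module_def Q_carrier Q_zero using Z_zero by blast
 also have "\<dots> \<longleftrightarrow> (\<forall>z\<in>Z. z \<in> B)"
  by (intro ball_cong refl cls_eq_zero_iff subsetD[OF Z_sub])
 finally show ?thesis by blast
qed

lemma torsion_free_iff:
 "torsion_free_module Q \<longleftrightarrow> (\<forall>r. \<forall>z\<in>Z. r ~= 0 --> r \<odot> z \<in> B --> z \<in> B)"
proof -
 have "r \<odot>\<^bsub>Q\<^esub> cls z = B \<longleftrightarrow> r \<odot> z \<in> B" "cls z = B \<longleftrightarrow> z \<in> B" if "z \<in> Z" for r z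
  using subsetD[OF Z_sub that] by (simp_all add: Q_smult cls_eq_zero_iff)
 then show ?thesis
  unfolding torsion_free_module_def Q_carrier Q_zero by (simp cong: ball_cong)
qed

text \<open>A linear map \<open>\<kappa>\<close> from \<open>Z\<close> onto the finitely supported functions on \<open>I\<close> with kernel \<open>B\<close>
 provides coordinates on \<open>Z / B\<close>.\<close>

lemma free_by_coordinates:
 fixes \<kappa> :: "'m => 'i => 'k"
 assumes add: "!!x y. x \<in> Z ==> y \<in> Z ==> \<kappa> (x \<oplus> y) = (\<lambda>i. \<kappa> x i + \<kappa> y i)"
  and smult: "!!x r. x \<in> Z ==> \<kappa> (r \<odot> x) = (\<lambda>i. r * \<kappa> x i)"
  and fin: "!!x. x \<in> Z ==> finite {i. \<kappa> x i ~= 0}"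
  and supp: "!!x i. x \<in> Z ==> \<kappa> x i ~= 0 ==> i \<in> I"
  and ker: "!!x. x \<in> Z ==> \<kappa> x = (\<lambda>i. 0) \<longleftrightarrow> x \<in> B"
  and onto: "!!i. i \<in> I ==> \<exists>z\<in>Z. \<kappa> z = (\<lambda>j. if j = i then 1 else 0)"
 shows "free_module Q"
proof -
 interpret Q: kmodule Q by (rule Q_kmodule)
 note sub = subsetD[OF Z_sub]
 obtain z where z: "!!i. i \<in> I ==> z i \<in> Z" "!!i. i \<in> I ==> \<kappa> (z i) = (\<lambda>j. if j = i then 1 else 0)"
  using onto by metis
 define \<beta> where "\<beta> i = cls (z i)" for i
 have diffZ: "x \<ominus> y \<in> Z" if "x \<in> Z" "y \<in> Z" for x y
  using that Z_add Z_minus by (simp add: minus_eq)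
 have \<kappa>diff: "\<kappa> (x \<ominus> y) = (\<lambda>i. \<kappa> x i - \<kappa> y i)" if "x \<in> Z" "y \<in> Z" for x y
 proof -
  have "\<kappa> (\<ominus> y) = (\<lambda>i. - \<kappa> y i)"
   using smult[OF that(2), of "-1"] smult_minus_one that sub by simp
  then show ?thesis using add[OF that(1) Z_minus[OF that(2)]] by (simp add: minus_eq)
 qed
 have \<kappa>_eq: "cls x = cls y \<longleftrightarrow> \<kappa> x = \<kappa> y" if "x \<in> Z" "y \<in> Z" for x y
  using cls_eq_iff[of x y] ker[OF diffZ[OF that]] \<kappa>diff[OF that] that sub
  by (auto simp: fun_eq_iff)
 have inj: "inj_on \<beta> I"
 proof (rule inj_onI)
  fix i j assume ij: "i \<in> I" "j \<in> I" "\<beta> i = \<beta> j"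
  then have "\<kappa> (z i) i = \<kappa> (z j) i" using \<kappa>_eq z(1) by (simp add: \<beta>_def)
  then show "i = j" using z(2) ij by (auto split: if_splits)
 qed
 have \<beta>Q: "\<beta> i \<in> carrier Q" if "i \<in> I" for i
  using that z(1) by (simp add: \<beta>_def Q_carrier)
 \<comment> \<open>the class of a combination of the \<open>z i\<close> has the coefficients as its coordinates\<close>
 have comb: "\<exists>x\<in>Z. (\<Oplus>\<^bsub>Q\<^esub>i\<in>J. a i \<odot>\<^bsub>Q\<^esub> \<beta> i) = cls x \<and> \<kappa> x = (\<lambda>i. if i \<in> J then a i else 0)"
  if "finite J" "J \<subseteq> I" for a J
  using that
 proof (induction J)
  case empty
  have "\<kappa> \<zero> = (\<lambda>i. 0)" using ker Z_zero B_zero by blast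
  then show ?case using Z_zero Q_zero' by auto
 next
  case (insert j J)
  then obtain x where x: "x \<in> Z" "(\<Oplus>\<^bsub>Q\<^esub>i\<in>J. a i \<odot>\<^bsub>Q\<^esub> \<beta> i) = cls x"
   "\<kappa> x = (\<lambda>i. if i \<in> J then a i else 0)" by auto
  have j: "j \<in> I" using insert by auto
  have "(\<Oplus>\<^bsub>Q\<^esub>i\<in>insert j J. a i \<odot>\<^bsub>Q\<^esub> \<beta> i) = a j \<odot>\<^bsub>Q\<^esub> \<beta> j \<oplus>\<^bsub>Q\<^esub> cls x"
   unfolding x(2)[symmetric] using insert by (intro Q.finsum_insert) (auto intro!: \<beta>Q)
  also have "\<dots> = cls (a j \<odot> z j \<oplus> x)"
   using z(1)[OF j] x(1) sub by (simp add: \<beta>_def Q_smult Q_add)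
  finally have 1: "(\<Oplus>\<^bsub>Q\<^esub>i\<in>insert j J. a i \<odot>\<^bsub>Q\<^esub> \<beta> i) = cls (a j \<odot> z j \<oplus> x)" .
  have "\<kappa> (a j \<odot> z j \<oplus> x) = (\<lambda>i. if i \<in> insert j J then a i else 0)"
   using add[OF Z_smult[OF z(1)[OF j]] x(1)] smult[OF z(1)[OF j]] z(2)[OF j] x(3) insert
   by (auto simp: fun_eq_iff)
  then show ?case using 1 Z_add[OF Z_smult[OF z(1)[OF j]] x(1)] by blast
 qed
 have comb': "\<exists>x\<in>Z. (\<Oplus>\<^bsub>Q\<^esub>s\<in>{s. c s ~= 0}. c s \<odot>\<^bsub>Q\<^esub> s) = cls x \<and>
   \<kappa> x = (\<lambda>i. if i \<in> I then c (\<beta> i) else 0)"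
  if c: "finite {s. c s ~= 0}" "{s. c s ~= 0} \<subseteq> \<beta> ` I" for c
 proof -
  let ?J = "{i \<in> I. c (\<beta> i) ~= 0}"
  have J: "{s. c s ~= 0} = \<beta> ` ?J" using c(2) by auto
  have injJ: "inj_on \<beta> ?J" using inj by (rule inj_on_subset) auto
  have finJ: "finite ?J" using c(1) J finite_image_iff[OF injJ] by metis
  have "(\<Oplus>\<^bsub>Q\<^esub>s\<in>{s. c s ~= 0}. c s \<odot>\<^bsub>Q\<^esub> s) = (\<Oplus>\<^bsub>Q\<^esub>i\<in>?J. c (\<beta> i) \<odot>\<^bsub>Q\<^esub> \<beta> i)"
   unfolding J by (rule Q.finsum_reindex) (use injJ \<beta>Q in auto)
  moreover obtain x where "x \<in> Z" "(\<Oplus>\<^bsub>Q\<^esub>i\<in>?J. c (\<beta> i) \<odot>\<^bsub>Q\<^esub> \<beta> i) = cls x"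
   "\<kappa> x = (\<lambda>i. if i \<in> ?J then c (\<beta> i) else 0)"
   using comb[OF finJ, of "\<lambda>i. c (\<beta> i)"] by auto
  ultimately show ?thesis by (intro bexI[of _ x]) auto
 qed
 show ?thesis
  unfolding free_module_def
 proof (intro exI[of _ "\<beta> ` I"] conjI ballI)
  show "\<beta> ` I \<subseteq> carrier Q" using \<beta>Q by auto
  fix m assume "m \<in> carrier Q"
  then obtain y where y: "y \<in> Z" "m = cls y" by (auto simp: Q_carrier)
  define c where "c s = (if s \<in> \<beta> ` I then \<kappa> y (the_inv_into I \<beta> s) else 0)" for s
  have c\<beta>: "c (\<beta> i) = \<kappa> y i" if "i \<in> I" for i
   using that by (simp add: c_def the_inv_into_f_f[OF inj])
  have csub: "{s. c s ~= 0} \<subseteq> \<beta> ` {i. \<kappa> y i ~= 0}"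
  proof
   fix s assume "s \<in> {s. c s ~= 0}"
   then obtain i where "i \<in> I" "s = \<beta> i" "c s ~= 0" by (auto simp: c_def split: if_splits)
   then show "s \<in> \<beta> ` {i. \<kappa> y i ~= 0}" using c\<beta> by auto
  qed
  have cfin: "finite {s. c s ~= 0}" using csub fin[OF y(1)] by (meson finite_imageI finite_subset)
  have csubI: "{s. c s ~= 0} \<subseteq> \<beta> ` I" by (auto simp: c_def split: if_splits)
  show "\<exists>!c. finite {s. c s ~= 0} \<and> {s. c s ~= 0} \<subseteq> \<beta> ` I \<and>
    m = (\<Oplus>\<^bsub>Q\<^esub>s\<in>{s. c s ~= 0}. c s \<odot>\<^bsub>Q\<^esub> s)"
  proof (rule ex1I[of _ c])
   obtain x where x: "x \<in> Z" "(\<Oplus>\<^bsub>Q\<^esub>s\<in>{s. c s ~= 0}. c s \<odot>\<^bsub>Q\<^esub> s) = cls x"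
    "\<kappa> x = (\<lambda>i. if i \<in> I then c (\<beta> i) else 0)" using comb'[OF cfin csubI] by blast
   have "\<kappa> x = \<kappa> y" using x(3) c\<beta> supp[OF y(1)] by (intro ext) (auto split: if_splits)
   then have "m = (\<Oplus>\<^bsub>Q\<^esub>s\<in>{s. c s ~= 0}. c s \<odot>\<^bsub>Q\<^esub> s)"
    using \<kappa>_eq[OF x(1) y(1)] x(2) y(2) by simp
   then show "finite {s. c s ~= 0} \<and> {s. c s ~= 0} \<subseteq> \<beta> ` I \<and>
    m = (\<Oplus>\<^bsub>Q\<^esub>s\<in>{s. c s ~= 0}. c s \<odot>\<^bsub>Q\<^esub> s)" using cfin csubI by blast
  next
   fix c' assume c': "finite {s. c' s ~= 0} \<and> {s. c' s ~= 0} \<subseteq> \<beta> ` I \<and>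
    m = (\<Oplus>\<^bsub>Q\<^esub>s\<in>{s. c' s ~= 0}. c' s \<odot>\<^bsub>Q\<^esub> s)"
   then obtain x where x: "x \<in> Z" "m = cls x" "\<kappa> x = (\<lambda>i. if i \<in> I then c' (\<beta> i) else 0)"
    using comb'[of c'] by auto
   then have "\<kappa> x = \<kappa> y" using \<kappa>_eq[OF x(1) y(1)] y(2) by simp
   then have 1: "c' (\<beta> i) = \<kappa> y i" if "i \<in> I" for i
    using x(3) that by metis
   show "c' = c"
   proof
    fix s
    show "c' s = c s"
    proof (cases "s \<in> \<beta> ` I")
     case True
     then show ?thesis using 1 c\<beta> by auto
    next
     case False
     then show ?thesis using c' by (auto simp: c_def)
    qed
   qed
  qed
 qed
qed

end

section \<open>Quotients of modules of functions over a field or the integers\<close>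

text \<open>A euclidean size function treats both kinds of scalars alike: on a field, every quotient is
 exact.\<close>

definition euclidean_size :: "('k::comm_ring_1 => nat) => bool" where
 "euclidean_size N \<longleftrightarrow> (\<forall>a. N a = 0 \<longleftrightarrow> a = 0) \<and>
   (\<forall>a b. b ~= 0 --> (\<exists>q. N (a - q * b) < N b)) \<and> (\<forall>a b :: 'k. a * b = 0 --> a = 0 \<or> b = 0)"

lemma field_or_integers_euclidean_size:
 assumes "field_or_integers TYPE('k::comm_ring_1)"
 obtains N :: "'k::comm_ring_1 => nat" where "euclidean_size N"
proof -
 consider (field) "\<forall>x::'k. x ~= 0 --> (\<exists>y. x * y = 1)" | (int) "bij (of_int :: int => 'k)"
  using assms unfolding field_or_integers_def by blast
 then show thesis
 proof cases
  case field
  have dom: "a = 0 \<or> b = 0" if "a * b = 0" for a b :: 'k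
  proof (rule ccontr)
   assume "\<not> (a = 0 \<or> b = 0)"
   then obtain a' where "a * a' = 1" using field by blast
   then have "b = a' * (a * b)" by (metis mult.assoc mult.commute mult_1)
   then show False using that \<open>\<not> (a = 0 \<or> b = 0)\<close> by simp
  qed
  have "\<exists>q. a - q * b = 0" if b: "b ~= 0" for a b :: 'k
  proof -
   obtain b' where b': "b * b' = 1" using field b by blast
   have "(a * b') * b = a * (b * b')" by (simp only: mult_ac)
   then have "a - (a * b') * b = 0" using b' by simp
   then show ?thesis ..
  qed
  then have "euclidean_size (\<lambda>a::'k. if a = 0 then 0 else 1)"
   unfolding euclidean_size_def using dom by simp
  then show thesis by (rule that)
 next
  case int
  let ?i = "inv_into UNIV (of_int :: int => 'k)"
  have inj: "(of_int a :: 'k) = of_int b \<longleftrightarrow> a = b" for a b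
   using int by (metis bij_is_inj injD)
  have i: "of_int (?i a) = a" for a
   using int by (metis bij_is_surj surj_f_inv_f)
  have i': "?i (of_int a) = a" for a
   using int by (metis bij_is_inj inv_f_f)
  have i0: "?i a = 0 \<longleftrightarrow> a = 0" for a
   by (metis i i' of_int_0)
  have dom: "a = 0 \<or> b = 0" if "a * b = 0" for a b :: 'k
  proof -
   have "(of_int (?i a * ?i b) :: 'k) = of_int 0" using that by (simp add: i)
   then show ?thesis unfolding inj using i0 by auto
  qed
  have "\<exists>q. nat \<bar>?i (a - q * b)\<bar> < nat \<bar>?i b\<bar>" if "b ~= 0" for a b :: 'k
  proof (rule exI)
   let ?q = "?i a div ?i b"
   have "a - of_int ?q * b = of_int (?i a mod ?i b)"
    by (simp add: i flip: minus_div_mult_eq_mod)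
   then show "nat \<bar>?i (a - of_int ?q * b)\<bar> < nat \<bar>?i b\<bar>"
    using i0[of b] that by (simp add: i' abs_mod_less)
  qed
  then have "euclidean_size (\<lambda>a. nat \<bar>?i a\<bar>)"
   unfolding euclidean_size_def using dom i0 by auto
  then show thesis by (rule that)
 qed
qed

definition fun_submodule :: "('b => 'k::comm_ring_1) set => bool" where
 "fun_submodule Z \<longleftrightarrow> (\<lambda>b. 0) \<in> Z \<and> (\<forall>x\<in>Z. \<forall>y\<in>Z. (\<lambda>b. x b + y b) \<in> Z) \<and>
   (\<forall>r. \<forall>x\<in>Z. (\<lambda>b. r * x b) \<in> Z)"

lemma fun_submodule_zero: "fun_submodule Z ==> (\<lambda>b. 0) \<in> Z"
 and fun_submodule_add: "fun_submodule Z ==> x \<in> Z ==> y \<in> Z ==> (\<lambda>b. x b + y b) \<in> Z"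
 and fun_submodule_smult: "fun_submodule Z ==> x \<in> Z ==> (\<lambda>b. r * x b) \<in> Z"
 by (auto simp: fun_submodule_def)

lemma fun_submodule_diff:
 assumes "fun_submodule Z" "x \<in> Z" "y \<in> Z"
 shows "(\<lambda>b. x b - y b) \<in> Z"
 using fun_submodule_add[OF assms(1,2) fun_submodule_smult[OF assms(1,3), of "-1"]] by simp

definition lin_on :: "('b => 'k::comm_ring_1) set => (('b => 'k) => 'c => 'k) => bool" where
 "lin_on Z T \<longleftrightarrow> (\<forall>x\<in>Z. \<forall>y\<in>Z. T (\<lambda>b. x b + y b) = (\<lambda>c. T x c + T y c)) \<and>
   (\<forall>r. \<forall>x\<in>Z. T (\<lambda>b. r * x b) = (\<lambda>c. r * T x c))"

lemma lin_on_add: "lin_on Z T ==> x \<in> Z ==> y \<in> Z ==> T (\<lambda>b. x b + y b) = (\<lambda>c. T x c + T y c)"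
 and lin_on_smult: "lin_on Z T ==> x \<in> Z ==> T (\<lambda>b. r * x b) = (\<lambda>c. r * T x c)"
 by (auto simp: lin_on_def)

lemma lin_on_diff:
 assumes "lin_on Z T" "fun_submodule Z" "x \<in> Z" "y \<in> Z"
 shows "T (\<lambda>b. x b - y b) = (\<lambda>c. T x c - T y c)"
 using lin_on_add[OF assms(1,3) fun_submodule_smult[OF assms(2,4), of "-1"]]
  lin_on_smult[OF assms(1,4), of "-1"] by simp

lemma lin_on_zero:
 assumes "lin_on Z T" "fun_submodule Z"
 shows "T (\<lambda>b. 0) = (\<lambda>c. 0)"
 using lin_on_smult[OF assms(1) fun_submodule_zero[OF assms(2)], of 0] by simp

text \<open>By induction on \<open>X\<close>, evaluating at the new point: its values on \<open>Z\<close> form an ideal,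
 generated by an element of least size.\<close>

lemma submodule_finitely_generated:
 fixes Z :: "('b => 'k::comm_ring_1) set"
 assumes N: "euclidean_size (N :: 'k => nat)" and X: "finite X"
  and Z: "fun_submodule Z" and supp: "!!z b. z \<in> Z ==> b \<notin> X ==> z b = 0"
 shows "\<exists>(n::nat) x. (\<forall>i<n. x i \<in> Z) \<and> (\<forall>z\<in>Z. \<exists>c. z = (\<lambda>b. \<Sum>i<n. c i * x i b))"
 using X Z supp
proof (induction X arbitrary: Z)
 case empty
 then have "\<forall>z\<in>Z. z = (\<lambda>b. 0)" by auto
 then show ?case by (intro exI[of _ 0]) simp
next
 case (insert a X)
 let ?Z0 = "{z \<in> Z. z a = 0}"
 have Z0: "fun_submodule ?Z0"
  using insert.prems(1) by (auto simp: fun_submodule_def)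
 obtain n x where x: "\<forall>i<n. x i \<in> ?Z0" "\<forall>z\<in>?Z0. \<exists>c. z = (\<lambda>b. \<Sum>i<(n::nat). c i * x i b)"
  using insert.IH[OF Z0] insert.prems(2) by (smt (verit) insert_iff mem_Collect_eq)
 show ?case
 proof (cases "\<forall>z\<in>Z. z a = 0")
  case True
  then have "?Z0 = Z" by auto
  then show ?thesis using x by auto
 next
  case False
  then obtain w where w: "w \<in> Z" "w a ~= 0" and least: "!!v. v \<in> Z ==> v a ~= 0 ==> N (w a) \<le> N (v a)"
   using ex_has_least_nat[of "\<lambda>z. z \<in> Z \<and> z a ~= 0" _ "\<lambda>z. N (z a)"] by blast
  define y where "y i = (if i = n then w else x i)" for i
  show ?thesis
  proof (intro exI[of _ "Suc n"] exI[of _ y] conjI allI ballI impI)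
   fix i assume "i < Suc n"
   then show "y i \<in> Z" using w x by (auto simp: y_def)
  next
   fix z assume z: "z \<in> Z"
   obtain q where q: "N (z a - q * w a) < N (w a)"
    using N w unfolding euclidean_size_def by blast
   let ?v = "\<lambda>b. z b - q * w b"
   have v: "?v \<in> Z"
    by (rule fun_submodule_diff[OF insert.prems(1) z fun_submodule_smult[OF insert.prems(1) w(1)]])
   then have "?v a = 0" using least[of ?v] q by force
   then obtain c where c: "?v = (\<lambda>b. \<Sum>i<n. c i * x i b)" using x(2) v by blast
   have "z = (\<lambda>b. \<Sum>i<Suc n. (if i = n then q else c i) * y i b)"
   proof
    fix b
    have "z b = (\<Sum>i<n. c i * x i b) + q * w b"
     using fun_cong[OF c, of b] by (simp add: algebra_simps)
    then show "z b = (\<Sum>i<Suc n. (if i = n then q else c i) * y i b)"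
     by (simp add: y_def)
   qed
   then show "\<exists>c. z = (\<lambda>b. \<Sum>i<Suc n. c i * y i b)" by (intro exI)
  qed
 qed
qed

text \<open>Take a shortest family of generators modulo \<open>B\<close> and a nontrivial relation with
 coefficients of least total size. If two coefficients did not vanish, a euclidean division step
 would decrease that total; so only one does not, and by torsion-freeness its generator could be
 dropped.\<close>

lemma torsion_free_quotient_coordinates:
 fixes Z B :: "('b => 'k::comm_ring_1) set"
 assumes N: "euclidean_size (N :: 'k => nat)" and X: "finite X"
  and Z: "fun_submodule Z" and supp: "!!z b. z \<in> Z ==> b \<notin> X ==> z b = 0"
  and B: "fun_submodule B"
  and tf: "!!r z. z \<in> Z ==> r ~= 0 ==> (\<lambda>b. r * z b) \<in> B ==> z \<in> B"
 shows "\<exists>(n::nat) \<kappa>. lin_on Z \<kappa> \<and> (\<forall>z\<in>Z. \<forall>i. \<kappa> z i ~= 0 --> i < n) \<and>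
   (\<forall>z\<in>Z. \<kappa> z = (\<lambda>i. 0) \<longleftrightarrow> z \<in> B) \<and>
   (\<forall>i<n. \<exists>z\<in>Z. \<kappa> z = (\<lambda>j. if j = i then 1 else 0))"
proof -
 define gen where "gen n x \<longleftrightarrow> (\<forall>i<n. x i \<in> Z) \<and>
  (\<forall>z\<in>Z. \<exists>c. (\<lambda>b. z b - (\<Sum>i<n. c i * x i b)) \<in> B)" for n :: nat and x
 have "\<exists>n x. gen n x"
 proof -
  obtain n :: nat and x where x: "\<forall>i<n. x i \<in> Z" "\<forall>z\<in>Z. \<exists>c. z = (\<lambda>b. \<Sum>i<n. c i * x i b)"
   using submodule_finitely_generated[of N X Z] N X Z supp by blast
  have "\<exists>c. (\<lambda>b. z b - (\<Sum>i<n. c i * x i b)) \<in> B" if z: "z \<in> Z" for z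
  proof -
   obtain c where "z = (\<lambda>b. \<Sum>i<n. c i * x i b)" using x(2) z by blast
   then have "(\<lambda>b. z b - (\<Sum>i<n. c i * x i b)) = (\<lambda>b. 0)" by simp
   then show ?thesis using fun_submodule_zero[OF B] by metis
  qed
  then have "gen n x" using x(1) by (simp add: gen_def)
  then show ?thesis by blast
 qed
 then obtain n where n: "\<exists>x. gen n x" and least_n: "!!m. m < n ==> \<not> (\<exists>x. gen m x)"
  by (metis exists_least_iff[of "\<lambda>n. \<exists>x. gen n x"])
 define rel where "rel x c \<longleftrightarrow> gen n x \<and> (\<lambda>b. \<Sum>i<n. c i * x i b) \<in> B \<and> (\<exists>i<n. c i ~= 0)" for x c
 have N0: "N a = 0 \<longleftrightarrow> a = 0" for a using N by (simp add: euclidean_size_def)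
 have no_rel: "\<not> rel x c" for x c
 proof
  assume "rel x c"
  then obtain x c where rel: "rel x c"
   and least: "!!x' c'. rel x' c' ==> (\<Sum>i<n. N (c i)) \<le> (\<Sum>i<n. N (c' i))"
   using ex_has_least_nat[of "\<lambda>(x, c). rel x c" "(x, c)" "\<lambda>(x, c). \<Sum>i<n. N (c i)"] by auto
  have genx: "gen n x" and relB: "(\<lambda>b. \<Sum>i<n. c i * x i b) \<in> B" using rel by (auto simp: rel_def)
  have xZ: "x i \<in> Z" if "i < n" for i using genx that by (simp add: gen_def)
  have step: False if ij: "i < n" "j < n" "i ~= j" "c j ~= 0" "N (c j) \<le> N (c i)" for i j
  proof -
   obtain q where q: "N (c i - q * c j) < N (c j)"
    using N ij unfolding euclidean_size_def by blast
   define x' where "x' = x(j := \<lambda>b. x j b + q * x i b)"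
   define c' where "c' = c(i := c i - q * c j)"
   have comb: "(\<Sum>k<n. a k * x' k b) = (\<Sum>k<n. (a(i := a i + q * a j)) k * x k b)" for a b
   proof -
    have "(\<Sum>k<n. a k * x' k b) - (\<Sum>k<n. a k * x k b) = (\<Sum>k<n. if k = j then a j * q * x i b else 0)"
     unfolding sum_subtractf[symmetric] by (rule sum.cong) (auto simp: x'_def algebra_simps)
    moreover have "(\<Sum>k<n. (a(i := a i + q * a j)) k * x k b) - (\<Sum>k<n. a k * x k b)
      = (\<Sum>k<n. if k = i then a j * q * x i b else 0)"
     unfolding sum_subtractf[symmetric] by (rule sum.cong) (auto simp: algebra_simps)
    ultimately have "(\<Sum>k<n. a k * x' k b) - (\<Sum>k<n. a k * x k b)
      = (\<Sum>k<n. (a(i := a i + q * a j)) k * x k b) - (\<Sum>k<n. a k * x k b)"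
     using ij by simp
    then show ?thesis by (simp only: diff_left_imp_eq add_diff_cancel diff_conv_add_uminus add_right_cancel)
   qed
   have "gen n x'"
    unfolding gen_def
   proof (intro conjI allI ballI impI)
    fix k assume "k < n"
    then show "x' k \<in> Z"
     using xZ ij fun_submodule_add[OF Z _ fun_submodule_smult[OF Z]] by (auto simp: x'_def)
   next
    fix z assume "z \<in> Z"
    then obtain a where a: "(\<lambda>b. z b - (\<Sum>k<n. a k * x k b)) \<in> B" using genx by (auto simp: gen_def)
    define a' where "a' = a(i := a i - q * a j)"
    have "a'(i := a' i + q * a' j) = a" using ij by (auto simp: a'_def)
    then have "(\<lambda>b. z b - (\<Sum>k<n. a' k * x' k b)) \<in> B" using a comb[of a'] by simp
    then show "\<exists>a. (\<lambda>b. z b - (\<Sum>k<n. a k * x' k b)) \<in> B" by blast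
   qed
   moreover have "c'(i := c' i + q * c' j) = c" using ij by (auto simp: c'_def)
   then have "(\<lambda>b. \<Sum>k<n. c' k * x' k b) \<in> B" using relB comb[of c'] by simp
   moreover have "c' j ~= 0" using ij by (simp add: c'_def)
   ultimately have "rel x' c'" using ij by (auto simp: rel_def)
   then have "(\<Sum>k<n. N (c k)) \<le> (\<Sum>k<n. N (c' k))" by (rule least)
   moreover have "(\<Sum>k<n. N (c' k)) < (\<Sum>k<n. N (c k))"
    by (rule sum_strict_mono_ex1) (use ij q in \<open>auto simp: c'_def\<close>)
   ultimately show False by simp
  qed
  obtain i where i: "i < n" "c i ~= 0" using rel by (auto simp: rel_def)
  have others: "c j = 0" if "j < n" "j ~= i" for j
   using step[of i j] step[of j i] i that by fastforce
  have "(\<Sum>k<n. c k * x k b) = c i * x i b" for b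
  proof -
   have "(\<Sum>k<n. c k * x k b) = (\<Sum>k<n. if k = i then c i * x i b else 0)"
    by (rule sum.cong) (use others in auto)
   then show ?thesis using i by simp
  qed
  then have xi: "x i \<in> B" using tf[OF xZ[OF i(1)] i(2)] relB by simp
  define x' where "x' k = (if k < i then x k else x (Suc k))" for k
  obtain m where m: "n = Suc m" using i(1) by (cases n) auto
  have "gen m x'"
   unfolding gen_def
  proof (intro conjI allI ballI impI)
   fix k assume "k < m"
   then show "x' k \<in> Z" using xZ m by (simp add: x'_def)
  next
   fix z assume "z \<in> Z"
   then obtain a where a: "(\<lambda>b. z b - (\<Sum>k<n. a k * x k b)) \<in> B" using genx by (auto simp: gen_def)
   define a' where "a' k = (if k < i then a k else a (Suc k))" for k
   have "(\<Sum>k<n. a k * x k b) = (\<Sum>k<m. a' k * x' k b) + a i * x i b" for b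
   proof -
    define f where "f k = (if k < i then k else Suc k)" for k
    have "{..<n} = insert i (f ` {..<m})"
    proof -
     have "k \<in> f ` {..<m}" if "k < n" "k ~= i" for k
      using that m i by (cases "k < i") (auto simp: f_def intro!: image_eqI[of _ _ "if k < i then k else k - 1"])
     then have "{..<n} \<subseteq> insert i (f ` {..<m})" by blast
     moreover have "f ` {..<m} \<subseteq> {..<n}" using m by (auto simp: f_def split: if_splits)
     ultimately show ?thesis using i(1) by blast
    qed
    moreover have "inj_on f {..<m}" by (auto simp: inj_on_def f_def split: if_splits)
    moreover have "i \<notin> f ` {..<m}" by (auto simp: f_def)
    ultimately have "(\<Sum>k<n. a k * x k b) = a i * x i b + (\<Sum>k<m. a (f k) * x (f k) b)"
     by (simp add: sum.reindex)
    also have "(\<Sum>k<m. a (f k) * x (f k) b) = (\<Sum>k<m. a' k * x' k b)"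
     by (rule sum.cong) (auto simp: a'_def x'_def f_def)
    finally show ?thesis by simp
   qed
   then have "(\<lambda>b. z b - (\<Sum>k<m. a' k * x' k b)) = (\<lambda>b. (z b - (\<Sum>k<n. a k * x k b)) + a i * x i b)"
    by auto
   also have "\<dots> \<in> B" by (rule fun_submodule_add[OF B a fun_submodule_smult[OF B xi]])
   finally show "\<exists>a. (\<lambda>b. z b - (\<Sum>k<m. a k * x' k b)) \<in> B" by blast
  qed
  then show False using least_n[of m] m by blast
 qed
 obtain x where genx: "gen n x" using n by blast
 have xZ: "x i \<in> Z" if "i < n" for i using genx that by (simp add: gen_def)
 have uniq: "c i = c' i" if c: "(\<lambda>b. z b - (\<Sum>i<n. c i * x i b)) \<in> B"
  "(\<lambda>b. z b - (\<Sum>i<n. c' i * x i b)) \<in> B" and i: "i < n" for z c c' i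
 proof (rule ccontr)
  assume "c i ~= c' i"
  moreover have "(\<lambda>b. \<Sum>i<n. (c i - c' i) * x i b) \<in> B"
   using fun_submodule_diff[OF B c(2,1)] by (simp add: sum_subtractf left_diff_distrib)
  ultimately have "rel x (\<lambda>i. c i - c' i)" using genx i by (auto simp: rel_def)
  then show False using no_rel by blast
 qed
 define \<kappa> where "\<kappa> z = (SOME c. (\<lambda>b. z b - (\<Sum>i<n. c i * x i b)) \<in> B \<and> (\<forall>i. i \<ge> n --> c i = 0))" for z
 have \<kappa>: "(\<lambda>b. z b - (\<Sum>i<n. \<kappa> z i * x i b)) \<in> B \<and> (\<forall>i. i \<ge> n --> \<kappa> z i = 0)" if z: "z \<in> Z" for z
 proof -
  obtain c where c: "(\<lambda>b. z b - (\<Sum>i<n. c i * x i b)) \<in> B" using genx z by (auto simp: gen_def)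
  then have "\<exists>c. (\<lambda>b. z b - (\<Sum>i<n. c i * x i b)) \<in> B \<and> (\<forall>i. i \<ge> n --> c i = 0)"
   by (intro exI[of _ "\<lambda>i. if i < n then c i else 0"]) simp
  from someI_ex[OF this] show ?thesis unfolding \<kappa>_def .
 qed
 have \<kappa>I: "\<kappa> z = c" if "z \<in> Z" "(\<lambda>b. z b - (\<Sum>i<n. c i * x i b)) \<in> B" "!!i. i \<ge> n ==> c i = 0" for z c
  using \<kappa>[OF that(1)] uniq[of z "\<kappa> z" c] that by (intro ext) (metis not_le)
 show ?thesis
 proof (intro exI[of _ n] exI[of _ \<kappa>] conjI ballI allI impI)
  show "lin_on Z \<kappa>"
   unfolding lin_on_def
  proof (intro conjI ballI allI)
   fix y z assume yz: "y \<in> Z" "z \<in> Z"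
   show "\<kappa> (\<lambda>b. y b + z b) = (\<lambda>i. \<kappa> y i + \<kappa> z i)"
   proof (rule \<kappa>I)
    show "(\<lambda>b. y b + z b) \<in> Z" by (rule fun_submodule_add[OF Z yz])
    show "(\<lambda>b. y b + z b - (\<Sum>i<n. (\<kappa> y i + \<kappa> z i) * x i b)) \<in> B"
     using fun_submodule_add[OF B conjunct1[OF \<kappa>[OF yz(1)]] conjunct1[OF \<kappa>[OF yz(2)]]]
     by (simp add: distrib_right sum.distrib algebra_simps)
   qed (use \<kappa> yz in auto)
  next
   fix r y assume y: "y \<in> Z"
   show "\<kappa> (\<lambda>b. r * y b) = (\<lambda>i. r * \<kappa> y i)"
   proof (rule \<kappa>I)
    show "(\<lambda>b. r * y b) \<in> Z" by (rule fun_submodule_smult[OF Z y])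
    show "(\<lambda>b. r * y b - (\<Sum>i<n. (r * \<kappa> y i) * x i b)) \<in> B"
     using fun_submodule_smult[OF B conjunct1[OF \<kappa>[OF y]], of r]
     by (simp add: right_diff_distrib sum_distrib_left mult.assoc)
   qed (use \<kappa> y in auto)
  qed
 next
  fix z i assume "z \<in> Z" "\<kappa> z i ~= 0"
  then show "i < n" using \<kappa> by (meson not_le)
 next
  fix z assume z: "z \<in> Z"
  show "\<kappa> z = (\<lambda>i. 0) \<longleftrightarrow> z \<in> B"
  proof
   assume "\<kappa> z = (\<lambda>i. 0)"
   then show "z \<in> B" using \<kappa>[OF z] by simp
  next
   assume "z \<in> B"
   then show "\<kappa> z = (\<lambda>i. 0)" by (intro \<kappa>I z) simp_all
  qed
 next
  fix i assume i: "i < n"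
  have "\<kappa> (x i) = (\<lambda>j. if j = i then 1 else 0)"
  proof (rule \<kappa>I)
   have "(\<Sum>j<n. (if j = i then 1 else 0) * x j b) = x i b" for b
   proof -
    have "(\<Sum>j<n. (if j = i then 1 else 0) * x j b) = (\<Sum>j<n. if j = i then x i b else 0)"
     by (rule sum.cong) auto
    then show ?thesis using i by simp
   qed
   then show "(\<lambda>b. x i b - (\<Sum>j<n. (if j = i then 1 else 0) * x j b)) \<in> B"
    using fun_submodule_zero[OF B] by simp
  qed (use i xZ in auto)
  then show "\<exists>z\<in>Z. \<kappa> z = (\<lambda>j. if j = i then 1 else 0)" using xZ[OF i] by blast
 qed
qed

text \<open>An isomorphism between the quotients of cocycles \<open>Z\<close> by coboundaries \<open>B\<close> of two complexes,
 given by a linear map of cocycles.\<close>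

definition quotient_iso ::
 "('b => 'k::comm_ring_1) set => ('b => 'k) set => ('c => 'k) set => ('c => 'k) set =>
   (('b => 'k) => 'c => 'k) => bool" where
 "quotient_iso Z B Z' B' T \<longleftrightarrow> lin_on Z T \<and> (\<forall>z\<in>Z. T z \<in> Z') \<and> (\<forall>z\<in>Z. T z \<in> B' \<longleftrightarrow> z \<in> B) \<and>
   (\<forall>z'\<in>Z'. \<exists>z\<in>Z. (\<lambda>c. z' c - T z c) \<in> B')"

lemma quotient_iso_trans:
 assumes 1: "quotient_iso Z B Z' B' T" and 2: "quotient_iso Z' B' Z'' B'' U"
  and Z': "fun_submodule Z'" and B'': "fun_submodule B''"
 shows "quotient_iso Z B Z'' B'' (U \<circ> T)"
 unfolding quotient_iso_def
proof (intro conjI ballI)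
 have TZ: "T z \<in> Z'" if "z \<in> Z" for z using 1 that by (simp add: quotient_iso_def)
 have U: "lin_on Z' U" using 2 by (simp add: quotient_iso_def)
 show "lin_on Z (U \<circ> T)"
  using 1 TZ U unfolding quotient_iso_def lin_on_def by simp
 fix z assume "z \<in> Z''"
 then obtain z' where z': "z' \<in> Z'" "(\<lambda>c. z c - U z' c) \<in> B''" using 2 by (auto simp: quotient_iso_def)
 then obtain w where w: "w \<in> Z" "(\<lambda>c. z' c - T w c) \<in> B'" using 1 by (auto simp: quotient_iso_def)
 have "U (\<lambda>c. z' c - T w c) \<in> B''"
  using 2 w(2) fun_submodule_diff[OF Z' z'(1) TZ[OF w(1)]] by (auto simp: quotient_iso_def)
 then have "(\<lambda>c. U z' c - U (T w) c) \<in> B''"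
  by (simp add: lin_on_diff[OF U Z' z'(1) TZ[OF w(1)]])
 from fun_submodule_add[OF B'' z'(2) this] w(1)
 show "\<exists>w\<in>Z. (\<lambda>c. z c - (U \<circ> T) w c) \<in> B''" by auto
qed (use 1 2 in \<open>auto simp: quotient_iso_def\<close>)

lemma quotient_isoI:
 assumes B: "fun_submodule B" and B': "fun_submodule B'" and Z: "fun_submodule Z" and Z': "fun_submodule Z'"
  and T: "lin_on Z T" "!!z. z \<in> Z ==> T z \<in> Z'" "!!z. z \<in> Z ==> z \<in> B ==> T z \<in> B'"
  and U: "!!z. z \<in> Z' ==> U z \<in> Z" "!!z. z \<in> Z' ==> z \<in> B' ==> U z \<in> B"
  and UT: "!!z. z \<in> Z ==> (\<lambda>b. U (T z) b - z b) \<in> B"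
  and TU: "!!z. z \<in> Z' ==> (\<lambda>b. T (U z) b - z b) \<in> B'"
 shows "quotient_iso Z B Z' B' T"
 unfolding quotient_iso_def
proof (intro conjI ballI iffI)
 fix z assume z: "z \<in> Z" "T z \<in> B'"
 have "(\<lambda>b. U (T z) b - (U (T z) b - z b)) \<in> B"
  by (rule fun_submodule_diff[OF B U(2)[OF T(2) z(2)] UT]) (use z in auto)
 then show "z \<in> B" by simp
next
 fix z assume z: "z \<in> Z'"
 have "(\<lambda>b. - 1 * (T (U z) b - z b)) \<in> B'" by (rule fun_submodule_smult[OF B' TU[OF z]])
 then show "\<exists>w\<in>Z. (\<lambda>c. z c - T w c) \<in> B'" using U(1)[OF z] by auto
qed (use T in auto)

section \<open>Chain complexes with a lattice of symmetries, and their orbit-finite cochains\<close>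

abbreviation "keys \<equiv> Poly_Mapping.keys"

definition pairing :: "('b => 'k::comm_ring_1) => ('b \<Rightarrow>\<^sub>0 int) => 'k" where
 "pairing \<phi> c = (\<Sum>b\<in>keys c. of_int (Poly_Mapping.lookup c b) * \<phi> b)"

lemma pairing_superset:
 assumes "finite A" "keys c \<subseteq> A"
 shows "pairing \<phi> c = (\<Sum>b\<in>A. of_int (Poly_Mapping.lookup c b) * \<phi> b)"
 unfolding pairing_def
 by (rule sum.mono_neutral_left) (use assms in \<open>auto simp: in_keys_iff\<close>)

lemma pairing_add: "pairing \<phi> (c + d) = pairing \<phi> c + pairing \<phi> d"
proof -
 let ?A = "keys c \<union> keys d"
 have "keys (c + d) \<subseteq> ?A" by (rule Poly_Mapping.keys_add)
 then show ?thesis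
  by (simp add: pairing_superset[of ?A] lookup_add distrib_right sum.distrib)
qed

lemma pairing_cmul: "pairing \<phi> (frag_cmul k c) = of_int k * pairing \<phi> c"
 unfolding pairing_superset[OF finite_keys keys_cmul]
 by (simp add: sum_distrib_left mult.assoc pairing_def)

lemma pairing_0 [simp]: "pairing \<phi> 0 = 0"
 by (simp add: pairing_def)

lemma pairing_of [simp]: "pairing \<phi> (frag_of b) = \<phi> b"
 by (simp add: pairing_def)

lemma pairing_minus: "pairing \<phi> (- c) = - pairing \<phi> c"
 using pairing_cmul[of \<phi> "-1" c] by simp

lemma pairing_diff: "pairing \<phi> (c - d) = pairing \<phi> c - pairing \<phi> d"
 using pairing_add[of \<phi> c "- d"] by (simp add: pairing_minus)

lemma pairing_sum: "pairing \<phi> (sum f A) = (\<Sum>a\<in>A. pairing \<phi> (f a))"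
 by (induction A rule: infinite_finite_induct) (simp_all add: pairing_add)

lemma pairing_frag_extend: "pairing \<phi> (frag_extend f c) = pairing (\<lambda>b. pairing \<phi> (f b)) c"
 by (simp add: frag_extend_def pairing_sum pairing_cmul pairing_def[of _ c])

lemma pairing_cong: "(!!b. b \<in> keys c ==> \<phi> b = \<psi> b) ==> pairing \<phi> c = pairing \<psi> c"
 by (simp add: pairing_def)

lemma pairing_zero_fun [simp]: "pairing (\<lambda>b. 0) c = 0"
 by (simp add: pairing_def)

lemma pairing_add_fun: "pairing (\<lambda>b. \<phi> b + \<psi> b) c = pairing \<phi> c + pairing \<psi> c"
 by (simp add: pairing_def distrib_left sum.distrib)

lemma pairing_smult_fun: "pairing (\<lambda>b. r * \<phi> b) c = r * pairing \<phi> c"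
 by (simp add: pairing_def sum_distrib_left mult.left_commute)

abbreviation augmentation :: "('b \<Rightarrow>\<^sub>0 int) => int" where
 "augmentation \<equiv> pairing (\<lambda>_. 1)"

lemma frag_extend_frag_extend:
 "frag_extend f (frag_extend g c) = frag_extend (\<lambda>b. frag_extend f (g b)) c"
proof -
 have "c = c ==> keys c \<subseteq> UNIV" by simp
 then have "keys c \<subseteq> UNIV" by simp
 then show ?thesis
  by (induction c rule: frag_induction) (auto simp: frag_extend_diff)
qed

lemma frag_extend_cong:
 "(!!b. b \<in> keys c ==> f b = g b) ==> frag_extend f c = frag_extend g c"
 by (simp add: frag_extend_def)

lemma frag_extend_diff_fun: "frag_extend (\<lambda>b. f b - g b) c = frag_extend f c - frag_extend g c"
proof -
 have "keys c \<subseteq> UNIV" by simp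
 then show ?thesis
  by (induction c rule: frag_induction) (auto simp: frag_extend_diff)
qed

lemma frag_extend_id: "frag_extend frag_of c = c"
 using frag_expansion by metis

lemma keys_frag_extend_subset:
 "(!!b. b \<in> keys c ==> keys (f b) \<subseteq> A) ==> keys (frag_extend f c) \<subseteq> A"
 using keys_frag_extend[of f c] by blast

lemma keys_diff_subset:
 "keys c \<subseteq> A ==> keys d \<subseteq> A ==> keys (c - d) \<subseteq> A"
 using keys_diff[of c d] by blast

text \<open>A chain complex of free abelian groups with bases \<open>B p\<close>, permuted by a group \<open>\<Lambda>\<close> of
 translations. The equivariant map \<open>base\<close> to the group shows that \<open>\<Lambda>\<close> acts freely, and it
 selects a representative of each orbit, namely the element with base point \<open>0\<close>.\<close>

locale lattice_complex =
 fixes \<Lambda> :: "'g::ab_group_add set" and B :: "nat => 'b set"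
  and bd :: "nat => 'b => ('b \<Rightarrow>\<^sub>0 int)" and tr :: "nat => 'g => 'b => 'b"
  and base :: "nat => 'b => 'g"
 assumes lattice_add: "m \<in> \<Lambda> ==> n \<in> \<Lambda> ==> m + n \<in> \<Lambda>"
  and lattice_minus: "n \<in> \<Lambda> ==> - n \<in> \<Lambda>"
  and lattice_zero: "0 \<in> \<Lambda>"
  and tr_B: "n \<in> \<Lambda> ==> b \<in> B p ==> tr p n b \<in> B p"
  and tr_zero: "b \<in> B p ==> tr p 0 b = b"
  and tr_add: "m \<in> \<Lambda> ==> n \<in> \<Lambda> ==> b \<in> B p ==> tr p (m + n) b = tr p m (tr p n b)"
  and base_lattice: "b \<in> B p ==> base p b \<in> \<Lambda>"
  and base_tr: "n \<in> \<Lambda> ==> b \<in> B p ==> base p (tr p n b) = n + base p b"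
  and bd_0: "b \<in> B 0 ==> bd 0 b = 0"
  and bd_keys: "b \<in> B (Suc p) ==> keys (bd (Suc p) b) \<subseteq> B p"
  and bd_tr: "n \<in> \<Lambda> ==> b \<in> B (Suc p) ==>
   bd (Suc p) (tr (Suc p) n b) = frag_extend (frag_of \<circ> tr p n) (bd (Suc p) b)"
  and bd_bd: "b \<in> B (Suc (Suc p)) ==> frag_extend (bd (Suc p)) (bd (Suc (Suc p)) b) = 0"
  and bd_augmentation: "b \<in> B (Suc 0) ==> augmentation (bd (Suc 0) b) = 0"
begin

abbreviation "ext_tr p n \<equiv> frag_extend (frag_of \<circ> tr p n)"
abbreviation "dd p \<equiv> frag_extend (bd p)"

lemma ext_tr_keys:
 "n \<in> \<Lambda> ==> keys c \<subseteq> B p ==> keys (ext_tr p n c) \<subseteq> B p"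
 by (rule keys_frag_extend_subset) (use tr_B in auto)

lemma ext_tr_add:
 assumes "m \<in> \<Lambda>" "n \<in> \<Lambda>" "keys c \<subseteq> B p"
 shows "ext_tr p (m + n) c = ext_tr p m (ext_tr p n c)"
 unfolding frag_extend_frag_extend
 by (rule frag_extend_cong) (use assms tr_add in auto)

lemma dd_tr:
 assumes "n \<in> \<Lambda>" "keys c \<subseteq> B (Suc p)"
 shows "dd (Suc p) (ext_tr (Suc p) n c) = ext_tr p n (dd (Suc p) c)"
 unfolding frag_extend_frag_extend
 by (rule frag_extend_cong) (use assms bd_tr in auto)

lemma tr_minus_cancel: "n \<in> \<Lambda> ==> b \<in> B p ==> tr p n (tr p (- n) b) = b"
 using tr_add[of n "- n" b p] lattice_minus tr_zero by simp

text \<open>Choices are made for the orbit representatives and translated from there.\<close>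

lemma equivariant_choice:
 assumes ex: "!!b. b \<in> B p ==> \<exists>x. P b x"
  and eqv: "!!b x n. b \<in> B p ==> n \<in> \<Lambda> ==> P b x ==> P (tr p n b) (act n x)"
  and act: "!!b x m n. b \<in> B p ==> P b x ==> m \<in> \<Lambda> ==> n \<in> \<Lambda> ==> act (m + n) x = act m (act n x)"
 obtains X where "!!b. b \<in> B p ==> P b (X b)" "!!b n. b \<in> B p ==> n \<in> \<Lambda> ==> X (tr p n b) = act n (X b)"
proof -
 obtain Y where Y: "!!b. b \<in> B p ==> P b (Y b)" using ex by metis
 define rep where "rep b = tr p (- base p b) b" for b
 have rep: "rep b \<in> B p" if "b \<in> B p" for b
  using that tr_B lattice_minus base_lattice by (simp add: rep_def)
 define X where "X b = act (base p b) (Y (rep b))" for b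
 show thesis
 proof (rule that)
  fix b assume b: "b \<in> B p"
  have "P (tr p (base p b) (rep b)) (X b)"
   unfolding X_def by (rule eqv[OF rep[OF b] base_lattice[OF b] Y[OF rep[OF b]]])
  then show "P b (X b)"
   using tr_minus_cancel[OF base_lattice[OF b] b] by (simp add: rep_def)
  fix n assume n: "n \<in> \<Lambda>"
  have "- (n + base p b) \<in> \<Lambda>"
   by (intro lattice_minus lattice_add n base_lattice b)
  then have "rep (tr p n b) = tr p (- (n + base p b) + n) b"
   unfolding rep_def base_tr[OF n b] using tr_add[of "- (n + base p b)" n b p] n b by simp
  also have "- (n + base p b) + n = - base p b" by simp
  finally have "rep (tr p n b) = rep b" unfolding rep_def .
  then show "X (tr p n b) = act n (X b)"
   unfolding X_def base_tr[OF n b] using act[OF rep[OF b] Y[OF rep[OF b]] n base_lattice[OF b]] by simp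
 qed
qed

definition is_cycle :: "nat => ('b \<Rightarrow>\<^sub>0 int) => bool" where
 "is_cycle p z \<longleftrightarrow> keys z \<subseteq> B p \<and> (if p = 0 then augmentation z = 0 else dd p z = 0)"

lemma is_cycle_bd: "b \<in> B (Suc p) ==> is_cycle p (bd (Suc p) b)"
 using bd_keys bd_augmentation bd_bd by (cases p) (auto simp: is_cycle_def)

end

locale lattice_complex_pair = C: lattice_complex \<Lambda> B bd tr base + C': lattice_complex \<Lambda> B' bd' tr' base'
 for \<Lambda> :: "'g::ab_group_add set" and B :: "nat => 'b set" and bd tr base
  and B' :: "nat => 'c set" and bd' tr' base'
begin

definition equivariant :: "nat => nat => ('b => 'c \<Rightarrow>\<^sub>0 int) => bool" where
 "equivariant p q F \<longleftrightarrow> (\<forall>b\<in>B p. keys (F b) \<subseteq> B' q \<and>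
   (\<forall>n\<in>\<Lambda>. F (tr p n b) = C'.ext_tr q n (F b)))"

definition chain_morphism :: "(nat => 'b => 'c \<Rightarrow>\<^sub>0 int) => bool" where
 "chain_morphism F \<longleftrightarrow> (\<forall>p. equivariant p p (F p)) \<and>
   (\<forall>p. \<forall>b\<in>B (Suc p). C'.dd (Suc p) (F (Suc p) b) = frag_extend (F p) (bd (Suc p) b))"

lemma equivariant_keys: "equivariant p q F ==> b \<in> B p ==> keys (F b) \<subseteq> B' q"
 and equivariant_tr: "equivariant p q F ==> b \<in> B p ==> n \<in> \<Lambda> ==> F (tr p n b) = C'.ext_tr q n (F b)"
 by (auto simp: equivariant_def)

lemma equivariant_ext_keys:
 "equivariant p q F ==> keys c \<subseteq> B p ==> keys (frag_extend F c) \<subseteq> B' q"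
 by (rule keys_frag_extend_subset) (auto simp: equivariant_def)

lemma equivariant_ext_tr:
 assumes "equivariant p q F" "keys c \<subseteq> B p" "n \<in> \<Lambda>"
 shows "frag_extend F (C.ext_tr p n c) = C'.ext_tr q n (frag_extend F c)"
 unfolding frag_extend_frag_extend
 by (rule frag_extend_cong) (use assms equivariant_tr in auto)

lemma chain_morphism_equivariant: "chain_morphism F ==> equivariant p p (F p)"
 by (simp add: chain_morphism_def)

lemma chain_morphism_dd:
 assumes "chain_morphism F" "keys c \<subseteq> B (Suc p)"
 shows "C'.dd (Suc p) (frag_extend (F (Suc p)) c) = frag_extend (F p) (C.dd (Suc p) c)"
 unfolding frag_extend_frag_extend
 by (rule frag_extend_cong) (use assms in \<open>auto simp: chain_morphism_def\<close>)

end

text \<open>A carrier assigns to every basis element \<open>b\<close> an acyclic subcomplex of the target, in which the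
 images of \<open>b\<close> under maps and homotopies are to be found.\<close>

locale acyclic_carrier = lattice_complex_pair +
 fixes car :: "nat => 'b => nat => 'c set"
 assumes car_B: "b \<in> B p ==> car p b q \<subseteq> B' q"
  and car_bd: "b \<in> B (Suc p) ==> b' \<in> keys (bd (Suc p) b) ==> car p b' q \<subseteq> car (Suc p) b q"
  and car_tr: "b \<in> B p ==> n \<in> \<Lambda> ==> c \<in> car p b q ==> tr' q n c \<in> car p (tr p n b) q"
  and car_nonempty: "b \<in> B 0 ==> car 0 b 0 ~= {}"
  and car_acyclic: "b \<in> B p ==> keys z \<subseteq> car p b q ==> C'.is_cycle q z ==>
    \<exists>w. keys w \<subseteq> car p b (Suc q) \<and> C'.dd (Suc q) w = z"
begin

definition carried :: "nat => nat => ('b => 'c \<Rightarrow>\<^sub>0 int) => bool" where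
 "carried p q F \<longleftrightarrow> (\<forall>b\<in>B p. keys (F b) \<subseteq> car p b q)"

lemma carried_bd:
 assumes "carried p q F" "b \<in> B (Suc p)"
 shows "keys (frag_extend F (bd (Suc p) b)) \<subseteq> car (Suc p) b q"
 by (rule keys_frag_extend_subset) (use assms car_bd C.bd_keys carried_def in blast)

lemma carrier_step:
 assumes Z: "carried p q Z" "equivariant p q Z" "!!b. b \<in> B p ==> C'.is_cycle q (Z b)"
 shows "\<exists>X. carried p (Suc q) X \<and> equivariant p (Suc q) X \<and> (\<forall>b\<in>B p. C'.dd (Suc q) (X b) = Z b)"
proof -
 define P where "P b x \<longleftrightarrow> keys x \<subseteq> car p b (Suc q) \<and> C'.dd (Suc q) x = Z b" for b x
 have PB: "keys x \<subseteq> B' (Suc q)" if "b \<in> B p" "P b x" for b x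
  by (rule subset_trans[OF conjunct1[OF that(2)[unfolded P_def]] car_B[OF that(1)]])
 obtain X where X: "!!b. b \<in> B p ==> P b (X b)"
  "!!b n. b \<in> B p ==> n \<in> \<Lambda> ==> X (tr p n b) = C'.ext_tr (Suc q) n (X b)"
 proof (rule C.equivariant_choice[of p P "C'.ext_tr (Suc q)"])
  show "\<exists>x. P b x" if "b \<in> B p" for b
   unfolding P_def
   by (rule car_acyclic[OF that]) (use Z that in \<open>simp_all add: carried_def\<close>)
  show "P (tr p n b) (C'.ext_tr (Suc q) n x)" if b: "b \<in> B p" and n: "n \<in> \<Lambda>" and P: "P b x" for b x n
  proof -
   have "keys (C'.ext_tr (Suc q) n x) \<subseteq> car p (tr p n b) (Suc q)"
    by (rule keys_frag_extend_subset) (use P car_tr[OF b n] in \<open>auto simp: P_def\<close>)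
   moreover have "C'.dd (Suc q) (C'.ext_tr (Suc q) n x) = Z (tr p n b)"
    using C'.dd_tr[OF n PB[OF b P]] P equivariant_tr[OF Z(2) b n] by (simp add: P_def)
   ultimately show ?thesis by (simp add: P_def)
  qed
  show "C'.ext_tr (Suc q) (m + n) x = C'.ext_tr (Suc q) m (C'.ext_tr (Suc q) n x)"
   if "b \<in> B p" "P b x" "m \<in> \<Lambda>" "n \<in> \<Lambda>" for b x m n
   by (rule C'.ext_tr_add) (use that PB in auto)
 qed auto
 have "carried p (Suc q) X" using X(1) by (auto simp: carried_def P_def)
 moreover have "equivariant p (Suc q) X" using X PB by (simp add: equivariant_def)
 ultimately show ?thesis using X(1) by (auto simp: P_def)
qed

text \<open>The map is built degree by degree: the image of the boundary of \<open>b\<close> is a cycle in the carrier of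
 \<open>b\<close>, so it bounds a chain there.\<close>

theorem carried_chain_morphism:
 "\<exists>F. chain_morphism F \<and> (\<forall>p. carried p p (F p)) \<and> (\<forall>b\<in>B 0. augmentation (F 0 b) = 1)"
proof -
 define Q where "Q p F \<longleftrightarrow> carried p p F \<and> equivariant p p F \<and>
  (p = 0 --> (\<forall>b\<in>B 0. augmentation (F b) = 1)) \<and>
  (\<forall>z. C.is_cycle p z --> C'.is_cycle p (frag_extend F z))" for p F
 have "\<exists>F. \<forall>p. Q p (F p) \<and>
  (\<forall>b\<in>B (Suc p). C'.dd (Suc p) (F (Suc p) b) = frag_extend (F p) (bd (Suc p) b))"
 proof (rule dependent_nat_choice[of Q "\<lambda>p F G. \<forall>b\<in>B (Suc p). C'.dd (Suc p) (G b) = frag_extend F (bd (Suc p) b)"])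
  show "\<exists>F. Q 0 F"
  proof -
   obtain X where X: "!!b. b \<in> B 0 ==> \<exists>c\<in>car 0 b 0. X b = frag_of c"
    "!!b n. b \<in> B 0 ==> n \<in> \<Lambda> ==> X (tr 0 n b) = C'.ext_tr 0 n (X b)"
   proof (rule C.equivariant_choice[of 0 "\<lambda>b x. \<exists>c\<in>car 0 b 0. x = frag_of c" "C'.ext_tr 0"])
    show "\<exists>x. \<exists>c\<in>car 0 b 0. x = frag_of c" if "b \<in> B 0" for b
     using car_nonempty[OF that] by blast
    show "\<exists>c\<in>car 0 (tr 0 n b) 0. C'.ext_tr 0 n x = frag_of c"
     if b: "b \<in> B 0" and n: "n \<in> \<Lambda>" and x: "\<exists>c\<in>car 0 b 0. x = frag_of c" for b x n
    proof -
     obtain c where c: "c \<in> car 0 b 0" "x = frag_of c" using x by blast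
     show ?thesis by (rule bexI[OF _ car_tr[OF b n c(1)]]) (simp add: c(2))
    qed
    show "C'.ext_tr 0 (m + n) x = C'.ext_tr 0 m (C'.ext_tr 0 n x)"
     if b: "b \<in> B 0" and x: "\<exists>c\<in>car 0 b 0. x = frag_of c" and mn: "m \<in> \<Lambda>" "n \<in> \<Lambda>" for b x m n
    proof (rule C'.ext_tr_add[OF mn])
     show "keys x \<subseteq> B' 0" using x car_B[OF b] by (elim bexE) auto
    qed
   qed blast
   have XB: "\<exists>c\<in>B' 0. X b = frag_of c" if "b \<in> B 0" for b using X(1)[OF that] car_B[OF that] by blast
   then have aug: "augmentation (X b) = 1" if "b \<in> B 0" for b using that by (metis pairing_of)
   have XB': "keys (X b) \<subseteq> B' 0" if "b \<in> B 0" for b using XB[OF that] by (elim bexE) simp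
   have eq: "equivariant 0 0 X" using X(2) XB' unfolding equivariant_def by blast
   have "C'.is_cycle 0 (frag_extend X z)" if z: "C.is_cycle 0 z" for z
   proof -
    have "augmentation (frag_extend X z) = augmentation z"
     unfolding pairing_frag_extend
     by (rule pairing_cong) (use z aug in \<open>auto simp: C.is_cycle_def\<close>)
    then show ?thesis using z equivariant_ext_keys[OF eq, of z] by (simp add: C.is_cycle_def C'.is_cycle_def)
   qed
   moreover have "carried 0 0 X"
    unfolding carried_def
   proof
    fix b assume "b \<in> B 0"
    from X(1)[OF this] show "keys (X b) \<subseteq> car 0 b 0" by (elim bexE) simp
   qed
   ultimately have "Q 0 X" using eq aug by (simp add: Q_def)
   then show ?thesis by (rule exI[of "Q 0"])
  qed
 next
  fix F p assume Q: "Q p F"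
  let ?Z = "\<lambda>b. frag_extend F (bd (Suc p) b)"
  have eF: "equivariant p p F" using Q by (simp add: Q_def)
  have "carried (Suc p) p ?Z"
   using Q carried_bd by (auto simp: Q_def carried_def)
  moreover have "equivariant (Suc p) p ?Z"
   unfolding equivariant_def
   using equivariant_ext_keys[OF eF C.bd_keys] equivariant_ext_tr[OF eF C.bd_keys] C.bd_tr by simp
  moreover have "C'.is_cycle p (?Z b)" if "b \<in> B (Suc p)" for b
   using Q C.is_cycle_bd[OF that] by (simp add: Q_def)
  ultimately obtain X where X: "carried (Suc p) (Suc p) X" "equivariant (Suc p) (Suc p) X"
   "\<forall>b\<in>B (Suc p). C'.dd (Suc p) (X b) = ?Z b" using carrier_step[of "Suc p" p ?Z] by blast
  have "C'.is_cycle (Suc p) (frag_extend X z)" if z: "C.is_cycle (Suc p) z" for z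
  proof -
   have zB: "keys z \<subseteq> B (Suc p)" using z by (simp add: C.is_cycle_def)
   have "C'.dd (Suc p) (frag_extend X z) = frag_extend ?Z z"
    unfolding frag_extend_frag_extend by (rule frag_extend_cong) (use zB X in auto)
   also have "\<dots> = frag_extend F (C.dd (Suc p) z)" by (simp add: frag_extend_frag_extend)
   also have "\<dots> = 0" using z by (simp add: C.is_cycle_def)
   finally show ?thesis using equivariant_ext_keys[OF X(2) zB] by (simp add: C'.is_cycle_def)
  qed
  then have "Q (Suc p) X" using X by (simp add: Q_def)
  then show "\<exists>G. Q (Suc p) G \<and> (\<forall>b\<in>B (Suc p). C'.dd (Suc p) (G b) = ?Z b)" using X(3) by (intro exI[of _ X] conjI)
 qed
 then obtain F where F: "\<forall>p. Q p (F p) \<and>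
  (\<forall>b\<in>B (Suc p). C'.dd (Suc p) (F (Suc p) b) = frag_extend (F p) (bd (Suc p) b))" by (rule exE)
 show ?thesis
  by (rule exI[of _ F]) (use F in \<open>simp add: chain_morphism_def Q_def\<close>)
qed

text \<open>In each degree, the part of the homotopy relation that is already determined is a cycle in the carrier,
 hence a boundary there. The relation is stated on basis elements; its term \<open>D p \<circ> bd\<close> is void
 in degree 0.\<close>

theorem carried_homotopy:
 assumes E: "!!p. equivariant p p (E p)" "!!p. carried p p (E p)" "!!b. b \<in> B 0 ==> augmentation (E 0 b) = 0"
  and Ed: "!!p b. b \<in> B (Suc p) ==> C'.dd (Suc p) (E (Suc p) b) = frag_extend (E p) (bd (Suc p) b)"
 shows "\<exists>D. (\<forall>p. equivariant p (Suc p) (D p)) \<and> (\<forall>b\<in>B 0. C'.dd (Suc 0) (D 0 b) = E 0 b) \<and>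
  (\<forall>p. \<forall>b\<in>B (Suc p). C'.dd (Suc (Suc p)) (D (Suc p) b) = E (Suc p) b - frag_extend (D p) (bd (Suc p) b))"
proof -
 define Q where "Q p D \<longleftrightarrow> carried p (Suc p) D \<and> equivariant p (Suc p) D \<and>
  (p = 0 --> (\<forall>b\<in>B 0. C'.dd (Suc 0) (D b) = E 0 b)) \<and>
  (\<forall>z. C.is_cycle p z --> C'.dd (Suc p) (frag_extend D z) = frag_extend (E p) z)" for p D
 have "\<exists>D. \<forall>p. Q p (D p) \<and>
  (\<forall>b\<in>B (Suc p). C'.dd (Suc (Suc p)) (D (Suc p) b) = E (Suc p) b - frag_extend (D p) (bd (Suc p) b))"
 proof (rule dependent_nat_choice[of Q "\<lambda>p D G. \<forall>b\<in>B (Suc p).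
   C'.dd (Suc (Suc p)) (G b) = E (Suc p) b - frag_extend D (bd (Suc p) b)"])
  have "C'.is_cycle 0 (E 0 b)" if "b \<in> B 0" for b
   using E(3)[OF that] equivariant_keys[OF E(1) that] by (simp add: C'.is_cycle_def)
  then obtain X where X: "carried 0 (Suc 0) X" "equivariant 0 (Suc 0) X" "\<forall>b\<in>B 0. C'.dd (Suc 0) (X b) = E 0 b"
   using carrier_step[OF E(2) E(1), of 0] by blast
  have "C'.dd (Suc 0) (frag_extend X z) = frag_extend (E 0) z" if z: "C.is_cycle 0 z" for z
   unfolding frag_extend_frag_extend
   by (rule frag_extend_cong) (use z X(3) in \<open>auto simp: C.is_cycle_def\<close>)
  then have "Q 0 X" using X by (simp add: Q_def)
  then show "\<exists>D. Q 0 D" by (rule exI[of "Q 0"])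
 next
  fix D p assume Q: "Q p D"
  let ?Z = "\<lambda>b. E (Suc p) b - frag_extend D (bd (Suc p) b)"
  have eD: "equivariant p (Suc p) D" using Q by (simp add: Q_def)
  have cD: "carried p (Suc p) D" using Q by (simp add: Q_def)
  have "carried (Suc p) (Suc p) ?Z"
   unfolding carried_def
   by (intro ballI keys_diff_subset[OF _ carried_bd[OF cD]])
    (use E(2)[of "Suc p"] in \<open>simp_all add: carried_def\<close>)
  moreover have eZ: "equivariant (Suc p) (Suc p) ?Z"
   unfolding equivariant_def
  proof (intro ballI conjI)
   fix b n assume b: "b \<in> B (Suc p)"
   show "keys (?Z b) \<subseteq> B' (Suc p)"
    by (rule keys_diff_subset[OF equivariant_keys[OF E(1) b] equivariant_ext_keys[OF eD C.bd_keys[OF b]]])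
   assume n: "n \<in> \<Lambda>"
   show "?Z (tr (Suc p) n b) = C'.ext_tr (Suc p) n (?Z b)"
    by (simp add: equivariant_tr[OF E(1) b n] C.bd_tr[OF n b]
      equivariant_ext_tr[OF eD C.bd_keys[OF b] n] frag_extend_diff)
  qed
  moreover have "C'.is_cycle (Suc p) (?Z b)" if b: "b \<in> B (Suc p)" for b
  proof -
   have "C'.dd (Suc p) (?Z b) = 0"
    using Q C.is_cycle_bd[OF b] Ed[OF b] by (simp add: Q_def frag_extend_diff)
   then show ?thesis using equivariant_keys[OF eZ b] by (simp add: C'.is_cycle_def)
  qed
  ultimately obtain X where X: "carried (Suc p) (Suc (Suc p)) X" "equivariant (Suc p) (Suc (Suc p)) X"
   "\<forall>b\<in>B (Suc p). C'.dd (Suc (Suc p)) (X b) = ?Z b" using carrier_step[of "Suc p" "Suc p" ?Z] by blast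
  have "C'.dd (Suc (Suc p)) (frag_extend X z) = frag_extend (E (Suc p)) z" if z: "C.is_cycle (Suc p) z" for z
  proof -
   have zB: "keys z \<subseteq> B (Suc p)" using z by (simp add: C.is_cycle_def)
   have "C'.dd (Suc (Suc p)) (frag_extend X z) = frag_extend ?Z z"
    unfolding frag_extend_frag_extend by (rule frag_extend_cong) (use zB X in auto)
   also have "\<dots> = frag_extend (E (Suc p)) z - frag_extend D (C.dd (Suc p) z)"
    by (simp add: frag_extend_frag_extend frag_extend_diff_fun)
   also have "C.dd (Suc p) z = 0" using z by (simp add: C.is_cycle_def)
   finally show ?thesis by simp
  qed
  then have "Q (Suc p) X" using X by (simp add: Q_def)
  then show "\<exists>G. Q (Suc p) G \<and> (\<forall>b\<in>B (Suc p). C'.dd (Suc (Suc p)) (G b) = ?Z b)" using X(3) by (intro exI[of _ X] conjI)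
 qed
 then obtain D where D: "\<forall>p. Q p (D p) \<and>
  (\<forall>b\<in>B (Suc p). C'.dd (Suc (Suc p)) (D (Suc p) b) = E (Suc p) b - frag_extend (D p) (bd (Suc p) b))"
  by (rule exE)
 show ?thesis
  by (rule exI[of _ D]) (use D in \<open>simp add: Q_def\<close>)
qed

end

context lattice_complex
begin

text \<open>Cochains with values in the group algebra of \<open>\<Lambda>\<close> correspond to these scalar-valued ones: the
 coefficients of the value at \<open>b\<close> are the values at the translates of \<open>b\<close>, so only finitely many
 of those may differ from 0.\<close>

definition cochains :: "int => ('b => 'k::comm_ring_1) set" where
 "cochains p = {\<phi>. (\<forall>b. \<not> (0 \<le> p \<and> b \<in> B (nat p)) --> \<phi> b = 0) \<and>
   (\<forall>b\<in>B (nat p). finite {n \<in> \<Lambda>. \<phi> (tr (nat p) n b) ~= 0})}"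

definition coboundary :: "int => ('b => 'k::comm_ring_1) => 'b => 'k" where
 "coboundary p \<phi> b = (if 0 \<le> p + 1 \<and> b \<in> B (nat (p + 1)) then pairing \<phi> (bd (nat (p + 1)) b) else 0)"

definition cocycles :: "int => ('b => 'k::comm_ring_1) set" where
 "cocycles p = {\<phi> \<in> cochains p. coboundary p \<phi> = (\<lambda>b. 0)}"

definition coboundaries :: "int => ('b => 'k::comm_ring_1) set" where
 "coboundaries p = coboundary (p - 1) ` cochains (p - 1)"

lemma cochains_nat: "cochains (int p) = {\<phi>. (\<forall>b. b \<notin> B p --> \<phi> b = 0) \<and>
   (\<forall>b\<in>B p. finite {n \<in> \<Lambda>. \<phi> (tr p n b) ~= 0})}"
 by (simp add: cochains_def)

lemma coboundary_nat: "coboundary (int p) \<phi> b = (if b \<in> B (Suc p) then pairing \<phi> (bd (Suc p) b) else 0)"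
 by (simp add: coboundary_def nat_add_distrib)

lemma cochains_neg: "p < 0 ==> cochains p = {\<lambda>b. 0}"
 by (auto simp: cochains_def)

lemma coboundary_add: "coboundary p (\<lambda>b. \<phi> b + \<psi> b) = (\<lambda>b. coboundary p \<phi> b + coboundary p \<psi> b)"
 and coboundary_smult: "coboundary p (\<lambda>b. r * \<phi> b) = (\<lambda>b. r * coboundary p \<phi> b)"
 and coboundary_zero: "coboundary p (\<lambda>b. 0) = (\<lambda>b. 0)"
 by (auto simp: coboundary_def pairing_add_fun pairing_smult_fun)

lemma cochains_neg_cobound:
 assumes "p < 0"
 shows "cocycles p = {\<lambda>b. 0}" "coboundaries p = {\<lambda>b. 0}"
 using assms by (auto simp: cocycles_def coboundaries_def cochains_neg coboundary_zero)

lemma cochains_submodule: "fun_submodule (cochains p :: ('b => 'k::comm_ring_1) set)"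
 unfolding fun_submodule_def
proof (intro conjI ballI allI)
 show "(\<lambda>b. 0) \<in> cochains p" by (simp add: cochains_def)
 fix \<phi> \<psi> :: "'b => 'k" assume 1: "\<phi> \<in> cochains p" "\<psi> \<in> cochains p"
 have "finite {n \<in> \<Lambda>. \<phi> (tr (nat p) n b) + \<psi> (tr (nat p) n b) ~= 0}" if "b \<in> B (nat p)" for b
 proof (rule finite_subset)
  show "finite ({n \<in> \<Lambda>. \<phi> (tr (nat p) n b) ~= 0} \<union> {n \<in> \<Lambda>. \<psi> (tr (nat p) n b) ~= 0})"
   using 1 that by (simp add: cochains_def)
 qed auto
 then show "(\<lambda>b. \<phi> b + \<psi> b) \<in> cochains p" using 1 by (simp add: cochains_def)
next
 fix r :: 'k and \<phi> :: "'b => 'k" assume 1: "\<phi> \<in> cochains p"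
 have "finite {n \<in> \<Lambda>. r * \<phi> (tr (nat p) n b) ~= 0}" if "b \<in> B (nat p)" for b
 proof (rule finite_subset)
  show "finite {n \<in> \<Lambda>. \<phi> (tr (nat p) n b) ~= 0}" using 1 that by (simp add: cochains_def)
 qed auto
 then show "(\<lambda>b. r * \<phi> b) \<in> cochains p" using 1 by (simp add: cochains_def)
qed

lemma cocycles_submodule: "fun_submodule (cocycles p :: ('b => 'k::comm_ring_1) set)"
 using cochains_submodule[of p]
 by (auto simp: fun_submodule_def cocycles_def coboundary_add coboundary_smult coboundary_zero)

lemma coboundaries_submodule: "fun_submodule (coboundaries p :: ('b => 'k::comm_ring_1) set)"
 unfolding fun_submodule_def coboundaries_def
proof (intro conjI ballI allI)
 have C: "fun_submodule (cochains (p - 1) :: ('b => 'k) set)" by (rule cochains_submodule)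
 show "(\<lambda>b. 0 :: 'k) \<in> coboundary (p - 1) ` cochains (p - 1)"
  by (rule image_eqI[where x="\<lambda>b. 0"]) (simp_all add: coboundary_zero fun_submodule_zero[OF C])
 fix x y :: "'b => 'k" assume "x \<in> coboundary (p - 1) ` cochains (p - 1)" "y \<in> coboundary (p - 1) ` cochains (p - 1)"
 then obtain \<phi> \<psi> where "x = coboundary (p - 1) \<phi>" "y = coboundary (p - 1) \<psi>"
  "\<phi> \<in> cochains (p - 1)" "\<psi> \<in> cochains (p - 1)" by (elim imageE)
 then show "(\<lambda>b. x b + y b) \<in> coboundary (p - 1) ` cochains (p - 1)"
  by (intro image_eqI[where x="\<lambda>b. \<phi> b + \<psi> b"]) (simp_all add: coboundary_add fun_submodule_add[OF C])
next
 have C: "fun_submodule (cochains (p - 1) :: ('b => 'k) set)" by (rule cochains_submodule)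
 fix r :: 'k and x :: "'b => 'k" assume "x \<in> coboundary (p - 1) ` cochains (p - 1)"
 then obtain \<phi> where "x = coboundary (p - 1) \<phi>" "\<phi> \<in> cochains (p - 1)" by (elim imageE)
 then show "(\<lambda>b. r * x b) \<in> coboundary (p - 1) ` cochains (p - 1)"
  by (intro image_eqI[where x="\<lambda>b. r * \<phi> b"]) (simp_all add: coboundary_smult fun_submodule_smult[OF C])
qed

lemma pairing_bd_cocycle:
 assumes "\<phi> \<in> cocycles (int p)" "keys c \<subseteq> B (Suc p)"
 shows "pairing \<phi> (dd (Suc p) c) = 0"
proof -
 have "pairing \<phi> (dd (Suc p) c) = pairing (coboundary (int p) \<phi>) c"
  unfolding pairing_frag_extend
  by (rule pairing_cong) (use assms(2) in \<open>auto simp: coboundary_nat\<close>)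
 then show ?thesis using assms(1) by (simp add: cocycles_def)
qed

end

definition pullback :: "'b set => ('b => 'c \<Rightarrow>\<^sub>0 int) => ('c => 'k::comm_ring_1) => 'b => 'k" where
 "pullback A F \<phi> b = (if b \<in> A then pairing \<phi> (F b) else 0)"

lemma pullback_lin_on: "lin_on Z (pullback A F)"
 by (auto simp: lin_on_def pullback_def pairing_add_fun pairing_smult_fun)

context lattice_complex_pair
begin

lemma pullback_cochain:
 assumes F: "equivariant p q F" and \<phi>: "\<phi> \<in> C'.cochains (int q)"
 shows "pullback (B p) F \<phi> \<in> C.cochains (int p)"
proof -
 have "finite {n \<in> \<Lambda>. pullback (B p) F \<phi> (tr p n b) ~= 0}" if b: "b \<in> B p" for b
 proof (rule finite_subset)
  have sub: "keys (F b) \<subseteq> B' q" by (rule equivariant_keys[OF F b])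
  show "finite (\<Union>c\<in>keys (F b). {n \<in> \<Lambda>. \<phi> (tr' q n c) ~= 0})"
   using \<phi> sub by (auto simp: C'.cochains_nat)
  show "{n \<in> \<Lambda>. pullback (B p) F \<phi> (tr p n b) ~= 0} \<subseteq>
   (\<Union>c\<in>keys (F b). {n \<in> \<Lambda>. \<phi> (tr' q n c) ~= 0})"
  proof
   fix n assume n: "n \<in> {n \<in> \<Lambda>. pullback (B p) F \<phi> (tr p n b) ~= 0}"
   then have nL: "n \<in> \<Lambda>" by simp
   have "pairing \<phi> (C'.ext_tr q n (F b)) ~= 0"
    using n equivariant_tr[OF F b nL] C.tr_B[OF nL b] by (simp add: pullback_def)
   then have "pairing (\<lambda>c. \<phi> (tr' q n c)) (F b) ~= 0" by (simp add: pairing_frag_extend)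
   then have "\<exists>c\<in>keys (F b). \<phi> (tr' q n c) ~= 0"
    using pairing_cong[of "F b" "\<lambda>c. \<phi> (tr' q n c)" "\<lambda>c. 0"] by fastforce
   then show "n \<in> (\<Union>c\<in>keys (F b). {n \<in> \<Lambda>. \<phi> (tr' q n c) ~= 0})" using n by blast
  qed
 qed
 then show ?thesis by (simp add: C.cochains_nat pullback_def)
qed

lemma pullback_coboundary:
 assumes F: "chain_morphism F"
 shows "pullback (B (Suc p)) (F (Suc p)) (C'.coboundary (int p) \<phi>) = C.coboundary (int p) (pullback (B p) (F p) \<phi>)"
proof
 fix b
 show "pullback (B (Suc p)) (F (Suc p)) (C'.coboundary (int p) \<phi>) b = C.coboundary (int p) (pullback (B p) (F p) \<phi>) b"
 proof (cases "b \<in> B (Suc p)")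
  case True
  have "pairing (C'.coboundary (int p) \<phi>) (F (Suc p) b) = pairing \<phi> (C'.dd (Suc p) (F (Suc p) b))"
   unfolding pairing_frag_extend
   by (rule pairing_cong)
    (use equivariant_keys[OF chain_morphism_equivariant[OF F] True] in \<open>auto simp: C'.coboundary_nat\<close>)
  also have "\<dots> = pairing \<phi> (frag_extend (F p) (bd (Suc p) b))"
   using F True by (simp add: chain_morphism_def)
  also have "\<dots> = pairing (pullback (B p) (F p) \<phi>) (bd (Suc p) b)"
   unfolding pairing_frag_extend
   by (rule pairing_cong) (use C.bd_keys[OF True] in \<open>auto simp: pullback_def\<close>)
  finally show ?thesis using True by (simp add: pullback_def C.coboundary_nat)
 qed (simp add: pullback_def C.coboundary_nat)
qed

lemma pullback_zero: "pullback A F (\<lambda>c. 0) = (\<lambda>b. 0)"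
 by (auto simp: pullback_def)

lemma pullback_cocycles:
 assumes F: "chain_morphism F" and \<phi>: "\<phi> \<in> C'.cocycles (int p)"
 shows "pullback (B p) (F p) \<phi> \<in> C.cocycles (int p)"
 using pullback_coboundary[OF F, of p \<phi>] pullback_cochain[OF chain_morphism_equivariant[OF F], of \<phi> p] \<phi>
 by (simp add: C.cocycles_def C'.cocycles_def pullback_zero)

lemma pullback_coboundaries:
 fixes \<phi> :: "'c => 'k::comm_ring_1"
 assumes F: "chain_morphism F" and \<phi>: "\<phi> \<in> C'.coboundaries (int p)"
 shows "pullback (B p) (F p) \<phi> \<in> C.coboundaries (int p)"
proof (cases p)
 case 0
 obtain \<psi> :: "'c => 'k" where \<psi>: "\<psi> \<in> C'.cochains (- 1)" "\<phi> = C'.coboundary (- 1) \<psi>"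
  using \<phi> unfolding C'.coboundaries_def 0 by (elim imageE) simp
 have "\<psi> = (\<lambda>c. 0)" using \<psi>(1) by (simp add: C'.cochains_neg)
 then have "\<phi> = (\<lambda>c. 0)" using \<psi>(2) by (simp add: C'.coboundary_zero)
 then show ?thesis using fun_submodule_zero[OF C.coboundaries_submodule] by (simp add: pullback_zero)
next
 case (Suc q)
 have pred: "int (Suc q) - 1 = int q" by simp
 obtain \<psi> where \<psi>: "\<psi> \<in> C'.cochains (int q)" "\<phi> = C'.coboundary (int q) \<psi>"
  using \<phi> unfolding C'.coboundaries_def Suc pred by (elim imageE) simp
 show ?thesis
  unfolding Suc C.coboundaries_def pred \<psi>(2) pullback_coboundary[OF F]
  by (intro imageI pullback_cochain[OF chain_morphism_equivariant[OF F]] \<psi>(1))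
qed

text \<open>On a cocycle, the pullback along \<open>E\<close> is the coboundary of the pullback along the homotopy \<open>D\<close>.\<close>

lemma pullback_null_homotopic:
 assumes D: "!!p. equivariant p (Suc p) (D p)"
  and D0: "!!b. b \<in> B 0 ==> C'.dd (Suc 0) (D 0 b) = E 0 b"
  and DS: "!!p b. b \<in> B (Suc p) ==>
    C'.dd (Suc (Suc p)) (D (Suc p) b) = E (Suc p) b - frag_extend (D p) (bd (Suc p) b)"
  and \<phi>: "\<phi> \<in> C'.cocycles (int p)"
 shows "pullback (B p) (E p) \<phi> \<in> C.coboundaries (int p)"
proof (cases p)
 case 0
 have "pullback (B p) (E p) \<phi> = (\<lambda>b. 0)"
  using C'.pairing_bd_cocycle[OF \<phi> equivariant_keys[OF D]] D0 0 by (fastforce simp: pullback_def)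
 then show ?thesis using fun_submodule_zero[OF C.coboundaries_submodule] by simp
next
 case (Suc q)
 have "pullback (B p) (E p) \<phi> = C.coboundary (int q) (pullback (B q) (D q) \<phi>)"
 proof
  fix b
  show "pullback (B p) (E p) \<phi> b = C.coboundary (int q) (pullback (B q) (D q) \<phi>) b"
  proof (cases "b \<in> B (Suc q)")
   case True
   have "pairing \<phi> (E (Suc q) b) - pairing \<phi> (frag_extend (D q) (bd (Suc q) b)) = 0"
    using C'.pairing_bd_cocycle[OF \<phi> equivariant_keys[OF D], of b] DS[OF True] True Suc
    by (simp add: pairing_diff)
   moreover have "pairing \<phi> (frag_extend (D q) (bd (Suc q) b)) =
     pairing (pullback (B q) (D q) \<phi>) (bd (Suc q) b)"
    unfolding pairing_frag_extend
    by (rule pairing_cong) (use C.bd_keys[OF True] in \<open>auto simp: pullback_def\<close>)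
   ultimately show ?thesis using True Suc by (simp add: pullback_def C.coboundary_nat)
  qed (simp add: pullback_def C.coboundary_nat Suc)
 qed
 moreover have "pullback (B q) (D q) \<phi> \<in> C.cochains (int q)"
  by (rule pullback_cochain[OF D]) (use \<phi> Suc in \<open>simp add: C'.cocycles_def\<close>)
 ultimately show ?thesis
  unfolding C.coboundaries_def using Suc by (intro image_eqI[where x="pullback (B q) (D q) \<phi>"]) simp_all
qed

end

section \<open>The cubical complex of the universal abelian cover\<close>

definition vertex_sign :: "'v::finite => 'v set => 'k::comm_ring_1" where
 "vertex_sign v \<tau> = (-1) ^ card {u \<in> \<tau>. to_nat u < to_nat v}"

lemma vertex_sign_insert:
 "(vertex_sign u (insert v \<tau>) :: 'k::comm_ring_1) = (if v \<notin> \<tau> \<and> to_nat v < to_nat u then - vertex_sign u \<tau> else vertex_sign u \<tau>)"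
proof -
 have "{w \<in> insert v \<tau>. to_nat w < to_nat u} =
   (if to_nat v < to_nat u then insert v {w \<in> \<tau>. to_nat w < to_nat u} else {w \<in> \<tau>. to_nat w < to_nat u})"
  by auto
 then show ?thesis
  by (auto simp: vertex_sign_def card_insert_if)
qed

lemma vertex_sign_remove:
 "(vertex_sign v (\<tau> - {u}) :: 'k::comm_ring_1) = (if u \<in> \<tau> \<and> to_nat u < to_nat v then - vertex_sign v \<tau> else vertex_sign v \<tau>)"
proof (cases "u \<in> \<tau>")
 case True
 then have "insert u (\<tau> - {u}) = \<tau>" by auto
 then show ?thesis using vertex_sign_insert[of v u "\<tau> - {u}", where 'k='k] True by auto
qed simp

lemma vertex_sign_square [simp]: "vertex_sign v \<tau> * vertex_sign v \<tau> = 1"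
 by (simp add: vertex_sign_def flip: power_add mult_2)

lemma vertex_sign_swap:
 assumes "u \<in> \<tau>" "v \<in> \<tau>" "u ~= v"
 shows "vertex_sign v \<tau> * vertex_sign u (\<tau> - {v}) = - (vertex_sign u \<tau> * vertex_sign v (\<tau> - {u}))"
proof -
 have "to_nat u ~= to_nat v" using assms by simp
 then show ?thesis using assms by (auto simp: vertex_sign_remove)
qed

text \<open>The deck group of the universal abelian cover: the free abelian group on the vertices.\<close>

definition lattice :: "'v::finite set set => (real^'v) set" where
 "lattice L = {n. (\<forall>i. n $ i \<in> \<int>) \<and> (\<forall>i. i \<notin> \<Union>L --> n $ i = 0)}"

lemma lattice_plus: "m \<in> lattice L ==> n \<in> lattice L ==> m + n \<in> lattice L"
 and lattice_diff: "m \<in> lattice L ==> n \<in> lattice L ==> m - n \<in> lattice L"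
 and lattice_uminus: "n \<in> lattice L ==> - n \<in> lattice L"
 and lattice_0: "0 \<in> lattice L"
 and lattice_axis: "v \<in> \<Union>L ==> axis v 1 \<in> lattice L"
 by (auto simp: lattice_def axis_def)

text \<open>The cell \<open>(\<tau>, n)\<close> is the cube with lowest corner \<open>n\<close> and edges in the directions \<open>\<tau>\<close>.\<close>

definition cells :: "'v::finite set set => nat => ('v set \<times> (real^'v)) set" where
 "cells L p = {(\<tau>, n). \<tau> \<in> L \<and> card \<tau> = p \<and> n \<in> lattice L}"

definition cell_boundary :: "'v::finite set \<times> (real^'v) => ('v set \<times> (real^'v) \<Rightarrow>\<^sub>0 int)" where
 "cell_boundary = (\<lambda>(\<tau>, n). \<Sum>v\<in>\<tau>. frag_cmul (vertex_sign v \<tau>)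
   (frag_of (\<tau> - {v}, n + axis v 1) - frag_of (\<tau> - {v}, n)))"

lemma cell_boundary_apply: "cell_boundary (\<tau>, n) = (\<Sum>v\<in>\<tau>. frag_cmul (vertex_sign v \<tau>)
   (frag_of (\<tau> - {v}, n + axis v 1) - frag_of (\<tau> - {v}, n)))"
 by (simp add: cell_boundary_def)

definition cell_translate :: "(real^'v) => 'v set \<times> (real^'v::finite) => 'v set \<times> (real^'v)" where
 "cell_translate m = (\<lambda>(\<tau>, n). (\<tau>, m + n))"

lemma cell_translate_simp [simp]: "cell_translate m (\<tau>, n) = (\<tau>, m + n)"
 by (simp add: cell_translate_def)

lemma frag_extend_sum_cmul:
 "finite A ==> frag_extend f (\<Sum>a\<in>A. frag_cmul (k a) (x a)) = (\<Sum>a\<in>A. frag_cmul (k a) (frag_extend f (x a)))"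
 by (simp add: frag_extend_sum frag_extend_cmul o_def)

lemma frag_cmul_diff_right: "frag_cmul k (a - b) = frag_cmul k a - frag_cmul k b"
 by (rule poly_mapping_eqI) (simp add: lookup_minus right_diff_distrib)

lemma frag_add_self_zero: "c + c = 0 ==> c = 0" for c :: "'b \<Rightarrow>\<^sub>0 int"
 by (metis frag_cmul_eq_0_iff frag_cmul_distrib frag_cmul_one one_add_one zero_neq_numeral)

lemma sum_antisymmetric_zero:
 fixes f :: "'v => 'v => 'b \<Rightarrow>\<^sub>0 int"
 assumes A: "finite A" and f: "!!u v. u \<in> A ==> v \<in> A ==> u ~= v ==> f u v = - f v u"
 shows "(\<Sum>v\<in>A. \<Sum>u\<in>A - {v}. f v u) = 0"
proof -
 define g where "g v u = (if u = v then 0 else f v u)" for u v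
 have g: "g v u = - g u v" if "u \<in> A" "v \<in> A" for u v
  using f[OF that(2,1)] by (cases "u = v") (auto simp: g_def)
 have "(\<Sum>u\<in>A - {v}. f v u) = (\<Sum>u\<in>A. g v u)" if "v \<in> A" for v
  by (rule sum.mono_neutral_cong_left) (use A in \<open>auto simp: g_def\<close>)
 then have S: "(\<Sum>v\<in>A. \<Sum>u\<in>A - {v}. f v u) = (\<Sum>v\<in>A. \<Sum>u\<in>A. g v u)" by simp
 have "(\<Sum>v\<in>A. \<Sum>u\<in>A. g v u) = (\<Sum>u\<in>A. \<Sum>v\<in>A. g v u)" by (rule sum.swap)
 also have "\<dots> = (\<Sum>u\<in>A. \<Sum>v\<in>A. - g u v)"
  by (intro sum.cong refl g)
 also have "\<dots> = - (\<Sum>v\<in>A. \<Sum>u\<in>A. g v u)" by (simp add: sum_negf)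
 finally have "(\<Sum>v\<in>A. \<Sum>u\<in>A. g v u) + (\<Sum>v\<in>A. \<Sum>u\<in>A. g v u) = 0" by (simp add: eq_neg_iff_add_eq_0)
 then show ?thesis unfolding S by (rule frag_add_self_zero)
qed

text \<open>The two orders in which a pair of directions can be removed carry opposite signs.\<close>

lemma cell_boundary_boundary: "frag_extend cell_boundary (cell_boundary (\<tau>, n :: real^'v::finite)) = 0"
proof -
 define X :: "'v => 'v => 'v set \<times> (real^'v) \<Rightarrow>\<^sub>0 int" where
  "X v u = frag_of (\<tau> - {v} - {u}, n + axis v 1 + axis u 1) - frag_of (\<tau> - {v} - {u}, n + axis v 1)
   - (frag_of (\<tau> - {v} - {u}, n + axis u 1) - frag_of (\<tau> - {v} - {u}, n))" for v u
 have X: "X v u = X u v" for u v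
 proof -
  have 1: "\<tau> - {v} - {u} = \<tau> - {u} - {v}" by auto
  show ?thesis unfolding X_def 1 by (simp add: algebra_simps)
 qed
 have "frag_extend cell_boundary (cell_boundary (\<tau>, n)) =
   (\<Sum>v\<in>\<tau>. \<Sum>u\<in>\<tau> - {v}. frag_cmul (vertex_sign v \<tau> * vertex_sign u (\<tau> - {v})) (X v u))"
 proof -
  have "frag_extend cell_boundary (frag_of (\<tau> - {v}, n + axis v 1) - frag_of (\<tau> - {v}, n)) =
    (\<Sum>u\<in>\<tau> - {v}. frag_cmul (vertex_sign u (\<tau> - {v})) (X v u))" for v
   by (simp add: frag_extend_diff cell_boundary_apply X_def frag_cmul_diff_right flip: sum_subtractf)
  then have "frag_extend cell_boundary (cell_boundary (\<tau>, n)) =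
    (\<Sum>v\<in>\<tau>. frag_cmul (vertex_sign v \<tau>) (\<Sum>u\<in>\<tau> - {v}. frag_cmul (vertex_sign u (\<tau> - {v})) (X v u)))"
   unfolding cell_boundary_apply by (simp add: frag_extend_sum_cmul)
  then show ?thesis by (simp add: frag_cmul_sum)
 qed
 also have "\<dots> = 0"
 proof (rule sum_antisymmetric_zero)
  fix u v assume "u \<in> \<tau>" "v \<in> \<tau>" "u ~= v"
  then have "vertex_sign u \<tau> * vertex_sign v (\<tau> - {u}) = (- (vertex_sign v \<tau> * vertex_sign u (\<tau> - {v})) :: int)"
   by (intro vertex_sign_swap) auto
  then show "frag_cmul (vertex_sign u \<tau> * vertex_sign v (\<tau> - {u})) (X u v) =
    - frag_cmul (vertex_sign v \<tau> * vertex_sign u (\<tau> - {v})) (X v u)"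
   using X[of u v] by simp
 qed simp
 finally show ?thesis .
qed

section \<open>Cubes are acyclic\<close>

text \<open>The cells of the cube with lowest corner \<open>m\<close> and edges in the directions \<open>D\<close>.\<close>

definition cube_cells :: "(real^'v) => 'v set => nat => ('v set \<times> (real^'v::finite)) set" where
 "cube_cells m D q = {(\<tau>, n). \<tau> \<subseteq> D \<and> card \<tau> = q \<and>
   (\<forall>i. n $ i = m $ i \<or> i \<in> D - \<tau> \<and> n $ i = m $ i + 1)}"

text \<open>Collapsing the direction \<open>v\<close>: the homotopy \<open>collapse\<close> sweeps a cell of the upper face to the
 lower face, onto which \<open>lower\<close> projects.\<close>

definition collapse :: "(real^'v) => 'v => 'v set \<times> (real^'v::finite) => ('v set \<times> (real^'v) \<Rightarrow>\<^sub>0 int)" where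
 "collapse m v = (\<lambda>(\<tau>, n). if v \<notin> \<tau> \<and> n $ v = m $ v + 1
   then frag_cmul (vertex_sign v \<tau>) (frag_of (insert v \<tau>, n - axis v 1)) else 0)"

definition lower :: "(real^'v) => 'v => 'v set \<times> (real^'v::finite) => ('v set \<times> (real^'v) \<Rightarrow>\<^sub>0 int)" where
 "lower m v = (\<lambda>(\<tau>, n). if v \<in> \<tau> then 0
   else frag_of (\<tau>, if n $ v = m $ v + 1 then n - axis v 1 else n))"

lemma collapse_homotopy:
 assumes "(\<tau>, n) \<in> cube_cells m D q"
 shows "frag_extend cell_boundary (collapse m v (\<tau>, n)) + frag_extend (collapse m v) (cell_boundary (\<tau>, n))
  = frag_of (\<tau>, n) - lower m v (\<tau>, n)"
proof -
 have n: "n $ i = m $ i \<or> i \<in> D - \<tau> \<and> n $ i = m $ i + 1" for i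
  using assms by (auto simp: cube_cells_def)
 have hb: "frag_extend (collapse m v) (cell_boundary (\<tau>, n)) = (\<Sum>u\<in>\<tau>. frag_cmul (vertex_sign u \<tau>)
   (collapse m v (\<tau> - {u}, n + axis u 1) - collapse m v (\<tau> - {u}, n)))"
  unfolding cell_boundary_apply by (simp add: frag_extend_sum_cmul frag_extend_diff)
 consider (edge) "v \<in> \<tau>" | (low) "v \<notin> \<tau>" "n $ v ~= m $ v + 1" | (high) "v \<notin> \<tau>" "n $ v = m $ v + 1" by blast
 then show ?thesis
 proof cases
  case edge
  have "frag_cmul (vertex_sign u \<tau>) (collapse m v (\<tau> - {u}, n + axis u 1) - collapse m v (\<tau> - {u}, n))
    = (if u = v then frag_of (\<tau>, n) else 0)" if "u \<in> \<tau>" for u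
   using edge n[of v] that
   by (auto simp: collapse_def vertex_sign_remove insert_absorb)
  then have "frag_extend (collapse m v) (cell_boundary (\<tau>, n)) = frag_of (\<tau>, n)"
   unfolding hb using edge by simp
  then show ?thesis using edge by (simp add: collapse_def lower_def)
 next
  case low
  have "collapse m v (\<tau> - {u}, n + axis u 1) = 0" "collapse m v (\<tau> - {u}, n) = 0" if "u \<in> \<tau>" for u
   using low that by (auto simp: collapse_def axis_def)
  then show ?thesis unfolding hb using low by (simp add: collapse_def lower_def)
 next
  case high
  define n' where "n' = n - axis v 1"
  let ?\<tau> = "insert v \<tau>"
  have 1: "frag_cmul (vertex_sign u \<tau>) (collapse m v (\<tau> - {u}, n + axis u 1) - collapse m v (\<tau> - {u}, n))
   = - frag_cmul (vertex_sign v \<tau> * vertex_sign u ?\<tau>)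
      (frag_of (?\<tau> - {u}, n' + axis u 1) - frag_of (?\<tau> - {u}, n'))" if "u \<in> \<tau>" for u
  proof -
   have neg: "frag_cmul (- a) x = - frag_cmul a x" for a and x :: "'v set \<times> (real^'v) \<Rightarrow>\<^sub>0 int" by simp
   have uv: "u ~= v" using that high by auto
   then have sets: "insert v (\<tau> - {u}) = ?\<tau> - {u}" by auto
   have "to_nat u ~= to_nat v" using uv by simp
   then have "vertex_sign u \<tau> * vertex_sign v (\<tau> - {u}) = (- (vertex_sign v \<tau> * vertex_sign u ?\<tau>) :: int)"
    using that high by (auto simp: vertex_sign_remove vertex_sign_insert)
   moreover have "collapse m v (\<tau> - {u}, n + axis u 1) =
     frag_cmul (vertex_sign v (\<tau> - {u})) (frag_of (?\<tau> - {u}, n' + axis u 1))"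
    "collapse m v (\<tau> - {u}, n) = frag_cmul (vertex_sign v (\<tau> - {u})) (frag_of (?\<tau> - {u}, n'))"
    using high uv by (auto simp: collapse_def axis_def n'_def sets algebra_simps)
   ultimately show ?thesis
    by (simp add: frag_cmul_diff_right neg del: minus_frag_cmul)
  qed
  have "frag_extend cell_boundary (collapse m v (\<tau>, n)) =
    frag_cmul (vertex_sign v \<tau>) (\<Sum>u\<in>?\<tau>. frag_cmul (vertex_sign u ?\<tau>)
     (frag_of (?\<tau> - {u}, n' + axis u 1) - frag_of (?\<tau> - {u}, n')))"
   using high by (simp add: collapse_def frag_extend_cmul cell_boundary_apply n'_def)
  also have "\<dots> = frag_of (\<tau>, n) - frag_of (\<tau>, n') + (\<Sum>u\<in>\<tau>. frag_cmul (vertex_sign v \<tau> * vertex_sign u ?\<tau>)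
     (frag_of (?\<tau> - {u}, n' + axis u 1) - frag_of (?\<tau> - {u}, n')))"
  proof -
   have "?\<tau> - {v} = \<tau>" "n' + axis v 1 = n" using high by (auto simp: n'_def)
   moreover have "vertex_sign v ?\<tau> = (vertex_sign v \<tau> :: int)" by (simp add: vertex_sign_insert)
   ultimately show ?thesis
    using high by (simp add: sum.insert frag_cmul_distrib2 frag_cmul_sum)
  qed
  moreover have "frag_extend (collapse m v) (cell_boundary (\<tau>, n)) =
    - (\<Sum>u\<in>\<tau>. frag_cmul (vertex_sign v \<tau> * vertex_sign u ?\<tau>)
     (frag_of (?\<tau> - {u}, n' + axis u 1) - frag_of (?\<tau> - {u}, n')))"
   unfolding hb sum_negf[symmetric] by (rule sum.cong[OF refl 1])
  ultimately show ?thesis using high by (simp add: lower_def n'_def)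
 qed
qed

lemma collapse_cube_cells:
 assumes "c \<in> cube_cells m D q" "v \<in> D"
 shows "keys (collapse m v c) \<subseteq> cube_cells m D (Suc q)"
 using assms by (auto simp: collapse_def cube_cells_def axis_def card_insert_if split: if_splits)

lemma lower_cube_cells:
 assumes "c \<in> cube_cells m D q" "v \<in> D"
 shows "keys (lower m v c) \<subseteq> cube_cells m (D - {v}) q"
 using assms by (fastforce simp: lower_def cube_cells_def axis_def split: if_splits)

lemma augmentation_cell_boundary:
 assumes "c \<in> cube_cells m D (Suc 0)"
 shows "augmentation (cell_boundary c) = 0"
 using assms by (auto simp: cube_cells_def cell_boundary_apply pairing_sum pairing_cmul pairing_diff)

text \<open>By induction on the set of directions: collapsing one of them moves a cycle to the lower face, which
 is a cube of smaller dimension.\<close>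

lemma cube_cells_acyclic:
 assumes "keys z \<subseteq> cube_cells m D q" 
  and "if q = 0 then augmentation z = 0 else frag_extend cell_boundary z = 0"
 shows "\<exists>w. keys w \<subseteq> cube_cells m D (Suc q) \<and> frag_extend cell_boundary w = z"
 using finite[of D] assms
proof (induction D arbitrary: z)
 case empty
 have "z = 0"
 proof (cases "q = 0")
  case True
  have "cube_cells m {} q = {({}, m)}" using True by (auto simp: cube_cells_def vec_eq_iff)
  then have "augmentation z = Poly_Mapping.lookup z ({}, m)"
   using empty by (subst pairing_superset[of "{({}, m)}"]) auto
  then have "Poly_Mapping.lookup z ({}, m) = 0" using empty True by simp
  then show ?thesis
   using empty(1) \<open>cube_cells m {} q = {({}, m)}\<close> by (metis in_keys_iff keys_eq_empty subset_singletonD singletonI)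
 next
  case False
  then have "cube_cells m {} q = {}" by (auto simp: cube_cells_def)
  then show ?thesis using empty by auto
 qed
 then show ?case by (intro exI[of _ 0]) auto
next
 case (insert v D)
 let ?D = "insert v D" and ?h = "frag_extend (collapse m v)" and ?l = "frag_extend (lower m v)"
 have hz: "frag_extend cell_boundary (?h z) + ?h (frag_extend cell_boundary z) = z - ?l z"
 proof -
  have "frag_extend cell_boundary (?h z) + ?h (frag_extend cell_boundary z)
    = frag_extend (\<lambda>c. frag_of c - lower m v c) z"
   unfolding frag_extend_frag_extend
   using insert.prems(1)
  proof (induction z rule: frag_induction)
   case (one c)
   then show ?case using collapse_homotopy[of "fst c" "snd c" m ?D q v] by simp
  next
   case (diff a b)
   then show ?case by (simp add: frag_extend_diff algebra_simps)
  qed simp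
  then show ?thesis by (simp add: frag_extend_diff_fun frag_extend_id)
 qed
 have h0: "?h (frag_extend cell_boundary z) = 0"
 proof (cases "q = 0")
  case True
  have "frag_extend cell_boundary z = 0"
   by (rule frag_extend_eq_0)
    (use insert.prems(1) True in \<open>auto simp: cube_cells_def cell_boundary_apply\<close>)
  then show ?thesis by simp
 qed (use insert.prems(2) in simp)
 have keys_h: "keys (?h z) \<subseteq> cube_cells m ?D (Suc q)"
  by (rule keys_frag_extend_subset) (use collapse_cube_cells insert.prems(1) in blast)
 have l: "?l z = z - frag_extend cell_boundary (?h z)" using hz h0 by simp
 have "keys (?l z) \<subseteq> cube_cells m (?D - {v}) q"
  by (rule keys_frag_extend_subset) (use lower_cube_cells insert.prems(1) in blast)
 then have keys_l: "keys (?l z) \<subseteq> cube_cells m D q" using insert.hyps by simp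
 have "if q = 0 then augmentation (?l z) = 0 else frag_extend cell_boundary (?l z) = 0"
 proof (cases "q = 0")
  case True
  have "augmentation (frag_extend cell_boundary (?h z)) = 0"
   unfolding pairing_frag_extend[of _ cell_boundary]
   using pairing_cong[of "?h z" "\<lambda>c. augmentation (cell_boundary c)" "\<lambda>c. 0"]
    augmentation_cell_boundary keys_h True by fastforce
  then show ?thesis using insert.prems(2) True unfolding l by (simp add: pairing_diff)
 next
  case False
  have "frag_extend cell_boundary (frag_extend cell_boundary (?h z)) = 0"
   unfolding frag_extend_frag_extend[of cell_boundary cell_boundary]
   by (rule frag_extend_eq_0) (metis cell_boundary_boundary surj_pair)
  then show ?thesis using insert.prems(2) False unfolding l by (simp add: frag_extend_diff)
 qed
 from insert.IH[OF keys_l this] obtain w where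
  w: "keys w \<subseteq> cube_cells m D (Suc q)" "frag_extend cell_boundary w = ?l z" by blast
 show ?case
 proof (intro exI[of _ "w + ?h z"] conjI)
  have "cube_cells m D (Suc q) \<subseteq> cube_cells m ?D (Suc q)" by (fastforce simp: cube_cells_def)
  then show "keys (w + ?h z) \<subseteq> cube_cells m ?D (Suc q)"
   using w(1) keys_h Poly_Mapping.keys_add[of w "?h z"] by blast
  show "frag_extend cell_boundary (w + ?h z) = z"
   using w(2) l by (simp add: frag_extend_add)
 qed
qed

lemma simplicial_cx_subset: "simplicial_cx L ==> \<tau> \<in> L ==> \<sigma> \<subseteq> \<tau> ==> \<sigma> \<in> L"
 by (auto simp: simplicial_cx_def)

lemma cell_lattice_complex:
 assumes L: "simplicial_cx L"
 shows "lattice_complex (lattice L) (cells L) (\<lambda>p. cell_boundary) (\<lambda>p. cell_translate) (\<lambda>p. snd)"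
proof
 fix b :: "'a set \<times> (real^'a)" and p
 assume b: "b \<in> cells L (Suc p)"
 obtain \<tau> n where bn: "b = (\<tau>, n)" "\<tau> \<in> L" "card \<tau> = Suc p" "n \<in> lattice L" using b by (auto simp: cells_def)
 show "keys (cell_boundary b) \<subseteq> cells L p"
 proof -
  have "keys (frag_cmul (vertex_sign v \<tau>)
   (frag_of (\<tau> - {v}, n + axis v 1) - frag_of (\<tau> - {v}, n))) \<subseteq> cells L p" if v: "v \<in> \<tau>" for v
  proof -
   have "\<tau> - {v} \<in> L" "n + axis v 1 \<in> lattice L"
    using bn v by (auto intro!: simplicial_cx_subset[OF L bn(2)] lattice_plus lattice_axis)
   then have "(\<tau> - {v}, n + axis v 1) \<in> cells L p" "(\<tau> - {v}, n) \<in> cells L p"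
    using bn v by (auto simp: cells_def)
   then have "keys (frag_of (\<tau> - {v}, n + axis v 1) - frag_of (\<tau> - {v}, n)) \<subseteq> cells L p"
    by (intro keys_diff_subset) auto
   then show ?thesis using keys_cmul by blast
  qed
  then show ?thesis
   unfolding bn(1) cell_boundary_apply by (intro subset_trans[OF keys_sum] UN_least)
 qed
 show "cell_boundary (cell_translate m b) = frag_extend (frag_of \<circ> cell_translate m) (cell_boundary b)" for m
  by (simp add: bn(1) cell_boundary_apply frag_extend_sum_cmul frag_extend_diff add.assoc)
next
 fix b :: "'a set \<times> (real^'a)" and p
 show "frag_extend cell_boundary (cell_boundary b) = 0"
  by (metis cell_boundary_boundary surj_pair)
qed (auto simp: cells_def lattice_plus lattice_uminus lattice_0 cell_boundary_apply add.assoc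
  pairing_sum pairing_cmul pairing_diff)

section \<open>Splitting the cellular cochains into cochains of links\<close>

text \<open>Finitely supported functions on the lattice that live on the sublattice on which the
 coordinates in \<open>S\<close> vanish.\<close>

definition lattice_fun :: "'v::finite set set => 'v set => (real^'v => 'k::comm_ring_1) set" where
 "lattice_fun L S = {g. finite {n. g n ~= 0} \<and> (\<forall>n. g n ~= 0 --> n \<in> lattice L \<and> (\<forall>i\<in>S. n $ i = 0))}"

definition difference :: "'v::finite => (real^'v => 'k::comm_ring_1) => real^'v => 'k" where
 "difference v g n = g (n + axis v 1) - g n"

lemma lattice_fun_zero: "(\<lambda>n. 0) \<in> lattice_fun L S"
 by (simp add: lattice_fun_def)

lemma lattice_fun_add:
 assumes "g \<in> lattice_fun L S" "h \<in> lattice_fun L S"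
 shows "(\<lambda>n. g n + h n) \<in> lattice_fun L S"
proof -
 have "finite {n. g n + h n ~= 0}"
  by (rule finite_subset[of _ "{n. g n ~= 0} \<union> {n. h n ~= 0}"]) (use assms in \<open>auto simp: lattice_fun_def\<close>)
 moreover have "n \<in> lattice L \<and> (\<forall>i\<in>S. n $ i = 0)" if "g n + h n ~= 0" for n
 proof -
  have "g n ~= 0 \<or> h n ~= 0" using that by auto
  then show ?thesis using assms by (auto simp: lattice_fun_def)
 qed
 ultimately show ?thesis by (simp add: lattice_fun_def)
qed

lemma lattice_fun_smult:
 assumes "g \<in> lattice_fun L S"
 shows "(\<lambda>n. r * g n) \<in> lattice_fun L S"
proof -
 have "finite {n. r * g n ~= 0}"
  by (rule finite_subset[of _ "{n. g n ~= 0}"]) (use assms in \<open>auto simp: lattice_fun_def\<close>)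
 moreover have "n \<in> lattice L \<and> (\<forall>i\<in>S. n $ i = 0)" if "r * g n ~= 0" for n
 proof -
  have "g n ~= 0" using that by auto
  then show ?thesis using assms by (auto simp: lattice_fun_def)
 qed
 ultimately show ?thesis by (simp add: lattice_fun_def)
qed

lemma lattice_fun_diff:
 "g \<in> lattice_fun L S ==> h \<in> lattice_fun L S ==> (\<lambda>n. g n - h n) \<in> lattice_fun L S"
 using lattice_fun_add[of g L S "\<lambda>n. -1 * h n"] lattice_fun_smult[of h L S "-1"] by simp

lemma lattice_fun_sum:
 "(!!i. i \<in> A ==> g i \<in> lattice_fun L S) ==> (\<lambda>n. \<Sum>i\<in>A. g i n) \<in> lattice_fun L S"
 by (induction A rule: infinite_finite_induct) (auto intro: lattice_fun_zero lattice_fun_add)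

lemma lattice_fun_mono: "T \<subseteq> S ==> lattice_fun L S \<subseteq> lattice_fun L T"
 unfolding lattice_fun_def by blast

lemma lattice_fun_shift:
 assumes g: "g \<in> lattice_fun L S" and m: "m \<in> lattice L" "\<forall>i\<in>S. m $ i = 0"
 shows "(\<lambda>n. g (n + m)) \<in> lattice_fun L S"
proof -
 have "finite ((\<lambda>n. n + m) -` {n. g n ~= 0})"
  using g by (intro finite_vimageI) (auto simp: lattice_fun_def inj_on_def)
 then have "finite {n. g (n + m) ~= 0}" by (simp add: vimage_def)
 moreover have "n \<in> lattice L \<and> (\<forall>i\<in>S. n $ i = 0)" if "g (n + m) ~= 0" for n
 proof -
  have "n + m \<in> lattice L" "\<forall>i\<in>S. (n + m) $ i = 0" using g that unfolding lattice_fun_def by blast+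
  then show ?thesis using m lattice_diff[of "n + m" L m] by auto
 qed
 ultimately show ?thesis by (simp add: lattice_fun_def)
qed

lemma difference_lattice_fun:
 "v \<in> \<Union>L ==> v \<notin> S ==> g \<in> lattice_fun L S ==> difference v g \<in> lattice_fun L S"
 unfolding difference_def
 by (intro lattice_fun_diff lattice_fun_shift lattice_axis) (auto simp: axis_def)

text \<open>The basis change behind the splitting, in one coordinate: the lattice points with \<open>n $ v = 0\<close>
 and the differences of neighbouring points together form a basis.\<close>

lemma difference_decomposition:
 assumes v: "v \<in> \<Union>L" "v \<notin> S" and g: "g \<in> lattice_fun L S"
 shows "\<exists>u\<in>lattice_fun L S. \<exists>c\<in>lattice_fun L (insert v S). g = (\<lambda>n. difference v u n + c n)"
proof -
 define P where "P g \<longleftrightarrow> (\<exists>u\<in>lattice_fun L S. \<exists>c\<in>lattice_fun L (insert v S). g = (\<lambda>n. difference v u n + c n))"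
  for g :: "real^'a => 'b"
 have add: "P (\<lambda>n. g n + h n)" if gh: "P g" "P h" for g h
 proof -
  obtain u c where 1: "u \<in> lattice_fun L S" "c \<in> lattice_fun L (insert v S)" "g = (\<lambda>n. difference v u n + c n)"
   using gh(1) unfolding P_def by (elim bexE)
  obtain u' c' where 2: "u' \<in> lattice_fun L S" "c' \<in> lattice_fun L (insert v S)" "h = (\<lambda>n. difference v u' n + c' n)"
   using gh(2) unfolding P_def by (elim bexE)
  show ?thesis unfolding P_def
  proof (intro bexI)
   show "(\<lambda>n. g n + h n) = (\<lambda>n. difference v (\<lambda>n. u n + u' n) n + (\<lambda>n. c n + c' n) n)"
    by (auto simp: 1 2 difference_def)
  qed (intro lattice_fun_add 1 2)+
 qed
 have smult: "P (\<lambda>n. r * g n)" if Pg: "P g" for g r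
 proof -
  obtain u c where 1: "u \<in> lattice_fun L S" "c \<in> lattice_fun L (insert v S)" "g = (\<lambda>n. difference v u n + c n)"
   using Pg unfolding P_def by (elim bexE)
  show ?thesis unfolding P_def
  proof (intro bexI)
   show "(\<lambda>n. r * g n) = (\<lambda>n. difference v (\<lambda>n. r * u n) n + (\<lambda>n. r * c n) n)"
    by (auto simp: 1 difference_def algebra_simps)
  qed (intro lattice_fun_smult 1)+
 qed
 have diff: "P (difference v u)" if u: "u \<in> lattice_fun L S" for u
  unfolding P_def
 proof (intro bexI)
  show "difference v u = (\<lambda>n. difference v u n + (\<lambda>n. 0) n)" by simp
 qed (use u lattice_fun_zero in auto)
 define \<delta> :: "real^'a => real^'a => 'b" where "\<delta> m n = (if n = m then 1 else 0)" for m n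
 have \<delta>: "\<delta> m \<in> lattice_fun L S" if "m \<in> lattice L" "\<forall>i\<in>S. m $ i = 0" for m
  using that by (auto simp: lattice_fun_def \<delta>_def)
 have shift: "m + axis v 1 \<in> lattice L \<and> (\<forall>i\<in>S. (m + axis v 1) $ i = 0)"
  "m - axis v 1 \<in> lattice L \<and> (\<forall>i\<in>S. (m - axis v 1) $ i = 0)" if "m \<in> lattice L" "\<forall>i\<in>S. m $ i = 0" for m
  using that v by (auto simp: axis_def intro!: lattice_plus lattice_diff lattice_axis[unfolded axis_def])
 have P\<delta>: "P (\<delta> m)" if "m \<in> lattice L" "\<forall>i\<in>S. m $ i = 0" "\<bar>m $ v\<bar> \<le> of_nat k" for m k
  using that
 proof (induction k arbitrary: m)
  case 0
  then have "\<delta> m \<in> lattice_fun L (insert v S)" by (auto simp: lattice_fun_def \<delta>_def)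
  then show ?case unfolding P_def
   by (intro bexI[of _ "\<lambda>n. 0"] bexI[of _ "\<delta> m"]) (auto simp: difference_def lattice_fun_zero)
 next
  case (Suc k)
  have "m $ v \<in> \<int>" using Suc.prems(1) by (simp add: lattice_def)
  then obtain z :: int where z: "m $ v = of_int z" by (rule Ints_cases)
  have "\<bar>real_of_int z\<bar> \<le> real (Suc k)" using Suc.prems(3) z by simp
  then have zk: "\<bar>z\<bar> \<le> int (Suc k)" by linarith
  consider "z = 0" | "z > 0" | "z < 0" by linarith
  then show ?case
  proof cases
   case 1
   then show ?thesis using Suc.IH[of m] Suc.prems z by simp
  next
   case 2
   have "\<bar>(m - axis v 1) $ v\<bar> \<le> of_nat k" using z zk 2 by simp
   then have "P (\<delta> (m - axis v 1))" using Suc.IH shift(2)[OF Suc.prems(1,2)] by blast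
   moreover have "\<delta> m = (\<lambda>n. \<delta> (m - axis v 1) n + (- 1) * difference v (\<delta> m) n)"
    by (auto simp: \<delta>_def difference_def fun_eq_iff eq_diff_eq)
   ultimately show ?thesis using add smult diff \<delta>[OF Suc.prems(1,2)] by metis
  next
   case 3
   have "\<bar>(m + axis v 1) $ v\<bar> \<le> of_nat k" using z zk 3 by simp
   then have "P (\<delta> (m + axis v 1))" using Suc.IH shift(1)[OF Suc.prems(1,2)] by blast
   moreover have "\<delta> m = (\<lambda>n. \<delta> (m + axis v 1) n + difference v (\<delta> (m + axis v 1)) n)"
    by (auto simp: \<delta>_def difference_def fun_eq_iff)
   ultimately show ?thesis using add diff \<delta> shift(1)[OF Suc.prems(1,2)] by metis
  qed
 qed
 have "P (\<lambda>n. \<Sum>m\<in>A. g m * \<delta> m n)" if "finite A" "A \<subseteq> {n. g n ~= 0}" for A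
  using that
 proof (induction A)
  case empty
  have "difference v (\<lambda>n. 0) = (\<lambda>n. 0 :: 'b)" by (auto simp: difference_def)
  then show ?case using diff[OF lattice_fun_zero] by simp
 next
  case (insert m A)
  have "m \<in> lattice L" "\<forall>i\<in>S. m $ i = 0" using insert.prems g by (auto simp: lattice_fun_def)
  moreover obtain k :: nat where "\<bar>m $ v\<bar> \<le> of_nat k" using real_arch_simple by blast
  ultimately have "P (\<lambda>n. g m * \<delta> m n)" using P\<delta> smult by blast
  then have "P (\<lambda>n. g m * \<delta> m n + (\<Sum>m\<in>A. g m * \<delta> m n))" using insert add by simp
  then show ?case using insert by simp
 qed
 then have "P (\<lambda>n. \<Sum>m\<in>{n. g n ~= 0}. g m * \<delta> m n)" using g by (simp add: lattice_fun_def)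
 moreover have "(\<lambda>n. \<Sum>m\<in>{n. g n ~= 0}. g m * \<delta> m n) = g"
 proof
  fix n
  have "(\<Sum>m\<in>{n. g n ~= 0}. g m * \<delta> m n) = (\<Sum>m\<in>{n. g n ~= 0}. if m = n then g n else 0)"
   by (rule sum.cong) (auto simp: \<delta>_def)
  then show "(\<Sum>m\<in>{n. g n ~= 0}. g m * \<delta> m n) = g n" using g by (auto simp: lattice_fun_def)
 qed
 ultimately show ?thesis by (simp add: P_def)
qed

text \<open>On a support point of \<open>u\<close> with largest \<open>v\<close>-coordinate, and just below one with the least, the
 difference does not vanish; both points would have \<open>v\<close>-coordinate 0.\<close>

lemma difference_decomposition_unique:
 assumes u: "u \<in> lattice_fun L S" and c: "c \<in> lattice_fun L (insert v S)"
  and 0: "!!n. difference v u n + c n = 0"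
 shows "u = (\<lambda>n. 0)" "c = (\<lambda>n. 0)"
proof -
 have c0: "n $ v = 0" if "c n ~= 0" for n using c that by (auto simp: lattice_fun_def)
 let ?A = "{n. u n ~= 0}"
 have fin: "finite ?A" using u by (simp add: lattice_fun_def)
 show u0: "u = (\<lambda>n. 0)"
 proof (rule ccontr)
  assume "u ~= (\<lambda>n. 0)"
  then have ne: "?A ~= {}" by auto
  obtain a where a: "a \<in> ?A" "!!n. n \<in> ?A ==> n $ v \<le> a $ v"
   using finite_imageI[OF fin, of "\<lambda>n. n $ v"] ne Max_in[of "(\<lambda>n. n $ v) ` ?A"] Max_ge[of "(\<lambda>n. n $ v) ` ?A"]
   by (smt (verit) imageE imageI image_is_empty)
  obtain b where b: "b \<in> ?A" "!!n. n \<in> ?A ==> b $ v \<le> n $ v"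
   using finite_imageI[OF fin, of "\<lambda>n. n $ v"] ne Min_in[of "(\<lambda>n. n $ v) ` ?A"] Min_le[of "(\<lambda>n. n $ v) ` ?A"]
   by (smt (verit) imageE imageI image_is_empty)
  have "u (a + axis v 1) = 0" using a(2)[of "a + axis v 1"] by force
  then have "c a ~= 0" using 0[of a] a(1) by (auto simp: difference_def)
  moreover have "u (b - axis v 1) = 0" using b(2)[of "b - axis v 1"] by force
  then have "c (b - axis v 1) ~= 0" using 0[of "b - axis v 1"] b(1) by (auto simp: difference_def)
  ultimately show False using c0[of a] c0[of "b - axis v 1"] b(2)[OF a(1)] by simp
 qed
 show "c = (\<lambda>n. 0)" using 0 unfolding u0 by (auto simp: difference_def)
qed

definition differences :: "'v::finite set => (real^'v => 'k::comm_ring_1) => real^'v => 'k" where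
 "differences X g = Finite_Set.fold difference g X"

lemma difference_commute: "difference u (difference v g) = difference v (difference u g)"
 by (auto simp: difference_def fun_eq_iff algebra_simps)

interpretation difference: comp_fun_commute difference
 by standard (auto simp: fun_eq_iff difference_commute[THEN fun_cong])

lemma differences_empty [simp]: "differences {} g = g"
 and differences_insert: "v \<notin> X ==> differences (insert v X) g = difference v (differences X g)"
 and differences_insert2: "v \<notin> X ==> differences (insert v X) g = differences X (difference v g)"
 by (simp_all add: differences_def difference.fold_insert2 del: difference.fold_insert)
  (simp add: difference.fold_fun_left_comm)

lemma differences_linear:
 "differences X (\<lambda>n. g n + h n) = (\<lambda>n. differences X g n + differences X h n)"
 "differences X (\<lambda>n. r * g n) = (\<lambda>n. r * differences X g n)"
 "differences X (\<lambda>n. 0) = (\<lambda>n. 0)"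
 "differences X (\<lambda>n. \<Sum>i\<in>A. f i n) = (\<lambda>n. \<Sum>i\<in>A. differences X (f i) n)"
proof -
 show add: "differences X (\<lambda>n. g n + h n) = (\<lambda>n. differences X g n + differences X h n)" for g h
  using finite[of X] by induction (auto simp: differences_insert difference_def algebra_simps)
 show "differences X (\<lambda>n. r * g n) = (\<lambda>n. r * differences X g n)"
  using finite[of X] by induction (auto simp: differences_insert difference_def algebra_simps)
 show zero: "differences X (\<lambda>n. 0) = (\<lambda>n. 0)"
  using finite[of X] by induction (auto simp: differences_insert difference_def)
 show "differences X (\<lambda>n. \<Sum>i\<in>A. f i n) = (\<lambda>n. \<Sum>i\<in>A. differences X (f i) n)"
  by (induction A rule: infinite_finite_induct) (simp_all add: zero add)
qed

lemma differences_lattice_fun: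
 assumes "X \<subseteq> \<Union>L" "X \<inter> S = {}" "g \<in> lattice_fun L S"
 shows "differences X g \<in> lattice_fun L S"
 using finite[of X] assms(1,2)
 by induction (auto simp: differences_insert assms(3) intro!: difference_lattice_fun)

lemma sum_Pow_insert:
 assumes "finite X" "v \<notin> X"
 shows "(\<Sum>S\<in>Pow (insert v X). f S) = (\<Sum>S\<in>Pow X. f S + f (insert v S))"
proof -
 have "inj_on (insert v) (Pow X)" using assms(2) by (auto simp: inj_on_def)
 moreover have "Pow X \<inter> insert v ` Pow X = {}" using assms(2) by auto
 ultimately show ?thesis
  unfolding Pow_insert using assms(1) by (simp add: sum.union_disjoint sum.reindex sum.distrib)
qed

text \<open>The decomposition in one coordinate is applied to the coordinates of the cell one after another.\<close>

lemma differences_decomposition: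
 assumes "X \<subseteq> \<Union>L" "g \<in> lattice_fun L {}"
 shows "\<exists>b. (\<forall>S\<subseteq>X. b S \<in> lattice_fun L S) \<and> g = (\<lambda>n. \<Sum>S\<in>Pow X. differences (X - S) (b S) n)"
 using finite[of X] assms(1)
proof induction
 case empty
 then show ?case using assms(2) by (intro exI[of _ "\<lambda>S. g"]) auto
next
 case (insert v X)
 then obtain b where b: "\<forall>S\<subseteq>X. b S \<in> lattice_fun L S" "g = (\<lambda>n. \<Sum>S\<in>Pow X. differences (X - S) (b S) n)"
  by auto
 have "\<forall>S\<in>Pow X. \<exists>p. fst p \<in> lattice_fun L S \<and> snd p \<in> lattice_fun L (insert v S) \<and>
   b S = (\<lambda>n. difference v (fst p) n + snd p n)"
 proof
  fix S assume S: "S \<in> Pow X"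
  have "v \<in> \<Union>L" "v \<notin> S" "b S \<in> lattice_fun L S" using S b(1) insert.hyps insert.prems by auto
  from difference_decomposition[OF this] obtain u c where "u \<in> lattice_fun L S"
   "c \<in> lattice_fun L (insert v S)" "b S = (\<lambda>n. difference v u n + c n)" by (elim bexE)
  then show "\<exists>p. fst p \<in> lattice_fun L S \<and> snd p \<in> lattice_fun L (insert v S) \<and>
   b S = (\<lambda>n. difference v (fst p) n + snd p n)" by (intro exI[of _ "(u, c)"]) simp
 qed
 from bchoice[OF this] obtain f where f: "\<forall>S\<in>Pow X. fst (f S) \<in> lattice_fun L S \<and>
   snd (f S) \<in> lattice_fun L (insert v S) \<and> b S = (\<lambda>n. difference v (fst (f S)) n + snd (f S) n)"
  by (elim exE)
 define u c where "u S = fst (f S)" and "c S = snd (f S)" for S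
 have uc: "u S \<in> lattice_fun L S" "c S \<in> lattice_fun L (insert v S)"
  "b S = (\<lambda>n. difference v (u S) n + c S n)" if "S \<subseteq> X" for S
  using f that by (auto simp: u_def c_def)
 define b' where "b' S = (if v \<in> S then c (S - {v}) else u S)" for S
 have sets: "insert v X - S = insert v (X - S)" "insert v X - insert v S = X - S" "v \<notin> S" "insert v S - {v} = S"
  if "S \<subseteq> X" for S using that insert by auto
 show ?case
 proof (intro exI[of _ b'] conjI allI impI)
  fix S assume S: "S \<subseteq> insert v X"
  show "b' S \<in> lattice_fun L S"
  proof (cases "v \<in> S")
   case True
   then have "insert v (S - {v}) = S" "S - {v} \<subseteq> X" using S by auto
   then show ?thesis using uc(2)[of "S - {v}"] True by (simp add: b'_def)
  next
   case False
   then show ?thesis using uc(1)[of S] S by (auto simp: b'_def)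
  qed
 next
  have "differences (X - S) (b S) n = differences (insert v X - S) (b' S) n
    + differences (insert v X - insert v S) (b' (insert v S)) n" if S: "S \<subseteq> X" for S n
   using sets[OF S] insert.hyps uc(3)[OF S]
   by (simp add: b'_def differences_linear differences_insert2)
  then have "g n = (\<Sum>S\<in>Pow X. differences (insert v X - S) (b' S) n
    + differences (insert v X - insert v S) (b' (insert v S)) n)" for n
   unfolding b(2) by (intro sum.cong) auto
  then show "g = (\<lambda>n. \<Sum>S\<in>Pow (insert v X). differences (insert v X - S) (b' S) n)"
   using insert.hyps by (simp add: sum_Pow_insert fun_eq_iff)
 qed
qed

lemma differences_decomposition_unique:
 assumes "X \<subseteq> \<Union>L" "!!S. S \<subseteq> X ==> b S \<in> lattice_fun L S"
  and "!!n. (\<Sum>S\<in>Pow X. differences (X - S) (b S) n) = 0" and "S \<subseteq> X"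
 shows "b S = (\<lambda>n. 0)"
 using finite[of X] assms
proof (induction X arbitrary: b S)
 case empty
 then show ?case by auto
next
 case (insert v X)
 define b' where "b' S n = difference v (b S) n + b (insert v S) n" for S n
 have sets: "insert v X - S = insert v (X - S)" "insert v X - insert v S = X - S" "v \<notin> X - S"
  if "S \<subseteq> X" for S using that insert.hyps by auto
 have b: "b S \<in> lattice_fun L S" "b (insert v S) \<in> lattice_fun L (insert v S)" if "S \<subseteq> X" for S
  using insert.prems(2) that by (auto simp: subset_insertI2 insert_mono)
 have b': "b' S \<in> lattice_fun L S" if S: "S \<subseteq> X" for S
 proof -
  have "v \<in> \<Union>L" "v \<notin> S" using insert.hyps insert.prems(1) S by auto
  then show ?thesis
   unfolding b'_def using b[OF S] lattice_fun_mono[of S "insert v S" L]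
   by (intro lattice_fun_add difference_lattice_fun) auto
 qed
 have term_eq: "differences (X - S) (b' S) n = differences (insert v X - S) (b S) n
   + differences (insert v X - insert v S) (b (insert v S)) n" if S: "S \<subseteq> X" for S n
  unfolding b'_def using sets[OF S] by (simp add: differences_linear differences_insert2)
 have "(\<Sum>S\<in>Pow X. differences (X - S) (b' S) n) = 0" for n
 proof -
  have "(\<Sum>S\<in>Pow X. differences (X - S) (b' S) n) = (\<Sum>S\<in>Pow X. differences (insert v X - S) (b S) n
   + differences (insert v X - insert v S) (b (insert v S)) n)"
   by (intro sum.cong refl term_eq) auto
  also have "\<dots> = (\<Sum>S\<in>Pow (insert v X). differences (insert v X - S) (b S) n)"
   by (rule sum_Pow_insert[OF insert.hyps, symmetric])
  also have "\<dots> = 0" by (rule insert.prems(3))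
  finally show ?thesis .
 qed
 then have zero: "b' T = (\<lambda>n. 0)" if "T \<subseteq> X" for T
  using insert.IH[of b' T] insert.prems(1) b' that by auto
 have both: "b T = (\<lambda>n. 0) \<and> b (insert v T) = (\<lambda>n. 0)" if T: "T \<subseteq> X" for T
 proof -
  have "difference v (b T) n + b (insert v T) n = 0" for n
   using fun_cong[OF zero[OF T], of n] by (simp add: b'_def)
  from difference_decomposition_unique[OF b[OF T] this] show ?thesis by simp
 qed
 show ?case
 proof (cases "v \<in> S")
  case True
  then have "insert v (S - {v}) = S" "S - {v} \<subseteq> X" using insert.prems(4) by auto
  then show ?thesis using both[of "S - {v}"] by simp
 next
  case False
  then show ?thesis using both[of S] insert.prems(4) by auto
 qed
qed

lemma image_submodule:
 assumes "fun_submodule Z" "lin_on Z T"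
 shows "fun_submodule (T ` Z)"
 unfolding fun_submodule_def
proof (intro conjI ballI allI)
 show "(\<lambda>b. 0) \<in> T ` Z"
  using lin_on_zero[OF assms(2,1)] fun_submodule_zero[OF assms(1)] by (metis imageI)
 fix x y assume "x \<in> T ` Z" "y \<in> T ` Z"
 then obtain x' y' where "x' \<in> Z" "x = T x'" "y' \<in> Z" "y = T y'" by (elim imageE)
 then show "(\<lambda>b. x b + y b) \<in> T ` Z"
  by (intro image_eqI[where x="\<lambda>b. x' b + y' b"]) (simp_all add: lin_on_add[OF assms(2)] fun_submodule_add[OF assms(1)])
next
 fix r x assume "x \<in> T ` Z"
 then obtain x' where "x' \<in> Z" "x = T x'" by (elim imageE)
 then show "(\<lambda>b. r * x b) \<in> T ` Z"
  by (intro image_eqI[where x="\<lambda>b. r * x' b"]) (simp_all add: lin_on_smult[OF assms(2)] fun_submodule_smult[OF assms(1)])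
qed

locale finite_complex =
 fixes L :: "'v::finite set set"
 assumes L: "simplicial_cx L"
begin

sublocale K: lattice_complex "lattice L" "cells L" "\<lambda>p. cell_boundary" "\<lambda>p. cell_translate" "\<lambda>p. snd"
 by (rule cell_lattice_complex[OF L])

lemma mem_link: "\<rho> \<in> link L S \<longleftrightarrow> \<rho> \<inter> S = {} \<and> \<rho> \<union> S \<in> L"
 by (simp add: link_def)

lemma cellular_cochains_iff:
 "\<phi> \<in> K.cochains p \<longleftrightarrow> (\<forall>\<tau>. (\<lambda>n. \<phi> (\<tau>, n)) \<in> lattice_fun L {}) \<and>
   (\<forall>\<tau> n. \<phi> (\<tau>, n) ~= 0 --> \<tau> \<in> L \<and> int (card \<tau>) = p)"
proof
 assume \<phi>: "\<phi> \<in> K.cochains p"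
 have supp: "0 \<le> p \<and> \<tau> \<in> L \<and> card \<tau> = nat p \<and> n \<in> lattice L" if "\<phi> (\<tau>, n) ~= 0" for \<tau> n
  using \<phi> that by (auto simp: K.cochains_def cells_def)
 have "finite {n. \<phi> (\<tau>, n) ~= 0}" for \<tau>
 proof (cases "0 \<le> p \<and> \<tau> \<in> L \<and> card \<tau> = nat p")
  case True
  then have "(\<tau>, 0) \<in> cells L (nat p)" by (simp add: cells_def lattice_0)
  then have "finite {n \<in> lattice L. \<phi> (cell_translate n (\<tau>, 0)) ~= 0}" using \<phi> unfolding K.cochains_def by blast
  then show ?thesis by (rule rev_finite_subset) (use supp in auto)
 next
  case False
  then have "{n. \<phi> (\<tau>, n) ~= 0} = {}" using supp by blast
  then show ?thesis by simp
 qed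
 then show "(\<forall>\<tau>. (\<lambda>n. \<phi> (\<tau>, n)) \<in> lattice_fun L {}) \<and>
   (\<forall>\<tau> n. \<phi> (\<tau>, n) ~= 0 --> \<tau> \<in> L \<and> int (card \<tau>) = p)"
  using supp by (auto simp: lattice_fun_def)
next
 assume *: "(\<forall>\<tau>. (\<lambda>n. \<phi> (\<tau>, n)) \<in> lattice_fun L {}) \<and>
   (\<forall>\<tau> n. \<phi> (\<tau>, n) ~= 0 --> \<tau> \<in> L \<and> int (card \<tau>) = p)"
 have "\<phi> b = 0" if b: "\<not> (0 \<le> p \<and> b \<in> cells L (nat p))" for b
 proof (rule ccontr)
  assume "\<phi> b ~= 0"
  moreover obtain \<tau> n where bn: "b = (\<tau>, n)" by fastforce
  ultimately have "\<tau> \<in> L" "int (card \<tau>) = p" "n \<in> lattice L" using * by (auto simp: lattice_fun_def)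
  then show False using b bn by (auto simp: cells_def)
 qed
 moreover have "finite {m \<in> lattice L. \<phi> (cell_translate m b) ~= 0}" if "b \<in> cells L (nat p)" for b
 proof -
  obtain \<tau> n where bn: "b = (\<tau>, n)" by fastforce
  have "finite {n. \<phi> (\<tau>, n) ~= 0}" using * by (simp add: lattice_fun_def)
  then have "finite ((\<lambda>m. m + n) -` {n. \<phi> (\<tau>, n) ~= 0})" by (intro finite_vimageI) (auto simp: inj_on_def)
  then show ?thesis by (rule rev_finite_subset) (auto simp: bn)
 qed
 ultimately show "\<phi> \<in> K.cochains p" by (simp add: K.cochains_def)
qed

lemma cellular_coboundary:
 fixes \<phi> :: "_ => 'k::comm_ring_1"
 shows "K.coboundary p \<phi> (\<tau>, n) = (if \<tau> \<in> L \<and> int (card \<tau>) = p + 1 \<and> n \<in> lattice L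
   then \<Sum>v\<in>\<tau>. vertex_sign v \<tau> * difference v (\<lambda>n. \<phi> (\<tau> - {v}, n)) n else 0)"
proof -
 have "of_int (vertex_sign v \<tau>) = (vertex_sign v \<tau> :: 'k)" for v :: 'v and \<tau>
  by (simp add: vertex_sign_def)
 then have "pairing \<phi> (cell_boundary (\<tau>, n)) = (\<Sum>v\<in>\<tau>. vertex_sign v \<tau> * difference v (\<lambda>n. \<phi> (\<tau> - {v}, n)) n)"
  by (simp add: cell_boundary_apply pairing_sum pairing_cmul pairing_diff difference_def)
 moreover have "0 \<le> p + 1 \<and> (\<tau>, n) \<in> cells L (nat (p + 1)) \<longleftrightarrow> \<tau> \<in> L \<and> int (card \<tau>) = p + 1 \<and> n \<in> lattice L"
  by (auto simp: cells_def)
 ultimately show ?thesis by (simp add: K.coboundary_def)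
qed

text \<open>The direct sum, over the simplices \<open>S\<close> and the lattice points \<open>m\<close> with vanishing coordinates
 in \<open>S\<close>, of the augmented cochain complexes of the links of \<open>S\<close>, shifted by \<open>card S + 1\<close>.\<close>

definition split_cochains :: "int => ('v set \<times> (real^'v) \<times> 'v set => 'k::comm_ring_1) set" where
 "split_cochains p = {a. finite {x. a x ~= 0} \<and> (\<forall>S m \<rho>. a (S, m, \<rho>) ~= 0 -->
   S \<in> L \<and> m \<in> lattice L \<and> (\<forall>i\<in>S. m $ i = 0) \<and> \<rho> \<in> link L S \<and> int (card S + card \<rho>) = p)}"

definition split_coboundary ::
 "int => ('v set \<times> (real^'v) \<times> 'v set => 'k::comm_ring_1) => 'v set \<times> (real^'v) \<times> 'v set => 'k" where
 "split_coboundary p a = (\<lambda>(S, m, \<rho>).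
   simplicial_coboundary (link L S) (p - 1 - int (card S)) (\<lambda>\<rho>. a (S, m, \<rho>)) \<rho>)"

definition split_cocycles :: "int => ('v set \<times> (real^'v) \<times> 'v set => 'k::comm_ring_1) set" where
 "split_cocycles p = {a \<in> split_cochains p. split_coboundary p a = (\<lambda>x. 0)}"

definition split_coboundaries :: "int => ('v set \<times> (real^'v) \<times> 'v set => 'k::comm_ring_1) set" where
 "split_coboundaries p = split_coboundary (p - 1) ` split_cochains (p - 1)"

text \<open>The sign that turns the orientation of \<open>S \<union> \<rho>\<close> into those of \<open>S\<close> and \<open>\<rho>\<close>.\<close>

definition join_sign :: "'v set => 'v set => 'k::comm_ring_1" where
 "join_sign S \<rho> = (\<Prod>v\<in>\<rho>. vertex_sign v S)"

definition assemble :: "('v set \<times> (real^'v) \<times> 'v set => 'k::comm_ring_1) => 'v set \<times> (real^'v) => 'k" where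
 "assemble a = (\<lambda>(\<tau>, n). \<Sum>S\<in>Pow \<tau>. join_sign S (\<tau> - S) * differences (\<tau> - S) (\<lambda>m. a (S, m, \<tau> - S)) n)"

lemma join_sign_square [simp]: "join_sign S \<rho> * join_sign S \<rho> = 1"
 by (simp add: join_sign_def flip: prod.distrib)

lemma vertex_sign_Un:
 assumes "S \<inter> \<rho> = {}"
 shows "vertex_sign v (S \<union> \<rho>) = vertex_sign v S * (vertex_sign v \<rho> :: 'k::comm_ring_1)"
proof -
 have "{u \<in> S \<union> \<rho>. to_nat u < to_nat v} = {u \<in> S. to_nat u < to_nat v} \<union> {u \<in> \<rho>. to_nat u < to_nat v}" by auto
 moreover have "{u \<in> S. to_nat u < to_nat v} \<inter> {u \<in> \<rho>. to_nat u < to_nat v} = {}" using assms by auto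
 ultimately show ?thesis by (simp add: vertex_sign_def card_Un_disjoint power_add)
qed

lemma join_sign_vertex_sign:
 assumes "S \<inter> \<rho> = {}" "v \<in> \<rho>"
 shows "join_sign S \<rho> * vertex_sign v \<rho> = (vertex_sign v (S \<union> \<rho>) * join_sign S (\<rho> - {v}) :: 'k::comm_ring_1)"
proof -
 have "join_sign S \<rho> = vertex_sign v S * (join_sign S (\<rho> - {v}) :: 'k)"
  using assms by (simp add: join_sign_def prod.remove)
 then show ?thesis using vertex_sign_Un[OF assms(1), of v, where 'k='k] by (simp add: mult_ac)
qed

lemma split_cochains_lattice_fun:
 assumes "a \<in> split_cochains p"
 shows "(\<lambda>m. a (S, m, \<rho>)) \<in> lattice_fun L S"
proof -
 have "finite ((\<lambda>m. (S, m, \<rho>)) -` {x. a x ~= 0})"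
  using assms by (intro finite_vimageI) (auto simp: split_cochains_def inj_on_def)
 then show ?thesis using assms by (auto simp: lattice_fun_def split_cochains_def vimage_def)
qed

lemma split_cochains_submodule: "fun_submodule (split_cochains p :: (_ => 'k::comm_ring_1) set)"
 unfolding fun_submodule_def
proof (intro conjI ballI allI)
 fix a b :: "'v set \<times> (real^'v) \<times> 'v set => 'k" assume ab: "a \<in> split_cochains p" "b \<in> split_cochains p"
 have "finite {x. a x + b x ~= 0}"
  by (rule finite_subset[of _ "{x. a x ~= 0} \<union> {x. b x ~= 0}"]) (use ab in \<open>auto simp: split_cochains_def\<close>)
 moreover have "a x ~= 0 \<or> b x ~= 0" if "a x + b x ~= 0" for x using that by auto
 ultimately show "(\<lambda>x. a x + b x) \<in> split_cochains p"
  using ab unfolding split_cochains_def mem_Collect_eq by meson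
next
 fix r and a :: "'v set \<times> (real^'v) \<times> 'v set => 'k" assume a: "a \<in> split_cochains p"
 have "finite {x. r * a x ~= 0}"
  by (rule finite_subset[of _ "{x. a x ~= 0}"]) (use a in \<open>auto simp: split_cochains_def\<close>)
 moreover have "a x ~= 0" if "r * a x ~= 0" for x using that by auto
 ultimately show "(\<lambda>x. r * a x) \<in> split_cochains p"
  using a unfolding split_cochains_def mem_Collect_eq by meson
qed (simp add: split_cochains_def)

lemma simplicial_coboundary_linear:
 "simplicial_coboundary K q (\<lambda>\<rho>. f \<rho> + g \<rho>) \<rho> = simplicial_coboundary K q f \<rho> + simplicial_coboundary K q g \<rho>"
 "simplicial_coboundary K q (\<lambda>\<rho>. r * f \<rho>) \<rho> = r * simplicial_coboundary K q f \<rho>"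
 "simplicial_coboundary K q (\<lambda>\<rho>. 0) \<rho> = 0"
 by (auto simp: simplicial_coboundary_def sum.distrib sum_distrib_left algebra_simps)

lemma split_coboundary_linear:
 "split_coboundary p (\<lambda>x. a x + b x) = (\<lambda>x. split_coboundary p a x + split_coboundary p b x)"
 "split_coboundary p (\<lambda>x. r * a x) = (\<lambda>x. r * split_coboundary p a x)"
 "split_coboundary p (\<lambda>x. 0) = (\<lambda>x. 0)"
 by (auto simp: split_coboundary_def simplicial_coboundary_linear)

lemma split_cocycles_submodule: "fun_submodule (split_cocycles p :: (_ => 'k::comm_ring_1) set)"
 using split_cochains_submodule[of p, where 'k='k]
 by (auto simp: fun_submodule_def split_cocycles_def split_coboundary_linear)

lemma split_coboundaries_submodule: "fun_submodule (split_coboundaries p :: (_ => 'k::comm_ring_1) set)"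
 unfolding split_coboundaries_def
 by (rule image_submodule[OF split_cochains_submodule]) (simp add: lin_on_def split_coboundary_linear)

lemma split_coboundary_cochain:
 assumes a: "a \<in> split_cochains p"
 shows "split_coboundary p a \<in> split_cochains (p + 1)"
proof -
 have *: "(\<exists>\<rho>'. a (S, m, \<rho>') ~= 0) \<and> \<rho> \<in> link L S \<and> int (card S + card \<rho>) = p + 1"
  if "split_coboundary p a (S, m, \<rho>) ~= 0" for S m \<rho>
 proof -
  have sum: "\<rho> \<in> link L S" "int (card \<rho>) = p - 1 - int (card S) + 2"
   "(\<Sum>v\<in>\<rho>. (-1) ^ card {u \<in> \<rho>. to_nat u < to_nat v} * a (S, m, \<rho> - {v})) ~= 0"
   using that by (auto simp: split_coboundary_def simplicial_coboundary_def split: if_splits)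
  then have "\<exists>v\<in>\<rho>. a (S, m, \<rho> - {v}) ~= 0" by (metis (no_types, lifting) mult_zero_right sum.neutral)
  then show ?thesis using sum by auto
 qed
 let ?A = "(\<lambda>((S, m, \<rho>'), \<rho>). (S, m, \<rho>)) ` ({x. a x ~= 0} \<times> (UNIV :: 'v set set))"
 have "finite ?A"
  using a by (intro finite_imageI finite_cartesian_product) (auto simp: split_cochains_def)
 moreover have "{x. split_coboundary p a x ~= 0} \<subseteq> ?A"
 proof
  fix x assume "x \<in> {x. split_coboundary p a x ~= 0}"
  then obtain S m \<rho> where x: "x = (S, m, \<rho>)" "split_coboundary p a (S, m, \<rho>) ~= 0" by (cases x) auto
  then obtain \<rho>' where "a (S, m, \<rho>') ~= 0" using * by blast
  then show "x \<in> ?A" unfolding x(1) by (intro image_eqI[where x="((S, m, \<rho>'), \<rho>)"]) auto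
 qed
 ultimately have "finite {x. split_coboundary p a x ~= 0}" by (rule rev_finite_subset)
 moreover have "S \<in> L \<and> m \<in> lattice L \<and> (\<forall>i\<in>S. m $ i = 0) \<and> \<rho> \<in> link L S \<and> int (card S + card \<rho>) = p + 1"
  if ne: "split_coboundary p a (S, m, \<rho>) ~= 0" for S m \<rho>
 proof -
  obtain \<rho>' where "a (S, m, \<rho>') ~= 0" using *[OF ne] by blast
  then have "S \<in> L \<and> m \<in> lattice L \<and> (\<forall>i\<in>S. m $ i = 0)" using a by (simp add: split_cochains_def)
  then show ?thesis using *[OF ne] by blast
 qed
 ultimately show ?thesis by (simp add: split_cochains_def)
qed

lemma assemble_linear:
 "assemble (\<lambda>x. a x + b x) = (\<lambda>x. assemble a x + assemble b x)"
 "assemble (\<lambda>x. r * a x) = (\<lambda>x. r * assemble a x)"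
 by (auto simp: assemble_def differences_linear distrib_left sum.distrib sum_distrib_left mult_ac)

lemma assemble_off_support:
 assumes a: "a \<in> split_cochains p" and \<tau>: "\<not> (\<tau> \<in> L \<and> int (card \<tau>) = p)"
 shows "assemble a (\<tau>, n) = 0"
proof -
 have "a (S, m, \<tau> - S) = 0" if "S \<subseteq> \<tau>" for S m
 proof (rule ccontr)
  assume "a (S, m, \<tau> - S) ~= 0"
  then have "\<tau> - S \<in> link L S" "int (card S + card (\<tau> - S)) = p" using a by (auto simp: split_cochains_def)
  moreover have "\<tau> - S \<union> S = \<tau>" "card S + card (\<tau> - S) = card \<tau>"
   using that by (auto simp: card_Diff_subset card_mono)
  ultimately show False using \<tau> by (simp add: mem_link)
 qed
 then have "(\<lambda>m. a (S, m, \<tau> - S)) = (\<lambda>m. 0)" if "S \<subseteq> \<tau>" for S using that by blast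
 then show ?thesis by (simp add: assemble_def differences_linear)
qed

lemma assemble_cochain:
 assumes a: "a \<in> split_cochains p"
 shows "assemble a \<in> K.cochains p"
proof -
 have "(\<lambda>n. assemble a (\<tau>, n)) \<in> lattice_fun L {}" for \<tau>
 proof (cases "\<tau> \<in> L")
  case True
  have "(\<lambda>n. join_sign S (\<tau> - S) * differences (\<tau> - S) (\<lambda>m. a (S, m, \<tau> - S)) n) \<in> lattice_fun L {}" if "S \<in> Pow \<tau>" for S
  proof -
   have "differences (\<tau> - S) (\<lambda>m. a (S, m, \<tau> - S)) \<in> lattice_fun L S"
    by (rule differences_lattice_fun[OF _ _ split_cochains_lattice_fun[OF a]]) (use True in auto)
   then show ?thesis using lattice_fun_mono[of "{}" S L] by (intro lattice_fun_smult) auto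
  qed
  then show ?thesis unfolding assemble_def case_prod_conv by (rule lattice_fun_sum)
 next
  case False
  then show ?thesis using assemble_off_support[OF a] by (simp add: lattice_fun_zero)
 qed
 then show ?thesis unfolding cellular_cochains_iff using assemble_off_support[OF a] by blast
qed

lemma assemble_eq_zero:
 assumes a: "a \<in> split_cochains p" and 0: "assemble a = (\<lambda>x. 0)"
 shows "a = (\<lambda>x. 0)"
proof (rule ccontr)
 assume "a ~= (\<lambda>x. 0)"
 then obtain S m \<rho> where ne: "a (S, m, \<rho>) ~= 0" by (metis prod_cases3)
 then have \<rho>: "\<rho> \<inter> S = {}" "\<rho> \<union> S \<in> L" using a by (auto simp: split_cochains_def mem_link)
 let ?\<tau> = "\<rho> \<union> S"
 have "(\<lambda>m. join_sign S (?\<tau> - S) * a (S, m, ?\<tau> - S)) = (\<lambda>m. 0)"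
 proof (rule differences_decomposition_unique[of ?\<tau> L "\<lambda>S m. join_sign S (?\<tau> - S) * a (S, m, ?\<tau> - S)"])
  show "(\<Sum>S\<in>Pow ?\<tau>. differences (?\<tau> - S) (\<lambda>m. join_sign S (?\<tau> - S) * a (S, m, ?\<tau> - S)) n) = 0" for n
   using fun_cong[OF 0, of "(?\<tau>, n)"] by (simp add: assemble_def differences_linear)
 qed (use \<rho> in \<open>auto intro: lattice_fun_smult split_cochains_lattice_fun[OF a]\<close>)
 then have "join_sign S (?\<tau> - S) * (join_sign S (?\<tau> - S) * a (S, m, ?\<tau> - S)) = 0" by (metis mult_zero_right)
 moreover have "?\<tau> - S = \<rho>" using \<rho> by auto
 ultimately show False using ne by (simp flip: mult.assoc)
qed

lemma assemble_surj:
 assumes \<phi>: "\<phi> \<in> K.cochains p"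
 shows "\<exists>a\<in>split_cochains p. assemble a = \<phi>"
proof -
 have "\<forall>\<tau>\<in>L. \<exists>b. (\<forall>S\<subseteq>\<tau>. b S \<in> lattice_fun L S) \<and>
   (\<lambda>n. \<phi> (\<tau>, n)) = (\<lambda>n. \<Sum>S\<in>Pow \<tau>. differences (\<tau> - S) (b S) n)"
  using \<phi> by (intro ballI differences_decomposition) (auto simp: cellular_cochains_iff)
 from bchoice[OF this] obtain b where b: "\<forall>\<tau>\<in>L. (\<forall>S\<subseteq>\<tau>. b \<tau> S \<in> lattice_fun L S) \<and>
   (\<lambda>n. \<phi> (\<tau>, n)) = (\<lambda>n. \<Sum>S\<in>Pow \<tau>. differences (\<tau> - S) (b \<tau> S) n)" by (elim exE)
 define a where "a = (\<lambda>(S, m, \<rho>). if \<rho> \<in> link L S \<and> int (card S + card \<rho>) = p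
   then join_sign S \<rho> * b (\<rho> \<union> S) S m else 0)"
 have supp: "\<rho> \<in> link L S \<and> int (card S + card \<rho>) = p \<and> b (\<rho> \<union> S) S m ~= 0" if "a (S, m, \<rho>) ~= 0" for S m \<rho>
  using that by (auto simp: a_def split: if_splits)
 have bf: "b (\<rho> \<union> S) S \<in> lattice_fun L S" if "\<rho> \<in> link L S" for S \<rho>
  using b that by (auto simp: mem_link)
 have "finite (\<Union>S. \<Union>\<rho>\<in>link L S. (\<lambda>m. (S, m, \<rho>)) ` {m. b (\<rho> \<union> S) S m ~= 0})"
  using bf by (intro finite_UN_I finite_imageI) (auto simp: lattice_fun_def)
 then have fin: "finite {x. a x ~= 0}"
  by (rule rev_finite_subset) (use supp in \<open>auto simp: image_iff\<close>)
 have aD: "a \<in> split_cochains p"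
  unfolding split_cochains_def
 proof (intro CollectI conjI allI impI fin)
  fix S m \<rho> assume "a (S, m, \<rho>) ~= 0"
  from supp[OF this] have *: "\<rho> \<in> link L S" "int (card S + card \<rho>) = p" "b (\<rho> \<union> S) S m ~= 0" by auto
  show "S \<in> L" using * simplicial_cx_subset[OF L, of "\<rho> \<union> S" S] by (auto simp: mem_link)
  show "m \<in> lattice L" "\<forall>i\<in>S. m $ i = 0" using bf[OF *(1)] *(3) by (auto simp: lattice_fun_def)
  show "\<rho> \<in> link L S" "int (card S + card \<rho>) = p" by fact+
 qed
 have "assemble a (\<tau>, n) = \<phi> (\<tau>, n)" for \<tau> n
 proof (cases "\<tau> \<in> L \<and> int (card \<tau>) = p")
  case True
  have "join_sign S (\<tau> - S) * differences (\<tau> - S) (\<lambda>m. a (S, m, \<tau> - S)) n = differences (\<tau> - S) (b \<tau> S) n" if "S \<in> Pow \<tau>" for S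
  proof -
   have *: "\<tau> - S \<union> S = \<tau>" "card S + card (\<tau> - S) = card \<tau>"
    using that by (auto simp: card_Diff_subset card_mono)
   then have "\<tau> - S \<in> link L S" using True by (auto simp: mem_link)
   then have "(\<lambda>m. a (S, m, \<tau> - S)) = (\<lambda>m. join_sign S (\<tau> - S) * b \<tau> S m)"
    using * True by (simp add: a_def)
   then show ?thesis by (simp add: differences_linear flip: mult.assoc)
  qed
  then have "assemble a (\<tau>, n) = (\<Sum>S\<in>Pow \<tau>. differences (\<tau> - S) (b \<tau> S) n)"
   by (simp add: assemble_def)
  then show ?thesis using b True by (metis (no_types, lifting))
 next
  case False
  then show ?thesis using assemble_off_support[OF aD False] \<phi> by (auto simp: cellular_cochains_iff)
 qed
 then have "assemble a = \<phi>" by (intro ext) (metis surj_pair)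
 then show ?thesis using aD by blast
qed

text \<open>The cellular coboundary takes one more difference. On the component of \<open>S\<close> this enlarges the set of
 directions outside \<open>S\<close> by one vertex, as the coboundary of the link of \<open>S\<close> does.\<close>

lemma assemble_coboundary:
 assumes a: "a \<in> split_cochains p"
 shows "assemble (split_coboundary p a) = K.coboundary p (assemble a)"
proof
 fix x :: "'v set \<times> (real^'v)"
 obtain \<tau> n where x: "x = (\<tau>, n)" by fastforce
 have mem: "assemble (split_coboundary p a) \<in> K.cochains (p + 1)"
  by (rule assemble_cochain[OF split_coboundary_cochain[OF a]])
 show "assemble (split_coboundary p a) x = K.coboundary p (assemble a) x"
 proof (cases "\<tau> \<in> L \<and> int (card \<tau>) = p + 1 \<and> n \<in> lattice L")
  case False
  moreover have "(\<lambda>n. assemble (split_coboundary p a) (\<tau>, n)) \<in> lattice_fun L {}"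
   using mem by (simp add: cellular_cochains_iff)
  ultimately show ?thesis
   using mem unfolding x cellular_coboundary by (auto simp: cellular_cochains_iff lattice_fun_def)
 next
  case True
  let ?X = "\<lambda>S v. differences (\<tau> - S) (\<lambda>m. a (S, m, \<tau> - S - {v})) n"
  have "assemble (split_coboundary p a) x =
    (\<Sum>S\<in>Pow \<tau>. \<Sum>v\<in>\<tau> - S. vertex_sign v \<tau> * join_sign S (\<tau> - S - {v}) * ?X S v)"
   unfolding x assemble_def case_prod_conv
  proof (rule sum.cong[OF refl])
   fix S assume S: "S \<in> Pow \<tau>"
   have *: "S \<union> (\<tau> - S) = \<tau>" "card S + card (\<tau> - S) = card \<tau>"
    using S by (auto simp: card_Diff_subset card_mono)
   then have "\<tau> - S \<in> link L S" using True by (auto simp: mem_link Un_commute)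
   then have "(\<lambda>m. split_coboundary p a (S, m, \<tau> - S)) =
     (\<lambda>m. \<Sum>v\<in>\<tau> - S. vertex_sign v (\<tau> - S) * a (S, m, \<tau> - S - {v}))"
    using * True by (auto simp: split_coboundary_def simplicial_coboundary_def vertex_sign_def)
   then have "join_sign S (\<tau> - S) * differences (\<tau> - S) (\<lambda>m. split_coboundary p a (S, m, \<tau> - S)) n =
     (\<Sum>v\<in>\<tau> - S. (join_sign S (\<tau> - S) * vertex_sign v (\<tau> - S)) * ?X S v)"
    by (simp add: differences_linear sum_distrib_left mult.assoc)
   also have "\<dots> = (\<Sum>v\<in>\<tau> - S. vertex_sign v \<tau> * join_sign S (\<tau> - S - {v}) * ?X S v)"
    using *(1) by (intro sum.cong refl) (simp add: join_sign_vertex_sign)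
   finally show "join_sign S (\<tau> - S) * differences (\<tau> - S) (\<lambda>m. split_coboundary p a (S, m, \<tau> - S)) n =
     (\<Sum>v\<in>\<tau> - S. vertex_sign v \<tau> * join_sign S (\<tau> - S - {v}) * ?X S v)" .
  qed
  also have "\<dots> = (\<Sum>v\<in>\<tau>. \<Sum>S\<in>Pow (\<tau> - {v}). vertex_sign v \<tau> * join_sign S (\<tau> - S - {v}) * ?X S v)"
  proof -
   have "bij_betw (\<lambda>(S, v). (v, S)) (SIGMA S:Pow \<tau>. \<tau> - S) (SIGMA v:\<tau>. Pow (\<tau> - {v}))"
    by (rule bij_betwI[where g="\<lambda>(v, S). (S, v)"]) auto
   from sum.reindex_bij_betw[OF this, of "\<lambda>(v, S). vertex_sign v \<tau> * join_sign S (\<tau> - S - {v}) * ?X S v"]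
   show ?thesis by (simp add: sum.Sigma split_def)
  qed
  also have "\<dots> = (\<Sum>v\<in>\<tau>. vertex_sign v \<tau> * difference v (\<lambda>n. assemble a (\<tau> - {v}, n)) n)"
  proof (rule sum.cong[OF refl])
   fix v assume v: "v \<in> \<tau>"
   have "difference v (\<lambda>n. assemble a (\<tau> - {v}, n)) n =
     (\<Sum>S\<in>Pow (\<tau> - {v}). join_sign S (\<tau> - {v} - S) *
       difference v (differences (\<tau> - {v} - S) (\<lambda>m. a (S, m, \<tau> - {v} - S))) n)"
    by (simp add: difference_def assemble_def right_diff_distrib flip: sum_subtractf)
   also have "\<dots> = (\<Sum>S\<in>Pow (\<tau> - {v}). join_sign S (\<tau> - S - {v}) * ?X S v)"
   proof (rule sum.cong[OF refl])
    fix S assume "S \<in> Pow (\<tau> - {v})"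
    then have "\<tau> - {v} - S = \<tau> - S - {v}" "insert v (\<tau> - S - {v}) = \<tau> - S" using v by auto
    then show "join_sign S (\<tau> - {v} - S) * difference v (differences (\<tau> - {v} - S) (\<lambda>m. a (S, m, \<tau> - {v} - S))) n =
      join_sign S (\<tau> - S - {v}) * ?X S v"
     using differences_insert[of v "\<tau> - S - {v}" "\<lambda>m. a (S, m, \<tau> - S - {v})"] by simp
   qed
   finally show "(\<Sum>S\<in>Pow (\<tau> - {v}). vertex_sign v \<tau> * join_sign S (\<tau> - S - {v}) * ?X S v) =
     vertex_sign v \<tau> * difference v (\<lambda>n. assemble a (\<tau> - {v}, n)) n"
    by (simp add: sum_distrib_left mult.assoc)
  qed
  also have "\<dots> = K.coboundary p (assemble a) x" using True by (simp add: x cellular_coboundary)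
  finally show ?thesis .
 qed
qed

lemma assemble_inj:
 assumes "a \<in> split_cochains p" "b \<in> split_cochains p" "assemble a = assemble b"
 shows "a = b"
proof -
 have l: "lin_on (split_cochains p) assemble" by (simp add: lin_on_def assemble_linear)
 have "assemble (\<lambda>x. a x - b x) = (\<lambda>x. 0)"
  using lin_on_diff[OF l split_cochains_submodule assms(1,2)] assms(3) by simp
 then have "(\<lambda>x. a x - b x) = (\<lambda>x. 0)"
  by (rule assemble_eq_zero[OF fun_submodule_diff[OF split_cochains_submodule assms(1,2)]])
 then have "a x - b x = 0" for x by (rule fun_cong)
 then show ?thesis by (intro ext) simp
qed

theorem cellular_split_iso:
 "\<exists>T. quotient_iso (K.cocycles p :: (_ => 'k::comm_ring_1) set) (K.coboundaries p) (split_cocycles p) (split_coboundaries p) T"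
proof -
 define T where "T \<phi> = (SOME a. a \<in> split_cochains p \<and> assemble a = \<phi>)" for \<phi> :: "_ => 'k"
 have T: "T \<phi> \<in> split_cochains p \<and> assemble (T \<phi>) = \<phi>" if "\<phi> \<in> K.cochains p" for \<phi>
 proof -
  have "\<exists>a. a \<in> split_cochains p \<and> assemble a = \<phi>" using assemble_surj[OF that] by blast
  from someI_ex[OF this] show ?thesis unfolding T_def .
 qed
 have T': "T (assemble a) = a" if "a \<in> split_cochains p" for a
  using T[OF assemble_cochain[OF that]] assemble_inj[OF _ that] by blast
 have Zc: "z \<in> K.cochains p" if "z \<in> K.cocycles p" for z :: "_ => 'k" using that by (simp add: K.cocycles_def)
 have pred: "p - 1 + 1 = p" by simp
 have "quotient_iso (K.cocycles p :: (_ => 'k) set) (K.coboundaries p) (split_cocycles p) (split_coboundaries p) T"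
 proof (rule quotient_isoI[where U=assemble])
  show "lin_on (K.cocycles p) T"
   unfolding lin_on_def
  proof (intro conjI ballI allI)
   fix x y :: "_ => 'k" assume "x \<in> K.cocycles p" "y \<in> K.cocycles p"
   then have xy: "T x \<in> split_cochains p" "assemble (T x) = x" "T y \<in> split_cochains p" "assemble (T y) = y"
    using T Zc by blast+
   show "T (\<lambda>b. x b + y b) = (\<lambda>c. T x c + T y c)"
    using T'[OF fun_submodule_add[OF split_cochains_submodule xy(1,3)]] by (simp add: assemble_linear xy)
  next
   fix r and x :: "_ => 'k" assume "x \<in> K.cocycles p"
   then have x: "T x \<in> split_cochains p" "assemble (T x) = x" using T Zc by blast+
   show "T (\<lambda>b. r * x b) = (\<lambda>c. r * T x c)"
    using T'[OF fun_submodule_smult[OF split_cochains_submodule x(1)]] by (simp add: assemble_linear x)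
  qed
 next
  fix z :: "_ => 'k" assume z: "z \<in> K.cocycles p"
  note Tz = T[OF Zc[OF z]]
  have "assemble (split_coboundary p (T z)) = (\<lambda>x. 0)"
   using assemble_coboundary[of "T z" p] Tz z by (simp add: K.cocycles_def)
  then have "split_coboundary p (T z) = (\<lambda>x. 0)"
   using assemble_eq_zero[OF split_coboundary_cochain] Tz by blast
  then show "T z \<in> split_cocycles p" using Tz by (simp add: split_cocycles_def)
  show "(\<lambda>b. assemble (T z) b - z b) \<in> K.coboundaries p"
   using Tz fun_submodule_zero[OF K.coboundaries_submodule] by simp
  assume "z \<in> K.coboundaries p"
  then obtain \<phi> where \<phi>: "\<phi> \<in> K.cochains (p - 1)" "z = K.coboundary (p - 1) \<phi>"
   unfolding K.coboundaries_def by (elim imageE)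
  obtain b where b: "b \<in> split_cochains (p - 1)" "assemble b = \<phi>" using assemble_surj[OF \<phi>(1)] by blast
  have "T z = split_coboundary (p - 1) b"
   using T'[OF split_coboundary_cochain[OF b(1), unfolded pred]] assemble_coboundary[OF b(1)] b \<phi> by simp
  then show "T z \<in> split_coboundaries p" using b by (simp add: split_coboundaries_def)
 next
  fix a :: "_ => 'k" assume a: "a \<in> split_cocycles p"
  then have aD: "a \<in> split_cochains p" by (simp add: split_cocycles_def)
  have "assemble (\<lambda>x. 0) = (\<lambda>x. 0 :: 'k)" using assemble_linear(2)[of 0 "\<lambda>x. 0 :: 'k"] by simp
  then show "assemble a \<in> K.cocycles p"
   using assemble_coboundary[OF aD] a assemble_cochain[OF aD] by (simp add: K.cocycles_def split_cocycles_def)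
  show "(\<lambda>b. T (assemble a) b - a b) \<in> split_coboundaries p"
   using T'[OF aD] fun_submodule_zero[OF split_coboundaries_submodule] by simp
  assume "a \<in> split_coboundaries p"
  then obtain b where b: "b \<in> split_cochains (p - 1)" "a = split_coboundary (p - 1) b"
   unfolding split_coboundaries_def by (elim imageE)
  show "assemble a \<in> K.coboundaries p"
   unfolding K.coboundaries_def b(2) assemble_coboundary[OF b(1)] by (intro imageI assemble_cochain b(1))
 qed (intro K.coboundaries_submodule K.cocycles_submodule split_cocycles_submodule split_coboundaries_submodule)+
 then show ?thesis by blast
qed

end

definition simplicial_cocycles :: "'v::finite set set => int => ('v set => 'k::comm_ring_1) set" where
 "simplicial_cocycles K q = {f \<in> carrier (simplicial_cochains TYPE('k) K q). simplicial_coboundary K q f = (\<lambda>\<sigma>. 0)}"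

definition simplicial_coboundaries :: "'v::finite set set => int => ('v set => 'k::comm_ring_1) set" where
 "simplicial_coboundaries K q = simplicial_coboundary K (q - 1) ` carrier (simplicial_cochains TYPE('k) K (q - 1))"

lemma simplicial_cochains_carrier:
 "f \<in> carrier (simplicial_cochains TYPE('k::comm_ring_1) K q) \<longleftrightarrow> (\<forall>\<sigma>. f \<sigma> ~= 0 --> \<sigma> \<in> K \<and> int (card \<sigma>) = q + 1)"
 by (auto simp: simplicial_cochains_def)

lemma simplicial_cochains_kmodule: "kmodule (simplicial_cochains TYPE('k::comm_ring_1) (K :: 'v::finite set set) q)"
proof -
 let ?M = "simplicial_cochains TYPE('k) K q"
 have "abelian_group ?M"
 proof (rule abelian_groupI)
  fix x assume x: "x \<in> carrier ?M"
  show "\<exists>y\<in>carrier ?M. y \<oplus>\<^bsub>?M\<^esub> x = \<zero>\<^bsub>?M\<^esub>"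
   by (rule bexI[of _ "\<lambda>\<sigma>. - x \<sigma>"]) (use x in \<open>auto simp: simplicial_cochains_def\<close>)
 qed (auto simp: simplicial_cochains_def algebra_simps)
 then show ?thesis
  by (rule kmodule.intro) (unfold_locales, auto simp: simplicial_cochains_def algebra_simps)
qed

lemma simplicial_cocycles_submodule: "fun_submodule (simplicial_cocycles K q)"
proof -
 have lin: "simplicial_coboundary K q (\<lambda>\<rho>. f \<rho> + g \<rho>) = (\<lambda>\<rho>. simplicial_coboundary K q f \<rho> + simplicial_coboundary K q g \<rho>)"
  "simplicial_coboundary K q (\<lambda>\<rho>. r * f \<rho>) = (\<lambda>\<rho>. r * simplicial_coboundary K q f \<rho>)"
  "simplicial_coboundary K q (\<lambda>\<rho>. 0) = (\<lambda>\<rho>. 0)" for f g :: "_ => 'b" and r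
  by (auto simp: simplicial_coboundary_def sum.distrib sum_distrib_left algebra_simps)
 show ?thesis
  by (auto simp: fun_submodule_def simplicial_cocycles_def lin simplicial_cochains_def)
qed

lemma simplicial_coboundaries_submodule:
 "fun_submodule (simplicial_coboundaries K q :: ('v::finite set => 'k::comm_ring_1) set)"
 unfolding simplicial_coboundaries_def
proof (rule image_submodule)
 show "fun_submodule (carrier (simplicial_cochains TYPE('k) K (q - 1)))"
  by (auto simp: fun_submodule_def simplicial_cochains_def)
 show "lin_on (carrier (simplicial_cochains TYPE('k) K (q - 1))) (simplicial_coboundary K (q - 1))"
  by (auto simp: lin_on_def simplicial_coboundary_def sum.distrib sum_distrib_left algebra_simps)
qed

lemma simplicial_ksub:
 "ksub (simplicial_cochains TYPE('k::comm_ring_1) K q) (simplicial_cocycles K q) (simplicial_coboundaries K q)"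
proof (intro ksub.intro ksub_axioms.intro simplicial_cochains_kmodule)
 let ?M = "simplicial_cochains TYPE('k) K q"
 have ops: "\<zero>\<^bsub>?M\<^esub> = (\<lambda>\<sigma>. 0)" "x \<oplus>\<^bsub>?M\<^esub> y = (\<lambda>\<sigma>. x \<sigma> + y \<sigma>)" "r \<odot>\<^bsub>?M\<^esub> x = (\<lambda>\<sigma>. r * x \<sigma>)" for x y r
  by (simp_all add: simplicial_cochains_def)
 show "simplicial_cocycles K q \<subseteq> carrier ?M" by (auto simp: simplicial_cocycles_def)
 show "simplicial_coboundaries K q \<subseteq> carrier ?M"
  by (auto simp: simplicial_coboundaries_def simplicial_cochains_def simplicial_coboundary_def)
 note Z = simplicial_cocycles_submodule[of K q, where 'b='k]
 note B = simplicial_coboundaries_submodule[of K q, where 'k='k]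
 show "\<zero>\<^bsub>?M\<^esub> \<in> simplicial_cocycles K q" "\<zero>\<^bsub>?M\<^esub> \<in> simplicial_coboundaries K q"
  using fun_submodule_zero[OF Z] fun_submodule_zero[OF B] by (simp_all add: ops)
 fix x y r
 show "x \<oplus>\<^bsub>?M\<^esub> y \<in> simplicial_cocycles K q" if "x \<in> simplicial_cocycles K q" "y \<in> simplicial_cocycles K q"
  using fun_submodule_add[OF Z that] by (simp add: ops)
 show "x \<oplus>\<^bsub>?M\<^esub> y \<in> simplicial_coboundaries K q" if "x \<in> simplicial_coboundaries K q" "y \<in> simplicial_coboundaries K q"
  using fun_submodule_add[OF B that] by (simp add: ops)
 show "r \<odot>\<^bsub>?M\<^esub> x \<in> simplicial_cocycles K q" if "x \<in> simplicial_cocycles K q"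
  using fun_submodule_smult[OF Z that] by (simp add: ops)
 show "r \<odot>\<^bsub>?M\<^esub> x \<in> simplicial_coboundaries K q" if "x \<in> simplicial_coboundaries K q"
  using fun_submodule_smult[OF B that] by (simp add: ops)
qed

lemma reduced_cohomology_subquotient:
 "reduced_cohomology TYPE('k::comm_ring_1) K q =
   subquotient (simplicial_cochains TYPE('k) K q) (simplicial_cocycles K q) (simplicial_coboundaries K q)"
 by (simp add: reduced_cohomology_def cohomology_def simplicial_cocycles_def simplicial_coboundaries_def)
  (simp add: simplicial_cochains_def)

definition torsion_free_mod :: "('b => 'k::comm_ring_1) set => ('b => 'k) set => bool" where
 "torsion_free_mod Z B \<longleftrightarrow> (\<forall>r. \<forall>z\<in>Z. r ~= 0 --> (\<lambda>b. r * z b) \<in> B --> z \<in> B)"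

lemma reduced_cohomology_zero_iff:
 "zero_module (reduced_cohomology TYPE('k::comm_ring_1) K q) \<longleftrightarrow>
   (simplicial_cocycles K q :: (_ => 'k) set) \<subseteq> simplicial_coboundaries K q"
 unfolding reduced_cohomology_subquotient by (rule ksub.zero_module_iff[OF simplicial_ksub])

lemma reduced_cohomology_torsion_free_iff:
 "torsion_free_module (reduced_cohomology TYPE('k::comm_ring_1) K q) \<longleftrightarrow>
   torsion_free_mod (simplicial_cocycles K q :: (_ => 'k) set) (simplicial_coboundaries K q)"
 unfolding reduced_cohomology_subquotient ksub.torsion_free_iff[OF simplicial_ksub] torsion_free_mod_def
 by (simp add: simplicial_cochains_def)

context finite_complex
begin

abbreviation "link_cocycles p S \<equiv> simplicial_cocycles (link L S) (p - 1 - int (card S))"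
abbreviation "link_coboundaries p S \<equiv> simplicial_coboundaries (link L S) (p - 1 - int (card S))"

abbreviation part :: "('v set \<times> (real^'v) \<times> 'v set => 'k) => 'v set => (real^'v) => 'v set => 'k" where
 "part a S m \<equiv> (\<lambda>\<rho>. a (S, m, \<rho>))"

lemma part_cochain:
 fixes a :: "_ => 'k::comm_ring_1"
 assumes "a \<in> split_cochains p"
 shows "part a S m \<in> carrier (simplicial_cochains TYPE('k) (link L S) (p - 1 - int (card S)))"
 unfolding simplicial_cochains_carrier using assms by (force simp: split_cochains_def)

lemma split_cocycles_iff:
 fixes a :: "_ => 'k::comm_ring_1"
 assumes "a \<in> split_cochains p"
 shows "a \<in> split_cocycles p \<longleftrightarrow> (\<forall>S m. part a S m \<in> link_cocycles p S)"
proof -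
 have "split_coboundary p a = (\<lambda>x. 0) \<longleftrightarrow>
   (\<forall>S m. simplicial_coboundary (link L S) (p - 1 - int (card S)) (part a S m) = (\<lambda>\<rho>. 0))"
  by (auto simp: split_coboundary_def fun_eq_iff)
 then show ?thesis
  using assms part_cochain[OF assms] by (simp add: split_cocycles_def simplicial_cocycles_def)
qed

lemma split_coboundaries_iff:
 fixes a :: "_ => 'k::comm_ring_1"
 assumes a: "a \<in> split_cochains p"
 shows "a \<in> split_coboundaries p \<longleftrightarrow> (\<forall>S m. part a S m \<in> link_coboundaries p S)"
proof
 have deg: "p - 1 - 1 - int (card S) = p - 1 - int (card S) - 1" for S :: "'v set" by simp
 {
  assume "a \<in> split_coboundaries p"
  then obtain b where b: "b \<in> split_cochains (p - 1)" "a = split_coboundary (p - 1) b"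
   unfolding split_coboundaries_def by (elim imageE)
  show "\<forall>S m. part a S m \<in> link_coboundaries p S"
  proof (intro allI)
   fix S m
   have "part a S m = simplicial_coboundary (link L S) (p - 1 - int (card S) - 1) (part b S m)"
    unfolding b(2) split_coboundary_def case_prod_conv deg ..
   then show "part a S m \<in> link_coboundaries p S"
    using part_cochain[OF b(1), of S m, unfolded deg] by (simp add: simplicial_coboundaries_def)
  qed
 next
  assume *: "\<forall>S m. part a S m \<in> link_coboundaries p S"
  have "\<exists>f\<in>carrier (simplicial_cochains TYPE('k) (link L (fst x)) (p - 1 - 1 - int (card (fst x)))).
    simplicial_coboundary (link L (fst x)) (p - 1 - 1 - int (card (fst x))) f = part a (fst x) (snd x) \<and>
    (part a (fst x) (snd x) = (\<lambda>\<rho>. 0) --> f = (\<lambda>\<rho>. 0))" for x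
  proof (cases "part a (fst x) (snd x) = (\<lambda>\<rho>. 0)")
   case True
   then show ?thesis
    by (intro bexI[of _ "\<lambda>\<rho>. 0"]) (auto simp: simplicial_cochains_carrier simplicial_coboundary_def)
  next
   case False
   then show ?thesis using *[rule_format, of "fst x" "snd x"] unfolding simplicial_coboundaries_def deg by fastforce
  qed
  then obtain f where f: "!!x. f x \<in> carrier (simplicial_cochains TYPE('k) (link L (fst x)) (p - 1 - 1 - int (card (fst x))))"
   "!!x. simplicial_coboundary (link L (fst x)) (p - 1 - 1 - int (card (fst x))) (f x) = part a (fst x) (snd x)"
   "!!x. part a (fst x) (snd x) = (\<lambda>\<rho>. 0) --> f x = (\<lambda>\<rho>. 0)"
   by metis
  define b where "b = (\<lambda>(S, m, \<rho>). f (S, m) \<rho>)"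
  have nz: "\<exists>\<rho>'. a (S, m, \<rho>') ~= 0" if "b (S, m, \<rho>) ~= 0" for S m \<rho>
   using f(3)[of "(S, m)"] that by (auto simp: b_def)
  have "finite ((\<lambda>((S, m, \<rho>'), \<rho>). (S, m, \<rho>)) ` ({x. a x ~= 0} \<times> (UNIV :: 'v set set)))"
   using a by (intro finite_imageI finite_cartesian_product) (auto simp: split_cochains_def)
  then have fin: "finite {x. b x ~= 0}"
  proof (rule rev_finite_subset, intro subsetI)
   fix x assume "x \<in> {x. b x ~= 0}"
   then obtain S m \<rho> where x: "x = (S, m, \<rho>)" "b (S, m, \<rho>) ~= 0" by (cases x) auto
   obtain \<rho>' where "a (S, m, \<rho>') ~= 0" using nz[OF x(2)] by blast
   then show "x \<in> (\<lambda>((S, m, \<rho>'), \<rho>). (S, m, \<rho>)) ` ({x. a x ~= 0} \<times> UNIV)"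
    unfolding x(1) by (intro image_eqI[where x="((S, m, \<rho>'), \<rho>)"]) auto
  qed
  have bD: "b \<in> split_cochains (p - 1)"
   unfolding split_cochains_def
  proof (intro CollectI conjI allI impI fin)
   fix S m \<rho> assume ne: "b (S, m, \<rho>) ~= 0"
   obtain \<rho>' where "a (S, m, \<rho>') ~= 0" using nz[OF ne] by blast
   then show "S \<in> L" "m \<in> lattice L" "\<forall>i\<in>S. m $ i = 0" using a by (auto simp: split_cochains_def)
   show "\<rho> \<in> link L S" "int (card S + card \<rho>) = p - 1"
    using f(1)[of "(S, m)"] ne unfolding simplicial_cochains_carrier by (auto simp: b_def)
  qed
  have "a = split_coboundary (p - 1) b"
  proof
   fix x :: "'v set \<times> (real^'v) \<times> 'v set"
   obtain S m \<rho> where x: "x = (S, m, \<rho>)" by (cases x)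
   show "a x = split_coboundary (p - 1) b x"
    using fun_cong[OF f(2)[of "(S, m)"], of \<rho>] by (simp add: x split_coboundary_def b_def)
  qed
  then show "a \<in> split_coboundaries p" using bD by (simp add: split_coboundaries_def)
 }
qed

definition embed_part :: "'v set => ('v set => 'k::comm_ring_1) => 'v set \<times> (real^'v) \<times> 'v set => 'k" where
 "embed_part S f = (\<lambda>(S', m, \<rho>). if S' = S \<and> m = 0 then f \<rho> else 0)"

lemma part_embed_part: "part (embed_part S f) S' m = (if S' = S \<and> m = 0 then f else (\<lambda>\<rho>. 0))"
 by (auto simp: embed_part_def)

lemma embed_part_cochain:
 assumes S: "S \<in> L" and f: "f \<in> carrier (simplicial_cochains TYPE('k::comm_ring_1) (link L S) (p - 1 - int (card S)))"
 shows "embed_part S f \<in> split_cochains p"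
proof -
 have "finite {x. embed_part S f x ~= 0}"
 proof (rule finite_subset)
  show "{x. embed_part S f x ~= 0} \<subseteq> (\<lambda>\<rho>. (S, 0, \<rho>)) ` UNIV" by (auto simp: embed_part_def split: if_splits)
 qed simp
 then show ?thesis
  using S f unfolding simplicial_cochains_carrier
  by (auto simp: split_cochains_def embed_part_def lattice_0 split: if_splits)
qed

lemma embed_part_iff:
 fixes f :: "_ => 'k::comm_ring_1"
 assumes S: "S \<in> L" and f: "f \<in> carrier (simplicial_cochains TYPE('k) (link L S) (p - 1 - int (card S)))"
 shows "embed_part S f \<in> split_cocycles p \<longleftrightarrow> f \<in> link_cocycles p S"
  "embed_part S f \<in> split_coboundaries p \<longleftrightarrow> f \<in> link_coboundaries p S"
proof -
 note 0 = fun_submodule_zero[OF simplicial_cocycles_submodule] fun_submodule_zero[OF simplicial_coboundaries_submodule]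
 show "embed_part S f \<in> split_cocycles p \<longleftrightarrow> f \<in> link_cocycles p S"
  unfolding split_cocycles_iff[OF embed_part_cochain[OF S f]] part_embed_part using 0(1) by auto
 show "embed_part S f \<in> split_coboundaries p \<longleftrightarrow> f \<in> link_coboundaries p S"
  unfolding split_coboundaries_iff[OF embed_part_cochain[OF S f]] part_embed_part using 0(2) by auto
qed

lemma split_cocycles_cochains: "a \<in> split_cocycles p ==> a \<in> split_cochains p"
 by (simp add: split_cocycles_def)

lemma part_zero: "a \<in> split_cochains p ==> S \<notin> L ==> part a S m = (\<lambda>\<rho>. 0)"
 by (auto simp: split_cochains_def)

text \<open>Every part of a split cochain is a cochain of the link, and every cochain of the link is the part at
 \<open>m = 0\<close> of a split cochain.\<close>

theorem split_exact_iff: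
 "(split_cocycles p :: (_ => 'k::comm_ring_1) set) \<subseteq> split_coboundaries p \<longleftrightarrow>
  (\<forall>S\<in>L. (link_cocycles p S :: (_ => 'k) set)
   \<subseteq> link_coboundaries p S)"
proof (intro iffI ballI subsetI)
 fix S and f :: "_ => 'k"
 assume *: "(split_cocycles p :: (_ => 'k) set) \<subseteq> split_coboundaries p" and S: "S \<in> L"
  and f: "f \<in> link_cocycles p S"
 then have f': "f \<in> carrier (simplicial_cochains TYPE('k) (link L S) (p - 1 - int (card S)))"
  by (simp add: simplicial_cocycles_def)
 show "f \<in> link_coboundaries p S"
  using embed_part_iff[OF S f'] f * by blast
next
 fix a :: "_ => 'k"
 assume *: "\<forall>S\<in>L. (link_cocycles p S :: (_ => 'k) set)
   \<subseteq> link_coboundaries p S" and a: "a \<in> split_cocycles p"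
 note aD = split_cocycles_cochains[OF a]
 show "a \<in> split_coboundaries p"
  unfolding split_coboundaries_iff[OF aD]
 proof (intro allI)
  fix S m
  show "part a S m \<in> link_coboundaries p S"
  proof (cases "S \<in> L")
   case True
   then show ?thesis using * a split_cocycles_iff[OF aD] by blast
  next
   case False
   then show ?thesis using part_zero[OF aD] fun_submodule_zero[OF simplicial_coboundaries_submodule] by simp
  qed
 qed
qed

theorem split_torsion_free:
 assumes "torsion_free_mod (split_cocycles p :: (_ => 'k::comm_ring_1) set) (split_coboundaries p)" and S: "S \<in> L"
 shows "torsion_free_mod (link_cocycles p S :: (_ => 'k) set)
   (link_coboundaries p S)"
 unfolding torsion_free_mod_def
proof (intro allI ballI impI)
 fix r :: 'k and f :: "_ => 'k"
 assume f: "f \<in> link_cocycles p S" and r: "r ~= 0"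
  and rf: "(\<lambda>b. r * f b) \<in> link_coboundaries p S"
 have f': "f \<in> carrier (simplicial_cochains TYPE('k) (link L S) (p - 1 - int (card S)))"
  using f by (simp add: simplicial_cocycles_def)
 then have rf': "(\<lambda>b. r * f b) \<in> carrier (simplicial_cochains TYPE('k) (link L S) (p - 1 - int (card S)))"
  by (simp add: simplicial_cochains_def)
 have "embed_part S (\<lambda>b. r * f b) = (\<lambda>x. r * embed_part S f x)" by (auto simp: embed_part_def)
 then show "f \<in> link_coboundaries p S"
  using assms(1) embed_part_iff[OF S f'] embed_part_iff(2)[OF S rf'] f r rf unfolding torsion_free_mod_def by metis
qed

text \<open>The index of a coordinate consists of a summand and the number of a coordinate there. A split cochain
 has finitely many nonzero parts, so it has finitely many nonzero coordinates.\<close>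

theorem split_coordinates:
 assumes N: "euclidean_size (N :: 'k::comm_ring_1 => nat)"
  and tf: "!!S. S \<in> L ==> torsion_free_mod (link_cocycles p S :: (_ => 'k) set)
   (link_coboundaries p S)"
 shows "\<exists>(\<kappa> :: (_ => 'k) => 'v set \<times> (real^'v) \<times> nat => 'k) I. lin_on (split_cocycles p) \<kappa> \<and>
  (\<forall>z\<in>split_cocycles p. finite {i. \<kappa> z i ~= 0} \<and> {i. \<kappa> z i ~= 0} \<subseteq> I) \<and>
  (\<forall>z\<in>split_cocycles p. \<kappa> z = (\<lambda>i. 0) \<longleftrightarrow> z \<in> split_coboundaries p) \<and>
  (\<forall>i\<in>I. \<exists>z\<in>split_cocycles p. \<kappa> z = (\<lambda>j. if j = i then 1 else 0))"
proof -
 let ?Z = "\<lambda>S. link_cocycles p S :: (_ => 'k) set"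
 let ?B = "\<lambda>S. link_coboundaries p S :: (_ => 'k) set"
 have "\<forall>S\<in>L. \<exists>x. lin_on (?Z S) (snd x) \<and> (\<forall>z\<in>?Z S. \<forall>i. snd x z i ~= 0 --> i < (fst x :: nat)) \<and>
   (\<forall>z\<in>?Z S. snd x z = (\<lambda>i. 0) \<longleftrightarrow> z \<in> ?B S) \<and>
   (\<forall>i<fst x. \<exists>z\<in>?Z S. snd x z = (\<lambda>j. if j = i then 1 else 0))"
 proof
  fix S assume S: "S \<in> L"
  have "\<exists>(n::nat) \<kappa>. lin_on (?Z S) \<kappa> \<and> (\<forall>z\<in>?Z S. \<forall>i. \<kappa> z i ~= 0 --> i < n) \<and>
   (\<forall>z\<in>?Z S. \<kappa> z = (\<lambda>i. 0) \<longleftrightarrow> z \<in> ?B S) \<and>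
   (\<forall>i<n. \<exists>z\<in>?Z S. \<kappa> z = (\<lambda>j. if j = i then 1 else 0))"
   by (rule torsion_free_quotient_coordinates[OF N finite_class.finite_UNIV simplicial_cocycles_submodule
      _ simplicial_coboundaries_submodule])
    (use tf[OF S] in \<open>auto simp: torsion_free_mod_def\<close>)
  then show "\<exists>x. lin_on (?Z S) (snd x) \<and> (\<forall>z\<in>?Z S. \<forall>i. snd x z i ~= 0 --> i < (fst x :: nat)) \<and>
   (\<forall>z\<in>?Z S. snd x z = (\<lambda>i. 0) \<longleftrightarrow> z \<in> ?B S) \<and>
   (\<forall>i<fst x. \<exists>z\<in>?Z S. snd x z = (\<lambda>j. if j = i then 1 else 0))"
   by (elim exE) (rule_tac x="(n, \<kappa>)" in exI, simp)
 qed
 from bchoice[OF this] obtain h where h: "\<forall>S\<in>L. lin_on (?Z S) (snd (h S)) \<and>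
   (\<forall>z\<in>?Z S. \<forall>i. snd (h S) z i ~= 0 --> i < (fst (h S) :: nat)) \<and>
   (\<forall>z\<in>?Z S. snd (h S) z = (\<lambda>i. 0) \<longleftrightarrow> z \<in> ?B S) \<and>
   (\<forall>i<fst (h S). \<exists>z\<in>?Z S. snd (h S) z = (\<lambda>j. if j = i then 1 else 0))" by (elim exE)
 define k where "k S = snd (h S)" for S
 define n where "n S = fst (h S)" for S
 have k: "lin_on (?Z S) (k S)" "!!z i. z \<in> ?Z S ==> k S z i ~= 0 ==> i < n S"
  "!!z. z \<in> ?Z S ==> k S z = (\<lambda>i. 0) \<longleftrightarrow> z \<in> ?B S"
  "!!i. i < n S ==> \<exists>z\<in>?Z S. k S z = (\<lambda>j. if j = i then 1 else 0)" if "S \<in> L" for S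
  using h that unfolding k_def n_def by blast+
 have k0: "k S (\<lambda>\<rho>. 0) = (\<lambda>i. 0)" if "S \<in> L" for S
  by (rule lin_on_zero[OF k(1)[OF that] simplicial_cocycles_submodule])
 define \<kappa> where "\<kappa> a = (\<lambda>(S, m, i). if S \<in> L then k S (part a S m) i else 0)" for a
 define I where "I = {(S, m, i). S \<in> L \<and> m \<in> lattice L \<and> (\<forall>j\<in>S. m $ j = 0) \<and> i < n S}"
 have pZ: "part a S m \<in> ?Z S" if "a \<in> split_cocycles p" for a S m
  using split_cocycles_iff[OF split_cocycles_cochains[OF that]] that by blast
 have supp: "(\<exists>\<rho>. a (S, m, \<rho>) ~= 0) \<and> (S, m, i) \<in> I"
  if a: "a \<in> split_cocycles p" and ne: "\<kappa> a (S, m, i) ~= 0" for a S m i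
 proof -
  have S: "S \<in> L" and ki: "k S (part a S m) i ~= 0" using ne by (auto simp: \<kappa>_def split: if_splits)
  then have "part a S m ~= (\<lambda>\<rho>. 0)" using k0[OF S] by auto
  then obtain \<rho> where "a (S, m, \<rho>) ~= 0" by auto
  then show ?thesis
   using S k(2)[OF S pZ[OF a] ki] split_cocycles_cochains[OF a] by (auto simp: I_def split_cochains_def)
 qed
 have 1: "lin_on (split_cocycles p) \<kappa>"
  unfolding lin_on_def
  by (auto simp: \<kappa>_def fun_eq_iff lin_on_add[OF k(1) pZ pZ] lin_on_smult[OF k(1) pZ])
 have 2: "finite {i. \<kappa> a i ~= 0} \<and> {i. \<kappa> a i ~= 0} \<subseteq> I" if a: "a \<in> split_cocycles p" for a
 proof
  have "finite (\<Union>(S, m, \<rho>)\<in>{x. a x ~= 0}. (\<lambda>i. (S, m, i)) ` {..<n S})"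
   using split_cocycles_cochains[OF a] by (intro finite_UN_I) (auto simp: split_cochains_def)
  then show "finite {i. \<kappa> a i ~= 0}"
  proof (rule rev_finite_subset, intro subsetI)
   fix x assume "x \<in> {i. \<kappa> a i ~= 0}"
   then obtain S m i where x: "x = (S, m, i)" "\<kappa> a (S, m, i) ~= 0" by (cases x) auto
   obtain \<rho> where "a (S, m, \<rho>) ~= 0" "i < n S" using supp[OF a x(2)] by (auto simp: I_def)
   then show "x \<in> (\<Union>(S, m, \<rho>)\<in>{x. a x ~= 0}. (\<lambda>i. (S, m, i)) ` {..<n S})"
    unfolding x(1) by (intro UN_I[of "(S, m, \<rho>)"]) auto
  qed
  show "{i. \<kappa> a i ~= 0} \<subseteq> I"
  proof
   fix x assume "x \<in> {i. \<kappa> a i ~= 0}"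
   then show "x \<in> I" using supp[OF a] by (cases x) auto
  qed
 qed
 have 3: "\<kappa> a = (\<lambda>i. 0) \<longleftrightarrow> a \<in> split_coboundaries p" if a: "a \<in> split_cocycles p" for a
 proof -
  have "\<kappa> a = (\<lambda>i. 0) \<longleftrightarrow> (\<forall>S\<in>L. \<forall>m. k S (part a S m) = (\<lambda>i. 0))"
   by (auto simp: \<kappa>_def fun_eq_iff)
  also have "\<dots> \<longleftrightarrow> (\<forall>S\<in>L. \<forall>m. part a S m \<in> ?B S)"
   using k(3)[OF _ pZ[OF a]] by simp
  also have "\<dots> \<longleftrightarrow> (\<forall>S m. part a S m \<in> ?B S)"
   using part_zero[OF split_cocycles_cochains[OF a]] fun_submodule_zero[OF simplicial_coboundaries_submodule] by metis
  finally show ?thesis using split_coboundaries_iff[OF split_cocycles_cochains[OF a]] by simp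
 qed
 have 4: "\<exists>z\<in>split_cocycles p. \<kappa> z = (\<lambda>j. if j = x then 1 else 0)" if xI: "x \<in> I" for x
 proof -
  obtain S m i where x: "x = (S, m, i)" "S \<in> L" "m \<in> lattice L" "\<forall>j\<in>S. m $ j = 0" "i < n S"
   using xI by (auto simp: I_def)
  obtain f where f: "f \<in> ?Z S" "k S f = (\<lambda>j. if j = i then 1 else 0)" using k(4)[OF x(2,5)] by blast
  define a where "a = (\<lambda>(S', m', \<rho>). if S' = S \<and> m' = m then f \<rho> else 0)"
  have part_a: "part a S' m' = (if S' = S \<and> m' = m then f else (\<lambda>\<rho>. 0))" for S' m' by (auto simp: a_def)
  have "finite {x. a x ~= 0}"
  proof (rule finite_subset)
   show "{x. a x ~= 0} \<subseteq> (\<lambda>\<rho>. (S, m, \<rho>)) ` UNIV" by (auto simp: a_def split: if_splits)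
  qed simp
  moreover have "f \<in> carrier (simplicial_cochains TYPE('k) (link L S) (p - 1 - int (card S)))"
   using f(1) by (simp add: simplicial_cocycles_def)
  ultimately have aD: "a \<in> split_cochains p"
   using x unfolding simplicial_cochains_carrier by (auto simp: split_cochains_def a_def split: if_splits)
  have "a \<in> split_cocycles p"
   unfolding split_cocycles_iff[OF aD] part_a
   using f(1) fun_submodule_zero[OF simplicial_cocycles_submodule] by auto
  moreover have "\<kappa> a = (\<lambda>j. if j = x then 1 else 0)"
  proof
   fix y :: "'v set \<times> (real^'v) \<times> nat"
   obtain S' m' i' where y: "y = (S', m', i')" by (cases y)
   show "\<kappa> a y = (if y = x then 1 else 0)"
    using f(2) k0[of S'] x by (auto simp: y \<kappa>_def part_a)
  qed
  ultimately show ?thesis by blast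
 qed
 show ?thesis using 1 2 3 4 by blast
qed

end

section \<open>Singular chains of the universal abelian cover\<close>

text \<open>A finite cube complex in \<open>\<real>\<^sup>n\<close> whose quotient by the lattice is the toric complex.\<close>

definition abelian_cover :: "'v::finite set set => (real^'v) set" where
 "abelian_cover L = {x. {i. x $ i \<notin> \<int>} \<in> L \<and> (\<forall>i. i \<notin> \<Union>L --> x $ i = 0)}"

lemma abelian_cover_translate: "n \<in> lattice L ==> x \<in> abelian_cover L ==> n + x \<in> abelian_cover L"
proof -
 assume n: "n \<in> lattice L" and x: "x \<in> abelian_cover L"
 have "n $ i + x $ i \<in> \<int> \<longleftrightarrow> x $ i \<in> \<int>" for i
  using n by (metis (mono_tags, lifting) Ints_add Ints_diff add_diff_cancel_left' lattice_def mem_Collect_eq)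
 then show ?thesis using n x by (simp add: abelian_cover_def lattice_def)
qed

definition vertex :: "nat => nat => real" where
 "vertex j = (\<lambda>i. if i = j then 1 else 0)"

lemma vertex_standard_simplex: "j \<le> p ==> vertex j \<in> standard_simplex p"
 by (simp add: vertex_def)

lemma simplical_face_vertex: "simplical_face k (vertex j) = vertex (if j < k then j else Suc j)"
 by (auto simp: simplical_face_def vertex_def fun_eq_iff)

definition round_vec :: "real^'v => real^'v" where
 "round_vec x = (\<chi> i. of_int \<lfloor>x $ i + 1/2\<rfloor>)"

lemma round_vec_near: "\<bar>x $ i - round_vec x $ i\<bar> \<le> 1/2"
 unfolding round_vec_def vec_lambda_beta using floor_correct[of "x $ i + 1/2"] by linarith

lemma round_vec_int: "round_vec x $ i \<in> \<int>"
 by (simp add: round_vec_def)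

lemma round_vec_of_int: "x $ i \<in> \<int> ==> \<bar>y $ i - x $ i\<bar> < 1/2 ==> round_vec y $ i = x $ i"
proof -
 assume "x $ i \<in> \<int>" and y: "\<bar>y $ i - x $ i\<bar> < 1/2"
 then obtain z where z: "x $ i = of_int z" by (auto elim: Ints_cases)
 have "\<lfloor>y $ i + 1/2\<rfloor> = z" using y unfolding z by (intro floor_unique) linarith+
 then show ?thesis by (simp add: round_vec_def z)
qed

lemma round_vec_lattice: "x \<in> abelian_cover L ==> round_vec x \<in> lattice L"
 using round_vec_of_int[of x _ x] by (auto simp: lattice_def round_vec_int abelian_cover_def)

lemma round_vec_translate: "n \<in> lattice L ==> round_vec (n + x) = n + round_vec x"
proof -
 assume n: "n \<in> lattice L"
 have "of_int \<lfloor>n $ i + x $ i + 1/2\<rfloor> = n $ i + of_int \<lfloor>x $ i + 1/2\<rfloor>" for i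
 proof -
  have "n $ i \<in> \<int>" using n by (simp add: lattice_def)
  then obtain z where "n $ i = of_int z" by (rule Ints_cases)
  then show ?thesis by (simp add: add.assoc)
 qed
 then show ?thesis by (simp add: round_vec_def vec_eq_iff)
qed

text \<open>Simplices of \<open>X\<close> with a property that is inherited by faces and translates; it will be either
 trivial or smallness.\<close>

definition simplices :: "(real^'v::finite) set => (nat => ((nat => real) => real^'v) => bool) => nat =>
  ((nat => real) => real^'v) set" where
 "simplices X P p = {s. singular_simplex p (top_of_set X) s \<and> P p s}"

definition small :: "nat => ((nat => real) => real^'v) => bool" where
 "small p s \<longleftrightarrow> (\<forall>x\<in>standard_simplex p. \<forall>y\<in>standard_simplex p. \<forall>i. \<bar>s x $ i - s y $ i\<bar> < 1/2)"

abbreviation simplex_translate :: "nat => real^'v => ((nat => real) => real^'v) => (nat => real) => real^'v" where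
 "simplex_translate p n \<equiv> simplex_map p ((+) n)"

abbreviation simplex_boundary :: "nat => ((nat => real) => 'a) => 'a chain" where
 "simplex_boundary p s \<equiv> chain_boundary p (frag_of s)"

lemma frag_extend_simplex_boundary: "frag_extend (simplex_boundary p) c = chain_boundary p c"
proof -
 have "keys c \<subseteq> UNIV" by simp
 then show ?thesis
  by (induction c rule: frag_induction) (auto simp: frag_extend_diff chain_boundary_diff)
qed

lemma keys_simplex_boundary:
 "keys (simplex_boundary (Suc p) s) \<subseteq> (\<lambda>k. singular_face (Suc p) k s) ` {..Suc p}"
 unfolding chain_boundary_of
 by (auto intro!: subset_trans[OF keys_sum] simp del: sum.atMost_Suc split: if_splits)

lemma singular_simplex_cont: "singular_simplex p (top_of_set X) s \<longleftrightarrow>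
  continuous_on (standard_simplex p) s \<and> s ` standard_simplex p \<subseteq> X \<and> s \<in> extensional (standard_simplex p)"
 unfolding singular_simplex_def
 by (auto simp: euclidean_product_topology continuous_map_in_subtopology)

lemma singular_face_apply:
 "x \<in> standard_simplex p ==> singular_face (Suc p) k s x = s (simplical_face k x)"
 by (simp add: singular_face_def)

lemma simplical_face_mem: "k \<le> Suc p ==> x \<in> standard_simplex p ==> simplical_face k x \<in> standard_simplex (Suc p)"
 by (simp add: simplical_face_in_standard_simplex)

lemma small_face: "small (Suc p) s ==> k \<le> Suc p ==> small p (singular_face (Suc p) k s)"
 by (simp add: small_def singular_face_apply simplical_face_mem)

lemma simplex_translate_apply: "x \<in> standard_simplex p ==> simplex_translate p n s x = n + s x"
 by (simp add: simplex_map_def)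

lemma small_translate: "small p s ==> small p (simplex_translate p n s)"
 by (simp add: small_def simplex_translate_apply)

lemma singular_lattice_complex:
 assumes face: "!!p s k. P (Suc p) s ==> k \<le> Suc p ==> P p (singular_face (Suc p) k s)"
  and transl: "!!p s n. P p s ==> P p (simplex_translate p n s)"
 shows "lattice_complex (lattice L) (simplices (abelian_cover L) P) simplex_boundary simplex_translate
   (\<lambda>p s. round_vec (s (vertex 0)))"
proof
 let ?X = "abelian_cover L"
 have cm: "continuous_map (top_of_set ?X) (top_of_set ?X) ((+) n)" if "n \<in> lattice L" for n
  using abelian_cover_translate[OF that] by (auto intro!: continuous_intros)
 show "simplex_translate p n s \<in> simplices ?X P p" if "n \<in> lattice L" "s \<in> simplices ?X P p" for n s p
  using that transl singular_simplex_simplex_map[OF _ cm] by (auto simp: simplices_def)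
 show "simplex_translate p 0 s = s" if "s \<in> simplices ?X P p" for s p
  using that simplex_map_id_gen[of p "top_of_set ?X" s "(+) 0"] by (simp add: simplices_def)
 show "simplex_translate p (m + n) s = simplex_translate p m (simplex_translate p n s)" for m n s p
  by (auto simp: simplex_map_def add.assoc fun_eq_iff)
 show "round_vec (s (vertex 0)) \<in> lattice L" if "s \<in> simplices ?X P p" for s p
  using that vertex_standard_simplex[of 0 p]
  by (intro round_vec_lattice) (auto simp: simplices_def singular_simplex_cont)
 show "round_vec (simplex_translate p n s (vertex 0)) = n + round_vec (s (vertex 0))" if "n \<in> lattice L" for n s p
  using round_vec_translate[OF that] vertex_standard_simplex[of 0 p] by (simp add: simplex_translate_apply)
 show "simplex_boundary 0 s = 0" for s :: "(nat => real) => real^'a"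
  by (simp add: chain_boundary_def)
 fix s :: "(nat => real) => real^'a"
 show "keys (simplex_boundary (Suc p) s) \<subseteq> simplices ?X P p" if "s \<in> simplices ?X P (Suc p)" for p
  using that keys_simplex_boundary[of p s] face singular_simplex_singular_face[of "Suc p" "top_of_set ?X" s]
  by (fastforce simp: simplices_def)
 show "simplex_boundary (Suc p) (simplex_translate (Suc p) n s) =
   frag_extend (frag_of \<circ> simplex_translate p n) (simplex_boundary (Suc p) s)" if "s \<in> simplices ?X P (Suc p)" for p n
  using chain_boundary_chain_map[of "Suc p" "top_of_set ?X" "frag_of s" "(+) n"] that
  by (simp add: simplices_def singular_chain_of chain_map_def)
 show "frag_extend (simplex_boundary (Suc p)) (simplex_boundary (Suc (Suc p)) s) = 0"
  if "s \<in> simplices ?X P (Suc (Suc p))" for p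
  unfolding frag_extend_simplex_boundary
  using that chain_boundary_boundary_alt[of "Suc p" "top_of_set ?X" "frag_of s"]
  by (simp add: simplices_def singular_chain_of)
 show "augmentation (simplex_boundary (Suc 0) s) = 0"
  by (simp add: chain_boundary_of pairing_add pairing_cmul pairing_diff)
qed (auto intro: lattice_plus lattice_uminus lattice_0)

subsection \<open>Acyclicity of contractible spaces\<close>

text \<open>A contraction makes a cycle homologous to its image in a point.\<close>

lemma contractible_acyclic:
 assumes S: "contractible_space (top_of_set S)" and ne: "S ~= {}"
  and z: "singular_chain q (top_of_set S) z"
  and cyc: "if q = 0 then augmentation z = 0 else chain_boundary q z = 0"
 shows "\<exists>w. singular_chain (Suc q) (top_of_set S) w \<and> chain_boundary (Suc q) w = z"
proof -
 let ?S = "top_of_set S"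
 obtain a where a: "a \<in> S" and hom: "homotopic_with (\<lambda>x. True) ?S ?S id (\<lambda>x. a)"
 proof -
  obtain a where a: "homotopic_with (\<lambda>x. True) ?S ?S id (\<lambda>x. a)" using S unfolding contractible_space_def by blast
  have "continuous_map ?S ?S (\<lambda>x. a)" using homotopic_with_imp_continuous_maps[OF a] by blast
  then have "(\<lambda>x. a) \<in> topspace ?S \<rightarrow> topspace ?S" unfolding continuous_map_def by (rule conjunct1)
  then have "a \<in> S" using ne by auto
  then show thesis by (rule that[OF _ a])
 qed
 have cycle: "singular_relcycle q ?S {} z"
  using z cyc by (auto simp: singular_cycle chain_boundary_def split: if_splits)
 have "homologous_rel q ?S {} (chain_map q id z) (chain_map q (\<lambda>x. a) z)"
  by (rule homotopic_imp_homologous_rel_chain_maps[OF _ cycle]) (use hom in simp)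
 moreover have "chain_map q id z = z" by (rule chain_map_ident[OF z])
 moreover have "homologous_rel q ?S {} (chain_map q (\<lambda>x. a) z) 0"
 proof (cases "q = 0")
  case True
  have "singular_chain 0 ?S z ==> chain_map 0 (\<lambda>x. a) z = frag_cmul (augmentation z) (frag_of (restrict (\<lambda>x. a) (standard_simplex 0)))"
   unfolding singular_chain_def
   by (induction z rule: frag_induction)
    (auto simp: chain_map_diff pairing_diff frag_cmul_diff_distrib simplex_map_def o_def restrict_def)
  then show ?thesis using z cyc True by simp
 next
  case False
  have cmap: "continuous_map ?S (top_of_set {a}) (\<lambda>x. a)" by auto
  have 1: "singular_chain q (top_of_set {a}) (chain_map q (\<lambda>x. a) z)"
   by (rule singular_chain_chain_map[OF z cmap])
  have "chain_boundary q (chain_map q (\<lambda>x. a) z) = 0"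
   using chain_boundary_chain_map[OF z, of "\<lambda>x. a"] cyc False by simp
  then have "singular_relcycle q (top_of_set {a}) {} (chain_map q (\<lambda>x. a) z)"
   using 1 by (simp add: singular_cycle)
  then have "singular_relboundary q (top_of_set {a}) {} (chain_map q (\<lambda>x. a) z)"
   using singular_boundary_eq_cycle_singleton[of "top_of_set {a}" a q] False by simp
  then obtain d where "singular_chain (Suc q) (top_of_set {a}) d" "chain_boundary (Suc q) d = chain_map q (\<lambda>x. a) z"
   by (auto simp: singular_boundary)
  moreover have "singular_chain (Suc q) ?S d"
   using \<open>singular_chain (Suc q) (top_of_set {a}) d\<close> a by (metis empty_subsetI insert_subset singular_chain_mono)
  ultimately show ?thesis by (auto simp: homologous_rel_def singular_boundary)
 qed
 ultimately have "homologous_rel q ?S {} z 0" using homologous_rel_trans by metis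
 then show ?thesis by (simp add: homologous_rel_def singular_boundary)
qed

lemma straight_homotopy:
 fixes f g :: "real^'v => real^'v::finite"
 assumes f: "continuous_on S f" and g: "continuous_on S g"
  and seg: "!!x t. x \<in> S ==> 0 \<le> t ==> t \<le> 1 ==> (1 - t) *\<^sub>R f x + t *\<^sub>R g x \<in> S"
 shows "homotopic_with (\<lambda>x. True) (top_of_set S) (top_of_set S) f g"
proof -
 have "homotopic_with_canon (\<lambda>x. True) S S f g"
 proof (rule homotopic_with_linear[OF f g])
  show "closed_segment (f x) (g x) \<subseteq> S" if "x \<in> S" for x
   using seg[OF that] by (auto simp: in_segment)
 qed
 then show ?thesis .
qed

lemma convex_contractible_space:
 fixes S :: "(real^'v::finite) set"
 assumes S: "convex S" "S ~= {}"
 shows "contractible_space (top_of_set S)"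
proof -
 obtain a where "a \<in> S" using S by auto
 then have "homotopic_with (\<lambda>x. True) (top_of_set S) (top_of_set S) id (\<lambda>x. a)"
  using S by (intro straight_homotopy) (auto simp: convex_def)
 then show ?thesis unfolding contractible_space_def by blast
qed

section \<open>Small simplices\<close>

lemma chain_boundary_frag_extend:
 "chain_boundary q (frag_extend f z) = frag_extend (\<lambda>s. chain_boundary q (f s)) z"
proof -
 have "keys z \<subseteq> UNIV" by simp
 then show ?thesis
  by (induction z rule: frag_induction) (auto simp: frag_extend_diff chain_boundary_diff)
qed

lemma singular_subdivision_power_chain:
 "singular_chain p X c ==> singular_chain p X ((singular_subdivision p ^^ n) c)"
 by (induction n) (auto intro: singular_chain_singular_subdivision)

lemma iterated_subdivision_small:
 assumes c: "singular_chain q (top_of_set I) (c :: (real^'v::finite) chain)"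
 shows "\<exists>n. \<forall>f\<in>keys ((singular_subdivision q ^^ n) c). small q f"
proof -
 define U where "U y = I \<inter> {x. \<forall>i. \<bar>x $ i - y $ i\<bar> < 1/4}" for y :: "real^'v"
 have "open {x :: real^'v. \<forall>i. \<bar>x $ i - y $ i\<bar> < 1/4}" for y :: "real^'v"
 proof -
  have "{x :: real^'v. \<forall>i. \<bar>x $ i - y $ i\<bar> < 1/4} = (\<Inter>i. {x. \<bar>x $ i - y $ i\<bar> < 1/4})" by auto
  then show ?thesis by (auto intro!: open_INT open_Collect_less continuous_intros)
 qed
 then have op: "openin (top_of_set I) (U y)" for y unfolding U_def by (rule openin_open_Int)
 have cov: "topspace (top_of_set I) \<subseteq> \<Union>(range U)"
 proof
  fix x assume "x \<in> topspace (top_of_set I)"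
  then have "x \<in> U x" by (simp add: U_def)
  then show "x \<in> \<Union>(range U)" by blast
 qed
 obtain n where n: "!!m f. \<lbrakk>n \<le> m; f \<in> keys ((singular_subdivision q ^^ m) c)\<rbrakk>
   \<Longrightarrow> \<exists>V\<in>range U. f \<in> standard_simplex q \<rightarrow> V"
  using sufficient_iterated_singular_subdivision_exists[OF _ cov c] op by blast
 have "small q f" if f: "f \<in> keys ((singular_subdivision q ^^ n) c)" for f
 proof -
  obtain y where y: "f \<in> standard_simplex q \<rightarrow> U y" using n[OF le_refl f] by (elim bexE rangeE) blast
  show ?thesis
   unfolding small_def
  proof (intro ballI allI)
   fix a b i assume "a \<in> standard_simplex q" "b \<in> standard_simplex q"
   then have "\<bar>f a $ i - y $ i\<bar> < 1/4" "\<bar>f b $ i - y $ i\<bar> < 1/4" using y by (auto simp: U_def Pi_iff)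
   then show "\<bar>f a $ i - f b $ i\<bar> < 1/2" by linarith
  qed
 qed
 then show ?thesis by blast
qed

lemma small_in_image:
 assumes s: "small p s" and f: "singular_simplex q (top_of_set (s ` standard_simplex p)) f"
 shows "small q f"
 unfolding small_def
proof (intro ballI allI)
 fix x y i assume xy: "x \<in> standard_simplex q" "y \<in> standard_simplex q"
 have "f ` standard_simplex q \<subseteq> s ` standard_simplex p" using f by (simp add: singular_simplex_cont)
 then have "f x \<in> s ` standard_simplex p" "f y \<in> s ` standard_simplex p" using xy by blast+
 then obtain a b where "a \<in> standard_simplex p" "f x = s a" "b \<in> standard_simplex p" "f y = s b"
  by (elim imageE)
 then show "\<bar>f x $ i - f y $ i\<bar> < 1/2" using s by (simp add: small_def)
qed

lemma singular_chain_keys: "singular_chain p X c \<longleftrightarrow> (\<forall>s\<in>keys c. singular_simplex p X s)"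
 by (auto simp: singular_chain_def)

text \<open>Subdivide the chain and subtract the subdivision homotopy of its boundary. This restores the boundary,
 and it consists of small simplices because the boundary does.\<close>

lemma chain_homologous_small:
 fixes c :: "(real^'v::finite) chain"
 assumes c: "singular_chain (Suc p) (top_of_set I) c"
  and bd: "keys (chain_boundary (Suc p) c) \<subseteq> Collect (small p)"
 shows "\<exists>x y. singular_chain (Suc p) (top_of_set I) x \<and> keys x \<subseteq> Collect (small (Suc p)) \<and>
   singular_chain (Suc (Suc p)) (top_of_set I) y \<and> chain_boundary (Suc (Suc p)) y = x - c"
proof -
 obtain n where n: "\<forall>f\<in>keys ((singular_subdivision (Suc p) ^^ n) c). small (Suc p) f"
  using iterated_subdivision_small[OF c] by blast
 obtain h where h0: "!!p. h p 0 = (0 :: (real^'v) chain)"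
  and hd: "!!p c1 c2. h p (c1 - c2) = h p c1 - h p c2"
  and hc: "!!p X c. singular_chain p X c ==> singular_chain (Suc p) X (h p c)"
  and hh: "!!p X c. singular_chain p X c ==> chain_boundary (Suc p) (h p c) + h (p - Suc 0) (chain_boundary p c)
    = (singular_subdivision p ^^ n) c - c"
  by (blast intro: chain_homotopic_iterated_singular_subdivision[of n])
 let ?z = "chain_boundary (Suc p) c"
 have z: "singular_chain p (top_of_set I) ?z" using singular_chain_boundary_alt[OF c] .
 have hz': "keys (h p z) \<subseteq> Collect (small (Suc p))"
  if "keys z \<subseteq> {s. singular_simplex p (top_of_set I) s \<and> small p s}" for z
  using that
 proof (induction z rule: frag_induction)
  case zero
  then show ?case by (simp add: h0)
 next
  case (one s)
  have "singular_simplex p (top_of_set (s ` standard_simplex p)) s"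
   using one by (simp add: singular_simplex_cont)
  then have "singular_chain (Suc p) (top_of_set (s ` standard_simplex p)) (h p (frag_of s))"
   by (intro hc) (simp add: singular_chain_of)
  then show ?case using one small_in_image[of p s "Suc p"] by (auto simp: singular_chain_keys)
 next
  case (diff a b)
  then show ?case by (simp add: hd keys_diff_subset)
 qed
 have hz: "keys (h p ?z) \<subseteq> Collect (small (Suc p))"
  by (rule hz') (use z bd in \<open>auto simp: singular_chain_keys\<close>)
 let ?x = "(singular_subdivision (Suc p) ^^ n) c - h p ?z" and ?y = "h (Suc p) c"
 have "singular_chain (Suc p) (top_of_set I) ?x"
  by (intro singular_chain_diff singular_subdivision_power_chain c hc z)
 moreover have "keys ?x \<subseteq> Collect (small (Suc p))"
  by (rule keys_diff_subset) (use n hz in auto)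
 moreover have "chain_boundary (Suc (Suc p)) ?y = ?x - c" using hh[OF c] by (simp add: algebra_simps)
 ultimately show ?thesis using hc[OF c] by blast
qed

lemma singular_chain_frag_extend:
 "(!!s. s \<in> keys c ==> singular_chain p X (f s)) ==> singular_chain p X (frag_extend f c)"
 by (rule singular_chain_extend)

lemma singular_face_image:
 assumes "k \<le> Suc p"
 shows "singular_face (Suc p) k s ` standard_simplex p \<subseteq> s ` standard_simplex (Suc p)"
 using simplical_face_mem[OF assms] by (auto simp: singular_face_apply)

context finite_complex
begin

sublocale S: lattice_complex "lattice L" "simplices (abelian_cover L) (\<lambda>p s. True)" simplex_boundary
  simplex_translate "\<lambda>p s. round_vec (s (vertex 0))"
 by (rule singular_lattice_complex) auto

sublocale M: lattice_complex "lattice L" "simplices (abelian_cover L) small" simplex_boundary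
  simplex_translate "\<lambda>p s. round_vec (s (vertex 0))"
 by (rule singular_lattice_complex) (auto intro: small_face small_translate)

sublocale SM: lattice_complex_pair "lattice L" "simplices (abelian_cover L) (\<lambda>p s. True)" simplex_boundary
  simplex_translate "\<lambda>p s. round_vec (s (vertex 0))" "simplices (abelian_cover L) small" simplex_boundary
  simplex_translate "\<lambda>p s. round_vec (s (vertex 0))" ..

sublocale SS: lattice_complex_pair "lattice L" "simplices (abelian_cover L) (\<lambda>p s. True)" simplex_boundary
  simplex_translate "\<lambda>p s. round_vec (s (vertex 0))" "simplices (abelian_cover L) (\<lambda>p s. True)" simplex_boundary
  simplex_translate "\<lambda>p s. round_vec (s (vertex 0))" ..

abbreviation "Sing \<equiv> simplices (abelian_cover L) (\<lambda>p s. True)"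
abbreviation "Small \<equiv> simplices (abelian_cover L) small"

definition subdivided :: "nat => (((nat => real) => real^'v) => (real^'v) chain) \<times> (((nat => real) => real^'v) => (real^'v) chain) => bool" where
 "subdivided p rd \<longleftrightarrow> (\<forall>s\<in>Sing p. singular_chain p (top_of_set (s ` standard_simplex p)) (fst rd s) \<and>
   keys (fst rd s) \<subseteq> Collect (small p) \<and>
   singular_chain (Suc p) (top_of_set (s ` standard_simplex p)) (snd rd s) \<and>
   (\<forall>n\<in>lattice L. fst rd (simplex_translate p n s) = S.ext_tr p n (fst rd s) \<and>
     snd rd (simplex_translate p n s) = S.ext_tr (Suc p) n (snd rd s))) \<and>
  (\<forall>z. keys z \<subseteq> Sing p \<and> (p = 0 \<or> chain_boundary p z = 0) -->
    chain_boundary (Suc p) (frag_extend (snd rd) z) = frag_extend (fst rd) z - z) \<and>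
  (p = 0 --> (\<forall>s\<in>Sing 0. fst rd s = frag_of s \<and> snd rd s = 0))"

lemma ext_tr_chain_map: "S.ext_tr p n c = chain_map p ((+) n) c"
 by (simp add: chain_map_def)

lemma translate_singular_chain:
 assumes "singular_chain q (top_of_set (s ` standard_simplex p)) c"
 shows "singular_chain q (top_of_set (simplex_translate p n s ` standard_simplex p)) (chain_map q ((+) n) c)"
proof (rule singular_chain_chain_map[OF assms])
 show "continuous_map (top_of_set (s ` standard_simplex p)) (top_of_set (simplex_translate p n s ` standard_simplex p)) ((+) n)"
  by (auto simp: simplex_translate_apply intro!: continuous_intros)
qed

lemma singular_chain_cover:
 assumes "s \<in> Sing p" "singular_chain q (top_of_set (s ` standard_simplex p)) c"
 shows "keys c \<subseteq> Sing q"
 using assms by (fastforce simp: simplices_def singular_chain_keys singular_simplex_cont)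

lemma subdivided_step:
 assumes rd: "subdivided p rd"
 shows "\<exists>rd'. subdivided (Suc p) rd' \<and> (\<forall>s\<in>Sing (Suc p).
   chain_boundary (Suc (Suc p)) (snd rd' s) = fst rd' s - frag_of s - frag_extend (snd rd) (simplex_boundary (Suc p) s) \<and>
   chain_boundary (Suc p) (fst rd' s) = frag_extend (fst rd) (simplex_boundary (Suc p) s))"
proof -
 obtain r d where rd_eq: "rd = (r, d)" by fastforce
 have r: "singular_chain p (top_of_set (s ` standard_simplex p)) (r s)" "keys (r s) \<subseteq> Collect (small p)"
  "singular_chain (Suc p) (top_of_set (s ` standard_simplex p)) (d s)" if "s \<in> Sing p" for s
  using rd that by (auto simp: subdivided_def rd_eq)
 have rtr: "r (simplex_translate p n s) = chain_map p ((+) n) (r s)" "d (simplex_translate p n s) = chain_map (Suc p) ((+) n) (d s)"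
  if "s \<in> Sing p" "n \<in> lattice L" for s n
  using rd that by (auto simp: subdivided_def rd_eq ext_tr_chain_map)
 have dz: "chain_boundary (Suc p) (frag_extend d z) = frag_extend r z - z"
  if "keys z \<subseteq> Sing p" "p = 0 \<or> chain_boundary p z = 0" for z
  using rd that by (auto simp: subdivided_def rd_eq)
 let ?w = "\<lambda>s. frag_extend d (simplex_boundary (Suc p) s)"
 have face: "s' \<in> Sing p" "s' ` standard_simplex p \<subseteq> s ` standard_simplex (Suc p)"
  if "s \<in> Sing (Suc p)" "s' \<in> keys (simplex_boundary (Suc p) s)" for s s'
 proof -
  show "s' \<in> Sing p" by (rule subsetD[OF S.bd_keys[OF that(1)] that(2)])
  have "s' \<in> (\<lambda>k. singular_face (Suc p) k s) ` {..Suc p}" by (rule subsetD[OF keys_simplex_boundary that(2)])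
  then show "s' ` standard_simplex p \<subseteq> s ` standard_simplex (Suc p)"
   by (elim imageE) (simp add: singular_face_image)
 qed
 have w: "singular_chain (Suc p) (top_of_set (s ` standard_simplex (Suc p))) (?w s)" if s: "s \<in> Sing (Suc p)" for s
  by (rule singular_chain_frag_extend) (rule singular_chain_mono[OF r(3)[OF face(1)[OF s]] face(2)[OF s]])
 have s_img: "singular_chain (Suc p) (top_of_set (s ` standard_simplex (Suc p))) (frag_of s)" if "s \<in> Sing (Suc p)" for s
  using that by (simp add: simplices_def singular_chain_of singular_simplex_cont)
 have bb: "p = 0 \<or> chain_boundary p (simplex_boundary (Suc p) s) = 0" if s: "s \<in> Sing (Suc p)" for s
 proof (cases p)
  case (Suc q)
  then show ?thesis using S.bd_bd[of s q] s by (simp add: frag_extend_simplex_boundary)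
 qed simp
 have bc: "chain_boundary (Suc p) (frag_of s + ?w s) = frag_extend r (simplex_boundary (Suc p) s)" if "s \<in> Sing (Suc p)" for s
  using dz[OF S.bd_keys[OF that] bb[OF that]] by (simp add: chain_boundary_add)
 have small_r: "keys (frag_extend r (simplex_boundary (Suc p) s)) \<subseteq> Collect (small p)" if "s \<in> Sing (Suc p)" for s
  by (rule keys_frag_extend_subset) (rule r(2)[OF face(1)[OF that]])
 define P where "P s xy \<longleftrightarrow> singular_chain (Suc p) (top_of_set (s ` standard_simplex (Suc p))) (fst xy) \<and>
   keys (fst xy) \<subseteq> Collect (small (Suc p)) \<and>
   singular_chain (Suc (Suc p)) (top_of_set (s ` standard_simplex (Suc p))) (snd xy) \<and>
   chain_boundary (Suc (Suc p)) (snd xy) = fst xy - (frag_of s + ?w s)" for s xy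
 define act where "act n xy = (chain_map (Suc p) ((+) n) (fst xy), chain_map (Suc (Suc p)) ((+) n) (snd xy))"
  for n :: "real^'v" and xy
 obtain Y where Y: "!!s. s \<in> Sing (Suc p) ==> P s (Y s)"
  "!!s n. s \<in> Sing (Suc p) ==> n \<in> lattice L ==> Y (simplex_translate (Suc p) n s) = act n (Y s)"
 proof (rule S.equivariant_choice[of "Suc p" P act])
  fix s assume s: "s \<in> Sing (Suc p)"
  have "\<exists>x y. singular_chain (Suc p) (top_of_set (s ` standard_simplex (Suc p))) x \<and> keys x \<subseteq> Collect (small (Suc p)) \<and>
    singular_chain (Suc (Suc p)) (top_of_set (s ` standard_simplex (Suc p))) y \<and>
    chain_boundary (Suc (Suc p)) y = x - (frag_of s + ?w s)"
   by (rule chain_homologous_small) (use s s_img w bc small_r in \<open>auto intro: singular_chain_add\<close>)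
  then obtain x y where "P s (x, y)" unfolding P_def fst_conv snd_conv by blast
  then show "\<exists>xy. P s xy" by blast
 next
  fix s xy n assume s: "s \<in> Sing (Suc p)" and n: "n \<in> lattice L" and P: "P s xy"
  let ?T = "chain_map (Suc p) ((+) n)"
  have "keys (fst xy) \<subseteq> Small (Suc p)"
   using P singular_chain_cover[OF s, of "Suc p" "fst xy"] by (auto simp: P_def simplices_def)
  then have small: "keys (?T (fst xy)) \<subseteq> Collect (small (Suc p))"
   using M.ext_tr_keys[OF n, of "fst xy" "Suc p"] by (auto simp: chain_map_def simplices_def)
  have "?w (simplex_translate (Suc p) n s) = ?T (?w s)"
  proof -
   have "?w (simplex_translate (Suc p) n s) = frag_extend d (S.ext_tr p n (simplex_boundary (Suc p) s))"
    by (simp add: S.bd_tr[OF n s])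
   also have "\<dots> = frag_extend (\<lambda>s. ?T (d s)) (simplex_boundary (Suc p) s)"
    unfolding frag_extend_frag_extend
    by (rule frag_extend_cong) (use rtr(2) face(1)[OF s] n in auto)
   also have "\<dots> = ?T (?w s)" by (simp add: chain_map_def frag_extend_frag_extend)
   finally show ?thesis .
  qed
  then have "chain_boundary (Suc (Suc p)) (chain_map (Suc (Suc p)) ((+) n) (snd xy)) =
    ?T (fst xy) - (frag_of (simplex_translate (Suc p) n s) + ?w (simplex_translate (Suc p) n s))"
   using chain_boundary_chain_map[of "Suc (Suc p)" "top_of_set (s ` standard_simplex (Suc p))" "snd xy" "(+) n"] P
   by (simp add: P_def chain_map_diff chain_map_add)
  then show "P (simplex_translate (Suc p) n s) (act n xy)"
   using P small unfolding P_def act_def by (auto intro: translate_singular_chain)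
 next
  fix xy and m n :: "real^'v"
  have "(+) (m + n) = (+) m \<circ> (+) n" by (simp add: fun_eq_iff add.assoc)
  then show "act (m + n) xy = act m (act n xy)" by (simp add: act_def chain_map_compose)
 qed blast
 have YP: "singular_chain (Suc p) (top_of_set (s ` standard_simplex (Suc p))) (fst (Y s))"
   "keys (fst (Y s)) \<subseteq> Collect (small (Suc p))"
   "singular_chain (Suc (Suc p)) (top_of_set (s ` standard_simplex (Suc p))) (snd (Y s))"
   "chain_boundary (Suc (Suc p)) (snd (Y s)) = fst (Y s) - (frag_of s + ?w s)" if "s \<in> Sing (Suc p)" for s
  using Y(1)[OF that] by (auto simp: P_def)
 have "chain_boundary (Suc (Suc p)) (frag_extend (\<lambda>s. snd (Y s)) z) = frag_extend (\<lambda>s. fst (Y s)) z - z"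
  if z: "keys z \<subseteq> Sing (Suc p)" "chain_boundary (Suc p) z = 0" for z
 proof -
  have "chain_boundary (Suc (Suc p)) (frag_extend (\<lambda>s. snd (Y s)) z) =
    frag_extend (\<lambda>s. chain_boundary (Suc (Suc p)) (snd (Y s))) z"
   by (rule chain_boundary_frag_extend)
  also have "\<dots> = frag_extend (\<lambda>s. (fst (Y s) - frag_of s) - ?w s) z"
   by (rule frag_extend_cong) (use z YP(4) in \<open>auto simp: algebra_simps\<close>)
  also have "\<dots> = frag_extend (\<lambda>s. fst (Y s)) z - z - frag_extend d (frag_extend (simplex_boundary (Suc p)) z)"
   unfolding frag_extend_diff_fun by (simp add: frag_extend_id frag_extend_frag_extend)
  finally show ?thesis using z by (simp add: frag_extend_simplex_boundary)
 qed
 then have "subdivided (Suc p) (\<lambda>s. fst (Y s), \<lambda>s. snd (Y s))"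
  unfolding subdivided_def using YP Y(2) by (auto simp: act_def ext_tr_chain_map)
 moreover have "chain_boundary (Suc p) (fst (Y s)) = frag_extend r (simplex_boundary (Suc p) s)" if "s \<in> Sing (Suc p)" for s
 proof -
  have "chain_boundary (Suc p) (chain_boundary (Suc (Suc p)) (snd (Y s))) = 0"
   using chain_boundary_boundary_alt YP(3)[OF that] by blast
  then show ?thesis using YP(4)[OF that] bc[OF that] by (simp add: chain_boundary_diff)
 qed
 ultimately show ?thesis
  using YP(4) by (intro exI[of _ "(\<lambda>s. fst (Y s), \<lambda>s. snd (Y s))"]) (auto simp: rd_eq algebra_simps)
qed

text \<open>The number of subdivisions that make a simplex small depends on the simplex, so there is no uniform
 formula. The maps are constructed by induction on the degree: once they are chosen on the boundary,
 a sufficiently fine subdivision extends them over the simplex. The choices are made for one simplex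
 of each orbit.\<close>

theorem small_approximation:
 "\<exists>\<rho> D. SM.chain_morphism \<rho> \<and> (\<forall>p. SS.equivariant p (Suc p) (D p)) \<and>
  (\<forall>s\<in>Sing 0. chain_boundary (Suc 0) (D 0 s) = \<rho> 0 s - frag_of s) \<and>
  (\<forall>p. \<forall>s\<in>Sing (Suc p). chain_boundary (Suc (Suc p)) (D (Suc p) s) =
    \<rho> (Suc p) s - frag_of s - frag_extend (D p) (simplex_boundary (Suc p) s)) \<and>
  (\<forall>p. \<forall>s\<in>Sing p. singular_chain p (top_of_set (s ` standard_simplex p)) (\<rho> p s)) \<and>
  (\<forall>s\<in>Sing 0. augmentation (\<rho> 0 s) = 1)"
proof -
 have "small 0 s" for s :: "(nat => real) => real^'v"
  by (simp add: small_def standard_simplex_0)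
 then have "subdivided 0 (frag_of, \<lambda>s. 0)"
  by (auto simp: subdivided_def singular_chain_of simplices_def singular_simplex_cont frag_extend_id)
   (simp add: frag_extend_def)
 then have ex0: "\<exists>rd. subdivided 0 rd" by blast
 have "\<exists>F. \<forall>p. subdivided p (F p) \<and> (\<forall>s\<in>Sing (Suc p).
   chain_boundary (Suc (Suc p)) (snd (F (Suc p)) s) = fst (F (Suc p)) s - frag_of s - frag_extend (snd (F p)) (simplex_boundary (Suc p) s) \<and>
   chain_boundary (Suc p) (fst (F (Suc p)) s) = frag_extend (fst (F p)) (simplex_boundary (Suc p) s))"
  by (rule dependent_nat_choice[of subdivided "\<lambda>p rd rd'. \<forall>s\<in>Sing (Suc p).
   chain_boundary (Suc (Suc p)) (snd rd' s) = fst rd' s - frag_of s - frag_extend (snd rd) (simplex_boundary (Suc p) s) \<and>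
   chain_boundary (Suc p) (fst rd' s) = frag_extend (fst rd) (simplex_boundary (Suc p) s)"])
   (rule ex0, rule subdivided_step)
 then obtain F where F: "!!p. subdivided p (F p)"
  and Fd: "!!p s. s \<in> Sing (Suc p) ==> chain_boundary (Suc (Suc p)) (snd (F (Suc p)) s) =
    fst (F (Suc p)) s - frag_of s - frag_extend (snd (F p)) (simplex_boundary (Suc p) s)"
  and Fr: "!!p s. s \<in> Sing (Suc p) ==>
    chain_boundary (Suc p) (fst (F (Suc p)) s) = frag_extend (fst (F p)) (simplex_boundary (Suc p) s)"
  by blast
 have F1: "singular_chain p (top_of_set (s ` standard_simplex p)) (fst (F p) s)"
  "keys (fst (F p) s) \<subseteq> Collect (small p)"
  "singular_chain (Suc p) (top_of_set (s ` standard_simplex p)) (snd (F p) s)"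
  "n \<in> lattice L ==> fst (F p) (simplex_translate p n s) = S.ext_tr p n (fst (F p) s)"
  "n \<in> lattice L ==> snd (F p) (simplex_translate p n s) = S.ext_tr (Suc p) n (snd (F p) s)" if "s \<in> Sing p" for s p n
  using F[of p] that by (auto simp: subdivided_def)
 have F0: "fst (F 0) s = frag_of s" "snd (F 0) s = 0" if "s \<in> Sing 0" for s
  using F[of 0] that by (auto simp: subdivided_def)
 have keys: "keys (fst (F p) s) \<subseteq> Small p" "keys (snd (F p) s) \<subseteq> Sing (Suc p)" if "s \<in> Sing p" for s p
  using singular_chain_cover[OF that] F1(1-3)[OF that] by (auto simp: simplices_def)
 have "SM.chain_morphism (\<lambda>p. fst (F p))"
  unfolding SM.chain_morphism_def SM.equivariant_def
  using keys F1(4) Fr by (simp add: frag_extend_simplex_boundary)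
 moreover have "SS.equivariant p (Suc p) (snd (F p))" for p
  unfolding SS.equivariant_def using keys F1(5) by simp
 ultimately show ?thesis
  using F0 F1(1) Fd by (intro exI[of _ "\<lambda>p. fst (F p)"] exI[of _ "\<lambda>p. snd (F p)"]) auto
qed

end

section \<open>Singular and cellular cochains of the cover\<close>

definition vertex_values :: "nat => ((nat => real) => real^'v) => 'v => real set" where
 "vertex_values p s i = (\<lambda>j. round_vec (s (vertex j)) $ i) ` {..p}"

definition box :: "('v => real set) => nat => ('v set \<times> (real^'v::finite)) set" where
 "box V q = {(\<tau>, n). card \<tau> = q \<and> (\<forall>i. n $ i \<in> V i \<and> (i \<in> \<tau> --> n $ i + 1 \<in> V i))}"

definition cube :: "(real^'v::finite) => 'v set => (real^'v) set" where
 "cube n \<tau> = {x. \<forall>i. n $ i \<le> x $ i \<and> x $ i \<le> n $ i + (if i \<in> \<tau> then 1 else 0)}"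

lemma cubeD: "x \<in> cube n \<tau> ==> n $ i \<le> x $ i \<and> x $ i \<le> n $ i + (if i \<in> \<tau> then 1 else 0)"
 unfolding cube_def by blast

lemma box_mono: "(!!i. V i \<subseteq> W i) ==> box V q \<subseteq> box W q"
 unfolding box_def by blast

lemma box_eq_cube_cells:
 assumes V: "!!i. V i = (if i \<in> D then {m $ i, m $ i + 1} else {m $ i})"
 shows "box V q = cube_cells m D q"
proof -
 have "n $ i \<in> V i \<and> (i \<in> \<tau> --> n $ i + 1 \<in> V i) \<longleftrightarrow>
   (i \<in> \<tau> --> i \<in> D) \<and> (n $ i = m $ i \<or> i \<in> D - \<tau> \<and> n $ i = m $ i + 1)" for i \<tau> and n :: "real^'a"
  by (cases "i \<in> D"; cases "i \<in> \<tau>") (auto simp: V)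
 then have eq: "(\<forall>i. n $ i \<in> V i \<and> (i \<in> \<tau> --> n $ i + 1 \<in> V i)) \<longleftrightarrow>
   \<tau> \<subseteq> D \<and> (\<forall>i. n $ i = m $ i \<or> i \<in> D - \<tau> \<and> n $ i = m $ i + 1)" for \<tau> and n :: "real^'a"
  unfolding subset_iff all_conj_distrib[symmetric] by presburger
 show ?thesis
 proof (rule Set.set_eqI)
  fix c :: "'a set \<times> (real^'a)"
  obtain \<tau> n where "c = (\<tau>, n)" by fastforce
  then show "c \<in> box V q \<longleftrightarrow> c \<in> cube_cells m D q"
   by (simp only: box_def cube_cells_def mem_Collect_eq prod.case eq conj_ac)
 qed
qed

lemma vertex_values_face:
 assumes "k \<le> Suc p"
 shows "vertex_values p (singular_face (Suc p) k s) i \<subseteq> vertex_values (Suc p) s i"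
proof
 fix u assume "u \<in> vertex_values p (singular_face (Suc p) k s) i"
 then obtain j where "j \<le> p" "u = round_vec (s (vertex (if j < k then j else Suc j))) $ i"
  by (auto simp: vertex_values_def singular_face_apply vertex_standard_simplex simplical_face_vertex)
 then show "u \<in> vertex_values (Suc p) s i"
  unfolding vertex_values_def by (intro image_eqI[where x="if j < k then j else Suc j"]) auto
qed

lemma vertex_values_boundary:
 assumes "s' \<in> keys (simplex_boundary (Suc p) s)"
 shows "vertex_values p s' i \<subseteq> vertex_values (Suc p) s i"
 using subsetD[OF keys_simplex_boundary assms] by (elim imageE) (simp add: vertex_values_face)

lemma vertex_values_translate:
 "n \<in> lattice L ==> vertex_values p (simplex_translate p n s) i = (+) (n $ i) ` vertex_values p s i"
 by (auto simp: vertex_values_def simplex_translate_apply vertex_standard_simplex round_vec_translate image_image)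

lemma ints_close_imp:
 assumes "u \<in> \<int>" "w \<in> \<int>" "\<bar>u - w\<bar> < (2::real)" "w \<le> u"
 shows "u = w \<or> u = w + 1"
proof -
 obtain a b where "u = of_int a" "w = of_int b" using assms(1,2) by (auto elim!: Ints_cases)
 then show ?thesis using assms(3,4) by (auto simp flip: of_int_diff of_int_add)
qed

lemma keys_cell_boundary:
 "keys (cell_boundary (\<tau>, n)) \<subseteq> (\<Union>v\<in>\<tau>. {(\<tau> - {v}, n + axis v 1), (\<tau> - {v}, n)})"
proof -
 have "keys (frag_cmul (vertex_sign v \<tau>) (frag_of (\<tau> - {v}, n + axis v 1) - frag_of (\<tau> - {v}, n)))
   \<subseteq> {(\<tau> - {v}, n + axis v 1), (\<tau> - {v}, n)}" for v
  by (rule subset_trans[OF keys_cmul]) (rule keys_diff_subset; simp)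
 then show ?thesis unfolding cell_boundary_apply by (intro subset_trans[OF keys_sum] UN_mono) auto
qed

lemma convex_cube: "convex (cube n \<tau>)"
proof -
 have "cube n \<tau> = (\<Inter>i. {x. n $ i \<le> x $ i} \<inter> {x. x $ i \<le> n $ i + (if i \<in> \<tau> then 1 else 0)})"
  unfolding cube_def by blast
 moreover have "convex {x :: real^'a. a \<le> x $ i}" "convex {x :: real^'a. x $ i \<le> a}" for a i
  using convex_halfspace_ge[of a "axis i 1 :: real^'a"] convex_halfspace_le[of "axis i 1 :: real^'a" a]
  by (simp_all add: inner_axis' )
 ultimately show ?thesis by (auto intro!: convex_INT convex_Int)
qed

lemma cube_subset_cover:
 assumes L: "simplicial_cx L" and c: "(\<tau>, n) \<in> cells L p"
 shows "cube n \<tau> \<subseteq> abelian_cover L"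
proof
 fix x assume x: "x \<in> cube n \<tau>"
 have eq: "x $ i = n $ i" if "i \<notin> \<tau>" for i using cubeD[OF x, of i] that by simp
 have "{i. x $ i \<notin> \<int>} \<subseteq> \<tau>" using eq c by (force simp: cells_def lattice_def)
 then have "{i. x $ i \<notin> \<int>} \<in> L" using c simplicial_cx_subset[OF L] by (auto simp: cells_def)
 moreover have "x $ i = 0" if "i \<notin> \<Union>L" for i
  using eq[of i] that c by (auto simp: cells_def lattice_def)
 ultimately show "x \<in> abelian_cover L" by (simp add: abelian_cover_def)
qed

lemma singular_acyclic:
 fixes S :: "(real^'v::finite) set"
 assumes "contractible_space (top_of_set S)" "S ~= {}"
  and "keys z \<subseteq> Collect (singular_simplex q (top_of_set S))"
  and "if q = 0 then augmentation z = 0 else frag_extend (simplex_boundary q) z = 0"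
 shows "\<exists>w. keys w \<subseteq> Collect (singular_simplex (Suc q) (top_of_set S)) \<and>
   frag_extend (simplex_boundary (Suc q)) w = z"
 using contractible_acyclic[OF assms(1,2), of q z] assms(3,4)
 unfolding frag_extend_simplex_boundary singular_chain_def by blast

lemma singular_simplex_translate:
 assumes "singular_simplex q (top_of_set A) s" "(+) n ` A \<subseteq> A'"
 shows "singular_simplex q (top_of_set A') (simplex_translate q n s)"
 by (rule singular_simplex_simplex_map[OF assms(1)]) (use assms(2) in \<open>auto intro!: continuous_intros\<close>)

lemma singular_simplex_subset:
 "singular_simplex q (top_of_set A) s ==> A \<subseteq> A' ==> singular_simplex q (top_of_set A') s"
 by (auto simp: singular_simplex_cont)

context finite_complex
begin

text \<open>The union of the open stars of the vertices of a cube. It is contractible: clamping the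
 coordinates retracts it onto the cube.\<close>

definition star_nbhd :: "('v => real set) => (real^'v) set" where
 "star_nbhd V = {x \<in> abelian_cover L. \<forall>i. \<exists>u\<in>V i. \<bar>x $ i - u\<bar> < 1}"

lemma star_nbhd_contractible:
 assumes V: "!!i. V i = (if i \<in> D then {m $ i, m $ i + 1} else {m $ i})" and m: "m \<in> lattice L" and D: "D \<in> L"
 shows "contractible_space (top_of_set (star_nbhd V))" "star_nbhd V ~= {}"
proof -
 define hi where "hi i = m $ i + (if i \<in> D then 1 else 0)" for i
 define clamp :: "real^'v => real^'v" where "clamp x = (\<chi> i. max (m $ i) (min (x $ i) (hi i)))" for x
 have int: "m $ i \<in> \<int>" "hi i \<in> \<int>" for i using m by (auto simp: lattice_def hi_def)
 have hi: "m $ i \<le> hi i" "hi i \<in> V i" "m $ i \<in> V i" for i by (auto simp: hi_def V)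
 have bounds: "m $ i - 1 < x $ i \<and> x $ i < hi i + 1" if x: "x \<in> star_nbhd V" for x i
 proof -
  obtain u where "u \<in> V i" "\<bar>x $ i - u\<bar> < 1" using x unfolding star_nbhd_def by blast
  then show ?thesis by (auto simp: V hi_def split: if_splits)
 qed
 have nbhdI: "y \<in> star_nbhd V" if "{i. y $ i \<notin> \<int>} \<in> L" "!!i. i \<notin> \<Union>L ==> y $ i = 0"
  "!!i. m $ i - 1 < y $ i \<and> y $ i < hi i + 1" for y
 proof -
  have "\<exists>u\<in>V i. \<bar>y $ i - u\<bar> < 1" for i
  proof (cases "y $ i < m $ i + 1")
   case True
   then show ?thesis using that(3)[of i] hi(3)[of i] by (intro bexI[of _ "m $ i"]) auto
  next
   case False
   then show ?thesis using that(3)[of i] hi(2)[of i]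
    by (intro bexI[of _ "hi i"]) (auto simp: hi_def split: if_splits)
  qed
  then show ?thesis using that by (simp add: star_nbhd_def abelian_cover_def)
 qed
 have zero: "m $ i = 0 \<and> hi i = 0" if "i \<notin> \<Union>L" for i
  using that m D by (auto simp: lattice_def hi_def)
 have clamp_int: "clamp x $ i = x $ i" if x: "x \<in> star_nbhd V" "x $ i \<in> \<int>" for x i
 proof -
  have "m $ i \<le> x $ i \<and> x $ i \<le> hi i"
  proof -
   obtain a b c where *: "m $ i = of_int a" "hi i = of_int b" "x $ i = of_int c"
    using int[of i] x(2) by (auto elim!: Ints_cases)
   have "a \<le> c \<and> c \<le> b" using bounds[OF x(1), of i] unfolding * by linarith
   then show ?thesis unfolding * by simp
  qed
  then show ?thesis by (simp add: clamp_def)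
 qed
 have supp1: "{i. ((1 - t) *\<^sub>R x + t *\<^sub>R clamp x) $ i \<notin> \<int>} \<in> L" if "x \<in> star_nbhd V" for x t
 proof (rule simplicial_cx_subset[OF L])
  show "{i. x $ i \<notin> \<int>} \<in> L" using that by (simp add: star_nbhd_def abelian_cover_def)
  show "{i. ((1 - t) *\<^sub>R x + t *\<^sub>R clamp x) $ i \<notin> \<int>} \<subseteq> {i. x $ i \<notin> \<int>}"
   using clamp_int[OF that] by (auto simp: left_diff_distrib)
 qed
 have cl: "m $ i \<le> clamp x $ i \<and> clamp x $ i \<le> hi i" for i x using hi(1)[of i] by (auto simp: clamp_def)
 have conv: "a < (1 - t) * u + t * w \<and> (1 - t) * u + t * w < b"
  if "a < u" "u < b" "a < w" "w < b" "0 \<le> t" "t \<le> 1" for a b u w t :: real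
  using convex_bound_lt[of u b w "1 - t" t] convex_bound_lt[of "- u" "- a" "- w" "1 - t" t] that by simp
 have seg1: "(1 - t) *\<^sub>R x + t *\<^sub>R clamp x \<in> star_nbhd V" if x: "x \<in> star_nbhd V" and t: "0 \<le> t" "t \<le> 1" for x t
 proof (rule nbhdI[OF supp1[OF x]])
  show "((1 - t) *\<^sub>R x + t *\<^sub>R clamp x) $ i = 0" if i: "i \<notin> \<Union>L" for i
   using zero[OF i] x i cl[of i x] by (simp add: star_nbhd_def abelian_cover_def)
  show "m $ i - 1 < ((1 - t) *\<^sub>R x + t *\<^sub>R clamp x) $ i \<and> ((1 - t) *\<^sub>R x + t *\<^sub>R clamp x) $ i < hi i + 1" for i
   using bounds[OF x, of i] cl[of i x] t by (simp, intro conv) auto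
 qed
 have inD: "{i. y $ i \<notin> \<int>} \<in> L" if "!!i. m $ i \<le> y $ i \<and> y $ i \<le> hi i" for y
 proof (rule simplicial_cx_subset[OF L D])
  show "{i. y $ i \<notin> \<int>} \<subseteq> D"
  proof
   fix i assume i: "i \<in> {i. y $ i \<notin> \<int>}"
   show "i \<in> D"
   proof (rule ccontr)
    assume "i \<notin> D"
    then have "y $ i = m $ i" using that[of i] by (simp add: hi_def)
    then show False using i int(1) by simp
   qed
  qed
 qed
 have seg2: "(1 - t) *\<^sub>R clamp x + t *\<^sub>R m \<in> star_nbhd V" if t: "0 \<le> t" "t \<le> 1" for x t
 proof -
  let ?y = "(1 - t) *\<^sub>R clamp x + t *\<^sub>R m"
  have y: "m $ i \<le> ?y $ i \<and> ?y $ i \<le> hi i" for i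
  proof -
   have "m $ i \<le> (1 - t) * clamp x $ i + t * m $ i"
    using convex_bound_le[of "- (clamp x $ i)" "- m $ i" "- m $ i" "1 - t" t] cl[of i x] t by simp
   moreover have "(1 - t) * clamp x $ i + t * m $ i \<le> hi i"
    using convex_bound_le[of "clamp x $ i" "hi i" "m $ i" "1 - t" t] cl[of i x] hi(1)[of i] t by simp
   ultimately show ?thesis by simp
  qed
  show ?thesis
  proof (rule nbhdI[OF inD[OF y]])
   show "?y $ i = 0" if "i \<notin> \<Union>L" for i using y[of i] zero[OF that] by (intro antisym) auto
   show "m $ i - 1 < ?y $ i \<and> ?y $ i < hi i + 1" for i using y[of i] by linarith
  qed
 qed
 have cont: "continuous_on A clamp" for A
  unfolding clamp_def by (intro continuous_on_vec_lambda continuous_intros)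
 have "homotopic_with (\<lambda>x. True) (top_of_set (star_nbhd V)) (top_of_set (star_nbhd V)) (\<lambda>x. x) clamp"
  by (rule straight_homotopy[OF continuous_on_id cont seg1])
 moreover have "homotopic_with (\<lambda>x. True) (top_of_set (star_nbhd V)) (top_of_set (star_nbhd V)) clamp (\<lambda>x. m)"
  by (rule straight_homotopy[OF cont continuous_on_const seg2])
 ultimately have "homotopic_with (\<lambda>x. True) (top_of_set (star_nbhd V)) (top_of_set (star_nbhd V)) (\<lambda>x. x) (\<lambda>x. m)"
  by (rule homotopic_with_trans)
 then show "contractible_space (top_of_set (star_nbhd V))" unfolding contractible_space_def id_def by blast
 have "m \<in> star_nbhd V"
  by (rule nbhdI[OF inD]) (use hi(1) zero in \<open>auto intro: less_le_trans\<close>, smt (verit) hi(1))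
 then show "star_nbhd V ~= {}" by blast
qed

text \<open>If the vertices of a small simplex round to two values in a direction, then all its points lie
 strictly between these values. So the directions with two values form a simplex of \<open>L\<close>.\<close>

lemma small_vertex_values:
 assumes s: "s \<in> Small p"
 shows "\<exists>m\<in>lattice L. \<exists>D\<in>L. \<forall>i. vertex_values p s i = (if i \<in> D then {m $ i, m $ i + 1} else {m $ i})"
proof -
 let ?V = "vertex_values p s"
 have sX: "s (vertex j) \<in> abelian_cover L" if "j \<le> p" for j
  using s vertex_standard_simplex[OF that] by (auto simp: simplices_def singular_simplex_cont)
 have near: "\<bar>s (vertex j) $ i - s (vertex k) $ i\<bar> < 1/2" if "j \<le> p" "k \<le> p" for i j k
  using s vertex_standard_simplex that by (simp add: simplices_def small_def)
 have fin: "finite (?V i)" "?V i ~= {}" for i by (auto simp: vertex_values_def)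
 have int: "u \<in> \<int>" if "u \<in> ?V i" for u i using that by (auto simp: vertex_values_def round_vec_int)
 have close: "\<bar>u - w\<bar> < 2" if uw: "u \<in> ?V i" "w \<in> ?V i" for u w i
 proof -
  obtain j k where "j \<le> p" "k \<le> p" "u = round_vec (s (vertex j)) $ i" "w = round_vec (s (vertex k)) $ i"
   using uw by (auto simp: vertex_values_def)
  then show ?thesis
   using near[of j k i] round_vec_near[of "s (vertex j)" i] round_vec_near[of "s (vertex k)" i] by linarith
 qed
 define m :: "real^'v" where "m = (\<chi> i. Min (?V i))"
 define D where "D = {i. m $ i + 1 \<in> ?V i}"
 have mV: "m $ i \<in> ?V i" for i using fin by (simp add: m_def)
 have V: "?V i = (if i \<in> D then {m $ i, m $ i + 1} else {m $ i})" for i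
 proof -
  have "u = m $ i \<or> u = m $ i + 1" if "u \<in> ?V i" for u
   by (rule ints_close_imp[OF int[OF that] int[OF mV] close[OF that mV]]) (use fin that in \<open>simp add: m_def\<close>)
  then show ?thesis using mV[of i] by (auto simp: D_def)
 qed
 have "m \<in> lattice L"
  unfolding lattice_def
 proof (intro CollectI conjI allI impI)
  show "m $ i \<in> \<int>" for i using int[OF mV] .
  fix i assume "i \<notin> \<Union>L"
  then have "?V i \<subseteq> {0}"
   using round_vec_lattice[OF sX] by (auto simp: vertex_values_def lattice_def)
  then show "m $ i = 0" using mV[of i] by blast
 qed
 moreover have "D \<in> L"
 proof (rule simplicial_cx_subset[OF L])
  show "{i. s (vertex 0) $ i \<notin> \<int>} \<in> L" using sX[of 0] by (simp add: abelian_cover_def)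
  show "D \<subseteq> {i. s (vertex 0) $ i \<notin> \<int>}"
  proof
   fix i assume i: "i \<in> D"
   show "i \<in> {i. s (vertex 0) $ i \<notin> \<int>}"
   proof (rule ccontr)
    assume "i \<notin> {i. s (vertex 0) $ i \<notin> \<int>}"
    then have "?V i \<subseteq> {s (vertex 0) $ i}"
     using near round_vec_of_int[of "s (vertex 0)" i] by (auto simp: vertex_values_def)
    then show False using i V[of i] by auto
   qed
  qed
 qed
 ultimately show ?thesis using V by blast
qed

lemma cube_cells_cells:
 assumes "m \<in> lattice L" "D \<in> L"
 shows "cube_cells m D q \<subseteq> cells L q"
proof
 fix c assume "c \<in> cube_cells m D q"
 then obtain \<tau> n where c: "c = (\<tau>, n)" "\<tau> \<subseteq> D" "card \<tau> = q" "!!i. n $ i = m $ i \<or> i \<in> D - \<tau> \<and> n $ i = m $ i + 1"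
  unfolding cube_cells_def by blast
 have "n \<in> lattice L"
  unfolding lattice_def
 proof (intro CollectI conjI allI impI)
  show "n $ i \<in> \<int>" for i using c(4)[of i] assms(1) by (auto simp: lattice_def)
  show "n $ i = 0" if "i \<notin> \<Union>L" for i using c(4)[of i] assms that by (auto simp: lattice_def)
 qed
 then show "c \<in> cells L q" using c simplicial_cx_subset[OF L assms(2)] by (simp add: cells_def)
qed

sublocale MK: lattice_complex_pair "lattice L" Small simplex_boundary simplex_translate "\<lambda>p s. round_vec (s (vertex 0))"
  "cells L" "\<lambda>p. cell_boundary" "\<lambda>p. cell_translate" "\<lambda>p. snd" ..
sublocale KS: lattice_complex_pair "lattice L" "cells L" "\<lambda>p. cell_boundary" "\<lambda>p. cell_translate" "\<lambda>p. snd"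
  Sing simplex_boundary simplex_translate "\<lambda>p s. round_vec (s (vertex 0))" ..
sublocale MS: lattice_complex_pair "lattice L" Small simplex_boundary simplex_translate "\<lambda>p s. round_vec (s (vertex 0))"
  Sing simplex_boundary simplex_translate "\<lambda>p s. round_vec (s (vertex 0))" ..
sublocale KK: lattice_complex_pair "lattice L" "cells L" "\<lambda>p. cell_boundary" "\<lambda>p. cell_translate" "\<lambda>p. snd"
  "cells L" "\<lambda>p. cell_boundary" "\<lambda>p. cell_translate" "\<lambda>p. snd" ..

text \<open>The carriers of the comparison maps between small singular simplices and cells in both directions,
 and of the two composites: the cube of a cell, the cube spanned by the rounded vertices of a simplex,
 and the union of the open stars of these vertices.\<close>

sublocale MKc: acyclic_carrier "lattice L" Small simplex_boundary simplex_translate "\<lambda>p s. round_vec (s (vertex 0))"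
  "cells L" "\<lambda>p. cell_boundary" "\<lambda>p. cell_translate" "\<lambda>p. snd" "\<lambda>p s. box (vertex_values p s)"
proof
 fix p q s assume s: "s \<in> Small p"
 obtain m D where mD: "m \<in> lattice L" "D \<in> L"
  and V: "!!i. vertex_values p s i = (if i \<in> D then {m $ i, m $ i + 1} else {m $ i})"
  using small_vertex_values[OF s] by blast
 note box = box_eq_cube_cells[OF V]
 show "box (vertex_values p s) q \<subseteq> cells L q" unfolding box by (rule cube_cells_cells[OF mD])
 show "\<exists>w. keys w \<subseteq> box (vertex_values p s) (Suc q) \<and> K.dd (Suc q) w = z"
  if "keys z \<subseteq> box (vertex_values p s) q" "K.is_cycle q z" for z
  unfolding box by (rule cube_cells_acyclic) (use that in \<open>simp_all add: box K.is_cycle_def\<close>)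
 fix n c assume n: "n \<in> lattice L" and c: "c \<in> box (vertex_values p s) q"
 show "cell_translate n c \<in> box (vertex_values p (simplex_translate p n s)) q"
  using c unfolding box_def vertex_values_translate[OF n] by (auto simp: image_iff add.assoc)
next
 fix p q and s s' :: "(nat => real) => real^'v" assume "s' \<in> keys (simplex_boundary (Suc p) s)"
 then show "box (vertex_values p s') q \<subseteq> box (vertex_values (Suc p) s) q"
  by (intro box_mono vertex_values_boundary)
next
 fix s :: "(nat => real) => real^'v"
 have "({}, round_vec (s (vertex 0))) \<in> box (vertex_values 0 s) 0" by (auto simp: box_def vertex_values_def)
 then show "box (vertex_values 0 s) 0 ~= {}" by blast
qed

sublocale KSc: acyclic_carrier "lattice L" "cells L" "\<lambda>p. cell_boundary" "\<lambda>p. cell_translate" "\<lambda>p. snd"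
  Sing simplex_boundary simplex_translate "\<lambda>p s. round_vec (s (vertex 0))"
  "\<lambda>p c q. Collect (singular_simplex q (top_of_set (cube (snd c) (fst c))))"
proof
 fix p q c assume c: "c \<in> cells L p"
 have ne: "snd c \<in> cube (snd c) (fst c)" by (simp add: cube_def)
 show "Collect (singular_simplex q (top_of_set (cube (snd c) (fst c)))) \<subseteq> Sing q"
  using cube_subset_cover[OF L, of "fst c" "snd c" p] c by (auto simp: simplices_def intro: singular_simplex_subset)
 show "\<exists>w. keys w \<subseteq> Collect (singular_simplex (Suc q) (top_of_set (cube (snd c) (fst c)))) \<and> S.dd (Suc q) w = z"
  if "keys z \<subseteq> Collect (singular_simplex q (top_of_set (cube (snd c) (fst c))))" "S.is_cycle q z" for z
  by (rule singular_acyclic) (use ne that convex_contractible_space[OF convex_cube] in \<open>auto simp: S.is_cycle_def\<close>)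
 fix n s assume "n \<in> lattice L" and s: "s \<in> Collect (singular_simplex q (top_of_set (cube (snd c) (fst c))))"
 have "(+) n ` cube (snd c) (fst c) \<subseteq> cube (snd (cell_translate n c)) (fst (cell_translate n c))"
  by (auto simp: cube_def cell_translate_def split_def add.assoc simp del: if_image_distrib split del: if_split)
 then show "simplex_translate q n s \<in> Collect (singular_simplex q (top_of_set (cube (snd (cell_translate n c)) (fst (cell_translate n c)))))"
  using s by (auto intro: singular_simplex_translate)
next
 fix p q c c' assume "c \<in> cells L (Suc p)" and c': "c' \<in> keys (cell_boundary c)"
 obtain \<tau> n where c: "c = (\<tau>, n)" by fastforce
 then obtain v where v: "v \<in> \<tau>" "c' = (\<tau> - {v}, n + axis v 1) \<or> c' = (\<tau> - {v}, n)"
  using keys_cell_boundary[of \<tau> n] c' by blast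
 have "cube (n + axis v 1) (\<tau> - {v}) \<subseteq> cube n \<tau>"
 proof
  fix x assume x: "x \<in> cube (n + axis v 1) (\<tau> - {v})"
  have "n $ i \<le> x $ i \<and> x $ i \<le> n $ i + (if i \<in> \<tau> then 1 else 0)" for i
   using spec[OF x[unfolded cube_def mem_Collect_eq], of i] v(1) by (cases "i = v") (auto simp: axis_def)
  then show "x \<in> cube n \<tau>" by (simp add: cube_def)
 qed
 moreover have "cube n (\<tau> - {v}) \<subseteq> cube n \<tau>"
 proof
  fix x assume x: "x \<in> cube n (\<tau> - {v})"
  have "n $ i \<le> x $ i \<and> x $ i \<le> n $ i + (if i \<in> \<tau> then 1 else 0)" for i
   using spec[OF x[unfolded cube_def mem_Collect_eq], of i] by (cases "i = v") auto
  then show "x \<in> cube n \<tau>" by (simp add: cube_def)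
 qed
 ultimately have "cube (snd c') (fst c') \<subseteq> cube (snd c) (fst c)" using v(2) c by auto
 then show "Collect (singular_simplex q (top_of_set (cube (snd c') (fst c')))) \<subseteq>
   Collect (singular_simplex q (top_of_set (cube (snd c) (fst c))))"
  by (auto intro: singular_simplex_subset)
next
 fix c :: "'v set \<times> (real^'v)"
 have "restrict (\<lambda>x. snd c) (standard_simplex 0) \<in> Collect (singular_simplex 0 (top_of_set (cube (snd c) (fst c))))"
  by (auto simp: singular_simplex_cont cube_def intro!: continuous_on_eq[OF continuous_on_const])
 then show "Collect (singular_simplex 0 (top_of_set (cube (snd c) (fst c)))) ~= {}" by blast
qed

lemma small_in_star:
 assumes s: "s \<in> Small p"
 shows "singular_simplex p (top_of_set (star_nbhd (vertex_values p s))) s"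
proof -
 have "s x \<in> star_nbhd (vertex_values p s)" if x: "x \<in> standard_simplex p" for x
 proof -
  have "\<bar>s x $ i - round_vec (s (vertex 0)) $ i\<bar> < 1" for i
  proof -
   have "\<bar>s x $ i - s (vertex 0) $ i\<bar> < 1/2"
    using s x vertex_standard_simplex[of 0 p] by (simp add: simplices_def small_def)
   then show ?thesis using round_vec_near[of "s (vertex 0)" i] by linarith
  qed
  then show ?thesis using s x
   by (auto simp: star_nbhd_def vertex_values_def simplices_def singular_simplex_cont)
 qed
 then show ?thesis using s by (auto simp: simplices_def singular_simplex_cont)
qed

sublocale MSc: acyclic_carrier "lattice L" Small simplex_boundary simplex_translate "\<lambda>p s. round_vec (s (vertex 0))"
  Sing simplex_boundary simplex_translate "\<lambda>p s. round_vec (s (vertex 0))"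
  "\<lambda>p s q. Collect (singular_simplex q (top_of_set (star_nbhd (vertex_values p s))))"
proof
 fix p q s assume s: "s \<in> Small p"
 obtain m D where mD: "m \<in> lattice L" "D \<in> L"
  and V: "!!i. vertex_values p s i = (if i \<in> D then {m $ i, m $ i + 1} else {m $ i})"
  using small_vertex_values[OF s] by blast
 show "Collect (singular_simplex q (top_of_set (star_nbhd (vertex_values p s)))) \<subseteq> Sing q"
  by (auto simp: simplices_def star_nbhd_def intro: singular_simplex_subset)
 show "\<exists>w. keys w \<subseteq> Collect (singular_simplex (Suc q) (top_of_set (star_nbhd (vertex_values p s)))) \<and> S.dd (Suc q) w = z"
  if "keys z \<subseteq> Collect (singular_simplex q (top_of_set (star_nbhd (vertex_values p s))))" "S.is_cycle q z" for z
  by (rule singular_acyclic[OF star_nbhd_contractible[OF V mD]]) (use that in \<open>auto simp: S.is_cycle_def\<close>)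
 fix n f assume n: "n \<in> lattice L" and f: "f \<in> Collect (singular_simplex q (top_of_set (star_nbhd (vertex_values p s))))"
 have "(+) n ` star_nbhd (vertex_values p s) \<subseteq> star_nbhd (vertex_values p (simplex_translate p n s))"
  using abelian_cover_translate[OF n] unfolding vertex_values_translate[OF n] by (auto simp: star_nbhd_def)
 then show "simplex_translate q n f \<in> Collect (singular_simplex q (top_of_set (star_nbhd (vertex_values p (simplex_translate p n s)))))"
  using f by (auto intro: singular_simplex_translate)
next
 fix p q and s s' :: "(nat => real) => real^'v" assume "s' \<in> keys (simplex_boundary (Suc p) s)"
 then have "star_nbhd (vertex_values p s') \<subseteq> star_nbhd (vertex_values (Suc p) s)"
  using vertex_values_boundary unfolding star_nbhd_def by blast
 then show "Collect (singular_simplex q (top_of_set (star_nbhd (vertex_values p s')))) \<subseteq>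
   Collect (singular_simplex q (top_of_set (star_nbhd (vertex_values (Suc p) s))))"
  by (auto intro: singular_simplex_subset)
next
 fix s assume "s \<in> Small 0"
 from small_in_star[OF this]
 show "Collect (singular_simplex 0 (top_of_set (star_nbhd (vertex_values 0 s)))) ~= {}" by blast
qed

sublocale KKc: acyclic_carrier "lattice L" "cells L" "\<lambda>p. cell_boundary" "\<lambda>p. cell_translate" "\<lambda>p. snd"
  "cells L" "\<lambda>p. cell_boundary" "\<lambda>p. cell_translate" "\<lambda>p. snd" "\<lambda>p c. cube_cells (snd c) (fst c)"
proof
 fix p q c assume c: "c \<in> cells L p"
 show "cube_cells (snd c) (fst c) q \<subseteq> cells L q" by (rule cube_cells_cells) (use c in \<open>auto simp: cells_def\<close>)
 show "\<exists>w. keys w \<subseteq> cube_cells (snd c) (fst c) (Suc q) \<and> K.dd (Suc q) w = z"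
  if "keys z \<subseteq> cube_cells (snd c) (fst c) q" "K.is_cycle q z" for z
  by (rule cube_cells_acyclic) (use that in \<open>simp_all add: K.is_cycle_def\<close>)
 show "cell_translate n d \<in> cube_cells (snd (cell_translate n c)) (fst (cell_translate n c)) q"
  if "d \<in> cube_cells (snd c) (fst c) q" for n d
  using that by (auto simp: cube_cells_def cell_translate_def split_def add.assoc)
next
 fix p q c c' assume "c' \<in> keys (cell_boundary c)"
 moreover obtain \<tau> n where c: "c = (\<tau>, n)" by fastforce
 ultimately obtain v where v: "v \<in> \<tau>" "c' = (\<tau> - {v}, n + axis v 1) \<or> c' = (\<tau> - {v}, n)"
  using keys_cell_boundary[of \<tau> n] by blast
 have "cube_cells (n + axis v 1) (\<tau> - {v}) q \<subseteq> cube_cells n \<tau> q"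
 proof
  fix d assume "d \<in> cube_cells (n + axis v 1) (\<tau> - {v}) q"
  then obtain \<sigma> k where d: "d = (\<sigma>, k)" "\<sigma> \<subseteq> \<tau> - {v}" "card \<sigma> = q"
   "!!i. k $ i = (n + axis v 1) $ i \<or> i \<in> \<tau> - {v} - \<sigma> \<and> k $ i = (n + axis v 1) $ i + 1"
   unfolding cube_cells_def by blast
  have "k $ i = n $ i \<or> i \<in> \<tau> - \<sigma> \<and> k $ i = n $ i + 1" for i
   using d(2) d(4)[of i] v(1) by (cases "i = v") (auto simp: axis_def)
  then show "d \<in> cube_cells n \<tau> q" using d(1-3) by (auto simp: cube_cells_def)
 qed
 moreover have "cube_cells n (\<tau> - {v}) q \<subseteq> cube_cells n \<tau> q" unfolding cube_cells_def by blast
 ultimately show "cube_cells (snd c') (fst c') q \<subseteq> cube_cells (snd c) (fst c) q" using v(2) c by auto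
next
 fix c assume "c \<in> cells L 0"
 then have "c \<in> cube_cells (snd c) (fst c) 0" by (auto simp: cells_def cube_cells_def)
 then show "cube_cells (snd c) (fst c) 0 ~= {}" by blast
qed

end

lemma pullback_pullback:
 assumes "b \<in> A" "keys (F b) \<subseteq> A'"
 shows "pairing (pullback A' G \<phi>) (F b) = pairing \<phi> (frag_extend G (F b))"
 unfolding pairing_frag_extend
 by (rule pairing_cong) (use assms in \<open>auto simp: pullback_def\<close>)

lemma augmentation_frag_extend:
 assumes "!!b. b \<in> keys c ==> augmentation (f b) = 1"
 shows "augmentation (frag_extend f c) = augmentation c"
 unfolding pairing_frag_extend by (rule pairing_cong) (rule assms)

context finite_complex
begin

lemma round_vec_cube:
 assumes "x \<in> cube n \<tau>" "n $ i \<in> \<int>"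
 shows "round_vec x $ i = n $ i \<or> i \<in> \<tau> \<and> round_vec x $ i = n $ i + 1"
proof -
 obtain z where z: "n $ i = of_int z" using assms(2) by (rule Ints_cases)
 have "\<lfloor>x $ i + 1/2\<rfloor> = z \<or> i \<in> \<tau> \<and> \<lfloor>x $ i + 1/2\<rfloor> = z + 1"
  using cubeD[OF assms(1), of i] unfolding z by (cases "i \<in> \<tau>") (simp_all, linarith+)
 then show ?thesis by (auto simp: round_vec_def z)
qed

lemma vertex_values_cube:
 assumes s: "singular_simplex p (top_of_set (cube n \<tau>)) s" and n: "n \<in> lattice L"
 shows "box (vertex_values p s) q \<subseteq> cube_cells n \<tau> q"
proof
 fix c assume c: "c \<in> box (vertex_values p s) q"
 obtain \<sigma> k where ck: "c = (\<sigma>, k)" by fastforce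
 have val: "u = n $ i \<or> i \<in> \<tau> \<and> u = n $ i + 1" if u: "u \<in> vertex_values p s i" for u i
 proof -
  obtain j where j: "j \<le> p" "u = round_vec (s (vertex j)) $ i" using u by (auto simp: vertex_values_def)
  have "s (vertex j) \<in> cube n \<tau>"
   using s vertex_standard_simplex[OF j(1)] by (auto simp: singular_simplex_cont)
  then show ?thesis using round_vec_cube[of _ n \<tau> i] n j(2) by (simp add: lattice_def)
 qed
 have k: "k $ i \<in> vertex_values p s i" "i \<in> \<sigma> ==> k $ i + 1 \<in> vertex_values p s i" for i
  using c unfolding ck box_def by blast+
 have 1: "i \<in> \<tau> \<and> k $ i = n $ i" if "i \<in> \<sigma>" for i
  using val[OF k(1)[of i]] val[OF k(2)[OF that]] by auto
 have 2: "k $ i = n $ i \<or> i \<in> \<tau> - \<sigma> \<and> k $ i = n $ i + 1" for i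
  using val[OF k(1)[of i]] 1[of i] by auto
 show "c \<in> cube_cells n \<tau> q" using c 1 2 unfolding ck box_def cube_cells_def by blast
qed

lemma cube_in_star:
 assumes c: "(\<tau>, n) \<in> box V q" and cell: "(\<tau>, n) \<in> cells L q"
 shows "cube n \<tau> \<subseteq> star_nbhd V"
proof
 fix x assume x: "x \<in> cube n \<tau>"
 have "\<exists>u\<in>V i. \<bar>x $ i - u\<bar> < 1" for i
 proof (cases "x $ i < n $ i + 1")
  case True
  have "n $ i \<in> V i" using c unfolding box_def by blast
  then show ?thesis using True cubeD[OF x, of i] by (intro bexI[of _ "n $ i"]) auto
 next
  case False
  then have i: "i \<in> \<tau>" "x $ i = n $ i + 1" using cubeD[OF x, of i] by (auto split: if_splits)
  then have "n $ i + 1 \<in> V i" using c unfolding box_def by blast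
  then show ?thesis using i by (intro bexI[of _ "n $ i + 1"]) auto
 qed
 then show "x \<in> star_nbhd V" using cube_subset_cover[OF L cell] x unfolding star_nbhd_def by blast
qed

text \<open>All chain maps are carried by cubes and open stars, and subdivision does not leave the image of
 a simplex; so the acyclic carrier theorem provides the two homotopies of a chain equivalence.\<close>

theorem singular_cellular_iso:
 "\<exists>T. quotient_iso (S.cocycles p :: (_ => 'k::comm_ring_1) set) (S.coboundaries p) (K.cocycles p) (K.coboundaries p) T"
proof (cases "p < 0")
 case True
 then show ?thesis
  unfolding S.cochains_neg_cobound[OF True] K.cochains_neg_cobound[OF True] quotient_iso_def
  by (intro exI[of _ "\<lambda>\<phi> c. 0"]) (simp add: lin_on_def)
next
 case False
 define q where "q = nat p"
 have p: "p = int q" using False by (simp add: q_def)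
 obtain F where F: "MK.chain_morphism F" and Fc: "!!p. MKc.carried p p (F p)"
  and Fa: "!!b. b \<in> Small 0 ==> augmentation (F 0 b) = 1"
  using MKc.carried_chain_morphism by blast
 obtain G where G: "KS.chain_morphism G" and Gc: "!!p. KSc.carried p p (G p)"
  and Ga: "!!b. b \<in> cells L 0 ==> augmentation (G 0 b) = 1"
  using KSc.carried_chain_morphism by blast
 obtain \<rho> D where \<rho>: "SM.chain_morphism \<rho>" and D: "!!p. SS.equivariant p (Suc p) (D p)"
  and D0: "!!s. s \<in> Sing 0 ==> chain_boundary (Suc 0) (D 0 s) = \<rho> 0 s - frag_of s"
  and DS: "!!p s. s \<in> Sing (Suc p) ==> chain_boundary (Suc (Suc p)) (D (Suc p) s) =
    \<rho> (Suc p) s - frag_of s - frag_extend (D p) (simplex_boundary (Suc p) s)"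
  and \<rho>_img: "!!p s. s \<in> Sing p ==> singular_chain p (top_of_set (s ` standard_simplex p)) (\<rho> p s)"
  and \<rho>_aug: "!!s. s \<in> Sing 0 ==> augmentation (\<rho> 0 s) = 1"
  using small_approximation by blast
 note Fe = MK.chain_morphism_equivariant[OF F] and Ge = KS.chain_morphism_equivariant[OF G]
  and \<rho>e = SM.chain_morphism_equivariant[OF \<rho>]
 define E where "E p s = frag_extend (G p) (F p s) - frag_of s" for p s
 have "\<exists>D1. (\<forall>p. MS.equivariant p (Suc p) (D1 p)) \<and> (\<forall>b\<in>Small 0. S.dd (Suc 0) (D1 0 b) = E 0 b) \<and>
  (\<forall>p. \<forall>b\<in>Small (Suc p). S.dd (Suc (Suc p)) (D1 (Suc p) b) = E (Suc p) b - frag_extend (D1 p) (simplex_boundary (Suc p) b))"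
 proof (rule MSc.carried_homotopy)
  fix p
  have SmS: "s \<in> Sing p" if "s \<in> Small p" for s using that by (simp add: simplices_def)
  show "MS.equivariant p p (E p)"
   unfolding MS.equivariant_def
  proof (intro ballI conjI)
   fix s n assume s: "s \<in> Small p"
   show "keys (E p s) \<subseteq> Sing p"
    unfolding E_def using KS.equivariant_ext_keys[OF Ge MK.equivariant_keys[OF Fe s]] SmS[OF s]
    by (intro keys_diff_subset) auto
   assume n: "n \<in> lattice L"
   show "E p (simplex_translate p n s) = S.ext_tr p n (E p s)"
    by (simp add: E_def MK.equivariant_tr[OF Fe s n] KS.equivariant_ext_tr[OF Ge MK.equivariant_keys[OF Fe s] n] frag_extend_diff)
  qed
  show "MSc.carried p p (E p)"
   unfolding MSc.carried_def
  proof
   fix s assume s: "s \<in> Small p"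
   have "keys (frag_extend (G p) (F p s)) \<subseteq> Collect (singular_simplex p (top_of_set (star_nbhd (vertex_values p s))))"
   proof (rule keys_frag_extend_subset)
    fix c assume c: "c \<in> keys (F p s)"
    then have box: "c \<in> box (vertex_values p s) p" using Fc[of p] s unfolding MKc.carried_def by blast
    have cell: "c \<in> cells L p" using MK.equivariant_keys[OF Fe s] c by blast
    have "cube (snd c) (fst c) \<subseteq> star_nbhd (vertex_values p s)"
     using cube_in_star[of "fst c" "snd c" _ p] box cell by simp
    moreover have "keys (G p c) \<subseteq> Collect (singular_simplex p (top_of_set (cube (snd c) (fst c))))"
     using Gc[of p] cell unfolding KSc.carried_def by blast
    ultimately show "keys (G p c) \<subseteq> Collect (singular_simplex p (top_of_set (star_nbhd (vertex_values p s))))"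
     using singular_simplex_subset by blast
   qed
   then show "keys (E p s) \<subseteq> Collect (singular_simplex p (top_of_set (star_nbhd (vertex_values p s))))"
    unfolding E_def using small_in_star[OF s] by (intro keys_diff_subset) auto
  qed
 next
  fix s assume s: "s \<in> Small 0"
  have "augmentation (frag_extend (G 0) (F 0 s)) = augmentation (F 0 s)"
   by (rule augmentation_frag_extend) (use Ga MK.equivariant_keys[OF Fe s] in blast)
  then show "augmentation (E 0 s) = 0" using Fa[OF s] by (simp add: E_def pairing_diff)
 next
  fix p s assume s: "s \<in> Small (Suc p)"
  have "S.dd (Suc p) (frag_extend (G (Suc p)) (F (Suc p) s)) = frag_extend (G p) (K.dd (Suc p) (F (Suc p) s))"
   by (rule KS.chain_morphism_dd[OF G MK.equivariant_keys[OF Fe s]])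
  also have "K.dd (Suc p) (F (Suc p) s) = frag_extend (F p) (simplex_boundary (Suc p) s)"
   using F s by (simp add: MK.chain_morphism_def)
  finally show "S.dd (Suc p) (E (Suc p) s) = frag_extend (E p) (simplex_boundary (Suc p) s)"
   unfolding E_def frag_extend_diff_fun by (simp add: frag_extend_diff frag_extend_frag_extend frag_extend_id)
 qed
 then obtain D1 where D1: "!!p. MS.equivariant p (Suc p) (D1 p)" "!!b. b \<in> Small 0 ==> S.dd (Suc 0) (D1 0 b) = E 0 b"
  "!!p b. b \<in> Small (Suc p) ==> S.dd (Suc (Suc p)) (D1 (Suc p) b) = E (Suc p) b - frag_extend (D1 p) (simplex_boundary (Suc p) b)"
  by blast
 define E' where "E' p c = frag_extend (F p) (frag_extend (\<rho> p) (G p c)) - frag_of c" for p c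
 have \<rho>G: "keys (frag_extend (\<rho> p) (G p c)) \<subseteq> Small p" if "c \<in> cells L p" for p c
  by (rule SM.equivariant_ext_keys[OF \<rho>e KS.equivariant_keys[OF Ge that]])
 have "\<exists>D2. (\<forall>p. KK.equivariant p (Suc p) (D2 p)) \<and> (\<forall>b\<in>cells L 0. K.dd (Suc 0) (D2 0 b) = E' 0 b) \<and>
  (\<forall>p. \<forall>b\<in>cells L (Suc p). K.dd (Suc (Suc p)) (D2 (Suc p) b) = E' (Suc p) b - frag_extend (D2 p) (cell_boundary b))"
 proof (rule KKc.carried_homotopy)
  fix p
  show "KK.equivariant p p (E' p)"
   unfolding KK.equivariant_def
  proof (intro ballI conjI)
   fix c n assume c: "c \<in> cells L p"
   show "keys (E' p c) \<subseteq> cells L p"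
    unfolding E'_def using MK.equivariant_ext_keys[OF Fe \<rho>G[OF c]] c
    by (intro keys_diff_subset) auto
   assume n: "n \<in> lattice L"
   show "E' p (cell_translate n c) = K.ext_tr p n (E' p c)"
    by (simp add: E'_def KS.equivariant_tr[OF Ge c n] SM.equivariant_ext_tr[OF \<rho>e KS.equivariant_keys[OF Ge c] n]
      MK.equivariant_ext_tr[OF Fe \<rho>G[OF c] n] frag_extend_diff)
  qed
  show "KKc.carried p p (E' p)"
   unfolding KKc.carried_def
  proof
   fix c assume c: "c \<in> cells L p"
   obtain \<tau> n where cn: "c = (\<tau>, n)" by fastforce
   have n: "n \<in> lattice L" using c cn by (simp add: cells_def)
   have "keys (frag_extend (F p) (frag_extend (\<rho> p) (G p c))) \<subseteq> cube_cells n \<tau> p"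
    unfolding frag_extend_frag_extend[of "F p" "\<rho> p"]
   proof (rule keys_frag_extend_subset, rule keys_frag_extend_subset)
    fix s t assume s: "s \<in> keys (G p c)" and t: "t \<in> keys (\<rho> p s)"
    have sS: "s \<in> Sing p" using KS.equivariant_keys[OF Ge c] s by blast
    have "keys (G p c) \<subseteq> Collect (singular_simplex p (top_of_set (cube (snd c) (fst c))))"
     using Gc[of p] c unfolding KSc.carried_def by blast
    then have "singular_simplex p (top_of_set (cube n \<tau>)) s" using s by (auto simp: cn)
    then have "s ` standard_simplex p \<subseteq> cube n \<tau>" by (simp add: singular_simplex_cont)
    moreover have "singular_simplex p (top_of_set (s ` standard_simplex p)) t"
     using \<rho>_img[OF sS] t by (simp add: singular_chain_keys)
    ultimately have "singular_simplex p (top_of_set (cube n \<tau>)) t" by (metis singular_simplex_subset)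
    then have "box (vertex_values p t) p \<subseteq> cube_cells n \<tau> p" by (rule vertex_values_cube[OF _ n])
    moreover have "t \<in> Small p" using SM.equivariant_keys[OF \<rho>e sS] t by blast
    then have "keys (F p t) \<subseteq> box (vertex_values p t) p"
     using Fc[of p] unfolding MKc.carried_def by blast
    ultimately show "keys (F p t) \<subseteq> cube_cells n \<tau> p" by blast
   qed
   moreover have "c \<in> cube_cells n \<tau> p" using c by (auto simp: cn cells_def cube_cells_def)
   ultimately show "keys (E' p c) \<subseteq> cube_cells (snd c) (fst c) p"
    unfolding E'_def cn by (intro keys_diff_subset) auto
  qed
 next
  fix c assume c: "c \<in> cells L 0"
  have "augmentation (frag_extend (F 0) (frag_extend (\<rho> 0) (G 0 c))) = augmentation (frag_extend (\<rho> 0) (G 0 c))"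
   by (rule augmentation_frag_extend) (use Fa \<rho>G[OF c] in blast)
  also have "\<dots> = augmentation (G 0 c)"
   by (rule augmentation_frag_extend) (use \<rho>_aug KS.equivariant_keys[OF Ge c] in blast)
  finally show "augmentation (E' 0 c) = 0" using Ga[OF c] by (simp add: E'_def pairing_diff)
 next
  fix p c assume c: "c \<in> cells L (Suc p)"
  have "K.dd (Suc p) (frag_extend (F (Suc p)) (frag_extend (\<rho> (Suc p)) (G (Suc p) c))) =
    frag_extend (F p) (M.dd (Suc p) (frag_extend (\<rho> (Suc p)) (G (Suc p) c)))"
   by (rule MK.chain_morphism_dd[OF F \<rho>G[OF c]])
  also have "M.dd (Suc p) (frag_extend (\<rho> (Suc p)) (G (Suc p) c)) = frag_extend (\<rho> p) (S.dd (Suc p) (G (Suc p) c))"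
   by (rule SM.chain_morphism_dd[OF \<rho> KS.equivariant_keys[OF Ge c]])
  also have "S.dd (Suc p) (G (Suc p) c) = frag_extend (G p) (cell_boundary c)"
   using G c by (simp add: KS.chain_morphism_def)
  finally show "K.dd (Suc p) (E' (Suc p) c) = frag_extend (E' p) (cell_boundary c)"
   unfolding E'_def frag_extend_diff_fun by (simp add: frag_extend_diff frag_extend_frag_extend frag_extend_id)
 qed
 then obtain D2 where D2: "!!p. KK.equivariant p (Suc p) (D2 p)" "!!b. b \<in> cells L 0 ==> K.dd (Suc 0) (D2 0 b) = E' 0 b"
  "!!p b. b \<in> cells L (Suc p) ==> K.dd (Suc (Suc p)) (D2 (Suc p) b) = E' (Suc p) b - frag_extend (D2 p) (cell_boundary b)"
  by blast
 define T where "T = (pullback (cells L q) (G q) :: (_ => 'k) => _)"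
 define U where "U \<phi> = pullback (Sing q) (\<rho> q) (pullback (Small q) (F q) \<phi>)" for \<phi> :: "_ => 'k"
 have "quotient_iso (S.cocycles p :: (_ => 'k) set) (S.coboundaries p) (K.cocycles p) (K.coboundaries p) T"
  unfolding p
 proof (rule quotient_isoI[where U=U])
  show "lin_on (S.cocycles (int q)) T" unfolding T_def by (rule pullback_lin_on)
  show "T z \<in> K.cocycles (int q)" if "z \<in> S.cocycles (int q)" for z
   unfolding T_def by (rule KS.pullback_cocycles[OF G that])
  show "T z \<in> K.coboundaries (int q)" if "z \<in> S.coboundaries (int q)" for z
   unfolding T_def by (rule KS.pullback_coboundaries[OF G that])
  show "U z \<in> S.cocycles (int q)" if "z \<in> K.cocycles (int q)" for z
   unfolding U_def by (rule SM.pullback_cocycles[OF \<rho> MK.pullback_cocycles[OF F that]])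
  show "U z \<in> S.coboundaries (int q)" if "z \<in> K.coboundaries (int q)" for z
   unfolding U_def by (rule SM.pullback_coboundaries[OF \<rho> MK.pullback_coboundaries[OF F that]])
 next
  fix z :: "_ => 'k" assume z: "z \<in> S.cocycles (int q)"
  have 1: "pullback (Small q) (E q) z \<in> M.coboundaries (int q)"
   by (rule MS.pullback_null_homotopic[OF D1 z])
  have 2: "pullback (Sing q) (\<lambda>s. \<rho> q s - frag_of s) z \<in> S.coboundaries (int q)"
   by (rule SS.pullback_null_homotopic[of D "\<lambda>p s. \<rho> p s - frag_of s"])
    (use D D0 DS z in \<open>simp_all add: frag_extend_simplex_boundary\<close>)
  have "(\<lambda>b. U (T z) b - z b) = (\<lambda>b. pullback (Sing q) (\<rho> q) (pullback (Small q) (E q) z) b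
    + pullback (Sing q) (\<lambda>s. \<rho> q s - frag_of s) z b)"
  proof
   fix b
   show "U (T z) b - z b = pullback (Sing q) (\<rho> q) (pullback (Small q) (E q) z) b
    + pullback (Sing q) (\<lambda>s. \<rho> q s - frag_of s) z b"
   proof (cases "b \<in> Sing q")
    case True
    note r = SM.equivariant_keys[OF \<rho>e True]
    have "pairing (pullback (Small q) (F q) (pullback (cells L q) (G q) z)) (\<rho> q b) =
      pairing (pullback (cells L q) (G q) z) (frag_extend (F q) (\<rho> q b))"
     by (rule pullback_pullback[OF True r])
    also have "\<dots> = pairing z (frag_extend (G q) (frag_extend (F q) (\<rho> q b)))"
     by (rule pullback_pullback[where b=b and A=UNIV and F="\<lambda>b. frag_extend (F q) (\<rho> q b)"])
      (use MK.equivariant_ext_keys[OF Fe r] in auto)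
    finally have UT: "U (T z) b = pairing z (frag_extend (G q) (frag_extend (F q) (\<rho> q b)))"
     using True by (simp add: U_def T_def pullback_def[of "Sing q"])
    have "pairing (pullback (Small q) (E q) z) (\<rho> q b) = pairing z (frag_extend (E q) (\<rho> q b))"
     by (rule pullback_pullback[OF True r])
    also have "frag_extend (E q) (\<rho> q b) = frag_extend (G q) (frag_extend (F q) (\<rho> q b)) - \<rho> q b"
     unfolding E_def frag_extend_diff_fun by (simp add: frag_extend_frag_extend frag_extend_id)
    finally show ?thesis
     using True UT by (simp add: pullback_def[of "Sing q"] pairing_diff)
   next
    case False
    then have "z b = 0" using z by (simp add: S.cocycles_def S.cochains_nat)
    then show ?thesis using False by (simp add: U_def pullback_def[of "Sing q"])
   qed
  qed
  also have "\<dots> \<in> S.coboundaries (int q)"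
   by (rule fun_submodule_add[OF S.coboundaries_submodule SM.pullback_coboundaries[OF \<rho> 1] 2])
  finally show "(\<lambda>b. U (T z) b - z b) \<in> S.coboundaries (int q)" .
 next
  fix z :: "_ => 'k" assume z: "z \<in> K.cocycles (int q)"
  have "(\<lambda>b. T (U z) b - z b) = pullback (cells L q) (E' q) z"
  proof
   fix c
   show "T (U z) c - z c = pullback (cells L q) (E' q) z c"
   proof (cases "c \<in> cells L q")
    case True
    have "pairing (pullback (Sing q) (\<rho> q) (pullback (Small q) (F q) z)) (G q c) =
      pairing (pullback (Small q) (F q) z) (frag_extend (\<rho> q) (G q c))"
     by (rule pullback_pullback[where b=c and A="cells L q" and F="G q"]) (use True KS.equivariant_keys[OF Ge True] in auto)
    also have "\<dots> = pairing z (frag_extend (F q) (frag_extend (\<rho> q) (G q c)))"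
     by (rule pullback_pullback[where b=c and A=UNIV and F="\<lambda>c. frag_extend (\<rho> q) (G q c)"])
      (use \<rho>G[OF True] in auto)
    finally show ?thesis
     using True by (simp add: T_def U_def pullback_def[of "cells L q"] E'_def pairing_diff)
   next
    case False
    then have "z c = 0" using z by (cases c) (auto simp: K.cocycles_def K.cochains_nat)
    then show ?thesis using False by (simp add: T_def pullback_def[of "cells L q"])
   qed
  qed
  then show "(\<lambda>b. T (U z) b - z b) \<in> K.coboundaries (int q)"
   using KK.pullback_null_homotopic[OF D2 z] by simp
 qed (intro S.coboundaries_submodule K.coboundaries_submodule S.cocycles_submodule K.cocycles_submodule)+
 then show ?thesis by blast
qed

theorem singular_split_iso:
 "\<exists>T. quotient_iso (S.cocycles p :: (_ => 'k::comm_ring_1) set) (S.coboundaries p) (split_cocycles p) (split_coboundaries p) T"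
proof -
 obtain T where T: "quotient_iso (S.cocycles p :: (_ => 'k) set) (S.coboundaries p) (K.cocycles p) (K.coboundaries p) T"
  using singular_cellular_iso by blast
 obtain U where U: "quotient_iso (K.cocycles p :: (_ => 'k) set) (K.coboundaries p) (split_cocycles p) (split_coboundaries p) U"
  using cellular_split_iso by blast
 from quotient_iso_trans[OF T U K.cocycles_submodule split_coboundaries_submodule] show ?thesis by blast
qed

end

section \<open>The covering of the toric complex\<close>

definition exp_cover :: "real^'v => complex^'v::finite" where
 "exp_cover x = (\<chi> i. cis (2 * pi * x $ i))"

lemma exp_cover_nth [simp]: "exp_cover x $ i = cis (2 * pi * x $ i)"
 by (simp add: exp_cover_def)

lemma continuous_exp_cover: "continuous_on A exp_cover"
 unfolding exp_cover_def by (intro continuous_on_vec_lambda continuous_intros)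

lemma cis_2pi_eq_1_iff: "cis (2 * pi * x) = 1 \<longleftrightarrow> x \<in> \<int>"
proof
 assume "cis (2 * pi * x) = 1"
 then have "cos (2 * pi * x) = 1" by (metis cis.simps(1) one_complex.simps(1))
 then obtain n :: int where "2 * pi * x = of_int n * 2 * pi" using cos_one_2pi_int by blast
 then show "x \<in> \<int>" by simp
next
 assume "x \<in> \<int>"
 then obtain n where "x = of_int n" by (rule Ints_cases)
 then have "cis (2 * pi * x) = cis (2 * pi) powi n" by (simp add: cis_power_int mult.commute)
 then show "cis (2 * pi * x) = 1" by simp
qed

lemma exp_cover_eq_iff: "exp_cover x = exp_cover y \<longleftrightarrow> (\<forall>i. x $ i - y $ i \<in> \<int>)"
proof -
 have "cis (2 * pi * x $ i) = cis (2 * pi * y $ i) \<longleftrightarrow> x $ i - y $ i \<in> \<int>" for i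
 proof -
  have "cis (2 * pi * (x $ i - y $ i)) = cis (2 * pi * x $ i) / cis (2 * pi * y $ i)"
   by (simp add: cis_divide right_diff_distrib)
  then show ?thesis using cis_2pi_eq_1_iff[of "x $ i - y $ i"] by (simp add: divide_eq_1_iff)
 qed
 then show ?thesis by (simp add: vec_eq_iff)
qed

lemma mem_toric_complex: "simplicial_cx L ==>
 y \<in> toric_complex L \<longleftrightarrow> (\<forall>i. norm (y $ i) = 1) \<and> {i. y $ i ~= 1} \<in> L"
proof
 assume L: "simplicial_cx L" and "y \<in> toric_complex L"
 then obtain \<tau> where "\<tau> \<in> L" "\<forall>i. norm (y $ i) = 1" "\<forall>i. i \<notin> \<tau> --> y $ i = 1"
  by (auto simp: toric_complex_def)
 then show "(\<forall>i. norm (y $ i) = 1) \<and> {i. y $ i ~= 1} \<in> L"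
  using simplicial_cx_subset[OF L, of \<tau> "{i. y $ i ~= 1}"] by auto
next
 assume "(\<forall>i. norm (y $ i) = 1) \<and> {i. y $ i ~= 1} \<in> L"
 then show "y \<in> toric_complex L"
  unfolding toric_complex_def by (intro UN_I[of "{i. y $ i ~= 1}"]) auto
qed

context finite_complex
begin

abbreviation "X \<equiv> toric_complex L"
abbreviation "Xc \<equiv> abelian_cover L"

lemma exp_cover_mem: "x \<in> Xc ==> exp_cover x \<in> X"
 by (simp add: mem_toric_complex[OF L] abelian_cover_def cis_2pi_eq_1_iff)

lemma exp_cover_fibre: "x \<in> Xc ==> y \<in> Xc ==> exp_cover x = exp_cover y ==> x - y \<in> lattice L"
 by (simp add: exp_cover_eq_iff lattice_def abelian_cover_def)

lemma exp_cover_translate: "n \<in> lattice L ==> exp_cover (n + x) = exp_cover x"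
 by (simp add: exp_cover_eq_iff lattice_def)

lemma exp_cover_0: "exp_cover 0 = toric_base"
 by (simp add: toric_base_def vec_eq_iff)

lemma zero_in_cover: "0 \<in> Xc"
 using L by (simp add: abelian_cover_def simplicial_cx_def)

lemma lattice_in_cover: "n \<in> lattice L ==> n \<in> Xc"
 using abelian_cover_translate[of n L 0] zero_in_cover by simp

end

text \<open>A map from a compact contractible space to the circle has an angle function: along the
 contraction, the angle is the sum of small increments, each given by the principal logarithm.\<close>

lemma circle_lift:
 fixes f :: "'c::metric_space => complex"
 assumes S: "compact S" and a: "a \<in> S"
  and H: "continuous_on ({0..1} \<times> S) H" "!!t x. 0 \<le> t ==> t \<le> 1 ==> x \<in> S ==> H (t, x) \<in> S"
  "!!x. x \<in> S ==> H (0, x) = a" "!!x. x \<in> S ==> H (1::real, x) = x"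
  and f: "continuous_on S f" "!!x. x \<in> S ==> norm (f x) = 1"
 shows "\<exists>\<theta>. continuous_on S \<theta> \<and> (\<forall>x\<in>S. f x = f a * cis (\<theta> x))"
proof -
 define g where "g z = f (H z)" for z
 have Himg: "H ` ({0..1} \<times> S) \<subseteq> S" using H(2) by auto
 have g: "continuous_on ({0..1} \<times> S) g"
  unfolding g_def by (rule continuous_on_compose2[OF f(1) H(1) Himg])
 have g1: "norm (g (t, x)) = 1" if "0 \<le> t" "t \<le> 1" "x \<in> S" for t x
  using f(2) H(2)[OF that] by (simp add: g_def)
 have "uniformly_continuous_on ({0..1} \<times> S) g"
  by (intro compact_uniformly_continuous g compact_Times S compact_Icc)
 then obtain d where d: "d > 0"
  "!!z z'. z \<in> {0..1} \<times> S ==> z' \<in> {0..1} \<times> S ==> dist z' z < d ==> dist (g z') (g z) < 1"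
  unfolding uniformly_continuous_on_def by (metis zero_less_one)
 obtain N where N: "inverse (of_nat (Suc N)) < d" using reals_Archimedean[OF d(1)] by blast
 define s where "s j = real j / real (Suc N)" for j
 have s: "0 \<le> s j" "s j \<le> 1" if "j \<le> Suc N" for j using that by (auto simp: s_def divide_simps)
 define r where "r j x = g (s (Suc j), x) / g (s j, x)" for j x
 have r1: "norm (r j x) = 1" if "j \<le> N" "x \<in> S" for j x
  using that g1 s[of j] s[of "Suc j"] by (simp add: r_def norm_divide)
 have near: "norm (r j x - 1) < 1" if j: "j \<le> N" and x: "x \<in> S" for j x
 proof -
  have "dist (s (Suc j)) (s j) = inverse (of_nat (Suc N))"
   by (simp add: dist_real_def s_def field_simps)
  then have "dist (s (Suc j), x) (s j, x) = inverse (of_nat (Suc N))"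
   by (simp only: dist_Pair_Pair dist_self) simp
  then have "dist (g (s (Suc j), x)) (g (s j, x)) < 1"
   using s[of j] s[of "Suc j"] j x N by (intro d(2)) auto
  moreover have n: "norm (g (s j, x)) = 1" using g1 s[of j] j x by simp
  then have "g (s j, x) ~= 0" by auto
  then have "r j x - 1 = (g (s (Suc j), x) - g (s j, x)) / g (s j, x)" by (simp add: r_def field_simps)
  ultimately show ?thesis using n by (simp add: norm_divide dist_norm)
 qed
 have npos: "r j x \<notin> \<real>\<^sub>\<le>\<^sub>0" if "j \<le> N" "x \<in> S" for j x
 proof
  assume "r j x \<in> \<real>\<^sub>\<le>\<^sub>0"
  then have "Re (r j x) \<le> 0" by (auto simp: complex_nonpos_Reals_iff)
  then have "1 \<le> \<bar>Re (r j x - 1)\<bar>" by simp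
  also have "\<dots> \<le> norm (r j x - 1)" by (rule abs_Re_le_cmod)
  finally show False using near[OF that] by simp
 qed
 define \<theta> where "\<theta> x = (\<Sum>j\<le>N. Im (Ln (r j x)))" for x
 have slice: "continuous_on S (\<lambda>x. g (s j, x))" if "j \<le> Suc N" for j
  by (rule continuous_on_compose2[OF g]) (use s[OF that] in \<open>auto intro!: continuous_intros\<close>)
 have "continuous_on S (\<lambda>x. r j x)" if "j \<le> N" for j
  unfolding r_def using that g1 s[of j]
  by (intro continuous_on_divide slice) (auto, metis norm_zero zero_neq_one)
 then have "continuous_on S \<theta>"
  unfolding \<theta>_def by (intro continuous_intros) (use npos in auto)
 moreover have "f x = f a * cis (\<theta> x)" if x: "x \<in> S" for x
 proof -
  have ne: "g (s j, x) ~= 0" if "j \<le> Suc N" for j using g1 s[OF that] x by (metis norm_zero zero_neq_one)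
  have cis_r: "cis (Im (Ln (r j x))) = r j x" if "j \<le> N" for j
  proof -
   have r0: "r j x ~= 0" using r1[OF that x] by auto
   have "Re (Ln (r j x)) = 0" using Re_Ln[OF r0] r1[OF that x] by simp
   then have "exp (Ln (r j x)) = cis (Im (Ln (r j x)))" by (simp add: exp_eq_polar)
   then show ?thesis using exp_Ln[OF r0] by simp
  qed
  have "cis (\<theta> x) = (\<Prod>j\<le>N. cis (Im (Ln (r j x))))"
  proof -
   have "cis (\<Sum>j\<in>A. h j) = (\<Prod>j\<in>A. cis (h j))" if "finite A" for A :: "nat set" and h
    using that by (induction A) (auto simp flip: cis_mult)
   then show ?thesis by (simp add: \<theta>_def)
  qed
  also have "\<dots> = (\<Prod>j\<le>N. r j x)" using cis_r by simp
  also have "\<dots> = g (s (Suc N), x) / g (s 0, x)"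
  proof -
   have "(\<Prod>j\<le>k. r j x) = g (s (Suc k), x) / g (s 0, x)" if "k \<le> N" for k
    using that
   proof (induction k)
    case 0
    then show ?case by (simp add: r_def)
   next
    case (Suc k)
    then have "(\<Prod>j\<le>Suc k. r j x) = g (s (Suc k), x) / g (s 0, x) * r (Suc k) x" by simp
    also have "\<dots> = g (s (Suc (Suc k)), x) / g (s 0, x)"
     using ne[of "Suc k"] Suc.prems by (simp add: r_def)
    finally show ?case .
   qed
   then show ?thesis by simp
  qed
  also have "\<dots> = f x / f a" using H(3,4)[OF x] by (simp add: g_def s_def)
  finally have "cis (\<theta> x) = f x / f a" .
  moreover have "f a ~= 0" using f(2)[OF a] by auto
  ultimately show ?thesis by simp
 qed
 ultimately show ?thesis by blast
qed

definition contracts_to :: "'c::topological_space set => 'c => bool" where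
 "contracts_to S a \<longleftrightarrow> a \<in> S \<and> (\<exists>H. continuous_on ({0..1::real} \<times> S) H \<and>
   (\<forall>t x. 0 \<le> t --> t \<le> 1 --> x \<in> S --> H (t, x) \<in> S) \<and> (\<forall>x\<in>S. H (0, x) = a \<and> H (1, x) = x))"

lemma contracts_to_connected:
 assumes "contracts_to S a"
 shows "connected S"
proof -
 obtain H where H: "continuous_on ({0..1::real} \<times> S) H" "!!t x. 0 \<le> t ==> t \<le> 1 ==> x \<in> S ==> H (t, x) \<in> S"
  "!!x. x \<in> S ==> H (0, x) = a" "!!x. x \<in> S ==> H (1, x) = x"
  using assms unfolding contracts_to_def by blast
 define \<C> where "\<C> = {C. connected C \<and> a \<in> C \<and> C \<subseteq> S}"
 have "\<exists>C. (connected C \<and> a \<in> C \<and> C \<subseteq> S) \<and> x \<in> C" if x: "x \<in> S" for x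
 proof (intro exI conjI)
  have "continuous_on {0..1} (\<lambda>t. H (t, x))"
   by (rule continuous_on_compose2[OF H(1)]) (use x in \<open>auto intro!: continuous_intros\<close>)
  then show "connected ((\<lambda>t. H (t, x)) ` {0..1})" by (intro connected_continuous_image) auto
  show "a \<in> (\<lambda>t. H (t, x)) ` {0..1}" by (rule image_eqI[of _ _ 0]) (use H(3)[OF x] in auto)
  show "x \<in> (\<lambda>t. H (t, x)) ` {0..1}" by (rule image_eqI[of _ _ 1]) (use H(4)[OF x] in auto)
  show "(\<lambda>t. H (t, x)) ` {0..1} \<subseteq> S" using H(2) x by auto
 qed
 then have "S \<subseteq> \<Union>\<C>" by (intro subsetI) (simp add: \<C>_def)
 moreover have "\<Union>\<C> \<subseteq> S" by (auto simp: \<C>_def)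
 ultimately have "S = \<Union>\<C>" by (rule subset_antisym)
 moreover have "connected (\<Union>\<C>)" by (rule connected_Union) (auto simp: \<C>_def)
 ultimately show ?thesis by simp
qed

lemma connected_int_valued_constant:
 fixes h :: "'c::topological_space => real"
 assumes "connected S" "continuous_on S h" "!!x. x \<in> S ==> h x \<in> \<int>" "x \<in> S" "y \<in> S"
 shows "h x = h y"
proof -
 have "\<not> h u < h w" if uw: "u \<in> S" "w \<in> S" for u w
 proof
  assume less: "h u < h w"
  have conn: "connected (h ` S)" by (rule connected_continuous_image[OF assms(2,1)])
  obtain a b where ab: "h u = of_int a" "h w = of_int b" using assms(3) uw by (metis Ints_cases)
  have "h u + 1/2 \<in> {h u..h w}" using less unfolding ab by auto
  then have "h u + 1/2 \<in> h ` S" using connected_contains_Icc[OF conn, of "h u" "h w"] uw by blast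
  then obtain z where "h u + 1/2 = of_int z" using assms(3) by (metis Ints_cases imageE)
  then have "2 * a + 1 = 2 * z" unfolding ab by linarith
  then show False by presburger
 qed
 then show ?thesis using assms(4,5) by (meson linorder_neqE_linordered_idom)
qed

lemma contracts_to_unit_interval: "contracts_to {0..1::real} 0"
 unfolding contracts_to_def
 by (intro conjI exI[of _ "\<lambda>(t, x). t * x"]) (auto simp: split_def intro!: continuous_intros mult_le_one)

lemma contracts_to_unit_square: "contracts_to ({0..1::real} \<times> {0..1::real}) (0, 0)"
 unfolding contracts_to_def
 by (intro conjI exI[of _ "\<lambda>z. (fst z * fst (snd z), fst z * snd (snd z))"])
  (auto intro!: continuous_intros mult_le_one)

lemma compact_standard_simplex: "compact (standard_simplex p)"
 using compactin_standard_simplex[of p] by (simp add: euclidean_product_topology)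

lemma contracts_to_standard_simplex: "contracts_to (standard_simplex p) (vertex 0)"
 unfolding contracts_to_def
proof (intro conjI exI[of _ "\<lambda>(t, x) i. (1 - t) * vertex 0 i + t * x i"])
 show "vertex 0 \<in> standard_simplex p" by (simp add: vertex_standard_simplex)
 show "continuous_on ({0..1} \<times> standard_simplex p) (\<lambda>(t, x) i. (1 - t) * vertex 0 i + t * x i)"
 proof (rule continuous_on_coordinatewise_then_product)
  fix i
  have "continuous_on ({0..1} \<times> standard_simplex p) (\<lambda>z. snd z i)"
   by (rule continuous_on_product_then_coordinatewise) (intro continuous_intros)
  then show "continuous_on ({0..1} \<times> standard_simplex p) (\<lambda>z. (case z of (t, x) => \<lambda>i. (1 - t) * vertex 0 i + t * x i) i)"
   by (auto simp: split_def intro!: continuous_intros)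
 qed
 have "(\<lambda>i. (1 - t) * vertex 0 i + t * x i) \<in> standard_simplex p" if "0 \<le> t" "t \<le> 1" "x \<in> standard_simplex p" for t x
  using convex_standard_simplex[of "vertex 0" p x t] that vertex_standard_simplex[of 0 p]
  by simp
 then show "\<forall>t x. 0 \<le> t --> t \<le> 1 --> x \<in> standard_simplex p -->
   (case (t, x) of (t, x) => \<lambda>i. (1 - t) * vertex 0 i + t * x i) \<in> standard_simplex p"
  by simp
qed auto

context finite_complex
begin

definition is_lift :: "'c::topological_space set => ('c => complex^'v) => ('c => real^'v) => bool" where
 "is_lift S f g \<longleftrightarrow> continuous_on S g \<and> g ` S \<subseteq> Xc \<and> (\<forall>x\<in>S. exp_cover (g x) = f x)"

text \<open>The coordinates of the lift are the angle functions of the coordinates of the map, shifted so as to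
 start at \<open>y\<close>.\<close>

lemma lift_exists:
 fixes f :: "'c::metric_space => complex^'v"
 assumes S: "compact S" "contracts_to S a" and f: "continuous_on S f" "f ` S \<subseteq> X"
  and y: "y \<in> Xc" "exp_cover y = f a"
 shows "\<exists>g. is_lift S f g \<and> g a = y"
proof -
 obtain H where H: "continuous_on ({0..1::real} \<times> S) H" "!!t x. 0 \<le> t ==> t \<le> 1 ==> x \<in> S ==> H (t, x) \<in> S"
  "!!x. x \<in> S ==> H (0, x) = a" "!!x. x \<in> S ==> H (1, x) = x"
  using S(2) unfolding contracts_to_def by blast
 have a: "a \<in> S" using S(2) by (simp add: contracts_to_def)
 have fX: "norm (f x $ i) = 1" "{i. f x $ i ~= 1} \<in> L" if "x \<in> S" for x i
  using f(2) that mem_toric_complex[OF L, of "f x"] by auto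
 have "\<forall>i. \<exists>\<theta>. continuous_on S \<theta> \<and> (\<forall>x\<in>S. f x $ i = f a $ i * cis (\<theta> x))"
  by (intro allI circle_lift[OF S(1) a H]) (use f fX in \<open>auto intro!: continuous_intros\<close>)
 then obtain \<theta> where \<theta>: "!!i. continuous_on S (\<theta> i)" "!!i x. x \<in> S ==> f x $ i = f a $ i * cis (\<theta> i x)" by metis
 define g :: "'c => real^'v" where "g x = (\<chi> i. if i \<in> \<Union>L then y $ i + (\<theta> i x - \<theta> i a) / (2 * pi) else 0)" for x
 have y0: "y $ i = 0" if "i \<notin> \<Union>L" for i using y(1) that by (simp add: abelian_cover_def)
 have E: "exp_cover (g x) = f x" if x: "x \<in> S" for x
 proof -
  have "cis (2 * pi * g x $ i) = f x $ i" for i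
  proof (cases "i \<in> \<Union>L")
   case True
   have fa: "f a $ i ~= 0" using fX(1)[OF a, of i] by auto
   have "cis (\<theta> i a) = 1" using \<theta>(2)[OF a, of i] fa by simp
   then have "cis (\<theta> i x - \<theta> i a) = cis (\<theta> i x)" by (simp flip: cis_divide)
   moreover have "cis (2 * pi * y $ i) = f a $ i" using y(2) by (metis exp_cover_nth)
   moreover have "2 * pi * g x $ i = 2 * pi * y $ i + (\<theta> i x - \<theta> i a)" using True by (simp add: g_def field_simps)
   ultimately show ?thesis using \<theta>(2)[OF x, of i] by (simp flip: cis_mult)
  next
   case False
   then have "f x $ i = 1" using fX(2)[OF x] by blast
   then show ?thesis using False by (simp add: g_def)
  qed
  then show ?thesis by (simp add: vec_eq_iff)
 qed
 have "g x \<in> Xc" if x: "x \<in> S" for x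
 proof -
  have "cis (2 * pi * g x $ i) = f x $ i" for i using E[OF x] by (metis exp_cover_nth)
  then have "{i. g x $ i \<notin> \<int>} = {i. f x $ i ~= 1}" by (metis cis_2pi_eq_1_iff)
  then show ?thesis using fX(2)[OF x] by (simp add: abelian_cover_def g_def)
 qed
 moreover have "continuous_on S g"
  unfolding g_def
 proof (rule continuous_on_vec_lambda)
  fix i
  show "continuous_on S (\<lambda>x. if i \<in> \<Union>L then y $ i + (\<theta> i x - \<theta> i a) / (2 * pi) else 0)"
   using \<theta>(1)[of i] by (cases "i \<in> \<Union>L") (auto intro!: continuous_intros)
 qed
 moreover have "g a = y" using y0 by (simp add: g_def vec_eq_iff)
 ultimately show ?thesis using E by (auto simp: is_lift_def)
qed

text \<open>The difference is continuous and has integer coordinates.\<close>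

lemma lift_difference_constant:
 fixes f :: "'c::topological_space => complex^'v"
 assumes S: "connected S" and g: "is_lift S f g" and h: "is_lift S f h" and x: "x \<in> S" "y \<in> S"
 shows "g x - h x = g y - h y"
proof -
 have "(g x - h x) $ i = (g y - h y) $ i" for i
 proof (rule connected_int_valued_constant[OF S _ _ x, of "\<lambda>x. (g x - h x) $ i"])
  show "continuous_on S (\<lambda>x. (g x - h x) $ i)"
   using g h by (auto simp: is_lift_def intro!: continuous_intros)
  show "(g z - h z) $ i \<in> \<int>" if "z \<in> S" for z
   using g h that exp_cover_eq_iff[of "g z" "h z"] by (simp add: is_lift_def)
 qed
 then show ?thesis by (simp add: vec_eq_iff)
qed

lemma lift_unique:
 fixes f :: "'c::topological_space => complex^'v"
 assumes "connected S" "is_lift S f g" "is_lift S f h" "a \<in> S" "g a = h a" "x \<in> S"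
 shows "g x = h x"
 using lift_difference_constant[OF assms(1-3,6,4)] assms(5) by simp

lemma lift_translate: "n \<in> lattice L ==> is_lift S f g ==> is_lift S f (\<lambda>x. n + g x)"
 unfolding is_lift_def
 by (auto simp: exp_cover_translate abelian_cover_translate image_subset_iff intro!: continuous_intros)

text \<open>The endpoint, in the cover, of the lift from \<open>0\<close> of a path from the base point.\<close>

definition endpoint :: "(real => complex^'v) => real^'v" where
 "endpoint \<gamma> = (SOME g. is_lift {0..1} \<gamma> g \<and> g 0 = 0) 1"

abbreviation "based \<equiv> paths_from_to X toric_base"

lemma path_lift:
 assumes "\<gamma> \<in> paths_from_to X x z" "y \<in> Xc" "exp_cover y = x"
 shows "\<exists>g. is_lift {0..1} \<gamma> g \<and> g 0 = y"
 by (rule lift_exists[OF compact_Icc contracts_to_unit_interval])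
  (use assms in \<open>auto simp: paths_from_to_def path_def path_image_def pathstart_def\<close>)

lemma endpoint_eq:
 assumes "is_lift {0..1} \<gamma> g" "g 0 = 0"
 shows "endpoint \<gamma> = g 1"
proof -
 define P where "P g \<longleftrightarrow> is_lift {0..1} \<gamma> g \<and> g 0 = 0" for g
 define h where "h = (SOME g. P g)"
 have "P h" unfolding h_def by (rule someI[of P g]) (simp add: P_def assms)
 then have h: "is_lift {0..1} \<gamma> h" "h 0 = 0" by (simp_all add: P_def)
 have "h 1 = g 1" by (rule lift_unique[OF _ h(1) assms(1), of 0]) (simp_all add: h assms)
 then show ?thesis by (simp add: endpoint_def h_def P_def)
qed

lemma is_lift_exp_cover: "path g ==> path_image g \<subseteq> Xc ==> is_lift {0..1} (exp_cover \<circ> g) g"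
 by (simp add: is_lift_def path_def path_image_def)

lemma is_lift_path: "is_lift {0..1} \<gamma> g \<longleftrightarrow> path g \<and> path_image g \<subseteq> Xc \<and> (\<forall>t\<in>{0..1}. exp_cover (g t) = \<gamma> t)"
 by (simp add: is_lift_def path_def path_image_def)

lemma endpoint_exp_cover: "path g ==> path_image g \<subseteq> Xc ==> g 0 = 0 ==> endpoint (exp_cover \<circ> g) = g 1"
 by (rule endpoint_eq[OF is_lift_exp_cover])

lemma endpoint_props:
 assumes "\<gamma> \<in> based z"
 shows "endpoint \<gamma> \<in> Xc" "exp_cover (endpoint \<gamma>) = z"
proof -
 obtain g where g: "is_lift {0..1} \<gamma> g" "g 0 = 0" using path_lift[OF assms zero_in_cover exp_cover_0] by blast
 then show "endpoint \<gamma> \<in> Xc" "exp_cover (endpoint \<gamma>) = z"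
  using assms by (auto simp: endpoint_eq[OF g] is_lift_def paths_from_to_def pathfinish_def)
qed

lemma is_lift_join:
 assumes "is_lift {0..1} \<gamma> g" "is_lift {0..1} \<eta> h" "g 1 = h 0"
 shows "is_lift {0..1} (\<gamma> +++ \<eta>) (g +++ h)"
 using assms unfolding is_lift_path
 by (auto simp: pathfinish_def pathstart_def path_image_join intro!: path_join_imp) (auto simp: joinpaths_def)

lemma endpoint_join:
 assumes \<gamma>: "\<gamma> \<in> based z" and h: "is_lift {0..1} \<eta> h" "h 0 = endpoint \<gamma>"
 shows "endpoint (\<gamma> +++ \<eta>) = h 1"
proof -
 obtain g where g: "is_lift {0..1} \<gamma> g" "g 0 = 0" using path_lift[OF \<gamma> zero_in_cover exp_cover_0] by blast
 have "is_lift {0..1} (\<gamma> +++ \<eta>) (g +++ h)" using is_lift_join[OF g(1) h(1)] endpoint_eq[OF g] h(2) by simp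
 from endpoint_eq[OF this] show ?thesis using g(2) by (simp add: joinpaths_def)
qed

lemma endpoint_loop_join:
 assumes \<omega>: "\<omega> \<in> based toric_base" and \<gamma>: "\<gamma> \<in> based z"
 shows "endpoint (\<omega> +++ \<gamma>) = endpoint \<omega> + endpoint \<gamma>" "endpoint \<omega> \<in> lattice L"
proof -
 have "exp_cover (endpoint \<omega>) = exp_cover 0" by (simp only: endpoint_props(2)[OF \<omega>] exp_cover_0)
 then have "endpoint \<omega> - 0 \<in> lattice L" by (rule exp_cover_fibre[OF endpoint_props(1)[OF \<omega>] zero_in_cover])
 then show n: "endpoint \<omega> \<in> lattice L" by simp
 obtain g where g: "is_lift {0..1} \<gamma> g" "g 0 = 0" using path_lift[OF \<gamma> zero_in_cover exp_cover_0] by blast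
 show "endpoint (\<omega> +++ \<gamma>) = endpoint \<omega> + endpoint \<gamma>"
  using endpoint_join[OF \<omega> lift_translate[OF n g(1)]] g(2) endpoint_eq[OF g] by simp
qed

lemma endpoint_homotopic:
 assumes hom: "homotopic_paths X \<gamma> \<gamma>'" and \<gamma>: "pathstart \<gamma> = toric_base"
 shows "endpoint \<gamma> = endpoint \<gamma>'"
proof -
 obtain h where h: "continuous_on ({0..1} \<times> {0..1}) h" "h ` ({0..1} \<times> {0..1}) \<subseteq> X"
  "!!x. x \<in> {0..1} ==> h (0, x) = \<gamma> x" "!!x. x \<in> {0..1} ==> h (1, x) = \<gamma>' x"
  "!!t. t \<in> {0..1::real} ==> h (t, 0) = pathstart \<gamma> \<and> h (t, 1) = pathfinish \<gamma>"
  using hom unfolding homotopic_paths by (auto simp: pathstart_def pathfinish_def image_subset_iff_funcset)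
 have "exp_cover 0 = h (0, 0)" using h(5)[of 0] \<gamma> exp_cover_0 by simp
 then have "\<exists>g. is_lift ({0..1} \<times> {0..1}) h g \<and> g (0, 0) = 0"
  by (rule lift_exists[OF compact_Times[OF compact_Icc compact_Icc] contracts_to_unit_square h(1,2) zero_in_cover])
 then obtain g where g: "is_lift ({0..1} \<times> {0..1}) h g" "g (0, 0) = 0" by blast
 have gc: "continuous_on ({0..1} \<times> {0..1}) g" "!!s t. s \<in> {0..1} ==> t \<in> {0..1} ==> g (s, t) \<in> Xc"
  "!!s t. s \<in> {0..1} ==> t \<in> {0..1} ==> exp_cover (g (s, t)) = h (s, t)"
  using g(1) by (auto simp: is_lift_def image_subset_iff)
 have row: "continuous_on {0..1} (\<lambda>t. g (s, t))" if "s \<in> {0..1}" for s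
  by (rule continuous_on_compose2[OF gc(1)]) (use that in \<open>auto intro!: continuous_intros\<close>)
 have col: "continuous_on {0..1} (\<lambda>s. g (s, t))" if "t \<in> {0..1}" for t
  by (rule continuous_on_compose2[OF gc(1)]) (use that in \<open>auto intro!: continuous_intros\<close>)
 have edge: "g (s, t) = g (0, t)" if s: "s \<in> {0..1}" and t: "t = 0 \<or> t = 1" for s t
 proof (rule lift_unique[where f="\<lambda>s. h (s, t)" and a=0 and S="{0..1}" and g="\<lambda>s. g (s, t)" and h="\<lambda>s. g (0, t)" and x=s])
  have t': "t \<in> {0..1}" using t by auto
  show "is_lift {0..1} (\<lambda>s. h (s, t)) (\<lambda>s. g (s, t))"
   using col[OF t'] gc(2,3)[OF _ t'] by (auto simp: is_lift_def)
  have "exp_cover (g (0, t)) = h (s, t)" if "s \<in> {0..1}" for s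
   using gc(3)[OF _ t', of 0] h(5)[OF that] h(5)[of 0] t by auto
  then show "is_lift {0..1} (\<lambda>s. h (s, t)) (\<lambda>s. g (0, t))"
   using gc(2)[OF _ t', of 0] by (simp add: is_lift_def image_subset_iff)
 qed (use s in auto)
 have "g (1, 1) = g (0, 1)" "g (1, 0) = 0" using edge[of 1 1] edge[of 1 0] g(2) by auto
 moreover have "is_lift {0..1} \<gamma> (\<lambda>t. g (0, t))" "is_lift {0..1} \<gamma>' (\<lambda>t. g (1, t))"
  using row[of 0] row[of 1] gc(2,3)[of 0] gc(2,3)[of 1] h(3,4) by (simp_all add: is_lift_def image_subset_iff)
 ultimately show ?thesis
  using endpoint_eq[of \<gamma> "\<lambda>t. g (0, t)"] endpoint_eq[of \<gamma>' "\<lambda>t. g (1, t)"] g(2) by simp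
qed

end

section \<open>Paths in the cover\<close>

lemma paths_join: "g \<in> paths_from_to S x y ==> h \<in> paths_from_to S y z ==> g +++ h \<in> paths_from_to S x z"
 by (auto simp: paths_from_to_def path_image_join)

lemma paths_reverse: "g \<in> paths_from_to S x y ==> reversepath g \<in> paths_from_to S y x"
 by (auto simp: paths_from_to_def)

lemma paths_linepath: "closed_segment x y \<subseteq> S ==> linepath x y \<in> paths_from_to S x y"
 by (auto simp: paths_from_to_def)

lemma homotopic_assoc:
 "p \<in> paths_from_to S x y ==> q \<in> paths_from_to S y z ==> r \<in> paths_from_to S z w ==>
  homotopic_paths S (p +++ (q +++ r)) ((p +++ q) +++ r)"
 by (rule homotopic_paths_assoc) (auto simp: paths_from_to_def)

lemma homotopic_join:
 "homotopic_paths S p p' ==> homotopic_paths S q q' ==> p \<in> paths_from_to S x y ==> q \<in> paths_from_to S y z ==>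
  homotopic_paths S (p +++ q) (p' +++ q')"
 by (rule homotopic_paths_join) (auto simp: paths_from_to_def)

lemma homotopic_refl: "p \<in> paths_from_to S x y ==> homotopic_paths S p p"
 by (simp add: paths_from_to_def)

lemma homotopic_lid:
 fixes S :: "'a::real_normed_vector set"
 shows "p \<in> paths_from_to S x y ==> homotopic_paths S (linepath x x +++ p) p"
 by (rule homotopic_paths_lid') (auto simp: paths_from_to_def)

lemma homotopic_rid:
 fixes S :: "'a::real_normed_vector set"
 shows "p \<in> paths_from_to S x y ==> homotopic_paths S (p +++ linepath y y) p"
 by (rule homotopic_paths_rid') (auto simp: paths_from_to_def)

lemma homotopic_linv:
 fixes S :: "'a::real_normed_vector set"
 shows "p \<in> paths_from_to S x y ==> homotopic_paths S (reversepath p +++ p) (linepath y y)"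
 using homotopic_paths_linv[of p S] by (auto simp: paths_from_to_def)

lemma homotopic_cancel:
 fixes S :: "'a::real_normed_vector set"
 assumes b: "b \<in> paths_from_to S x y" and r: "r \<in> paths_from_to S y z"
 shows "homotopic_paths S (reversepath b +++ (b +++ r)) r"
proof -
 have "homotopic_paths S (reversepath b +++ (b +++ r)) ((reversepath b +++ b) +++ r)"
  by (rule homotopic_assoc[OF paths_reverse[OF b] b r])
 also have "homotopic_paths S \<dots> (linepath y y +++ r)"
  by (rule homotopic_join[OF homotopic_linv[OF b] homotopic_refl[OF r] paths_join[OF paths_reverse[OF b] b] r])
 also have "homotopic_paths S \<dots> r" by (rule homotopic_lid[OF r])
 finally show ?thesis .
qed

lemma homotopic_conjugate_join:
 fixes S :: "'a::real_normed_vector set"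
 assumes a: "a \<in> paths_from_to S x0 x" and b: "b \<in> paths_from_to S y0 y" and c: "c \<in> paths_from_to S z0 z"
  and g: "g \<in> paths_from_to S x y" and h: "h \<in> paths_from_to S y z"
 shows "homotopic_paths S ((a +++ (g +++ reversepath b)) +++ (b +++ (h +++ reversepath c)))
  (a +++ ((g +++ h) +++ reversepath c))"
proof -
 note b' = paths_reverse[OF b] and c' = paths_reverse[OF c]
 note r = paths_join[OF h c'] and gb = paths_join[OF g b']
 note br = paths_join[OF b r]
 have "homotopic_paths S ((a +++ (g +++ reversepath b)) +++ (b +++ (h +++ reversepath c)))
   (a +++ ((g +++ reversepath b) +++ (b +++ (h +++ reversepath c))))"
  by (rule homotopic_paths_sym[OF homotopic_assoc[OF a gb br]])
 also have "homotopic_paths S \<dots> (a +++ (g +++ (reversepath b +++ (b +++ (h +++ reversepath c)))))"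
  by (rule homotopic_join[OF homotopic_refl[OF a] homotopic_paths_sym[OF homotopic_assoc[OF g b' br]] a
     paths_join[OF gb br]])
 also have "homotopic_paths S \<dots> (a +++ (g +++ (h +++ reversepath c)))"
  by (rule homotopic_join[OF homotopic_refl[OF a] homotopic_join[OF homotopic_refl[OF g] homotopic_cancel[OF b r] g
     paths_join[OF b' br]] a paths_join[OF g paths_join[OF b' br]]])
 also have "homotopic_paths S \<dots> (a +++ ((g +++ h) +++ reversepath c))"
  by (rule homotopic_join[OF homotopic_refl[OF a] homotopic_assoc[OF g h c'] a paths_join[OF g r]])
 finally show ?thesis .
qed

lemma homotopic_in_simply_connected:
 fixes S :: "'a::real_normed_vector set"
 assumes "simply_connected S" "S \<subseteq> T" "g \<in> paths_from_to S x y" "h \<in> paths_from_to S x y"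
 shows "homotopic_paths T g h"
 using assms homotopic_paths_subset[of S g h T]
 unfolding simply_connected_eq_homotopic_paths paths_from_to_def by simp

lemma paths_mono: "g \<in> paths_from_to S x y ==> S \<subseteq> T ==> g \<in> paths_from_to T x y"
 by (auto simp: paths_from_to_def)

lemma round_vec_in_cube:
 assumes n: "n \<in> lattice L" and x: "x \<in> cube n \<tau>"
 shows "round_vec x \<in> cube n \<tau>"
 unfolding cube_def
proof (intro CollectI allI)
 fix i
 have "n $ i \<in> \<int>" using n by (simp add: lattice_def)
 then obtain k where k: "n $ i = of_int k" by (rule Ints_cases)
 have x': "of_int k \<le> x $ i" "x $ i \<le> of_int k + (if i \<in> \<tau> then 1 else 0)" using cubeD[OF x, of i] k by auto
 have "k \<le> \<lfloor>x $ i + 1/2\<rfloor>" "\<lfloor>x $ i + 1/2\<rfloor> \<le> k + (if i \<in> \<tau> then 1 else 0)"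
  using x' by (auto simp: le_floor_iff floor_le_iff split: if_splits)
 then have "real_of_int k \<le> of_int \<lfloor>x $ i + 1/2\<rfloor>" "real_of_int \<lfloor>x $ i + 1/2\<rfloor> \<le> of_int (k + (if i \<in> \<tau> then 1 else 0))"
  unfolding of_int_le_iff by simp_all
 then show "n $ i \<le> round_vec x $ i \<and> round_vec x $ i \<le> n $ i + (if i \<in> \<tau> then 1 else 0)"
  by (auto simp: round_vec_def k)
qed

context finite_complex
begin

lemma cube_in_cover: "\<tau> \<in> L ==> n \<in> lattice L ==> cube n \<tau> \<subseteq> Xc"
 using cube_subset_cover[OF L, of \<tau> n "card \<tau>"] by (simp add: cells_def)

text \<open>A coordinate of \<open>x\<close> that is not an integer stays between the same integers under a small change,
 and one that is an integer bounds the unit interval into which it moves.\<close>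

lemma nearby_points_share_cube:
 assumes x: "x \<in> Xc"
 shows "\<exists>e>0. \<forall>y\<in>Xc. (\<forall>i. \<bar>y $ i - x $ i\<bar> < e) --> (\<exists>n\<in>lattice L. \<exists>\<tau>\<in>L. x \<in> cube n \<tau> \<and> y \<in> cube n \<tau>)"
proof -
 define r where "r i = (if x $ i \<in> \<int> then 1 else min (frac (x $ i)) (1 - frac (x $ i)))" for i
 define e where "e = Min (range r)"
 have "r i > 0" for i by (auto simp: r_def frac_lt_1 frac_gt_0_iff)
 then have e0: "e > 0" by (simp add: e_def)
 have er: "e \<le> r i" for i by (simp add: e_def)
 show ?thesis
 proof (intro exI conjI ballI impI)
 show "e > 0" by (rule e0)
 fix y assume y: "y \<in> Xc" and "\<forall>i. \<bar>y $ i - x $ i\<bar> < e"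
 then have near: "\<bar>y $ i - x $ i\<bar> < e" for i by blast
 define n :: "real^'v" where "n = (\<chi> i. of_int \<lfloor>y $ i\<rfloor>)"
 define \<tau> where "\<tau> = {i. y $ i \<notin> \<int>}"
 have "n \<in> lattice L" using y by (simp add: n_def lattice_def abelian_cover_def)
 moreover have "\<tau> \<in> L" using y by (simp add: \<tau>_def abelian_cover_def)
 moreover have "y \<in> cube n \<tau>"
 proof -
  have "of_int \<lfloor>y $ i\<rfloor> = y $ i" if "y $ i \<in> \<int>" for i using that by (auto elim: Ints_cases)
  moreover have "of_int \<lfloor>y $ i\<rfloor> \<le> y $ i \<and> y $ i \<le> of_int \<lfloor>y $ i\<rfloor> + 1" for i by linarith
  ultimately show ?thesis by (simp add: cube_def n_def \<tau>_def)
 qed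
 moreover have "x \<in> cube n \<tau>"
  unfolding cube_def
 proof (intro CollectI allI)
  fix i
  have lt: "\<bar>y $ i - x $ i\<bar> < r i" using near[of i] er[of i] by linarith
  show "n $ i \<le> x $ i \<and> x $ i \<le> n $ i + (if i \<in> \<tau> then 1 else 0)"
  proof (cases "x $ i \<in> \<int>")
   case True
   then obtain k where k: "x $ i = of_int k" by (rule Ints_cases)
   have d: "\<bar>y $ i - of_int k\<bar> < 1" using lt by (simp add: r_def True flip: k)
   then have "\<lfloor>y $ i\<rfloor> \<le> k" "k \<le> \<lfloor>y $ i\<rfloor> + 1" by linarith+
   then have "of_int \<lfloor>y $ i\<rfloor> \<le> real_of_int k" "real_of_int k \<le> of_int \<lfloor>y $ i\<rfloor> + 1" by linarith+
   moreover have "real_of_int k \<le> of_int \<lfloor>y $ i\<rfloor>" if "y $ i \<in> \<int>"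
   proof -
    from that obtain l where "y $ i = of_int l" by (rule Ints_cases)
    then show ?thesis using d by simp
   qed
   ultimately show ?thesis by (simp add: n_def \<tau>_def k)
  next
   case False
   have "\<bar>y $ i - x $ i\<bar> < x $ i - of_int \<lfloor>x $ i\<rfloor>" "\<bar>y $ i - x $ i\<bar> < 1 - (x $ i - of_int \<lfloor>x $ i\<rfloor>)"
    using lt False by (simp_all add: r_def frac_def)
   then have b: "of_int \<lfloor>x $ i\<rfloor> < y $ i" "y $ i < of_int \<lfloor>x $ i\<rfloor> + 1" by linarith+
   then have fl: "\<lfloor>y $ i\<rfloor> = \<lfloor>x $ i\<rfloor>" by linarith
   then have "y $ i \<notin> \<int>" using b by (auto elim!: Ints_cases)
   moreover have "of_int \<lfloor>x $ i\<rfloor> \<le> x $ i" "x $ i \<le> of_int \<lfloor>x $ i\<rfloor> + 1" by linarith+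
   ultimately show ?thesis by (simp add: n_def \<tau>_def fl)
  qed
 qed
 ultimately show "\<exists>n\<in>lattice L. \<exists>\<tau>\<in>L. x \<in> cube n \<tau> \<and> y \<in> cube n \<tau>" by blast
 qed
qed

lemma round_segment_in_cover:
 assumes "x \<in> Xc"
 shows "closed_segment (round_vec x) x \<subseteq> Xc"
proof -
 obtain e where e: "e > 0" "\<forall>y\<in>Xc. (\<forall>i. \<bar>y $ i - x $ i\<bar> < e) -->
   (\<exists>n\<in>lattice L. \<exists>\<tau>\<in>L. x \<in> cube n \<tau> \<and> y \<in> cube n \<tau>)"
  using nearby_points_share_cube[OF assms] by (elim exE conjE) (rule that; assumption)
 obtain n \<tau> where n: "n \<in> lattice L" "\<tau> \<in> L" "x \<in> cube n \<tau>" using bspec[OF e(2) assms] e(1) by auto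
 have "closed_segment (round_vec x) x \<subseteq> cube n \<tau>"
  by (rule closed_segment_subset[OF round_vec_in_cube[OF n(1,3)] n(3) convex_cube])
 then show ?thesis using cube_in_cover[OF n(2,1)] by blast
qed

lemma edge_in_cover: "n \<in> lattice L ==> {v} \<in> L ==> closed_segment n (n + axis v 1) \<subseteq> Xc"
proof -
 assume n: "n \<in> lattice L" and v: "{v} \<in> L"
 have "closed_segment n (n + axis v 1) \<subseteq> cube n {v}"
  by (rule closed_segment_subset[OF _ _ convex_cube]) (auto simp: cube_def axis_def)
 then show ?thesis using cube_in_cover[OF v n] by blast
qed

end

text \<open>A path in the cover between lattice points is homotopic to a composite of unit edges. To
 prove a property of all these paths, extend it to arbitrary paths by joining their ends to the
 rounded ends by segments. For short paths the extended property reduces to a path in one cube.\<close>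

locale path_property = finite_complex L for L :: "'v::finite set set" +
 fixes P :: "(real => real^'v) => bool"
 assumes homotopic: "!!m n g h. m \<in> lattice L ==> n \<in> lattice L ==> g \<in> paths_from_to Xc m n ==>
   homotopic_paths Xc g h ==> P g ==> P h"
  and join: "!!l m n g h. l \<in> lattice L ==> m \<in> lattice L ==> n \<in> lattice L ==> g \<in> paths_from_to Xc l m ==>
   h \<in> paths_from_to Xc m n ==> P g ==> P h ==> P (g +++ h)"
  and reverse: "!!m n g. m \<in> lattice L ==> n \<in> lattice L ==> g \<in> paths_from_to Xc m n ==> P g ==> P (reversepath g)"
  and trivial_path: "!!n. n \<in> lattice L ==> P (linepath n n)"
  and edge: "!!n v. n \<in> lattice L ==> {v} \<in> L ==> P (linepath n (n + axis v 1))"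
begin

text \<open>By induction on the number of coordinates in which the ends differ. As the cube is convex, the path is
 homotopic to a unit edge, or its reverse, followed by a segment between closer points.\<close>

lemma in_cube:
 assumes k: "k \<in> lattice L" and \<tau>: "\<tau> \<in> L"
 shows "m \<in> lattice L ==> n \<in> lattice L ==> m \<in> cube k \<tau> ==> n \<in> cube k \<tau> ==>
  g \<in> paths_from_to (cube k \<tau>) m n ==> P g"
proof (induction "card {i. m $ i ~= n $ i}" arbitrary: m g rule: less_induct)
 case less
 note cub = cube_in_cover[OF \<tau> k]
 have sc: "simply_connected (cube k \<tau>)" by (rule convex_imp_simply_connected[OF convex_cube])
 note seg = paths_linepath[OF closed_segment_subset[OF _ _ convex_cube]]
 show ?case
 proof (cases "m = n")
  case True
  have "homotopic_paths Xc (linepath m m) g"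
   by (rule homotopic_in_simply_connected[OF sc cub seg[OF less.prems(3,3)]]) (use less.prems(5) True in simp)
  with homotopic[OF less.prems(1,1) paths_mono[OF seg[OF less.prems(3,3)] cub] _ trivial_path[OF less.prems(1)]]
  show ?thesis .
 next
  case False
  then obtain v where v: "m $ v ~= n $ v" by (auto simp: vec_eq_iff)
  define l where "l = m + (n $ v - m $ v) *\<^sub>R axis v 1"
  have lv: "l $ v = n $ v" and li: "i ~= v ==> l $ i = m $ i" for i by (auto simp: l_def axis_def)
  have mk: "m $ v \<in> \<int>" "n $ v \<in> \<int>" "k $ v \<in> \<int>" using less.prems(1,2) k by (auto simp: lattice_def)
  have v\<tau>: "v \<in> \<tau>" using cubeD[OF less.prems(3), of v] cubeD[OF less.prems(4), of v] v by (auto split: if_splits)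
  have b: "k $ v \<le> m $ v" "m $ v \<le> k $ v + 1" "k $ v \<le> n $ v" "n $ v \<le> k $ v + 1"
   using cubeD[OF less.prems(3), of v] cubeD[OF less.prems(4), of v] v\<tau> by simp_all
  have opp: "m $ v = k $ v \<and> n $ v = k $ v + 1 \<or> m $ v = k $ v + 1 \<and> n $ v = k $ v"
  proof -
   obtain a b' c where abc: "m $ v = of_int a" "n $ v = of_int b'" "k $ v = of_int c"
    using mk by (metis Ints_cases)
   have "c \<le> a" "a \<le> c + 1" "c \<le> b'" "b' \<le> c + 1" using b unfolding abc by linarith+
   moreover have "a ~= b'" using v unfolding abc by simp
   ultimately have "a = c \<and> b' = c + 1 \<or> a = c + 1 \<and> b' = c" by arith
   then show ?thesis unfolding abc by auto
  qed
  have vL: "{v} \<in> L" using simplicial_cx_subset[OF L \<tau>, of "{v}"] v\<tau> by simp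
  have lc: "l \<in> cube k \<tau>"
   unfolding cube_def
  proof (intro CollectI allI)
   fix i show "k $ i \<le> l $ i \<and> l $ i \<le> k $ i + (if i \<in> \<tau> then 1 else 0)"
    using cubeD[OF less.prems(3), of i] cubeD[OF less.prems(4), of i] lv li[of i] by (cases "i = v") simp_all
  qed
  have ll: "l \<in> lattice L"
   unfolding lattice_def
  proof (intro CollectI conjI allI impI)
   fix i
   show "l $ i \<in> \<int>" using less.prems(1,2) lv li[of i] by (cases "i = v") (simp_all add: lattice_def)
   show "l $ i = 0" if "i \<notin> \<Union>L" using less.prems(1,2) lv li[of i] that by (cases "i = v") (simp_all add: lattice_def)
  qed
  have "{i. l $ i ~= n $ i} \<subset> {i. m $ i ~= n $ i}"
  proof
   show "{i. l $ i ~= n $ i} \<subseteq> {i. m $ i ~= n $ i}"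
   proof
    fix i assume "i \<in> {i. l $ i ~= n $ i}"
    then show "i \<in> {i. m $ i ~= n $ i}" using lv li[of i] by (cases "i = v") simp_all
   qed
   show "{i. l $ i ~= n $ i} ~= {i. m $ i ~= n $ i}" using v lv by blast
  qed
  then have "card {i. l $ i ~= n $ i} < card {i. m $ i ~= n $ i}" by (intro psubset_card_mono) simp
  then have Pln: "P (linepath l n)" by (rule less.hyps[OF _ ll less.prems(2) lc less.prems(4) seg[OF lc less.prems(4)]])
  have Pml: "P (linepath m l)"
   using opp
  proof
   assume "m $ v = k $ v \<and> n $ v = k $ v + 1"
   then have "l = m + axis v 1" by (simp add: l_def)
   then show ?thesis using edge[OF less.prems(1) vL] by simp
  next
   assume "m $ v = k $ v + 1 \<and> n $ v = k $ v"
   then have m: "m = l + axis v 1" by (simp add: l_def)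
   have "P (reversepath (linepath l (l + axis v 1)))"
    by (rule reverse[OF ll _ paths_linepath[OF edge_in_cover[OF ll vL]] edge[OF ll vL]]) (use less.prems(1) m in simp)
   then show ?thesis by (simp add: m)
  qed
  note p1 = seg[OF less.prems(3) lc] and p2 = seg[OF lc less.prems(4)]
  have Pj: "P (linepath m l +++ linepath l n)"
   by (rule join[OF less.prems(1) ll less.prems(2) paths_mono[OF p1 cub] paths_mono[OF p2 cub] Pml Pln])
  have "homotopic_paths Xc (linepath m l +++ linepath l n) g"
   by (rule homotopic_in_simply_connected[OF sc cub paths_join[OF p1 p2] less.prems(5)])
  from homotopic[OF less.prems(1,2) paths_mono[OF paths_join[OF p1 p2] cub] this Pj] show ?thesis .
 qed
qed

definition extended :: "(real => real^'v) => bool" where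
 "extended g \<longleftrightarrow> P (linepath (round_vec (g 0)) (g 0) +++ (g +++ reversepath (linepath (round_vec (g 1)) (g 1))))"

abbreviation "leg x \<equiv> linepath (round_vec x) x"

lemma leg: "x \<in> Xc ==> leg x \<in> paths_from_to Xc (round_vec x) x"
 by (rule paths_linepath[OF round_segment_in_cover])

lemma extended_eq:
 "g \<in> paths_from_to Xc x y ==> extended g \<longleftrightarrow> P (leg x +++ (g +++ reversepath (leg y)))"
 by (auto simp: extended_def paths_from_to_def pathstart_def pathfinish_def)

lemma extended_path:
 assumes g: "g \<in> paths_from_to Xc x y"
 shows "x \<in> Xc" "y \<in> Xc" "leg x +++ (g +++ reversepath (leg y)) \<in> paths_from_to Xc (round_vec x) (round_vec y)"
proof -
 show x: "x \<in> Xc" and y: "y \<in> Xc" using g pathstart_in_path_image[of g] pathfinish_in_path_image[of g] by (auto simp: paths_from_to_def)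
 show "leg x +++ (g +++ reversepath (leg y)) \<in> paths_from_to Xc (round_vec x) (round_vec y)"
  by (rule paths_join[OF leg[OF x] paths_join[OF g paths_reverse[OF leg[OF y]]]])
qed

lemma extended_homotopic:
 assumes g: "g \<in> paths_from_to Xc x y" and h: "h \<in> paths_from_to Xc x y" and hom: "homotopic_paths Xc g h" and e: "extended g"
 shows "extended h"
proof -
 note x = extended_path(1,2)[OF g]
 note ly = paths_reverse[OF leg[OF x(2)]]
 have "homotopic_paths Xc (leg x +++ (g +++ reversepath (leg y))) (leg x +++ (h +++ reversepath (leg y)))"
  by (rule homotopic_join[OF homotopic_refl[OF leg[OF x(1)]] homotopic_join[OF hom homotopic_refl[OF ly] g ly]
     leg[OF x(1)] paths_join[OF g ly]])
 then show ?thesis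
  using homotopic[OF round_vec_lattice[OF x(1)] round_vec_lattice[OF x(2)] extended_path(3)[OF g]] e
  by (simp add: extended_eq[OF g] extended_eq[OF h])
qed

lemma extended_join:
 assumes g: "g \<in> paths_from_to Xc x y" and h: "h \<in> paths_from_to Xc y z" and e: "extended g" "extended h"
 shows "extended (g +++ h)"
proof -
 note x = extended_path(1,2)[OF g] and z = extended_path(2)[OF h]
 note r = round_vec_lattice
 have "P ((leg x +++ (g +++ reversepath (leg y))) +++ (leg y +++ (h +++ reversepath (leg z))))"
  using e by (intro join[OF r[OF x(1)] r[OF x(2)] r[OF z] extended_path(3)[OF g] extended_path(3)[OF h]])
   (simp_all add: extended_eq[OF g] extended_eq[OF h])
 from homotopic[OF r[OF x(1)] r[OF z] paths_join[OF extended_path(3)[OF g] extended_path(3)[OF h]]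
   homotopic_conjugate_join[OF leg[OF x(1)] leg[OF x(2)] leg[OF z] g h] this]
 show ?thesis by (simp add: extended_eq[OF paths_join[OF g h]])
qed

lemma extended_reverse:
 assumes g: "g \<in> paths_from_to Xc x y" and e: "extended g"
 shows "extended (reversepath g)"
proof -
 note x = extended_path(1,2)[OF g]
 note r = round_vec_lattice
 have ly: "reversepath (leg y) \<in> paths_from_to Xc y (round_vec y)" and lx: "reversepath (leg x) \<in> paths_from_to Xc x (round_vec x)"
  by (rule paths_reverse[OF leg[OF x(2)]], rule paths_reverse[OF leg[OF x(1)]])
 have eq: "reversepath (leg x +++ (g +++ reversepath (leg y))) = (leg y +++ reversepath g) +++ reversepath (leg x)"
  using g by (simp add: reversepath_joinpaths paths_from_to_def)
 have "P (reversepath (leg x +++ (g +++ reversepath (leg y))))"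
  by (rule reverse[OF r[OF x(1)] r[OF x(2)] extended_path(3)[OF g]]) (use e extended_eq[OF g] in simp)
 moreover have "homotopic_paths Xc ((leg y +++ reversepath g) +++ reversepath (leg x)) (leg y +++ (reversepath g +++ reversepath (leg x)))"
  by (rule homotopic_paths_sym[OF homotopic_assoc[OF leg[OF x(2)] paths_reverse[OF g] lx]])
 ultimately have "P (leg y +++ (reversepath g +++ reversepath (leg x)))"
  unfolding eq by (rule homotopic[OF r[OF x(2)] r[OF x(1)]
     paths_join[OF paths_join[OF leg[OF x(2)] paths_reverse[OF g]] lx], rotated])
 then show ?thesis by (simp add: extended_eq[OF paths_reverse[OF g]])
qed

text \<open>The points of the cover near \<open>x\<close> form a star-shaped set, which need not be convex. So a short path
 from \<open>x\<close> is homotopic to a segment, and a cube contains this segment and its rounded ends.\<close>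

lemma extended_short:
 assumes x: "x \<in> Xc"
 shows "\<exists>e>0. \<forall>g y. (\<forall>t\<in>{0..1}. \<forall>i. \<bar>g t $ i - x $ i\<bar> < e) --> g \<in> paths_from_to Xc x y --> extended g"
proof -
 obtain e where e: "e > 0" "\<forall>y\<in>Xc. (\<forall>i. \<bar>y $ i - x $ i\<bar> < e) -->
   (\<exists>n\<in>lattice L. \<exists>\<tau>\<in>L. x \<in> cube n \<tau> \<and> y \<in> cube n \<tau>)"
  using nearby_points_share_cube[OF x] by (elim exE conjE) (rule that; assumption)
 define N where "N = {y \<in> Xc. \<forall>i. \<bar>y $ i - x $ i\<bar> < e}"
 have seg: "closed_segment x y \<subseteq> N" if y: "y \<in> N" for y
 proof
  fix z assume z: "z \<in> closed_segment x y"
  obtain n \<tau> where n: "n \<in> lattice L" "\<tau> \<in> L" "x \<in> cube n \<tau>" "y \<in> cube n \<tau>" using bspec[OF e(2), of y] y by (auto simp: N_def)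
  have "z \<in> Xc" using closed_segment_subset[OF n(3,4) convex_cube] cube_in_cover[OF n(2,1)] z by blast
  moreover have "\<bar>z $ i - x $ i\<bar> < e" for i
  proof -
   obtain u where u: "0 \<le> u" "u \<le> 1" "z = (1 - u) *\<^sub>R x + u *\<^sub>R y" using z by (auto simp: in_segment)
   have "z $ i - x $ i = u * (y $ i - x $ i)" by (simp add: u(3) algebra_simps)
   then have "\<bar>z $ i - x $ i\<bar> \<le> \<bar>y $ i - x $ i\<bar>" using u(1,2) by (simp add: abs_mult mult_left_le_one_le)
   also have "\<dots> < e" using y by (simp add: N_def)
   finally show ?thesis .
  qed
  ultimately show "z \<in> N" by (simp add: N_def)
 qed
 have "x \<in> N" using x e(1) by (simp add: N_def)
 then have sc: "simply_connected N" using seg by (intro starlike_imp_simply_connected) (auto simp: starlike_def)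
 have NX: "N \<subseteq> Xc" by (auto simp: N_def)
 have "extended g" if near: "\<forall>t\<in>{0..1}. \<forall>i. \<bar>g t $ i - x $ i\<bar> < e" and g: "g \<in> paths_from_to Xc x y" for g y
 proof -
  have gN: "g \<in> paths_from_to N x y"
   using g near by (auto simp: paths_from_to_def N_def path_image_def)
  then have y: "y \<in> N" using pathfinish_in_path_image[of g] by (auto simp: paths_from_to_def)
  note l = paths_linepath[OF seg[OF y]]
  note lX = paths_mono[OF l NX]
  obtain n \<tau> where n: "n \<in> lattice L" "\<tau> \<in> L" "x \<in> cube n \<tau>" "y \<in> cube n \<tau>" using bspec[OF e(2), of y] y by (auto simp: N_def)
  note rx = round_vec_in_cube[OF n(1,3)] and ry = round_vec_in_cube[OF n(1,4)]
  note cseg = paths_linepath[OF closed_segment_subset[OF _ _ convex_cube]]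
  have "P (leg x +++ (linepath x y +++ reversepath (leg y)))"
   by (rule in_cube[OF n(1,2) round_vec_lattice[OF x] round_vec_lattice[OF subsetD[OF NX y]] rx ry
      paths_join[OF cseg[OF rx n(3)] paths_join[OF cseg[OF n(3,4)] paths_reverse[OF cseg[OF ry n(4)]]]]])
  then have "extended (linepath x y)" by (simp add: extended_eq[OF lX])
  then show ?thesis
   by (rule extended_homotopic[OF lX g homotopic_in_simply_connected[OF sc NX l gN]])
 qed
 then show ?thesis using e(1) by blast
qed

text \<open>Being joined by a subpath with the property is an equivalence relation on the unit interval with
 open classes.\<close>

lemma extended_path_all:
 assumes g: "g \<in> paths_from_to Xc x y"
 shows "extended g"
proof -
 define R where "R u w \<longleftrightarrow> extended (subpath u w g)" for u w
 have pg: "path g" "path_image g \<subseteq> Xc" using g by (auto simp: paths_from_to_def)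
 have gX: "g t \<in> Xc" if "t \<in> {0..1}" for t using pg(2) that by (auto simp: path_image_def)
 have sub: "subpath u w g \<in> paths_from_to Xc (g u) (g w)" if "u \<in> {0..1}" "w \<in> {0..1}" for u w
  using that pg path_image_subpath_subset[OF that(1,2), of g] by (auto simp: paths_from_to_def path_subpath)
 have "R 0 1"
 proof (rule connected_equivalence_relation[of "{0..1::real}"])
  show "R w u" if "R u w" "u \<in> {0..1}" "w \<in> {0..1}" for u w
   using extended_reverse[OF sub[OF that(2,3)]] that(1) by (simp add: R_def reversepath_subpath)
  show "R u z" if "R u w" "R w z" "u \<in> {0..1}" "w \<in> {0..1}" "z \<in> {0..1}" for u w z
  proof -
   have "extended (subpath u w g +++ subpath w z g)"
    using that(1,2) by (intro extended_join[OF sub[OF that(3,4)] sub[OF that(4,5)]]) (simp_all add: R_def)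
   moreover have "homotopic_paths Xc (subpath u w g +++ subpath w z g) (subpath u z g)"
    by (rule homotopic_join_subpaths[OF pg that(3-5)])
   ultimately show ?thesis unfolding R_def
    by (intro extended_homotopic[OF paths_join[OF sub[OF that(3,4)] sub[OF that(4,5)]] sub[OF that(3,5)]])
  qed
  fix a :: real assume a: "a \<in> {0..1}"
  obtain e where e: "e > 0" "!!h y. (\<forall>t\<in>{0..1}. \<forall>i. \<bar>h t $ i - g a $ i\<bar> < e) ==> h \<in> paths_from_to Xc (g a) y ==> extended h"
   using extended_short[OF gX[OF a]] by blast
  have "continuous_on {0..1} g" using pg(1) by (simp add: path_def)
  then obtain d where d: "d > 0" "!!u. u \<in> {0..1} ==> dist u a < d ==> dist (g u) (g a) < e"
   using a e(1) unfolding continuous_on_iff by metis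
  show "\<exists>T. openin (top_of_set {0..1}) T \<and> a \<in> T \<and> (\<forall>u\<in>T. R a u)"
  proof (intro exI conjI ballI)
   show "openin (top_of_set {0..1}) ({0..1} \<inter> ball a d)" by (simp add: openin_open_Int)
   show "a \<in> {0..1} \<inter> ball a d" using a d(1) by simp
   fix u assume u: "u \<in> {0..1} \<inter> ball a d"
   show "R a u" unfolding R_def
   proof (rule e(2)[OF _ sub[of a u]])
    show "\<forall>t\<in>{0..1}. \<forall>i. \<bar>subpath a u g t $ i - g a $ i\<bar> < e"
    proof (intro ballI allI)
     fix t :: real and i assume t: "t \<in> {0..1}"
     define z where "z = (u - a) * t + a"
     have z: "z = (1 - t) * a + t * u" by (simp add: z_def algebra_simps)
     have "0 \<le> z" unfolding z
      by (intro add_nonneg_nonneg mult_nonneg_nonneg) (use a t u in auto)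
     moreover have "z \<le> 1" unfolding z
      by (rule convex_bound_le) (use a t u in auto)
     moreover have "dist z a < d"
     proof -
      have "\<bar>z - a\<bar> = \<bar>u - a\<bar> * t" using t by (simp add: z_def abs_mult)
      also have "\<dots> \<le> \<bar>u - a\<bar> * 1" by (rule mult_left_mono) (use t in auto)
      finally show ?thesis using u by (simp add: dist_real_def abs_minus_commute)
     qed
     ultimately have "dist (g z) (g a) < e" by (intro d(2)) auto
     moreover have "\<bar>(g z - g a) $ i\<bar> \<le> norm (g z - g a)" by (rule component_le_norm_cart)
     ultimately show "\<bar>subpath a u g t $ i - g a $ i\<bar> < e" by (simp add: subpath_def z_def dist_norm)
    qed
   qed (use a u in auto)
  qed
 qed auto
 then show ?thesis by (simp add: R_def)
qed

lemma all_paths: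
 assumes m: "m \<in> lattice L" and n: "n \<in> lattice L" and g: "g \<in> paths_from_to Xc m n"
 shows "P g"
proof -
 have rnd: "round_vec m = m" "round_vec n = n"
  using m n round_vec_of_int[of m _ m] round_vec_of_int[of n _ n] by (auto simp: vec_eq_iff lattice_def)
 have 1: "P (linepath m m +++ (g +++ linepath n n))"
  using extended_path_all[OF g] by (simp add: extended_eq[OF g] rnd)
 have ln: "linepath n n \<in> paths_from_to Xc n n" "linepath m m \<in> paths_from_to Xc m m"
  using lattice_in_cover m n by (auto intro!: paths_linepath)
 have "homotopic_paths Xc (linepath m m +++ (g +++ linepath n n)) (g +++ linepath n n)"
  by (rule homotopic_lid[OF paths_join[OF g ln(1)]])
 also have "homotopic_paths Xc \<dots> g" by (rule homotopic_rid[OF g])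
 finally have "homotopic_paths Xc (linepath m m +++ (g +++ linepath n n)) g" .
 from homotopic[OF m n paths_join[OF ln(2) paths_join[OF g ln(1)]] this 1] show ?thesis .
qed

end

context finite_complex
begin

lemma lattice_path_from_0:
 assumes "n \<in> lattice L"
 shows "\<exists>g. g \<in> paths_from_to Xc 0 n"
 using assms
proof (induction "\<Sum>i\<in>UNIV. nat \<bar>\<lfloor>n $ i\<rfloor>\<bar>" arbitrary: n rule: less_induct)
 case less
 show ?case
 proof (cases "n = 0")
  case True
  then show ?thesis using zero_in_cover paths_linepath[of 0 0 Xc] by auto
 next
  case False
  then obtain v where v: "n $ v ~= 0" by (auto simp: vec_eq_iff)
  then have "v \<in> \<Union>L" using less.prems by (auto simp: lattice_def)
  then have vL: "{v} \<in> L" using simplicial_cx_subset[OF L] by (metis UnionE empty_subsetI insert_subset)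
  have "n $ v \<in> \<int>" using less.prems by (simp add: lattice_def)
  then obtain k where k: "n $ v = of_int k" by (rule Ints_cases)
  define m where "m = n - of_int (sgn k) *\<^sub>R axis v 1"
  have mi: "m $ i = (if i = v then of_int (k - sgn k) else n $ i)" for i by (simp add: m_def axis_def k)
  have ax: "axis v 1 \<in> lattice L" by (rule lattice_axis[OF \<open>v \<in> \<Union>L\<close>])
  have k0: "k ~= 0" using v k by simp
  have m: "m \<in> lattice L" and seg: "closed_segment m n \<subseteq> Xc"
  proof -
   consider "k > 0" | "k < 0" using k0 by linarith
   then have "m \<in> lattice L \<and> closed_segment m n \<subseteq> Xc"
   proof cases
    case 1
    then have eq: "m = n - axis v 1" by (simp add: m_def)
    then have "m \<in> lattice L" using lattice_diff[OF less.prems ax] by simp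
    then show ?thesis using edge_in_cover[of m v] vL eq by simp
   next
    case 2
    then have eq: "m = n + axis v 1" by (simp add: m_def)
    then have "m \<in> lattice L" using lattice_plus[OF less.prems ax] by simp
    then show ?thesis using edge_in_cover[OF less.prems vL] eq by (simp add: closed_segment_commute)
   qed
   then show "m \<in> lattice L" "closed_segment m n \<subseteq> Xc" by auto
  qed
  have "(\<Sum>i\<in>UNIV. nat \<bar>\<lfloor>m $ i\<rfloor>\<bar>) < (\<Sum>i\<in>UNIV. nat \<bar>\<lfloor>n $ i\<rfloor>\<bar>)"
  proof (rule sum_strict_mono_ex1)
   show "\<forall>i\<in>UNIV. nat \<bar>\<lfloor>m $ i\<rfloor>\<bar> \<le> nat \<bar>\<lfloor>n $ i\<rfloor>\<bar>" using k0 by (auto simp: mi k sgn_if)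
   show "\<exists>i\<in>UNIV. nat \<bar>\<lfloor>m $ i\<rfloor>\<bar> < nat \<bar>\<lfloor>n $ i\<rfloor>\<bar>" using k0 by (intro bexI[of _ v]) (auto simp: mi k sgn_if)
  qed simp
  from less.hyps[OF this m] obtain g where "g \<in> paths_from_to Xc 0 m" by blast
  from paths_join[OF this paths_linepath[OF seg]] show ?thesis by blast
 qed
qed

lemma cover_path_from_0:
 assumes x: "x \<in> Xc"
 shows "\<exists>g. g \<in> paths_from_to Xc 0 x"
proof -
 obtain g where "g \<in> paths_from_to Xc 0 (round_vec x)" using lattice_path_from_0[OF round_vec_lattice[OF x]] by blast
 from paths_join[OF this paths_linepath[OF round_segment_in_cover[OF x]]] show ?thesis by blast
qed

lemma exp_cover_path: "g \<in> paths_from_to Xc x y ==> exp_cover \<circ> g \<in> paths_from_to X (exp_cover x) (exp_cover y)"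
 using exp_cover_mem unfolding paths_from_to_def
 by (auto simp: path_image_compose pathstart_compose pathfinish_compose intro!: path_continuous_image continuous_exp_cover)

lemma path_with_endpoint:
 assumes x: "x \<in> Xc"
 shows "\<exists>\<gamma> \<in> based (exp_cover x). endpoint \<gamma> = x"
proof -
 obtain g where g: "g \<in> paths_from_to Xc 0 x" using cover_path_from_0[OF x] by blast
 then have "endpoint (exp_cover \<circ> g) = x"
  using endpoint_exp_cover[of g] by (auto simp: paths_from_to_def pathstart_def pathfinish_def)
 then show ?thesis
  using exp_cover_path[OF g] by (intro bexI[of _ "exp_cover \<circ> g"]) (simp_all add: exp_cover_0)
qed

end

section \<open>The fundamental group and its abelianization\<close>

lemma path_class_eq_iff:
 assumes "p \<in> paths_from_to S x y"
 shows "path_class S p = path_class S q \<longleftrightarrow> homotopic_paths S p q"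
proof
 assume "path_class S p = path_class S q"
 moreover have "p \<in> path_class S p" using homotopic_refl[OF assms] by (simp add: path_class_def)
 ultimately have "homotopic_paths S q p" by (simp add: path_class_def)
 then show "homotopic_paths S p q" by (rule homotopic_paths_sym)
next
 assume pq: "homotopic_paths S p q"
 show "path_class S p = path_class S q"
  unfolding path_class_def
  by (intro Collect_cong iffI) (erule homotopic_paths_trans[OF homotopic_paths_sym[OF pq]], erule homotopic_paths_trans[OF pq])
qed

lemma fundamental_group_mult:
 assumes p: "p \<in> paths_from_to S x x" and q: "q \<in> paths_from_to S x x"
 shows "path_class S p \<otimes>\<^bsub>fundamental_group S x\<^esub> path_class S q = path_class S (p +++ q)"
proof -
 have eq: "path_class S (\<gamma> +++ \<eta>) = path_class S (p +++ q)"
  if "\<gamma> \<in> path_class S p" "\<eta> \<in> path_class S q" for \<gamma> \<eta>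
 proof -
  have h: "homotopic_paths S (p +++ q) (\<gamma> +++ \<eta>)"
   by (rule homotopic_join[OF _ _ p q]) (use that in \<open>simp_all add: path_class_def\<close>)
  show ?thesis by (rule iffD2[OF path_class_eq_iff[OF paths_join[OF p q]] h, symmetric])
 qed
 have "p \<in> path_class S p" "q \<in> path_class S q"
  using homotopic_refl[OF p] homotopic_refl[OF q] by (simp_all add: path_class_def)
 then have ne: "path_class S p ~= {}" "path_class S q ~= {}" by (metis empty_iff)+
 have "(\<Union>\<gamma>\<in>path_class S p. \<Union>\<eta>\<in>path_class S q. path_class S (\<gamma> +++ \<eta>)) =
   (\<Union>\<gamma>\<in>path_class S p. \<Union>\<eta>\<in>path_class S q. path_class S (p +++ q))"
  by (intro SUP_cong refl eq)
 also have "\<dots> = path_class S (p +++ q)" by (simp only: UN_constant ne if_False)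
 finally have "(\<Union>\<gamma>\<in>path_class S p. \<Union>\<eta>\<in>path_class S q. path_class S (\<gamma> +++ \<eta>)) = path_class S (p +++ q)" .
 then show ?thesis by (simp add: fundamental_group_def)
qed

lemma fundamental_group_group:
 fixes S :: "'a::real_normed_vector set"
 assumes x: "x \<in> S"
 shows "group (fundamental_group S x)"
proof -
 let ?G = "fundamental_group S x"
 have car: "carrier ?G = path_class S ` paths_from_to S x x" by (simp add: fundamental_group_def)
 have one: "one ?G = path_class S (linepath x x)" by (simp add: fundamental_group_def linepath_refl)
 have l: "linepath x x \<in> paths_from_to S x x" using x by (intro paths_linepath) simp
 show ?thesis
 proof (rule groupI)
  show "a \<otimes>\<^bsub>?G\<^esub> b \<in> carrier ?G" if a: "a \<in> carrier ?G" and b: "b \<in> carrier ?G" for a b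
  proof -
   obtain p where "p \<in> paths_from_to S x x" "a = path_class S p" using a by (auto simp: car)
   moreover obtain q where "q \<in> paths_from_to S x x" "b = path_class S q" using b by (auto simp: car)
   ultimately have "p \<in> paths_from_to S x x" "a = path_class S p" "q \<in> paths_from_to S x x" "b = path_class S q" by auto
   then show ?thesis using paths_join[of p S x x q x] by (auto simp: fundamental_group_mult car)
  qed
  show "one ?G \<in> carrier ?G" using l by (simp add: one car)
  show "a \<otimes>\<^bsub>?G\<^esub> b \<otimes>\<^bsub>?G\<^esub> c = a \<otimes>\<^bsub>?G\<^esub> (b \<otimes>\<^bsub>?G\<^esub> c)"
   if "a \<in> carrier ?G" "b \<in> carrier ?G" "c \<in> carrier ?G" for a b c
  proof -
   obtain p where p: "p \<in> paths_from_to S x x" "a = path_class S p" using \<open>a \<in> carrier ?G\<close> by (auto simp: car)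
   obtain q where q: "q \<in> paths_from_to S x x" "b = path_class S q" using \<open>b \<in> carrier ?G\<close> by (auto simp: car)
   obtain r where r: "r \<in> paths_from_to S x x" "c = path_class S r" using \<open>c \<in> carrier ?G\<close> by (auto simp: car)
   note pq = paths_join[OF p(1) q(1)] and qr = paths_join[OF q(1) r(1)]
   have "path_class S (p +++ (q +++ r)) = path_class S ((p +++ q) +++ r)"
    using homotopic_assoc[OF p(1) q(1) r(1)] path_class_eq_iff[OF paths_join[OF p(1) qr]] by simp
   then show ?thesis
    by (simp add: p(2) q(2) r(2) fundamental_group_mult[OF p(1) q(1)] fundamental_group_mult[OF q(1) r(1)]
      fundamental_group_mult[OF pq r(1)] fundamental_group_mult[OF p(1) qr])
  qed
  show "one ?G \<otimes>\<^bsub>?G\<^esub> a = a" if a: "a \<in> carrier ?G" for a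
  proof -
   obtain p where p: "p \<in> paths_from_to S x x" "a = path_class S p" using a by (auto simp: car)
   have "path_class S (linepath x x +++ p) = path_class S p"
    using homotopic_lid[OF p(1)] path_class_eq_iff[OF paths_join[OF l p(1)]] by simp
   then show ?thesis by (simp add: one p(2) fundamental_group_mult[OF l p(1)])
  qed
  show "\<exists>b\<in>carrier ?G. b \<otimes>\<^bsub>?G\<^esub> a = one ?G" if a: "a \<in> carrier ?G" for a
  proof -
   obtain p where p: "p \<in> paths_from_to S x x" "a = path_class S p" using a by (auto simp: car)
   note p' = paths_reverse[OF p(1)]
   have "path_class S (reversepath p +++ p) = path_class S (linepath x x)"
    using homotopic_linv[OF p(1)] path_class_eq_iff[OF paths_join[OF p' p(1)]] by simp
   then have "path_class S (reversepath p) \<otimes>\<^bsub>?G\<^esub> a = one ?G"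
    by (simp add: one p(2) fundamental_group_mult[OF p' p(1)])
   then show ?thesis using p' by (auto simp: car)
  qed
 qed
qed

context finite_complex
begin

abbreviation "G \<equiv> toric_group L"
abbreviation "Gab \<equiv> abelianization G"
abbreviation "loops \<equiv> based toric_base"

definition loop_class :: "(real => complex^'v) => (real => complex^'v) set set" where
 "loop_class \<omega> = abelianization_map G (path_class X \<omega>)"

lemma base_in_toric: "toric_base \<in> X"
 using exp_cover_mem[OF zero_in_cover] by (simp add: exp_cover_0)

lemma toric_group: "group G"
 unfolding toric_group_def by (rule fundamental_group_group[OF base_in_toric])

lemma toric_group_carrier: "carrier G = path_class X ` loops"
 by (simp add: toric_group_def fundamental_group_def)

lemma commutator_normal: "commutator_subgroup G \<lhd> G"
 unfolding commutator_subgroup_def by (rule group.derived_self_is_normal[OF toric_group])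

lemma abelianization_comm: "comm_group Gab"
 unfolding abelianization_def commutator_subgroup_def by (rule group.derived_quot_is_comm_group[OF toric_group])

lemma abelianization_carrier: "carrier Gab = loop_class ` loops"
 by (simp add: abelianization_def carrier_FactGroup toric_group_carrier image_image loop_class_def abelianization_map_def)

lemma loop_class_carrier: "\<omega> \<in> loops ==> loop_class \<omega> \<in> carrier Gab"
 by (simp add: abelianization_carrier)

lemma loop_class_join:
 assumes "\<omega> \<in> loops" "\<eta> \<in> loops"
 shows "loop_class (\<omega> +++ \<eta>) = loop_class \<omega> \<otimes>\<^bsub>Gab\<^esub> loop_class \<eta>"
proof -
 have "path_class X \<omega> \<in> carrier G" "path_class X \<eta> \<in> carrier G" using assms by (auto simp: toric_group_carrier)
 from hom_mult[OF normal.r_coset_hom_Mod[OF commutator_normal] this]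
 show ?thesis
  using fundamental_group_mult[OF assms]
  by (simp add: loop_class_def abelianization_map_def abelianization_def toric_group_def)
qed

lemma loop_class_homotopic: "\<omega> \<in> loops ==> homotopic_paths X \<omega> \<eta> ==> loop_class \<omega> = loop_class \<eta>"
 using path_class_eq_iff[of \<omega> X toric_base toric_base \<eta>] by (simp add: loop_class_def)

lemma loop_class_trivial: "loop_class (linepath toric_base toric_base) = \<one>\<^bsub>Gab\<^esub>"
proof -
 have "path_class X (linepath toric_base toric_base) = \<one>\<^bsub>G\<^esub>"
  by (simp add: toric_group_def fundamental_group_def linepath_refl)
 then show ?thesis
  using hom_one[OF normal.r_coset_hom_Mod[OF commutator_normal] toric_group]
   normal.factorgroup_is_group[OF commutator_normal]
  by (simp add: loop_class_def abelianization_map_def abelianization_def)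
qed

lemma loop_class_reverse:
 assumes \<omega>: "\<omega> \<in> loops"
 shows "loop_class (reversepath \<omega>) = inv\<^bsub>Gab\<^esub> loop_class \<omega>"
proof -
 interpret comm_group Gab by (rule abelianization_comm)
 note r = paths_reverse[OF \<omega>]
 have "loop_class (reversepath \<omega>) \<otimes>\<^bsub>Gab\<^esub> loop_class \<omega> = \<one>\<^bsub>Gab\<^esub>"
  using loop_class_join[OF r \<omega>] loop_class_homotopic[OF paths_join[OF r \<omega>] homotopic_linv[OF \<omega>]] loop_class_trivial
  by simp
 then show ?thesis using inv_equality loop_class_carrier \<omega> r by simp
qed

lemma endpoint_join_loops:
 "\<omega> \<in> loops ==> \<eta> \<in> loops ==> endpoint (\<omega> +++ \<eta>) = endpoint \<omega> + endpoint \<eta>"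
 by (rule endpoint_loop_join(1))

text \<open>The endpoint is a homomorphism from the group to an abelian group, so it is determined by the class
 in the abelianization.\<close>

lemma endpoint_loop_class:
 assumes \<omega>: "\<omega> \<in> loops" and \<eta>: "\<eta> \<in> loops" and eq: "loop_class \<omega> = loop_class \<eta>"
 shows "endpoint \<omega> = endpoint \<eta>"
proof -
 interpret group G by (rule toric_group)
 define N where "N = {c. \<exists>\<omega>\<in>loops. c = path_class X \<omega> \<and> endpoint \<omega> = 0}"
 have mult: "path_class X p \<otimes>\<^bsub>G\<^esub> path_class X q = path_class X (p +++ q)" if "p \<in> loops" "q \<in> loops" for p q
  using fundamental_group_mult[OF that] by (simp add: toric_group_def)
 have lin: "linepath toric_base toric_base \<in> loops" using base_in_toric by (intro paths_linepath) simp
 have end0: "endpoint (linepath toric_base toric_base) = 0"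
 proof -
  have "endpoint (linepath toric_base toric_base +++ linepath toric_base toric_base) = endpoint (linepath toric_base toric_base)"
   by (rule endpoint_homotopic[OF homotopic_lid[OF lin]]) simp
  then show ?thesis using endpoint_join_loops[OF lin lin] by simp
 qed
 have one: "\<one>\<^bsub>G\<^esub> = path_class X (linepath toric_base toric_base)"
  by (simp add: toric_group_def fundamental_group_def linepath_refl)
 have inv: "inv\<^bsub>G\<^esub> path_class X p = path_class X (reversepath p) \<and> endpoint (reversepath p) = - endpoint p"
  if p: "p \<in> loops" for p
 proof -
  note r = paths_reverse[OF p]
  have h: "homotopic_paths X (reversepath p +++ p) (linepath toric_base toric_base)" by (rule homotopic_linv[OF p])
  have "path_class X (reversepath p) \<otimes>\<^bsub>G\<^esub> path_class X p = \<one>\<^bsub>G\<^esub>"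
   using h path_class_eq_iff[OF paths_join[OF r p]] by (simp add: mult[OF r p] one)
  then have "inv\<^bsub>G\<^esub> path_class X p = path_class X (reversepath p)"
   using p r by (intro inv_equality) (auto simp: toric_group_carrier)
  moreover have "pathstart (reversepath p +++ p) = toric_base" using p by (simp add: paths_from_to_def)
  then have "endpoint (reversepath p +++ p) = 0" using endpoint_homotopic[OF h] end0 by simp
  then have "endpoint (reversepath p) = - endpoint p"
   using endpoint_join_loops[OF r p] by (simp add: eq_neg_iff_add_eq_0)
  ultimately show ?thesis by blast
 qed
 have "derived_set G (carrier G) \<subseteq> N"
 proof
  fix c assume "c \<in> derived_set G (carrier G)"
  then obtain p q where p: "p \<in> loops" and q: "q \<in> loops"
   and c: "c = path_class X p \<otimes>\<^bsub>G\<^esub> path_class X q \<otimes>\<^bsub>G\<^esub> (inv\<^bsub>G\<^esub> path_class X p) \<otimes>\<^bsub>G\<^esub> (inv\<^bsub>G\<^esub> path_class X q)"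
   by (auto simp: toric_group_carrier)
  note p' = paths_reverse[OF p] and q' = paths_reverse[OF q]
  note pq = paths_join[OF p q] note pqp = paths_join[OF pq p'] note all = paths_join[OF pqp q']
  have "c = path_class X (((p +++ q) +++ reversepath p) +++ reversepath q)"
   unfolding c using inv[OF p] inv[OF q] by (simp add: mult[OF p q] mult[OF pq p'] mult[OF pqp q'])
  moreover have "endpoint (((p +++ q) +++ reversepath p) +++ reversepath q) = 0"
   using inv[OF p] inv[OF q]
   by (simp add: endpoint_join_loops[OF p q] endpoint_join_loops[OF pq p'] endpoint_join_loops[OF pqp q'])
  ultimately show "c \<in> N" using all unfolding N_def by blast
 qed
 moreover have "subgroup N G"
 proof
  show "N \<subseteq> carrier G" by (auto simp: N_def toric_group_carrier)
  show "\<one>\<^bsub>G\<^esub> \<in> N" unfolding N_def one using lin end0 by blast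
  show "a \<otimes>\<^bsub>G\<^esub> b \<in> N" if ab: "a \<in> N" "b \<in> N" for a b
  proof -
   obtain p q where pq: "p \<in> loops" "a = path_class X p" "endpoint p = 0" "q \<in> loops" "b = path_class X q" "endpoint q = 0"
    using ab unfolding N_def by blast
   then have "a \<otimes>\<^bsub>G\<^esub> b = path_class X (p +++ q)" "endpoint (p +++ q) = 0" "p +++ q \<in> loops"
    using paths_join[OF pq(1,4)] by (simp_all add: mult endpoint_join_loops)
   then show ?thesis unfolding N_def by blast
  qed
  show "inv\<^bsub>G\<^esub> a \<in> N" if a: "a \<in> N" for a
  proof -
   obtain p where p: "p \<in> loops" "a = path_class X p" "endpoint p = 0" using a unfolding N_def by blast
   then show ?thesis using inv[OF p(1)] paths_reverse[OF p(1)] unfolding N_def by auto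
  qed
 qed
 ultimately have sub: "commutator_subgroup G \<subseteq> N"
  unfolding commutator_subgroup_def derived_def by (rule generate_subgroup_incl)
 have \<omega>G: "path_class X \<omega> \<in> carrier G" using \<omega> by (simp add: toric_group_carrier)
 have "path_class X \<omega> \<in> commutator_subgroup G #>\<^bsub>G\<^esub> path_class X \<eta>"
  using rcos_self[OF \<omega>G normal_imp_subgroup[OF commutator_normal]] eq by (simp add: loop_class_def abelianization_map_def)
 then obtain c where "c \<in> commutator_subgroup G" "path_class X \<omega> = c \<otimes>\<^bsub>G\<^esub> path_class X \<eta>" by (auto simp: r_coset_def)
 then obtain p where p: "p \<in> loops" "endpoint p = 0" "path_class X \<omega> = path_class X p \<otimes>\<^bsub>G\<^esub> path_class X \<eta>"
  using sub unfolding N_def by blast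
 then have "homotopic_paths X \<omega> (p +++ \<eta>)" using path_class_eq_iff[OF \<omega>] by (simp add: mult[OF p(1) \<eta>])
 then have "endpoint \<omega> = endpoint (p +++ \<eta>)" using \<omega> by (intro endpoint_homotopic) (simp_all add: paths_from_to_def)
 then show ?thesis using endpoint_join_loops[OF p(1) \<eta>] p(2) by simp
qed

definition generator :: "'v => (real => complex^'v) set set" where
 "generator v = (if {v} \<in> L then loop_class (exp_cover \<circ> linepath 0 (axis v 1)) else \<one>\<^bsub>Gab\<^esub>)"

definition lattice_class :: "real^'v => (real => complex^'v) set set" where
 "lattice_class n = finprod Gab (\<lambda>v. generator v [^]\<^bsub>Gab\<^esub> \<lfloor>n $ v\<rfloor>) UNIV"

lemma lattice_loop: "m \<in> lattice L ==> n \<in> lattice L ==> g \<in> paths_from_to Xc m n ==> exp_cover \<circ> g \<in> loops"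
 using exp_cover_path[of g m n] exp_cover_translate[of m 0] exp_cover_translate[of n 0] by (simp add: exp_cover_0)

lemma generator_carrier: "generator v \<in> carrier Gab"
proof -
 interpret comm_group Gab by (rule abelianization_comm)
 have "exp_cover \<circ> linepath 0 (axis v 1) \<in> loops" if v: "{v} \<in> L"
 proof (rule lattice_loop)
  show "0 \<in> lattice L" by (rule lattice_0)
  show "axis v 1 \<in> lattice L" using v by (intro lattice_axis) blast
  show "linepath 0 (axis v 1) \<in> paths_from_to Xc 0 (axis v 1)"
   using edge_in_cover[OF lattice_0 v] by (intro paths_linepath) simp
 qed
 then show ?thesis by (simp add: generator_def loop_class_carrier)
qed

lemma lattice_class_carrier: "lattice_class n \<in> carrier Gab"
proof -
 interpret comm_group Gab by (rule abelianization_comm)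
 show ?thesis unfolding lattice_class_def using generator_carrier by (intro finprod_closed) auto
qed

lemma lattice_class_plus:
 assumes "m \<in> lattice L" "n \<in> lattice L"
 shows "lattice_class (m + n) = lattice_class m \<otimes>\<^bsub>Gab\<^esub> lattice_class n"
proof -
 interpret comm_group Gab by (rule abelianization_comm)
 have "\<lfloor>(m + n) $ v\<rfloor> = \<lfloor>m $ v\<rfloor> + \<lfloor>n $ v\<rfloor>" for v
  using assms by (auto simp: lattice_def elim!: Ints_cases dest!: spec[of _ v])
 then have "lattice_class (m + n) = finprod Gab (\<lambda>v. generator v [^]\<^bsub>Gab\<^esub> \<lfloor>m $ v\<rfloor> \<otimes>\<^bsub>Gab\<^esub> generator v [^]\<^bsub>Gab\<^esub> \<lfloor>n $ v\<rfloor>) UNIV"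
  unfolding lattice_class_def using generator_carrier by (simp add: int_pow_mult)
 then show ?thesis
  unfolding lattice_class_def using generator_carrier by (simp add: Pi_def)
qed

lemma lattice_class_0: "lattice_class 0 = \<one>\<^bsub>Gab\<^esub>"
proof -
 interpret comm_group Gab by (rule abelianization_comm)
 show ?thesis by (simp add: lattice_class_def)
qed

lemma lattice_class_uminus:
 assumes "n \<in> lattice L"
 shows "lattice_class (- n) = inv\<^bsub>Gab\<^esub> lattice_class n"
proof -
 interpret comm_group Gab by (rule abelianization_comm)
 have "lattice_class (- n) \<otimes>\<^bsub>Gab\<^esub> lattice_class n = \<one>\<^bsub>Gab\<^esub>"
  using lattice_class_plus[OF lattice_uminus[OF assms] assms] by (simp add: lattice_class_0)
 then show ?thesis using lattice_class_carrier by (intro inv_equality[symmetric]) auto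
qed

lemma lattice_class_axis: "lattice_class (axis v 1) = generator v"
proof -
 interpret comm_group Gab by (rule abelianization_comm)
 have "lattice_class (axis v 1) = finprod Gab (\<lambda>w. if v = w then generator w else \<one>\<^bsub>Gab\<^esub>) UNIV"
  unfolding lattice_class_def by (rule finprod_cong') (auto simp: axis_def generator_carrier)
 also have "\<dots> = generator v" by (rule finprod_singleton) (auto simp: generator_carrier)
 finally show ?thesis .
qed

text \<open>The class of a loop depends only on the end of its lift. This holds for unit edges, and every
 path between lattice points is composed of those, up to homotopy.\<close>

lemma loop_class_of_path:
 assumes m: "m \<in> lattice L" and n: "n \<in> lattice L" and g: "g \<in> paths_from_to Xc m n"
 shows "loop_class (exp_cover \<circ> g) = lattice_class (n - m)"
proof -
 interpret comm_group Gab by (rule abelianization_comm)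
 define P where "P g \<longleftrightarrow> loop_class (exp_cover \<circ> g) = lattice_class (g 1 - g 0)" for g
 have ends: "g 0 = m \<and> g 1 = n" if "g \<in> paths_from_to Xc m n" for g m n
  using that by (auto simp: paths_from_to_def pathstart_def pathfinish_def)
 interpret path_property L P
 proof
  fix m n g h assume m: "m \<in> lattice L" and n: "n \<in> lattice L" and g: "g \<in> paths_from_to Xc m n"
   and gh: "homotopic_paths Xc g h" and P: "P g"
  have "homotopic_paths X (exp_cover \<circ> g) (exp_cover \<circ> h)"
   by (rule homotopic_paths_continuous_image[OF gh continuous_exp_cover]) (use exp_cover_mem in auto)
  then have "loop_class (exp_cover \<circ> g) = loop_class (exp_cover \<circ> h)"
   by (rule loop_class_homotopic[OF lattice_loop[OF m n g]])
  moreover have "h 0 = g 0" "h 1 = g 1"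
   using homotopic_paths_imp_pathstart[OF gh] homotopic_paths_imp_pathfinish[OF gh] by (simp_all add: pathstart_def pathfinish_def)
  ultimately show "P h" using P by (simp add: P_def)
 next
  fix l m n g h assume l: "l \<in> lattice L" and m: "m \<in> lattice L" and n: "n \<in> lattice L"
   and g: "g \<in> paths_from_to Xc l m" and h: "h \<in> paths_from_to Xc m n" and P: "P g" "P h"
  have "loop_class (exp_cover \<circ> (g +++ h)) = loop_class (exp_cover \<circ> g) \<otimes>\<^bsub>Gab\<^esub> loop_class (exp_cover \<circ> h)"
   unfolding path_compose_join by (rule loop_class_join[OF lattice_loop[OF l m g] lattice_loop[OF m n h]])
  also have "\<dots> = lattice_class (m - l) \<otimes>\<^bsub>Gab\<^esub> lattice_class (n - m)"
   using P ends[OF g] ends[OF h] by (simp add: P_def)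
  also have "\<dots> = lattice_class (n - l)"
   using lattice_class_plus[OF lattice_diff[OF m l] lattice_diff[OF n m]] by simp
  finally show "P (g +++ h)" using ends[OF paths_join[OF g h]] by (simp add: P_def)
 next
  fix m n g assume m: "m \<in> lattice L" and n: "n \<in> lattice L" and g: "g \<in> paths_from_to Xc m n" and P: "P g"
  have "loop_class (exp_cover \<circ> reversepath g) = inv\<^bsub>Gab\<^esub> lattice_class (n - m)"
   using P ends[OF g] by (simp add: P_def path_compose_reversepath loop_class_reverse[OF lattice_loop[OF m n g]])
  also have "\<dots> = lattice_class (m - n)"
   using lattice_class_uminus[OF lattice_diff[OF n m]] by simp
  finally show "P (reversepath g)" using ends[OF paths_reverse[OF g]] by (simp add: P_def)
 next
  fix n assume n: "n \<in> lattice L"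
  have "exp_cover \<circ> linepath n n = linepath toric_base toric_base"
   using exp_cover_translate[OF n, of 0] by (simp add: linepath_refl exp_cover_0 comp_def)
  then show "P (linepath n n)" by (simp add: P_def loop_class_trivial lattice_class_0)
 next
  fix n v assume n: "n \<in> lattice L" and v: "{v} \<in> L"
  have "linepath n (n + axis v 1) t = n + linepath 0 (axis v 1) t" for t :: real
   by (simp add: linepath_def algebra_simps)
  then have "exp_cover \<circ> linepath n (n + axis v 1) = exp_cover \<circ> linepath 0 (axis v 1)"
   by (simp add: fun_eq_iff exp_cover_translate[OF n])
  then show "P (linepath n (n + axis v 1))"
   using v by (simp add: P_def lattice_class_axis generator_def linepath_def)
 qed
 show ?thesis using all_paths[OF m n g] ends[OF g] by (simp add: P_def)
qed

lemma loop_class_eq: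
 assumes \<omega>: "\<omega> \<in> loops"
 shows "loop_class \<omega> = lattice_class (endpoint \<omega>)"
proof -
 obtain g where g: "is_lift {0..1} \<omega> g" "g 0 = 0" using path_lift[OF \<omega> zero_in_cover exp_cover_0] by blast
 have n: "endpoint \<omega> \<in> lattice L" by (rule endpoint_loop_join(2)[OF \<omega> \<omega>])
 have gp: "g \<in> paths_from_to Xc 0 (endpoint \<omega>)"
  using g endpoint_eq[OF g] unfolding is_lift_path by (simp add: paths_from_to_def pathstart_def pathfinish_def)
 have "homotopic_paths X (exp_cover \<circ> g) \<omega>"
  using lattice_loop[OF lattice_0 n gp] g(1)
  by (intro homotopic_paths_eq) (auto simp: paths_from_to_def is_lift_def)
 then have "loop_class (exp_cover \<circ> g) = loop_class \<omega>" by (rule loop_class_homotopic[OF lattice_loop[OF lattice_0 n gp]])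
 then show ?thesis using loop_class_of_path[OF lattice_0 n gp] by simp
qed

lemma loop_with_endpoint: "n \<in> lattice L ==> \<exists>\<omega>\<in>loops. endpoint \<omega> = n"
 using path_with_endpoint[OF lattice_in_cover[of n]] exp_cover_translate[of n 0] by (simp add: exp_cover_0)

text \<open>The abelianization is the deck group of the cover.\<close>

lemma lattice_class_bij: "bij_betw lattice_class (lattice L) (carrier Gab)"
proof (rule bij_betw_imageI)
 show "inj_on lattice_class (lattice L)"
 proof (rule inj_onI)
  fix m n assume "m \<in> lattice L" "n \<in> lattice L" and eq: "lattice_class m = lattice_class n"
  then obtain \<omega> \<eta> where w: "\<omega> \<in> loops" "endpoint \<omega> = m" "\<eta> \<in> loops" "endpoint \<eta> = n"
   using loop_with_endpoint by metis
  then show "m = n" using endpoint_loop_class[OF w(1,3)] eq by (simp add: loop_class_eq)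
 qed
 show "lattice_class ` lattice L = carrier Gab"
 proof
  show "lattice_class ` lattice L \<subseteq> carrier Gab" using lattice_class_carrier by blast
  show "carrier Gab \<subseteq> lattice_class ` lattice L"
   unfolding abelianization_carrier using loop_class_eq endpoint_loop_join(2) by auto
 qed
qed

end

section \<open>Local cochains as cochains of the cover\<close>

lemma group_algebra_abelian: "abelian_group (group_algebra TYPE('k::comm_ring_1) H)"
proof (rule abelian_groupI)
 let ?A = "group_algebra TYPE('k) H"
 have fin: "finite {h. a h + b h ~= 0} \<and> {h. a h + b h ~= 0} \<subseteq> carrier H"
  if "finite {h. a h ~= 0}" "{h. a h ~= 0} \<subseteq> carrier H" "finite {h. b h ~= 0}" "{h. b h ~= 0} \<subseteq> carrier H" for a b :: "_ => 'k"
 proof -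
  have "{h. a h + b h ~= 0} \<subseteq> {h. a h ~= 0} \<union> {h. b h ~= 0}" by auto
  then show ?thesis using that by (meson finite_UnI finite_subset le_sup_iff subset_trans)
 qed
 show "x \<oplus>\<^bsub>?A\<^esub> y \<in> carrier ?A" if "x \<in> carrier ?A" "y \<in> carrier ?A" for x y
  using that fin[of x y] by (simp add: group_algebra_def)
 show "\<exists>y\<in>carrier ?A. y \<oplus>\<^bsub>?A\<^esub> x = \<zero>\<^bsub>?A\<^esub>" if "x \<in> carrier ?A" for x
  by (rule bexI[of _ "\<lambda>h. - x h"]) (use that in \<open>auto simp: group_algebra_def\<close>)
qed (auto simp: group_algebra_def algebra_simps)

lemma group_algebra_finsum_apply:
 assumes "finite I" "!!i. i \<in> I ==> g i \<in> carrier (group_algebra TYPE('k::comm_ring_1) H)"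
 shows "(\<Oplus>\<^bsub>group_algebra TYPE('k) H\<^esub>i\<in>I. g i) h = (\<Sum>i\<in>I. g i h)"
proof -
 interpret abelian_group "group_algebra TYPE('k) H" by (rule group_algebra_abelian)
 show ?thesis
  using assms
 proof (induction I)
  case empty
  then show ?case by (simp) (simp add: group_algebra_def)
 next
  case (insert i I)
  then have "(\<Oplus>\<^bsub>group_algebra TYPE('k) H\<^esub>i\<in>insert i I. g i) = g i \<oplus>\<^bsub>group_algebra TYPE('k) H\<^esub> (\<Oplus>\<^bsub>group_algebra TYPE('k) H\<^esub>i\<in>I. g i)"
   by (intro finsum_insert) auto
  then show ?case using insert by (simp add: group_algebra_def)
 qed
qed

lemma singular_face_simplex_map:
 "k \<le> Suc p ==> singular_face (Suc p) k (simplex_map (Suc p) f s) = simplex_map p f (singular_face (Suc p) k s)"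
 by (auto simp: fun_eq_iff singular_face_def simplex_map_def simplical_face_mem restrict_def)

lemma initial_vertex_eq: "initial_vertex \<sigma> = \<sigma> (vertex 0)"
 by (simp add: initial_vertex_def vertex_def)

context finite_complex
begin

definition lift_simplex :: "nat => ((nat => real) => complex^'v) => real^'v => (nat => real) => real^'v" where
 "lift_simplex p \<sigma> y = (SOME s. s \<in> Sing p \<and> simplex_map p exp_cover s = \<sigma> \<and> s (vertex 0) = y)"

lemma Sing_iff: "s \<in> Sing p \<longleftrightarrow> continuous_on (standard_simplex p) s \<and> s ` standard_simplex p \<subseteq> Xc \<and> s \<in> extensional (standard_simplex p)"
 by (simp add: simplices_def singular_simplex_cont)

lemma Sing_vertex: "s \<in> Sing p ==> j \<le> p ==> s (vertex j) \<in> Xc"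
 using vertex_standard_simplex[of j p] by (auto simp: Sing_iff)

lemma Sing_is_lift: "s \<in> Sing p ==> is_lift (standard_simplex p) (simplex_map p exp_cover s) s"
 by (simp add: Sing_iff is_lift_def simplex_map_def)

lemma project_simplex: "s \<in> Sing p ==> singular_simplex p (top_of_set X) (simplex_map p exp_cover s)"
 unfolding simplices_def
 by (rule singular_simplex_simplex_map) (use exp_cover_mem continuous_exp_cover in auto)

lemma lift_simplex_eq:
 assumes s: "s \<in> Sing p"
 shows "lift_simplex p (simplex_map p exp_cover s) (s (vertex 0)) = s"
 unfolding lift_simplex_def
proof (rule some_equality)
 show "s \<in> Sing p \<and> simplex_map p exp_cover s = simplex_map p exp_cover s \<and> s (vertex 0) = s (vertex 0)" using s by simp
 fix r assume r: "r \<in> Sing p \<and> simplex_map p exp_cover r = simplex_map p exp_cover s \<and> r (vertex 0) = s (vertex 0)"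
 have lr: "is_lift (standard_simplex p) (simplex_map p exp_cover s) r" using Sing_is_lift[of r p] r by simp
 have v: "vertex 0 \<in> standard_simplex p" by (simp add: vertex_standard_simplex)
 show "r = s"
 proof (rule extensionalityI)
  show "r \<in> extensional (standard_simplex p)" "s \<in> extensional (standard_simplex p)" using r s by (simp_all add: Sing_iff)
  show "r x = s x" if "x \<in> standard_simplex p" for x
   by (rule lift_unique[OF contracts_to_connected[OF contracts_to_standard_simplex] lr Sing_is_lift[OF s] v _ that])
    (use r in simp)
 qed
qed

lemma lift_simplex:
 assumes \<sigma>: "singular_simplex p (top_of_set X) \<sigma>" and y: "y \<in> Xc" "exp_cover y = \<sigma> (vertex 0)"
 shows "lift_simplex p \<sigma> y \<in> Sing p" "simplex_map p exp_cover (lift_simplex p \<sigma> y) = \<sigma>" "lift_simplex p \<sigma> y (vertex 0) = y"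
proof -
 have c: "continuous_on (standard_simplex p) \<sigma>" "\<sigma> ` standard_simplex p \<subseteq> X" "\<sigma> \<in> extensional (standard_simplex p)"
  using \<sigma> by (simp_all add: singular_simplex_cont)
 have "\<exists>g. is_lift (standard_simplex p) \<sigma> g \<and> g (vertex 0) = y"
  by (rule lift_exists[where f=\<sigma> and a="vertex 0" and S="standard_simplex p", OF compact_standard_simplex contracts_to_standard_simplex c(1,2) y])
 then obtain g where g: "is_lift (standard_simplex p) \<sigma> g" "g (vertex 0) = y" by blast
 define s where "s = restrict g (standard_simplex p)"
 have v: "vertex 0 \<in> standard_simplex p" by (simp add: vertex_standard_simplex)
 have "continuous_on (standard_simplex p) s" using g(1) by (simp add: s_def is_lift_def cong: continuous_on_cong)
 then have 1: "s \<in> Sing p" using g(1) by (auto simp: Sing_iff is_lift_def s_def)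
 have 2: "simplex_map p exp_cover s = \<sigma>"
  using g(1) c(3) by (intro extensionalityI[of _ "standard_simplex p"]) (auto simp: simplex_map_def s_def is_lift_def)
 have 3: "s (vertex 0) = y" using g(2) v by (simp add: s_def)
 have "lift_simplex p \<sigma> y \<in> Sing p \<and> simplex_map p exp_cover (lift_simplex p \<sigma> y) = \<sigma> \<and> lift_simplex p \<sigma> y (vertex 0) = y"
  unfolding lift_simplex_def by (rule someI[of _ s]) (simp add: 1 2 3)
 then show "lift_simplex p \<sigma> y \<in> Sing p" "simplex_map p exp_cover (lift_simplex p \<sigma> y) = \<sigma>" "lift_simplex p \<sigma> y (vertex 0) = y"
  by auto
qed

lemma project_translate: "n \<in> lattice L ==> simplex_map p exp_cover (simplex_translate p n s) = simplex_map p exp_cover s"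
 by (simp add: simplex_map_def fun_eq_iff exp_cover_translate)

lemma translate_vertex: "simplex_translate p n s (vertex 0) = n + s (vertex 0)"
 by (simp add: simplex_translate_apply vertex_standard_simplex)

lemma lift_simplex_translate:
 assumes "singular_simplex p (top_of_set X) \<sigma>" "y \<in> Xc" "exp_cover y = \<sigma> (vertex 0)" and n: "n \<in> lattice L"
 shows "lift_simplex p \<sigma> (n + y) = simplex_translate p n (lift_simplex p \<sigma> y)"
proof -
 note l = lift_simplex[OF assms(1-3)]
 show ?thesis
  using lift_simplex_eq[OF S.tr_B[OF n l(1)]] by (simp only: project_translate[OF n] translate_vertex l)
qed

abbreviation "lifted p \<equiv> lifted_simplex X toric_base (int p)"

lemma lifted_simplexD:
 assumes "lifted p \<sigma> \<gamma>"
 shows "singular_simplex p (top_of_set X) \<sigma>" "\<gamma> \<in> based (\<sigma> (vertex 0))"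
  "endpoint \<gamma> \<in> Xc" "exp_cover (endpoint \<gamma>) = \<sigma> (vertex 0)"
 using assms endpoint_props[of \<gamma> "\<sigma> (vertex 0)"] by (simp_all add: lifted_simplex_def initial_vertex_eq)

lemma lifted_simplexI:
 "singular_simplex p (top_of_set X) \<sigma> ==> \<gamma> \<in> based (\<sigma> (vertex 0)) ==>
  lifted p \<sigma> \<gamma>"
 by (simp add: lifted_simplex_def initial_vertex_eq)

abbreviation lattice_point :: "(real => complex^'v) set set => real^'v" where
 "lattice_point \<equiv> inv_into (lattice L) lattice_class"

lemma lattice_point_class: "m \<in> lattice L ==> lattice_point (lattice_class m) = m"
 by (rule inv_into_f_f[OF bij_betw_imp_inj_on[OF lattice_class_bij]])

lemma lattice_point: "h \<in> carrier Gab ==> lattice_point h \<in> lattice L \<and> lattice_class (lattice_point h) = h"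
 using lattice_class_bij by (metis bij_betw_imp_surj_on f_inv_into_f inv_into_into)

text \<open>A cochain of the cover determines a local cochain: the coefficient at a group element is the
 value on the lift from the endpoint of the path, translated back by this element.\<close>

definition local_of :: "int => (((nat => real) => real^'v) => 'k::comm_ring_1) =>
  ((nat => real) => complex^'v) => (real => complex^'v) => (real => complex^'v) set set => 'k" where
 "local_of p \<phi> \<sigma> \<gamma> h = (if lifted_simplex X toric_base p \<sigma> \<gamma> \<and> h \<in> carrier Gab
   then \<phi> (simplex_translate (nat p) (- lattice_point h) (lift_simplex (nat p) \<sigma> (endpoint \<gamma>))) else 0)"

lemma local_of_class:
 "lifted p \<sigma> \<gamma> ==> m \<in> lattice L ==>
  local_of (int p) \<phi> \<sigma> \<gamma> (lattice_class m) = \<phi> (simplex_translate p (- m) (lift_simplex p \<sigma> (endpoint \<gamma>)))"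
 by (simp add: local_of_def lattice_class_carrier lattice_point_class)

abbreviation "coeff_module (k :: 'k::comm_ring_1 itself) \<equiv> toric_coeffs k L"
abbreviation "twisted (k :: 'k::comm_ring_1 itself) \<equiv> local_cochains X toric_base (coeff_module k) (toric_action k L)"

lemma toric_action_class:
 fixes a :: "_ => 'k::comm_ring_1"
 assumes \<omega>: "\<omega> \<in> loops"
 shows "m \<in> lattice L ==> toric_action TYPE('k) L (path_class X \<omega>) a (lattice_class m) = a (lattice_class (m - endpoint \<omega>))"
  and "h \<notin> carrier Gab ==> toric_action TYPE('k) L (path_class X \<omega>) a h = 0"
proof -
 interpret comm_group Gab by (rule abelianization_comm)
 have supp: "{g. group_element c g ~= (0 :: 'k)} = {c}" for c :: "(real => complex^'v) set set" by (auto simp: group_element_def)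
 have act: "toric_action TYPE('k) L (path_class X \<omega>) a =
   (\<lambda>h. if h \<in> carrier Gab then a (inv\<^bsub>Gab\<^esub> loop_class \<omega> \<otimes>\<^bsub>Gab\<^esub> h) else 0)"
  by (simp add: toric_action_def toric_coeffs_def group_algebra_def loop_class_def supp)
   (simp add: group_element_def fun_eq_iff loop_class_def)
 note n = endpoint_loop_join(2)[OF \<omega> \<omega>]
 show "toric_action TYPE('k) L (path_class X \<omega>) a (lattice_class m) = a (lattice_class (m - endpoint \<omega>))" if m: "m \<in> lattice L"
  using lattice_class_plus[OF lattice_uminus[OF n] m] lattice_class_uminus[OF n]
  by (simp add: act lattice_class_carrier loop_class_eq[OF \<omega>])
 show "toric_action TYPE('k) L (path_class X \<omega>) a h = 0" if "h \<notin> carrier Gab" using that by (simp add: act)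
qed

lemma twisted_simps:
 "\<zero>\<^bsub>twisted TYPE('k::comm_ring_1) p\<^esub> = (\<lambda>\<sigma> \<gamma> h. 0)"
 "x \<oplus>\<^bsub>twisted TYPE('k) p\<^esub> y = (\<lambda>\<sigma> \<gamma> h. x \<sigma> \<gamma> h + y \<sigma> \<gamma> h)"
 "r \<odot>\<^bsub>twisted TYPE('k) p\<^esub> x = (\<lambda>\<sigma> \<gamma> h. r * x \<sigma> \<gamma> h)"
 by (simp_all add: local_cochains_def toric_coeffs_def group_algebra_def)

lemma fun_eq_on_classes:
 assumes "!!m. m \<in> lattice L ==> a (lattice_class m) = b (lattice_class m)" "!!h. h \<notin> carrier Gab ==> a h = b h"
 shows "a = b"
proof
 fix h show "a h = b h" using assms lattice_point[of h] by metis
qed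

lemma local_of_carrier:
 fixes \<phi> :: "_ => 'k::comm_ring_1"
 assumes \<phi>: "\<phi> \<in> S.cochains (int p)"
 shows "local_of (int p) \<phi> \<in> carrier (twisted TYPE('k) (int p))"
 unfolding local_cochains_def partial_object.simps mem_Collect_eq
proof (intro conjI allI impI ballI)
 fix \<sigma> \<gamma> assume l: "lifted p \<sigma> \<gamma>"
 note D = lifted_simplexD[OF l]
 define s where "s = lift_simplex p \<sigma> (endpoint \<gamma>)"
 have s: "s \<in> Sing p" unfolding s_def by (rule lift_simplex(1)[OF D(1,3,4)])
 have "finite {n \<in> lattice L. \<phi> (simplex_translate p n s) ~= 0}" using \<phi> s by (simp add: S.cochains_nat)
 moreover have "{h. local_of (int p) \<phi> \<sigma> \<gamma> h ~= 0} \<subseteq> (\<lambda>n. lattice_class (- n)) ` {n \<in> lattice L. \<phi> (simplex_translate p n s) ~= 0}"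
 proof
  fix h assume h: "h \<in> {h. local_of (int p) \<phi> \<sigma> \<gamma> h ~= 0}"
  then have hc: "h \<in> carrier Gab" by (auto simp: local_of_def split: if_splits)
  then show "h \<in> (\<lambda>n. lattice_class (- n)) ` {n \<in> lattice L. \<phi> (simplex_translate p n s) ~= 0}"
   using h l lattice_point[OF hc] by (intro image_eqI[of _ _ "- lattice_point h"]) (auto simp: local_of_def s_def lattice_uminus)
 qed
 ultimately have "finite {h. local_of (int p) \<phi> \<sigma> \<gamma> h ~= 0}" by (rule finite_surj)
 moreover have "{h. local_of (int p) \<phi> \<sigma> \<gamma> h ~= 0} \<subseteq> carrier Gab" by (auto simp: local_of_def split: if_splits)
 ultimately show "local_of (int p) \<phi> \<sigma> \<gamma> \<in> carrier (coeff_module TYPE('k))" by (simp add: toric_coeffs_def group_algebra_def)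
 show "local_of (int p) \<phi> \<sigma> \<gamma>' = local_of (int p) \<phi> \<sigma> \<gamma>" if hom: "homotopic_paths X \<gamma> \<gamma>'" for \<gamma>'
 proof -
  have "\<gamma>' \<in> based (\<sigma> (vertex 0))"
   using D(2) homotopic_paths_imp_path[OF hom] homotopic_paths_imp_subset[OF hom]
    homotopic_paths_imp_pathstart[OF hom] homotopic_paths_imp_pathfinish[OF hom] by (simp add: paths_from_to_def)
  then have "lifted p \<sigma> \<gamma>'" by (rule lifted_simplexI[OF D(1)])
  moreover have "endpoint \<gamma> = endpoint \<gamma>'" using D(2) by (intro endpoint_homotopic[OF hom]) (simp add: paths_from_to_def)
  ultimately show ?thesis using l by (simp add: local_of_def fun_eq_iff)
 qed
 fix \<omega> assume \<omega>: "\<omega> \<in> loops"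
 note e = endpoint_loop_join[OF \<omega> D(2)]
 have l': "lifted p \<sigma> (\<omega> +++ \<gamma>)" by (rule lifted_simplexI[OF D(1) paths_join[OF \<omega> D(2)]])
 show "local_of (int p) \<phi> \<sigma> (\<omega> +++ \<gamma>) = toric_action TYPE('k) L (path_class X \<omega>) (local_of (int p) \<phi> \<sigma> \<gamma>)"
 proof (rule fun_eq_on_classes)
  fix m assume m: "m \<in> lattice L"
  have "simplex_translate p (- m) (simplex_translate p (endpoint \<omega>) s) = simplex_translate p (- (m - endpoint \<omega>)) s"
   using S.tr_add[OF lattice_uminus[OF m] e(2) s] by simp
  then show "local_of (int p) \<phi> \<sigma> (\<omega> +++ \<gamma>) (lattice_class m) = toric_action TYPE('k) L (path_class X \<omega>) (local_of (int p) \<phi> \<sigma> \<gamma>) (lattice_class m)"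
   by (simp only: local_of_class[OF l' m] toric_action_class(1)[OF \<omega> m] local_of_class[OF l lattice_diff[OF m e(2)]] e(1)
     lift_simplex_translate[OF D(1,3,4) e(2)] s_def)
 next
  fix h assume h: "h \<notin> carrier Gab"
  then show "local_of (int p) \<phi> \<sigma> (\<omega> +++ \<gamma>) h = toric_action TYPE('k) L (path_class X \<omega>) (local_of (int p) \<phi> \<sigma> \<gamma>) h"
   using toric_action_class(2)[OF \<omega> h] by (simp add: local_of_def)
 qed
qed (auto simp: local_of_def toric_coeffs_def group_algebra_def fun_eq_iff)

text \<open>Two paths with the same endpoint differ by a loop that lifts to a loop; it acts trivially, because its
 class in the abelianization is trivial.\<close>

lemma twisted_path_independent:
 fixes f :: "_ => _ => _ => 'k::comm_ring_1"
 assumes f: "f \<in> carrier (twisted TYPE('k) (int p))" and l: "lifted p \<sigma> \<gamma>"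
  and \<gamma>': "\<gamma>' \<in> based (\<sigma> (vertex 0))" and e: "endpoint \<gamma>' = endpoint \<gamma>"
 shows "f \<sigma> \<gamma>' = f \<sigma> \<gamma>"
proof -
 note D = lifted_simplexD[OF l]
 have f4: "f \<sigma> \<gamma> \<in> carrier (coeff_module TYPE('k))" "!!\<gamma> \<gamma>'. lifted p \<sigma> \<gamma> ==> homotopic_paths X \<gamma> \<gamma>' ==> f \<sigma> \<gamma>' = f \<sigma> \<gamma>"
  "!!\<omega>. \<omega> \<in> loops ==> f \<sigma> (\<omega> +++ \<gamma>) = toric_action TYPE('k) L (path_class X \<omega>) (f \<sigma> \<gamma>)"
  using f l by (simp_all add: local_cochains_def)
 define \<omega> where "\<omega> = \<gamma>' +++ reversepath \<gamma>"
 have \<omega>: "\<omega> \<in> loops" unfolding \<omega>_def by (rule paths_join[OF \<gamma>' paths_reverse[OF D(2)]])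
 note j = paths_join[OF \<omega> D(2)]
 have "homotopic_paths X (\<omega> +++ \<gamma>) (\<gamma>' +++ (reversepath \<gamma> +++ \<gamma>))"
  unfolding \<omega>_def by (rule homotopic_paths_sym[OF homotopic_assoc[OF \<gamma>' paths_reverse[OF D(2)] D(2)]])
 also have "homotopic_paths X \<dots> (\<gamma>' +++ linepath (\<sigma> (vertex 0)) (\<sigma> (vertex 0)))"
  by (rule homotopic_join[OF homotopic_refl[OF \<gamma>'] homotopic_linv[OF D(2)] \<gamma>' paths_join[OF paths_reverse[OF D(2)] D(2)]])
 also have "homotopic_paths X \<dots> \<gamma>'" by (rule homotopic_rid[OF \<gamma>'])
 finally have hom: "homotopic_paths X (\<omega> +++ \<gamma>) \<gamma>'" .
 have "endpoint (\<omega> +++ \<gamma>) = endpoint \<gamma>'" using j by (intro endpoint_homotopic[OF hom]) (simp add: paths_from_to_def)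
 then have \<omega>0: "endpoint \<omega> = 0" using endpoint_loop_join(1)[OF \<omega> D(2)] e by simp
 have "f \<sigma> \<gamma>' = f \<sigma> (\<omega> +++ \<gamma>)" by (rule f4(2)[OF lifted_simplexI[OF D(1) j] hom])
 also have "\<dots> = f \<sigma> \<gamma>"
  unfolding f4(3)[OF \<omega>]
 proof (rule fun_eq_on_classes)
  fix m assume m: "m \<in> lattice L"
  show "toric_action TYPE('k) L (path_class X \<omega>) (f \<sigma> \<gamma>) (lattice_class m) = f \<sigma> \<gamma> (lattice_class m)"
   by (simp add: toric_action_class(1)[OF \<omega> m] \<omega>0)
 next
  fix h assume h: "h \<notin> carrier Gab"
  then have "f \<sigma> \<gamma> h = 0" using f4(1) by (auto simp: toric_coeffs_def group_algebra_def)
  then show "toric_action TYPE('k) L (path_class X \<omega>) (f \<sigma> \<gamma>) h = f \<sigma> \<gamma> h" by (simp add: toric_action_class(2)[OF \<omega> h])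
 qed
 finally show ?thesis .
qed

text \<open>Conversely, a local cochain is recovered from its coefficients at the neutral element.\<close>

lemma local_of_surj:
 fixes f :: "_ => _ => _ => 'k::comm_ring_1"
 assumes f: "f \<in> carrier (twisted TYPE('k) (int p))"
 shows "\<exists>\<phi>\<in>S.cochains (int p). f = local_of (int p) \<phi>"
proof -
 define \<delta> where "\<delta> x = (SOME \<gamma>. \<gamma> \<in> based (exp_cover x) \<and> endpoint \<gamma> = x)" for x
 have \<delta>: "\<delta> x \<in> based (exp_cover x) \<and> endpoint (\<delta> x) = x" if "x \<in> Xc" for x
 proof -
  have "\<exists>\<gamma>. \<gamma> \<in> based (exp_cover x) \<and> endpoint \<gamma> = x"
   using path_with_endpoint[OF that] by blast
  then show ?thesis unfolding \<delta>_def by (rule someI_ex)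
 qed
 define \<phi> where "\<phi> s = (if s \<in> Sing p then f (simplex_map p exp_cover s) (\<delta> (s (vertex 0))) (lattice_class 0) else 0)" for s
 have f3: "f \<sigma> \<gamma> \<in> carrier (coeff_module TYPE('k))" "!!\<omega>. \<omega> \<in> loops ==> f \<sigma> (\<omega> +++ \<gamma>) = toric_action TYPE('k) L (path_class X \<omega>) (f \<sigma> \<gamma>)"
  if "lifted p \<sigma> \<gamma>" for \<sigma> \<gamma>
  using f that by (simp_all add: local_cochains_def)
 have f0: "f \<sigma> \<gamma> = (\<lambda>h. 0)" if "\<not> lifted p \<sigma> \<gamma>" for \<sigma> \<gamma>
  using f that by (simp add: local_cochains_def toric_coeffs_def group_algebra_def)
 have key: "f \<sigma> \<gamma> (lattice_class m) = \<phi> (simplex_translate p (- m) (lift_simplex p \<sigma> (endpoint \<gamma>)))"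
  if l: "lifted p \<sigma> \<gamma>" and m: "m \<in> lattice L" for \<sigma> \<gamma> m
 proof -
  note D = lifted_simplexD[OF l]
  define s where "s = lift_simplex p \<sigma> (endpoint \<gamma>)"
  note s = lift_simplex[OF D(1,3,4), folded s_def]
  have m': "- m \<in> lattice L" by (rule lattice_uminus[OF m])
  have x: "- m + endpoint \<gamma> \<in> Xc" by (rule abelian_cover_translate[OF m' D(3)])
  define \<eta> where "\<eta> = \<delta> (- m + endpoint \<gamma>)"
  have "exp_cover (- m + endpoint \<gamma>) = \<sigma> (vertex 0)" by (simp only: exp_cover_translate[OF m'] D(4))
  then have \<eta>: "\<eta> \<in> based (\<sigma> (vertex 0))" "endpoint \<eta> = - m + endpoint \<gamma>"
   using \<delta>[OF x] unfolding \<eta>_def by simp_all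
  note l\<eta> = lifted_simplexI[OF D(1) \<eta>(1)]
  obtain \<omega> where \<omega>: "\<omega> \<in> loops" "endpoint \<omega> = m" using loop_with_endpoint[OF m] by blast
  have "f \<sigma> \<gamma> = f \<sigma> (\<omega> +++ \<eta>)"
   by (rule twisted_path_independent[OF f lifted_simplexI[OF D(1) paths_join[OF \<omega>(1) \<eta>(1)]] D(2)])
    (simp add: endpoint_loop_join(1)[OF \<omega>(1) \<eta>(1)] \<eta>(2) \<omega>(2))
  then have "f \<sigma> \<gamma> (lattice_class m) = f \<sigma> \<eta> (lattice_class 0)"
   by (simp add: f3(2)[OF l\<eta> \<omega>(1)] toric_action_class(1)[OF \<omega>(1) m] \<omega>(2))
  also have "\<dots> = \<phi> (simplex_translate p (- m) s)"
   using S.tr_B[OF m' s(1)] by (simp only: \<phi>_def if_True project_translate[OF m'] s(2) translate_vertex s(3) \<eta>_def)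
  finally show ?thesis by (simp add: s_def)
 qed
 have "\<phi> \<in> S.cochains (int p)"
  unfolding S.cochains_nat
 proof (intro CollectI conjI allI impI ballI)
  show "\<phi> s = 0" if "s \<notin> Sing p" for s using that by (simp add: \<phi>_def)
  fix s assume s: "s \<in> Sing p"
  define x where "x = s (vertex 0)"
  have x: "x \<in> Xc" unfolding x_def by (rule Sing_vertex[OF s]) simp
  have v: "simplex_map p exp_cover s (vertex 0) = exp_cover x" by (simp add: simplex_map_def vertex_standard_simplex x_def)
  have l: "lifted p (simplex_map p exp_cover s) (\<delta> x)"
   by (rule lifted_simplexI[OF project_simplex[OF s]]) (use \<delta>[OF x] v in simp)
  have lift: "lift_simplex p (simplex_map p exp_cover s) (endpoint (\<delta> x)) = s"
   using lift_simplex_eq[OF s] \<delta>[OF x] by (simp add: x_def)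
  have fin: "finite {h. f (simplex_map p exp_cover s) (\<delta> x) h ~= 0}"
   using f3(1)[OF l] by (simp add: toric_coeffs_def group_algebra_def)
  have val: "\<phi> (simplex_translate p n s) = f (simplex_map p exp_cover s) (\<delta> x) (lattice_class (- n))" if "n \<in> lattice L" for n
   using key[OF l lattice_uminus[OF that]] by (simp add: lift)
  show "finite {n \<in> lattice L. \<phi> (simplex_translate p n s) ~= 0}"
  proof (rule finite_imageD[where f="\<lambda>n. lattice_class (- n)"])
   show "finite ((\<lambda>n. lattice_class (- n)) ` {n \<in> lattice L. \<phi> (simplex_translate p n s) ~= 0})"
    by (rule finite_subset[OF _ fin]) (auto simp: val)
   show "inj_on (\<lambda>n. lattice_class (- n)) {n \<in> lattice L. \<phi> (simplex_translate p n s) ~= 0}"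
   proof (rule inj_onI)
    fix a b assume "a \<in> {n \<in> lattice L. \<phi> (simplex_translate p n s) ~= 0}" "b \<in> {n \<in> lattice L. \<phi> (simplex_translate p n s) ~= 0}"
     and eq: "lattice_class (- a) = lattice_class (- b)"
    then have "- a \<in> lattice L" "- b \<in> lattice L" by (auto intro: lattice_uminus)
    then have "- a = - b" by (rule inj_onD[OF bij_betw_imp_inj_on[OF lattice_class_bij] eq])
    then show "a = b" by simp
   qed
  qed
 qed
 moreover have "f = local_of (int p) \<phi>"
 proof (intro ext)
  fix \<sigma> \<gamma> h
  show "f \<sigma> \<gamma> h = local_of (int p) \<phi> \<sigma> \<gamma> h"
  proof (cases "lifted p \<sigma> \<gamma> \<and> h \<in> carrier Gab")
   case True
   then show ?thesis using key[of \<sigma> \<gamma> "lattice_point h"] lattice_point[of h] by (simp add: local_of_def)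
  next
   case False
   then have "f \<sigma> \<gamma> h = 0"
    using f0[of \<sigma> \<gamma>] f3(1)[of \<sigma> \<gamma>]
    by (cases "lifted p \<sigma> \<gamma>") (auto simp: toric_coeffs_def group_algebra_def)
   then show ?thesis using False by (auto simp: local_of_def)
  qed
 qed
 ultimately show ?thesis by blast
qed

lemma local_of_inj:
 fixes \<phi> :: "_ => 'k::comm_ring_1"
 assumes \<phi>: "\<phi> \<in> S.cochains (int p)" and 0: "local_of (int p) \<phi> = (\<lambda>\<sigma> \<gamma> h. 0)"
 shows "\<phi> = (\<lambda>s. 0)"
proof
 fix s
 show "\<phi> s = 0"
 proof (cases "s \<in> Sing p")
  case s: True
  define x where "x = s (vertex 0)"
  have x: "x \<in> Xc" unfolding x_def by (rule Sing_vertex[OF s]) simp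
  have v: "simplex_map p exp_cover s (vertex 0) = exp_cover x" by (simp add: simplex_map_def vertex_standard_simplex x_def)
  obtain \<gamma> where \<gamma>: "\<gamma> \<in> based (exp_cover x)" "endpoint \<gamma> = x" using path_with_endpoint[OF x] by blast
  have l: "lifted p (simplex_map p exp_cover s) \<gamma>"
   by (rule lifted_simplexI[OF project_simplex[OF s]]) (use \<gamma> v in simp)
  have "local_of (int p) \<phi> (simplex_map p exp_cover s) \<gamma> (lattice_class 0) = \<phi> s"
   using local_of_class[OF l lattice_0, of \<phi>] lift_simplex_eq[OF s] S.tr_zero[OF s] by (simp add: \<gamma>(2) x_def)
  then show ?thesis using 0 by simp
 next
  case False
  then show ?thesis using \<phi> by (simp add: S.cochains_nat)
 qed
qed

abbreviation "twisted_coboundary (k :: 'k::comm_ring_1 itself) \<equiv> local_coboundary X toric_base (coeff_module k)"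

lemma first_edge_lift:
 assumes s: "s \<in> Sing (Suc p)"
 defines "\<sigma> \<equiv> simplex_map (Suc p) exp_cover s"
 shows "\<exists>g. is_lift {0..1} (first_edge \<sigma>) g \<and> g 0 = s (vertex 0) \<and> g 1 = s (vertex 1)"
proof -
 define e :: "real => nat => real" where "e t = (\<lambda>i. if i = 0 then 1 - t else if i = 1 then t else 0)" for t
 have ev: "e t = (\<lambda>i. (1 - t) * vertex 0 i + t * vertex 1 i)" for t by (auto simp: e_def vertex_def fun_eq_iff)
 have e: "e t \<in> standard_simplex (Suc p)" if "t \<in> {0..1}" for t
  unfolding ev by (rule convex_standard_simplex) (use that in \<open>auto simp: vertex_standard_simplex\<close>)
 have "continuous_on {0..1} e"
  unfolding ev by (intro continuous_on_coordinatewise_then_product continuous_intros)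
 then have "continuous_on {0..1} (\<lambda>t. s (e t))"
  by (rule continuous_on_compose2[of "standard_simplex (Suc p)" s, rotated]) (use s e in \<open>auto simp: Sing_iff\<close>)
 moreover have "(\<lambda>t. s (e t)) ` {0..1} \<subseteq> Xc" using s e by (auto simp: Sing_iff)
 moreover have "exp_cover (s (e t)) = first_edge \<sigma> t" if "t \<in> {0..1}" for t
  using e[OF that] by (simp add: first_edge_def \<sigma>_def simplex_map_def e_def)
 moreover have "e 0 = vertex 0" "e 1 = vertex 1" by (auto simp: e_def vertex_def fun_eq_iff)
 ultimately show ?thesis by (intro exI[of _ "\<lambda>t. s (e t)"]) (simp add: is_lift_def)
qed

text \<open>Only the face opposite to the initial vertex has another initial vertex. Prolonging the path along the
 first edge moves its endpoint to the initial vertex of the lifted face.\<close>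

lemma local_coboundary_local_of:
 fixes \<phi> :: "_ => 'k::comm_ring_1"
 assumes \<phi>: "\<phi> \<in> S.cochains (int p)"
 shows "twisted_coboundary TYPE('k) (int p) (local_of (int p) \<phi>) = local_of (int (Suc p)) (S.coboundary (int p) \<phi>)"
proof (intro ext)
 let ?A = "coeff_module TYPE('k)"
 fix \<sigma> \<gamma> h
 have q: "int p + 1 = int (Suc p)" "nat (int p + 1) = Suc p" by simp_all
 show "local_coboundary X toric_base ?A (int p) (local_of (int p) \<phi>) \<sigma> \<gamma> h = local_of (int (Suc p)) (S.coboundary (int p) \<phi>) \<sigma> \<gamma> h"
 proof (cases "lifted (Suc p) \<sigma> \<gamma>")
  case False
  then have "\<not> lifted_simplex X toric_base (int p + 1) \<sigma> \<gamma>" by (simp only: q(1) not_False_eq_True)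
  then show ?thesis using False by (simp add: local_coboundary_def local_of_def toric_coeffs_def group_algebra_def)
 next
  case l: True
  note D = lifted_simplexD[OF l]
  define s where "s = lift_simplex (Suc p) \<sigma> (endpoint \<gamma>)"
  note s = lift_simplex[OF D(1,3,4), folded s_def]
  define \<gamma>' where "\<gamma>' i = (if i = 0 then \<gamma> +++ first_edge \<sigma> else \<gamma>)" for i :: nat
  obtain g where g: "is_lift {0..1} (first_edge \<sigma>) g" "g 0 = s (vertex 0)" "g 1 = s (vertex 1)"
   using first_edge_lift[OF s(1)] unfolding s(2) by blast
  have v1: "exp_cover (s (vertex 1)) = \<sigma> (vertex 1)" and v0: "exp_cover (s (vertex 0)) = \<sigma> (vertex 0)"
   using arg_cong[OF s(2), of "\<lambda>r. r (vertex 1)"] arg_cong[OF s(2), of "\<lambda>r. r (vertex 0)"]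
    vertex_standard_simplex[of 1 "Suc p"] vertex_standard_simplex[of 0 "Suc p"] by (simp_all add: simplex_map_def)
  have fe: "first_edge \<sigma> \<in> paths_from_to X (\<sigma> (vertex 0)) (\<sigma> (vertex 1))"
  proof -
   have "path g" "path_image g \<subseteq> Xc" using g(1) by (simp_all add: is_lift_path)
   then have "exp_cover \<circ> g \<in> paths_from_to X (\<sigma> (vertex 0)) (\<sigma> (vertex 1))"
    using exp_cover_path[of g "s (vertex 0)" "s (vertex 1)"] g(2,3) v0 v1
    by (simp add: paths_from_to_def pathstart_def pathfinish_def)
   moreover from this have "homotopic_paths X (exp_cover \<circ> g) (first_edge \<sigma>)"
    using g(1) by (intro homotopic_paths_eq) (auto simp: is_lift_def paths_from_to_def)
   ultimately show ?thesis
    using homotopic_paths_imp_path[of X "exp_cover \<circ> g" "first_edge \<sigma>"] homotopic_paths_imp_subset[of X "exp_cover \<circ> g" "first_edge \<sigma>"]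
     homotopic_paths_imp_pathstart[of X "exp_cover \<circ> g" "first_edge \<sigma>"] homotopic_paths_imp_pathfinish[of X "exp_cover \<circ> g" "first_edge \<sigma>"]
    by (simp add: paths_from_to_def)
  qed
  have face: "lifted p (singular_face (Suc p) i \<sigma>) (\<gamma>' i) \<and>
    lift_simplex p (singular_face (Suc p) i \<sigma>) (endpoint (\<gamma>' i)) = singular_face (Suc p) i s \<and> singular_face (Suc p) i s \<in> Sing p"
   if i: "i \<le> Suc p" for i
  proof -
   have fs: "singular_face (Suc p) i s \<in> Sing p"
    using singular_simplex_singular_face[of "Suc p" "top_of_set Xc" s i] s(1) i by (simp add: simplices_def)
   have pr: "simplex_map p exp_cover (singular_face (Suc p) i s) = singular_face (Suc p) i \<sigma>"
    using singular_face_simplex_map[OF i, of exp_cover s] s(2) by simp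
   have fv: "singular_face (Suc p) i r (vertex 0) = r (vertex (if i = 0 then 1 else 0))" for r :: "(nat => real) => 'z"
    by (simp add: singular_face_apply vertex_standard_simplex simplical_face_vertex)
   have e: "endpoint (\<gamma>' i) = singular_face (Suc p) i s (vertex 0)"
    unfolding fv using endpoint_join[OF D(2) g(1)] g(2,3) s(3) by (simp add: \<gamma>'_def)
   have "\<gamma>' i \<in> based (singular_face (Suc p) i \<sigma> (vertex 0))"
    unfolding fv using paths_join[OF D(2) fe] D(2) by (simp add: \<gamma>'_def)
   then have "lifted p (singular_face (Suc p) i \<sigma>) (\<gamma>' i)"
    using project_simplex[OF fs] by (intro lifted_simplexI) (simp_all add: pr)
   then show ?thesis using lift_simplex_eq[OF fs] fs by (simp add: pr e)
  qed
  define f where "f i = local_of (int p) \<phi> (singular_face (Suc p) i \<sigma>) (\<gamma>' i)" for i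
  have fA: "f i \<in> carrier ?A" if "i \<le> Suc p" for i
   using local_of_carrier[OF \<phi>] face[OF that] by (simp add: local_cochains_def f_def)
  have smA: "(-1) ^ i \<odot>\<^bsub>?A\<^esub> f i \<in> carrier ?A" if "i \<in> {1..Suc p}" for i
  proof -
   have "{h. (-1) ^ i * f i h ~= 0} \<subseteq> {h. f i h ~= 0}" by auto
   then show ?thesis using fA[of i] that finite_subset[of "{h. (-1) ^ i * f i h ~= 0}" "{h. f i h ~= 0}"]
    by (auto simp: toric_coeffs_def group_algebra_def)
  qed
  have "local_coboundary X toric_base ?A (int p) (local_of (int p) \<phi>) \<sigma> \<gamma> =
    f 0 \<oplus>\<^bsub>?A\<^esub> (\<Oplus>\<^bsub>?A\<^esub>i\<in>{1..Suc p}. (-1) ^ i \<odot>\<^bsub>?A\<^esub> local_of (int p) \<phi> (singular_face (Suc p) i \<sigma>) \<gamma>)"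
   using l by (simp only: local_coboundary_def Let_def q if_True f_def \<gamma>'_def nat_int simp_thms)
  also have "(\<Oplus>\<^bsub>?A\<^esub>i\<in>{1..Suc p}. (-1) ^ i \<odot>\<^bsub>?A\<^esub> local_of (int p) \<phi> (singular_face (Suc p) i \<sigma>) \<gamma>) =
    (\<Oplus>\<^bsub>?A\<^esub>i\<in>{1..Suc p}. (-1) ^ i \<odot>\<^bsub>?A\<^esub> f i)"
  proof -
   interpret abelian_group ?A unfolding toric_coeffs_def by (rule group_algebra_abelian)
   show ?thesis by (rule finsum_cong') (use smA in \<open>auto simp: f_def \<gamma>'_def\<close>)
  qed
  finally have "local_coboundary X toric_base ?A (int p) (local_of (int p) \<phi>) \<sigma> \<gamma> h = f 0 h + (\<Sum>i\<in>{1..Suc p}. (-1) ^ i * f i h)"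
   using group_algebra_finsum_apply[of "{1..Suc p}" "\<lambda>i. (-1) ^ i \<odot>\<^bsub>?A\<^esub> f i" Gab h] smA
   by (simp add: toric_coeffs_def) (simp add: group_algebra_def)
  also have "\<dots> = (\<Sum>i\<le>Suc p. (-1) ^ i * f i h)"
  proof -
   have "{..Suc p} = insert 0 {1..Suc p}" by auto
   then show ?thesis by (simp del: sum.atMost_Suc)
  qed
  also have "\<dots> = local_of (int (Suc p)) (S.coboundary (int p) \<phi>) \<sigma> \<gamma> h"
  proof (cases "h \<in> carrier Gab")
   case h: True
   define n where "n = - lattice_point h"
   have n: "n \<in> lattice L" "lattice_class (- n) = h" using lattice_point[OF h] by (auto simp: n_def lattice_uminus)
   define t where "t = simplex_translate (Suc p) n s"
   have t: "t \<in> Sing (Suc p)" unfolding t_def by (rule S.tr_B[OF n(1) s(1)])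
   have "f i h = \<phi> (singular_face (Suc p) i t)" if "i \<le> Suc p" for i
    using face[OF that] h by (simp add: f_def local_of_def t_def n_def singular_face_simplex_map[OF that])
   then have "(\<Sum>i\<le>Suc p. (-1) ^ i * f i h) = pairing \<phi> (simplex_boundary (Suc p) t)"
    by (simp add: chain_boundary_of pairing_sum pairing_cmul pairing_add del: sum.atMost_Suc)
   also have "\<dots> = S.coboundary (int p) \<phi> t" using t by (simp add: S.coboundary_nat)
   also have "\<dots> = local_of (int (Suc p)) (S.coboundary (int p) \<phi>) \<sigma> \<gamma> h"
    using l h by (simp add: local_of_def t_def n_def s_def del: of_nat_Suc)
   finally show ?thesis .
  next
   case False
   then show ?thesis by (simp add: f_def local_of_def)
  qed
  finally show ?thesis .
 qed
qed

end

section \<open>Cohomology of the toric complex\<close>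

lemma quotient_iso_exact_iff:
 assumes T: "quotient_iso Z B Z' B' T" and B': "fun_submodule B'"
 shows "Z \<subseteq> B \<longleftrightarrow> Z' \<subseteq> B'"
proof
 assume ZB: "Z \<subseteq> B"
 show "Z' \<subseteq> B'"
 proof
  fix z' assume "z' \<in> Z'"
  then obtain z where z: "z \<in> Z" "(\<lambda>c. z' c - T z c) \<in> B'" using T unfolding quotient_iso_def by blast
  then have "T z \<in> B'" using T ZB unfolding quotient_iso_def by blast
  from fun_submodule_add[OF B' z(2) this] show "z' \<in> B'" by simp
 qed
next
 assume "Z' \<subseteq> B'"
 then show "Z \<subseteq> B" using T unfolding quotient_iso_def by blast
qed

lemma quotient_iso_torsion_free:
 assumes T: "quotient_iso Z B Z' B' T" and Z: "fun_submodule Z" and B': "fun_submodule B'"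
  and tf: "torsion_free_mod Z B"
 shows "torsion_free_mod Z' B'"
 unfolding torsion_free_mod_def
proof (intro allI ballI impI)
 fix r z' assume z': "z' \<in> Z'" and r: "r ~= 0" and rz: "(\<lambda>b. r * z' b) \<in> B'"
 obtain z where z: "z \<in> Z" "(\<lambda>c. z' c - T z c) \<in> B'" using T z' unfolding quotient_iso_def by blast
 have lin: "lin_on Z T" using T unfolding quotient_iso_def by blast
 have "(\<lambda>c. r * z' c - r * (z' c - T z c)) \<in> B'"
  by (rule fun_submodule_diff[OF B' rz fun_submodule_smult[OF B' z(2)]])
 then have "T (\<lambda>b. r * z b) \<in> B'" by (simp add: lin_on_smult[OF lin z(1)] right_diff_distrib)
 then have "(\<lambda>b. r * z b) \<in> B" using T fun_submodule_smult[OF Z z(1)] unfolding quotient_iso_def by blast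
 then have "z \<in> B" using tf z(1) r unfolding torsion_free_mod_def by blast
 then have "T z \<in> B'" using T z(1) unfolding quotient_iso_def by blast
 from fun_submodule_add[OF B' z(2) this] show "z' \<in> B'" by simp
qed

context finite_complex
begin

lemma local_of_linear:
 fixes \<phi> \<psi> :: "_ => 'k::comm_ring_1"
 shows "local_of p (\<lambda>s. 0 :: 'k) = (\<lambda>\<sigma> \<gamma> h. 0)"
  and "local_of p (\<lambda>s. \<phi> s + \<psi> s) = (\<lambda>\<sigma> \<gamma> h. local_of p \<phi> \<sigma> \<gamma> h + local_of p \<psi> \<sigma> \<gamma> h)"
  and "local_of p (\<lambda>s. r * \<phi> s) = (\<lambda>\<sigma> \<gamma> h. r * local_of p \<phi> \<sigma> \<gamma> h)"
 by (simp_all add: local_of_def fun_eq_iff)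

lemma twisted_carrier:
 "carrier (twisted TYPE('k::comm_ring_1) p) = local_of p ` (S.cochains p :: (_ => 'k) set)"
proof (cases p)
 case (nonneg n)
 show ?thesis unfolding nonneg using local_of_carrier[of _ n, where 'k='k] local_of_surj[of _ n, where 'k='k] by blast
next
 case (neg n)
 then have "\<not> lifted_simplex X toric_base p \<sigma> \<gamma>" for \<sigma> \<gamma> by (simp add: lifted_simplex_def)
 then have "carrier (twisted TYPE('k) p) = {\<lambda>\<sigma> \<gamma> h. 0}"
  by (auto simp: local_cochains_def toric_coeffs_def group_algebra_def fun_eq_iff)
 moreover have "(S.cochains p :: (_ => 'k) set) = {\<lambda>b. 0}" using neg by (intro S.cochains_neg) simp
 ultimately show ?thesis by (simp add: local_of_linear(1))
qed

lemma negative_cochain: "\<phi> \<in> S.cochains p ==> p < 0 ==> \<phi> = (\<lambda>b. 0 :: 'k::comm_ring_1)"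
 by (simp add: S.cochains_neg)

lemma singular_coboundary_cochain:
 fixes \<phi> :: "_ => 'k::comm_ring_1"
 assumes \<phi>: "\<phi> \<in> S.cochains p"
 shows "S.coboundary p \<phi> \<in> S.cochains (p + 1)"
proof (cases p)
 case (nonneg n)
 have "SS.equivariant (Suc n) n (simplex_boundary (Suc n))"
  unfolding SS.equivariant_def by (intro ballI conjI S.bd_keys S.bd_tr)
 then have "pullback (Sing (Suc n)) (simplex_boundary (Suc n)) \<phi> \<in> S.cochains (int (Suc n))"
  by (rule SS.pullback_cochain) (use \<phi> nonneg in simp)
 moreover have "pullback (Sing (Suc n)) (simplex_boundary (Suc n)) \<phi> = S.coboundary (int n) \<phi>"
  by (simp add: fun_eq_iff pullback_def S.coboundary_nat)
 ultimately show ?thesis by (simp add: nonneg add.commute)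
next
 case (neg n)
 then have "\<phi> = (\<lambda>b. 0)" using negative_cochain[OF \<phi>] by simp
 then show ?thesis by (simp add: S.coboundary_zero fun_submodule_zero[OF S.cochains_submodule])
qed

lemma singular_coboundaries_subset: "S.coboundaries p \<subseteq> (S.cochains p :: (_ => 'k::comm_ring_1) set)"
 using singular_coboundary_cochain[of _ "p - 1", where 'k='k] by (auto simp: S.coboundaries_def)

lemma local_coboundary_twisted:
 fixes \<phi> :: "_ => 'k::comm_ring_1"
 assumes \<phi>: "\<phi> \<in> S.cochains p"
 shows "twisted_coboundary TYPE('k) p (local_of p \<phi>) = local_of (p + 1) (S.coboundary p \<phi>)"
proof (cases p)
 case (nonneg n)
 then show ?thesis using local_coboundary_local_of[of \<phi> n] \<phi> by (simp add: add.commute)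
next
 case (neg n)
 then have "\<phi> = (\<lambda>b. 0)" using negative_cochain[OF \<phi>] by simp
 then have 0: "local_of p \<phi> = (\<lambda>\<sigma> \<gamma> h. 0)" "local_of (p + 1) (S.coboundary p \<phi>) = (\<lambda>\<sigma> \<gamma> h. 0)"
  by (simp_all only: local_of_linear(1) S.coboundary_zero)
 interpret A: abelian_group "coeff_module TYPE('k)" unfolding toric_coeffs_def by (rule group_algebra_abelian)
 have z: "(\<lambda>h. 0) = \<zero>\<^bsub>coeff_module TYPE('k)\<^esub>" by (simp add: toric_coeffs_def group_algebra_def)
 have "{1..nat (p + 1)} = {}" using neg by simp
 then show ?thesis unfolding 0 by (intro ext) (simp add: local_coboundary_def z; simp flip: z)
qed

lemma local_of_eq_iff:
 fixes \<phi> \<psi> :: "_ => 'k::comm_ring_1"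
 assumes \<phi>: "\<phi> \<in> S.cochains p" and \<psi>: "\<psi> \<in> S.cochains p"
 shows "local_of p \<phi> = local_of p \<psi> \<longleftrightarrow> \<phi> = \<psi>"
proof
 assume eq: "local_of p \<phi> = local_of p \<psi>"
 show "\<phi> = \<psi>"
 proof (cases p)
  case (nonneg n)
  have d: "(\<lambda>s. \<phi> s + (-1) * \<psi> s) \<in> S.cochains p"
   by (rule fun_submodule_add[OF S.cochains_submodule \<phi> fun_submodule_smult[OF S.cochains_submodule \<psi>]])
  have "local_of p (\<lambda>s. \<phi> s + (-1) * \<psi> s) = (\<lambda>\<sigma> \<gamma> h. 0)"
   unfolding local_of_linear eq by simp
  then have "(\<lambda>s. \<phi> s + (-1) * \<psi> s) = (\<lambda>s. 0)" using local_of_inj[of _ n] d unfolding nonneg by blast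
  then show ?thesis by (simp add: fun_eq_iff)
 next
  case (neg n)
  then show ?thesis using negative_cochain[OF \<phi>] negative_cochain[OF \<psi>] by simp
 qed
qed simp

lemma twisted_kmodule: "kmodule (twisted TYPE('k::comm_ring_1) p)"
proof -
 let ?M = "twisted TYPE('k) p"
 note C = S.cochains_submodule[of p, where 'k='k]
 have add: "x \<oplus>\<^bsub>?M\<^esub> y \<in> carrier ?M" if x: "x \<in> carrier ?M" and y: "y \<in> carrier ?M" for x y
 proof -
  obtain \<phi> \<psi> where "\<phi> \<in> S.cochains p" "x = local_of p \<phi>" "\<psi> \<in> S.cochains p" "y = local_of p \<psi>"
   using x y unfolding twisted_carrier by blast
  then show ?thesis
   unfolding twisted_carrier twisted_simps using local_of_linear(2)[of p \<phi> \<psi>, symmetric] fun_submodule_add[OF C] by auto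
 qed
 have smult: "r \<odot>\<^bsub>?M\<^esub> x \<in> carrier ?M" if x: "x \<in> carrier ?M" for x r
 proof -
  obtain \<phi> where "\<phi> \<in> S.cochains p" "x = local_of p \<phi>" using x unfolding twisted_carrier by blast
  then show ?thesis
   unfolding twisted_carrier twisted_simps using local_of_linear(3)[of p r \<phi>, symmetric] fun_submodule_smult[OF C] by auto
 qed
 have "abelian_group ?M"
 proof (rule abelian_groupI)
  show "\<zero>\<^bsub>?M\<^esub> \<in> carrier ?M"
   unfolding twisted_carrier twisted_simps
   unfolding local_of_linear(1)[of p, symmetric] by (rule imageI[OF fun_submodule_zero[OF C]])
  fix x assume x: "x \<in> carrier ?M"
  show "\<exists>y\<in>carrier ?M. y \<oplus>\<^bsub>?M\<^esub> x = \<zero>\<^bsub>?M\<^esub>"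
   by (rule bexI[OF _ smult[OF x, of "-1"]]) (simp add: twisted_simps)
 qed (simp_all add: add, simp_all add: twisted_simps algebra_simps)
 then show ?thesis
  by (rule kmodule.intro) (unfold_locales, simp_all add: smult, simp_all add: twisted_simps algebra_simps)
qed

lemma toric_cohomology_subquotient:
 "toric_cohomology TYPE('k::comm_ring_1) L p =
   subquotient (twisted TYPE('k) p) (local_of p ` (S.cocycles p :: (_ => 'k) set)) (local_of p ` S.coboundaries p)"
proof -
 have 1: "{c \<in> carrier (twisted TYPE('k) p). twisted_coboundary TYPE('k) p c = \<zero>\<^bsub>twisted TYPE('k) (p + 1)\<^esub>} =
   local_of p ` (S.cocycles p :: (_ => 'k) set)"
 proof -
  have "twisted_coboundary TYPE('k) p (local_of p \<phi>) = \<zero>\<^bsub>twisted TYPE('k) (p + 1)\<^esub> \<longleftrightarrow> \<phi> \<in> S.cocycles p"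
   if \<phi>: "\<phi> \<in> S.cochains p" for \<phi> :: "_ => 'k"
  proof -
   have "S.coboundary p \<phi> \<in> S.cochains (p + 1)"
    by (rule singular_coboundary_cochain[OF \<phi>])
   then show ?thesis
    using local_of_eq_iff[OF _ fun_submodule_zero[OF S.cochains_submodule], of "S.coboundary p \<phi>" "p + 1"] \<phi>
    by (simp only: local_coboundary_twisted[OF \<phi>] twisted_simps(1) local_of_linear(1) S.cocycles_def mem_Collect_eq simp_thms)
  qed
  then show ?thesis unfolding twisted_carrier by (auto simp: S.cocycles_def)
 qed
 have "twisted_coboundary TYPE('k) (p - 1) (local_of (p - 1) \<phi>) = local_of p (S.coboundary (p - 1) \<phi>)"
  if "\<phi> \<in> S.cochains (p - 1)" for \<phi> :: "_ => 'k"
  using local_coboundary_twisted[OF that] by simp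
 then have 2: "twisted_coboundary TYPE('k) (p - 1) ` carrier (twisted TYPE('k) (p - 1)) =
   local_of p ` S.coboundaries p"
  unfolding twisted_carrier S.coboundaries_def image_image by (intro image_cong refl)
 show ?thesis unfolding toric_cohomology_def local_cohomology_def cohomology_def 1 2 ..
qed

lemma twisted_ksub:
 "ksub (twisted TYPE('k::comm_ring_1) p) (local_of p ` (S.cocycles p :: (_ => 'k) set)) (local_of p ` S.coboundaries p)"
proof (intro ksub.intro ksub_axioms.intro twisted_kmodule)
 let ?M = "twisted TYPE('k) p"
 have sub: "local_of p ` W \<subseteq> carrier ?M \<and> \<zero>\<^bsub>?M\<^esub> \<in> local_of p ` W \<and>
   (\<forall>x\<in>local_of p ` W. \<forall>y\<in>local_of p ` W. x \<oplus>\<^bsub>?M\<^esub> y \<in> local_of p ` W) \<and> (\<forall>r. \<forall>x\<in>local_of p ` W. r \<odot>\<^bsub>?M\<^esub> x \<in> local_of p ` W)"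
  if W: "fun_submodule W" and WC: "W \<subseteq> S.cochains p" for W :: "(_ => 'k) set"
 proof (intro conjI ballI allI)
  show "local_of p ` W \<subseteq> carrier ?M" unfolding twisted_carrier by (rule image_mono[OF WC])
  show "\<zero>\<^bsub>?M\<^esub> \<in> local_of p ` W"
   unfolding twisted_simps unfolding local_of_linear(1)[of p, symmetric] by (rule imageI[OF fun_submodule_zero[OF W]])
  fix x assume "x \<in> local_of p ` W"
  then obtain \<phi> where \<phi>: "x = local_of p \<phi>" "\<phi> \<in> W" by blast
  show "r \<odot>\<^bsub>?M\<^esub> x \<in> local_of p ` W" for r
   unfolding twisted_simps \<phi>(1) unfolding local_of_linear(3)[symmetric] by (rule imageI[OF fun_submodule_smult[OF W \<phi>(2)]])
  fix y assume "y \<in> local_of p ` W"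
  then obtain \<psi> where \<psi>: "y = local_of p \<psi>" "\<psi> \<in> W" by blast
  show "x \<oplus>\<^bsub>?M\<^esub> y \<in> local_of p ` W"
   unfolding twisted_simps \<phi>(1) \<psi>(1) unfolding local_of_linear(2)[symmetric] by (rule imageI[OF fun_submodule_add[OF W \<phi>(2) \<psi>(2)]])
 qed
 have "S.cocycles p \<subseteq> (S.cochains p :: (_ => 'k) set)" by (auto simp: S.cocycles_def)
 note Z = sub[OF S.cocycles_submodule this]
 note B = sub[OF S.coboundaries_submodule singular_coboundaries_subset]
 show "local_of p ` (S.cocycles p :: (_ => 'k) set) \<subseteq> carrier ?M" "\<zero>\<^bsub>?M\<^esub> \<in> local_of p ` (S.cocycles p :: (_ => 'k) set)"
  using Z by blast+
 show "local_of p ` (S.coboundaries p :: (_ => 'k) set) \<subseteq> carrier ?M" "\<zero>\<^bsub>?M\<^esub> \<in> local_of p ` (S.coboundaries p :: (_ => 'k) set)"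
  using B by blast+
 fix x y r
 show "x \<oplus>\<^bsub>?M\<^esub> y \<in> local_of p ` S.cocycles p" if "x \<in> local_of p ` S.cocycles p" "y \<in> local_of p ` S.cocycles p"
  using Z that by blast
 show "x \<oplus>\<^bsub>?M\<^esub> y \<in> local_of p ` S.coboundaries p" if "x \<in> local_of p ` S.coboundaries p" "y \<in> local_of p ` S.coboundaries p"
  using B that by blast
 show "r \<odot>\<^bsub>?M\<^esub> x \<in> local_of p ` S.cocycles p" if "x \<in> local_of p ` S.cocycles p" using Z that by blast
 show "r \<odot>\<^bsub>?M\<^esub> x \<in> local_of p ` S.coboundaries p" if "x \<in> local_of p ` S.coboundaries p" using B that by blast
qed

lemma local_of_mem_iff:
 fixes \<phi> :: "_ => 'k::comm_ring_1"
 assumes "\<phi> \<in> S.cochains p"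
 shows "local_of p \<phi> \<in> local_of p ` S.coboundaries p \<longleftrightarrow> \<phi> \<in> S.coboundaries p"
 using local_of_eq_iff[OF assms] subsetD[OF singular_coboundaries_subset[where 'k='k]] by blast

lemma cocycle_cochain: "\<phi> \<in> S.cocycles p ==> \<phi> \<in> S.cochains p"
 by (simp add: S.cocycles_def)

text \<open>By the splitting, the cohomology of the toric complex is a direct sum of copies of the reduced
 cohomology of the links.\<close>

theorem toric_zero_iff:
 "zero_module (toric_cohomology TYPE('k::comm_ring_1) L p) \<longleftrightarrow>
   (\<forall>\<sigma>\<in>L. zero_module (reduced_cohomology TYPE('k) (link L \<sigma>) (p - 1 - int (card \<sigma>))))"
proof -
 obtain T where T: "quotient_iso (S.cocycles p :: (_ => 'k) set) (S.coboundaries p) (split_cocycles p) (split_coboundaries p) T"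
  using singular_split_iso by blast
 have "zero_module (toric_cohomology TYPE('k) L p) \<longleftrightarrow>
   local_of p ` (S.cocycles p :: (_ => 'k) set) \<subseteq> local_of p ` S.coboundaries p"
  unfolding toric_cohomology_subquotient by (rule ksub.zero_module_iff[OF twisted_ksub])
 also have "\<dots> \<longleftrightarrow> (S.cocycles p :: (_ => 'k) set) \<subseteq> S.coboundaries p"
  using local_of_mem_iff[OF cocycle_cochain, where 'k='k] by blast
 also have "\<dots> \<longleftrightarrow> (split_cocycles p :: (_ => 'k) set) \<subseteq> split_coboundaries p"
  by (rule quotient_iso_exact_iff[OF T split_coboundaries_submodule])
 finally show ?thesis by (simp only: split_exact_iff reduced_cohomology_zero_iff)
qed

theorem toric_torsion_free:
 assumes "torsion_free_module (toric_cohomology TYPE('k::comm_ring_1) L p)" and \<sigma>: "\<sigma> \<in> L"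
 shows "torsion_free_module (reduced_cohomology TYPE('k) (link L \<sigma>) (p - 1 - int (card \<sigma>)))"
proof -
 obtain T where T: "quotient_iso (S.cocycles p :: (_ => 'k) set) (S.coboundaries p) (split_cocycles p) (split_coboundaries p) T"
  using singular_split_iso by blast
 have tf: "\<forall>r. \<forall>z\<in>local_of p ` (S.cocycles p :: (_ => 'k) set). r ~= 0 -->
   r \<odot>\<^bsub>twisted TYPE('k) p\<^esub> z \<in> local_of p ` S.coboundaries p --> z \<in> local_of p ` S.coboundaries p"
  using assms(1) unfolding toric_cohomology_subquotient ksub.torsion_free_iff[OF twisted_ksub] .
 have "torsion_free_mod (S.cocycles p :: (_ => 'k) set) (S.coboundaries p)"
  unfolding torsion_free_mod_def
 proof (intro allI ballI impI)
  fix r :: 'k and z :: "_ => 'k" assume z: "z \<in> S.cocycles p" and r: "r ~= 0" and rz: "(\<lambda>b. r * z b) \<in> S.coboundaries p"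
  have "r \<odot>\<^bsub>twisted TYPE('k) p\<^esub> local_of p z \<in> local_of p ` S.coboundaries p"
   unfolding twisted_simps unfolding local_of_linear(3)[symmetric] by (rule imageI[OF rz])
  then have "local_of p z \<in> local_of p ` S.coboundaries p" using tf z r by blast
  then show "z \<in> S.coboundaries p" by (simp only: local_of_mem_iff[OF cocycle_cochain[OF z]])
 qed
 from quotient_iso_torsion_free[OF T S.cocycles_submodule split_coboundaries_submodule this]
 show ?thesis unfolding reduced_cohomology_torsion_free_iff by (rule split_torsion_free[OF _ \<sigma>])
qed

text \<open>Torsion-free cohomology of the links has coordinates, and those of all links together are coordinates
 of the direct sum.\<close>

theorem toric_free:
 assumes N: "euclidean_size (N :: 'k::comm_ring_1 => nat)"
  and tf: "!!\<sigma>. \<sigma> \<in> L ==> torsion_free_module (reduced_cohomology TYPE('k) (link L \<sigma>) (p - 1 - int (card \<sigma>)))"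
 shows "free_module (toric_cohomology TYPE('k) L p)"
proof -
 obtain T where T: "quotient_iso (S.cocycles p :: (_ => 'k) set) (S.coboundaries p) (split_cocycles p) (split_coboundaries p) T"
  using singular_split_iso by blast
 obtain \<kappa> :: "(_ => 'k) => 'v set \<times> (real^'v) \<times> nat => 'k" and I where \<kappa>: "lin_on (split_cocycles p) \<kappa>"
   "\<forall>z\<in>split_cocycles p. finite {i. \<kappa> z i ~= 0} \<and> {i. \<kappa> z i ~= 0} \<subseteq> I"
   "\<forall>z\<in>split_cocycles p. \<kappa> z = (\<lambda>i. 0) \<longleftrightarrow> z \<in> split_coboundaries p"
   "\<forall>i\<in>I. \<exists>z\<in>split_cocycles p. \<kappa> z = (\<lambda>j. if j = i then 1 else 0)"
  using split_coordinates[OF N, of p] tf unfolding reduced_cohomology_torsion_free_iff by blast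
 have lT: "lin_on (S.cocycles p) T" and TZ: "!!z. z \<in> S.cocycles p ==> T z \<in> split_cocycles p"
  and TB: "!!z. z \<in> S.cocycles p ==> T z \<in> split_coboundaries p \<longleftrightarrow> z \<in> S.coboundaries p"
  and Ts: "!!z'. z' \<in> split_cocycles p ==> \<exists>z\<in>S.cocycles p. (\<lambda>c. z' c - T z c) \<in> split_coboundaries p"
  using T unfolding quotient_iso_def by blast+
 note Zs = S.cocycles_submodule[of p, where 'k='k]
 define \<Theta> where "\<Theta> = inv_into (S.cochains p :: (_ => 'k) set) (local_of p)"
 have "inj_on (local_of p) (S.cochains p :: (_ => 'k) set)"
  by (rule inj_onI) (simp only: local_of_eq_iff)
 then have \<Theta>: "\<Theta> (local_of p z) = z" if "z \<in> S.cocycles p" for z :: "_ => 'k"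
  unfolding \<Theta>_def by (rule inv_into_f_f) (rule cocycle_cochain[OF that])
 show ?thesis
  unfolding toric_cohomology_subquotient
 proof (rule ksub.free_by_coordinates[OF twisted_ksub, where \<kappa>="\<lambda>x. \<kappa> (T (\<Theta> x))" and I=I])
  let ?M = "twisted TYPE('k) p" and ?Z = "local_of p ` (S.cocycles p :: (_ => 'k) set)"
  fix x assume "x \<in> ?Z"
  then obtain z where z: "z \<in> S.cocycles p" "x = local_of p z" by blast
  show "finite {i. \<kappa> (T (\<Theta> x)) i ~= 0}" using \<kappa>(2) TZ[OF z(1)] unfolding z(2) \<Theta>[OF z(1)] by blast
  show "i \<in> I" if "\<kappa> (T (\<Theta> x)) i ~= 0" for i using \<kappa>(2) TZ[OF z(1)] that unfolding z(2) \<Theta>[OF z(1)] by blast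
  show "\<kappa> (T (\<Theta> x)) = (\<lambda>i. 0) \<longleftrightarrow> x \<in> local_of p ` S.coboundaries p"
   using \<kappa>(3) TZ[OF z(1)] TB[OF z(1)] unfolding z(2) \<Theta>[OF z(1)] local_of_mem_iff[OF cocycle_cochain[OF z(1)]] by blast
  show "\<kappa> (T (\<Theta> (r \<odot>\<^bsub>?M\<^esub> x))) = (\<lambda>i. r * \<kappa> (T (\<Theta> x)) i)" for r
   unfolding z(2) twisted_simps local_of_linear(3)[symmetric] \<Theta>[OF fun_submodule_smult[OF Zs z(1)]] \<Theta>[OF z(1)]
    lin_on_smult[OF lT z(1)] by (rule lin_on_smult[OF \<kappa>(1) TZ[OF z(1)]])
  fix y assume "y \<in> ?Z"
  then obtain w where w: "w \<in> S.cocycles p" "y = local_of p w" by blast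
  show "\<kappa> (T (\<Theta> (x \<oplus>\<^bsub>?M\<^esub> y))) = (\<lambda>i. \<kappa> (T (\<Theta> x)) i + \<kappa> (T (\<Theta> y)) i)"
   unfolding z(2) w(2) twisted_simps local_of_linear(2)[symmetric] \<Theta>[OF fun_submodule_add[OF Zs z(1) w(1)]] \<Theta>[OF z(1)] \<Theta>[OF w(1)]
    lin_on_add[OF lT z(1) w(1)] by (rule lin_on_add[OF \<kappa>(1) TZ[OF z(1)] TZ[OF w(1)]])
 next
  fix i assume "i \<in> I"
  then obtain z' where z': "z' \<in> split_cocycles p" "\<kappa> z' = (\<lambda>j. if j = i then 1 else 0)" using \<kappa>(4) by blast
  obtain z where z: "z \<in> S.cocycles p" "(\<lambda>c. z' c - T z c) \<in> split_coboundaries p" using Ts[OF z'(1)] by blast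
  have d: "(\<lambda>c. z' c - T z c) \<in> split_cocycles p" by (rule fun_submodule_diff[OF split_cocycles_submodule z'(1) TZ[OF z(1)]])
  have "\<kappa> (\<lambda>c. z' c - T z c) = (\<lambda>i. 0)" using \<kappa>(3) d z(2) by blast
  then have "\<kappa> (T z) = \<kappa> z'" using lin_on_diff[OF \<kappa>(1) split_cocycles_submodule z'(1) TZ[OF z(1)]] by (simp add: fun_eq_iff)
  then show "\<exists>z\<in>local_of p ` (S.cocycles p :: (_ => 'k) set). \<kappa> (T (\<Theta> z)) = (\<lambda>j. if j = i then 1 else 0)"
   using z(1) z'(2) \<Theta>[OF z(1)] by (intro bexI[of _ "local_of p z"]) simp_all
 qed
qed

end

theorem theorem7p5:
  fixes L :: "'v::finite set set" and d :: int
  assumes "field_or_integers TYPE('k::comm_ring_1)"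
    and "simplicial_cx L"
    and "cx_dim L = d"
  shows "cohen_macaulay TYPE('k) L \<longleftrightarrow>
     (\<forall>p. p \<noteq> d + 1 \<longrightarrow> zero_module (toric_cohomology TYPE('k) L p)) \<and>
     free_module (toric_cohomology TYPE('k) L (d + 1))"
proof -
 interpret finite_complex L by (rule finite_complex.intro) (rule assms(2))
 obtain N :: "'k => nat" where N: "euclidean_size N"
  using field_or_integers_euclidean_size[OF assms(1)] by blast
 have dom: "a = 0 \<or> b = 0" if "a * b = 0" for a b :: 'k
  using N that unfolding euclidean_size_def by blast
 have deg: "p - 1 - int (card \<sigma>) = d - int (card \<sigma>) \<longleftrightarrow> p = d + 1" for p and \<sigma> :: "'v set" by auto
 show ?thesis
 proof
  assume cm: "cohen_macaulay TYPE('k) L"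
  then have "zero_module (toric_cohomology TYPE('k) L p)" if "p ~= d + 1" for p
   using that deg[of p] unfolding toric_zero_iff cohen_macaulay_def assms(3) by blast
  moreover have "free_module (toric_cohomology TYPE('k) L (d + 1))"
   by (rule toric_free[OF N]) (use cm in \<open>simp add: cohen_macaulay_def\<close>)
  ultimately show "(\<forall>p. p ~= d + 1 --> zero_module (toric_cohomology TYPE('k) L p)) \<and>
    free_module (toric_cohomology TYPE('k) L (d + 1))" by blast
 next
  assume *: "(\<forall>p. p ~= d + 1 --> zero_module (toric_cohomology TYPE('k) L p)) \<and>
    free_module (toric_cohomology TYPE('k) L (d + 1))"
  have "kmodule (toric_cohomology TYPE('k) L (d + 1))"
   unfolding toric_cohomology_subquotient by (rule ksub.Q_kmodule[OF twisted_ksub])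
  from kmodule.free_imp_torsion_free[OF this dom] *
  have tf: "torsion_free_module (toric_cohomology TYPE('k) L (d + 1))" by blast
  have zero: "zero_module (reduced_cohomology TYPE('k) (link L \<sigma>) q)" if \<sigma>: "\<sigma> \<in> L" and q: "q ~= d - int (card \<sigma>)" for \<sigma> q
  proof -
   have "q + 1 + int (card \<sigma>) ~= d + 1" using q by auto
   then have "zero_module (toric_cohomology TYPE('k) L (q + 1 + int (card \<sigma>)))" using * by blast
   then have "zero_module (reduced_cohomology TYPE('k) (link L \<sigma>) (q + 1 + int (card \<sigma>) - 1 - int (card \<sigma>)))"
    using \<sigma> unfolding toric_zero_iff by blast
   then show ?thesis by simp
  qed
  have "torsion_free_module (reduced_cohomology TYPE('k) (link L \<sigma>) q)" if \<sigma>: "\<sigma> \<in> L" for \<sigma> q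
  proof (cases "q = d - int (card \<sigma>)")
   case True
   then show ?thesis using toric_torsion_free[OF tf \<sigma>] by simp
  next
   case False
   then show ?thesis using zero[OF \<sigma>] by (simp add: zero_module_def torsion_free_module_def)
  qed
  then show "cohen_macaulay TYPE('k) L" using zero unfolding cohen_macaulay_def assms(3) by blast
 qed
qed

end
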